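(* There is an absolute constant $C\ge1$ such that the following holds. Let $N_1,N_2$ be positive integers with $N_1 \geq N_2^{1/2}$, let $0<\delta\le 1$, and let $A \subset [N_1]\times[N_2]$ with $|A| \geq \delta N_1N_2$. Given $0<\varepsilon \leq 1/2$, either $N_2 \leq \exp\big(C\varepsilon^{-C}\big)$, or there exist positive integers $q \leq \exp\big(C\varepsilon^{-C}\big)$ and $M \geq N_2^{1/2}/\exp\big(C\varepsilon^{-C}\big)$ such that $$\sum_{x,y, d\in\mathbb{Z}}\mu_{ M}(d)\,1_A(x,y)1_A(x+qd,y)1_A(x, y+q^2 d^2)\geq (\delta^3-\varepsilon) N_1N_2.$$
   Context: $[X]=\{1,\dots,\lfloor X\rfloor\}$. For real $H\ge 1$, $\mu_H(h)=\frac{1}{\lfloor H\rfloor}\big(1-\frac{|h|}{\lfloor H\rfloor}\big)_+$ for $h\in\mathbb{Z}$, with $t_+=\max\{t,0\}$. *)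

theory Defs
  imports "HOL-Analysis.Analysis"
begin

definition interval_upto :: "real \<Rightarrow> int set" where
  "interval_upto X = {1..\<lfloor>X\<rfloor>}"

text \<open>Only used for \<open>H \<ge> 1\<close>, where \<open>\<lfloor>H\<rfloor>\<close> is a positive integer.\<close>

definition mu :: "real \<Rightarrow> int \<Rightarrow> real" where
  "mu H h = 1 / of_int \<lfloor>H\<rfloor> * max (1 - of_int \<bar>h\<bar> / of_int \<lfloor>H\<rfloor>) 0"

end

(*
  Count corners through an energy increment over nested partitions of [N1] x [N2] into cells of
  arithmetic progressions, one partition in the x-direction (difference q) and one in the y-direction
  (difference q^2).  With f = 1_A replaced by its conditional expectations E1 f, E2 f in the last two
  places the count is close to sum_w f(w) E1 f(w) E2 f(w), which is at least delta^3 N1 N2 by AM-GM.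
  If the actual count is smaller, an inverse theorem shows that f - E1 f or f - E2 f correlates
  with cells of the next finer partition, so the energy grows; this happens boundedly often.

  For commuting actions T, S, suppose that sum_d sum_w f0(w) f1(T^d w) f2(S^(d^2) w) is large.  One may
  replace f2 by (the conjugate of) the dual function F(w) = E_d f0(S^(-d^2) w) f1(T^d S^(-d^2) w).
  Cauchy-Schwarz (PET) bounds the correlation by averages of third differences of F along S, with steps
  depending on auxiliary parameters; averaging over these parameters makes all steps independent of them.
  Hence, for many v, the function F(w) conj F(S^v w) has a large Fourier coefficient, of frequency
  theta(v, w), along S-orbits.  Expanding F as a dual function and applying Cauchy-Schwarz, the exponential
  sums that arise are small unless theta(v, w) - theta(v', w) is close to a rational of bounded height
  (Weyl and Vinogradov), so theta(v, w) may be taken independent of v after passing to a subprogression.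
  A second Fourier step and a second use of the same phase lemma show that F itself has large averages
  along S-progressions; no inverse theorem for higher Gowers norms is needed.
*)
theory Submission
  imports Defs
begin

section \<open>Exponentials and distance to the nearest integer\<close>

text \<open>The form of the bound dictates the bookkeeping. Losses in density (from \<open>K\<close>
  to constants like \<open>a_C K\<close>) must stay polynomial, because the energy argument runs for
  up to \<open>2 * a_C K ^ 2\<close> steps, each of which changes the modulus and the lengths by
  powers of one number \<open>G\<close>. The final bound is thus a power of \<open>G\<close> with an
  exponent polynomial in 1/\<epsilon>, and \<open>G\<close> itself may be as large as the
  exponential of such a polynomial. This freedom is spent on factorials. Whenever an argument
  produces a denominator that varies with a point \<open>w\<close> or with an auxiliary parameter,
  but is polynomially bounded in \<open>K\<close>, it is replaced by the factorial of its bound, so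
  that one modulus serves everywhere. The weight \<open>mu\<close> is a mean over
  \<open>j < M\<close> of uniform weights on the translates \<open>- j + {0..<M}\<close>. For this
  reason the inverse theorems treat plain sums over an interval of \<open>d\<close> starting at an
  arbitrary \<open>c\<close> with |c| <= M.\<close>

definition ec :: "real \<Rightarrow> complex" where "ec t = cis (2 * pi * t)"

lemma ec_add: "ec (a + b) = ec a * ec b"
  by (simp add: ec_def cis_mult distrib_left)

lemma norm_ec [simp]: "norm (ec t) = 1"
  by (simp add: ec_def)

lemma ec_0 [simp]: "ec 0 = 1"
  by (simp add: ec_def)

lemma cnj_ec: "cnj (ec t) = ec (- t)"
  by (simp add: ec_def cis_cnj)

lemma ec_of_int [simp]: "ec (of_int n) = 1"
proof -
  have "cis (2 * pi * of_int n) = 1"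
    by (rule cis_multiple_2pi) simp
  then show ?thesis by (simp add: ec_def)
qed

lemma ec_pow: "ec (t * of_nat n) = ec t ^ n"
  by (induction n) (simp_all add: ec_add distrib_left)

definition nd :: "real \<Rightarrow> real" where "nd t = \<bar>t - of_int (round t)\<bar>"

lemma nd_nonneg [simp]: "0 \<le> nd t" by (simp add: nd_def)

lemma nd_le: "nd t \<le> \<bar>t - of_int m\<bar>"
  unfolding nd_def by (rule round_diff_minimal)

lemma nd_le_abs: "nd t \<le> \<bar>t\<bar>"
  using nd_le[of t 0] by simp

lemma nd_add: "nd (a + b) \<le> nd a + nd b"
  using nd_le[of "a + b" "round a + round b"] by (simp add: nd_def)

lemma nd_minus [simp]: "nd (- a) = nd a"
proof -
  have "nd (- a) \<le> nd a" for a
    using nd_le[of "- a" "- round a"] by (simp add: nd_def)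
  from this[of a] this[of "- a"] show ?thesis by simp
qed

lemma nd_diff: "nd (a - b) \<le> nd a + nd b"
  using nd_add[of a "- b"] by simp

lemma nd_mult_int: "nd (of_int n * a) \<le> \<bar>of_int n\<bar> * nd a"
proof -
  have "nd (of_int n * a) \<le> \<bar>of_int n * a - of_int (n * round a)\<bar>" by (rule nd_le)
  also have "\<dots> = \<bar>of_int n * (a - of_int (round a))\<bar>" by (simp add: algebra_simps)
  finally show ?thesis by (simp add: nd_def abs_mult)
qed

lemma nd_mult_nat: "nd (of_nat n * a) \<le> of_nat n * nd a"
  using nd_mult_int[of "int n" a] by simp

lemma nd_add_int [simp]: "nd (a + of_int n) = nd a"
proof -
  have "nd (a + of_int n) \<le> nd a" for a n
    using nd_le[of "a + of_int n" "round a + n"] by (simp add: nd_def)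
  from this[of a n] this[of "a + of_int n" "- n"] show ?thesis by simp
qed

lemma ec_cong_int: "ec (a + of_int n) = ec a"
  by (simp add: ec_add)

lemma norm_ec_minus_1: "norm (ec t - 1) = 2 * \<bar>sin (pi * t)\<bar>"
  using dist_exp_i_1[of "2 * pi * t"] by (simp add: ec_def cis_conv_exp mult.assoc)

lemma norm_ec_minus_1_le: "norm (ec t - 1) \<le> 7 * \<bar>t\<bar>"
proof -
  have "norm (ec t - 1) \<le> 2 * \<bar>pi * t\<bar>"
    unfolding norm_ec_minus_1 using abs_sin_x_le_abs_x[of "pi * t"] by simp
  also have "\<dots> = (2 * pi) * \<bar>t\<bar>" by (simp add: abs_mult)
  also have "\<dots> \<le> 7 * \<bar>t\<bar>" using pi_less_4 pi_approx by (intro mult_right_mono) auto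
  finally show ?thesis .
qed

text \<open>The sharp constant would be 4; for 1 it is enough to reduce to |u| <= 1/2 and to use sin
  x >= x - x^3/6 >= x/3 on [0, 2] with x = pi |u| and pi > 3.\<close>

lemma norm_ec_minus_1_ge: "nd t \<le> norm (ec t - 1)"
proof -
  define u where "u = t - of_int (round t)"
  have u: "\<bar>u\<bar> \<le> 1/2" unfolding u_def using of_int_round_abs_le[of t] by (simp add: abs_minus_commute)
  have "t = u + of_int (round t)" by (simp add: u_def)
  then have e: "ec t = ec u" by (metis ec_cong_int)
  have *: "v \<le> sin (pi * v)" if "0 \<le> v" "v \<le> 1/2" for v
  proof -
    define x where "x = pi * v"
    have "pi * v \<le> 4 * (1/2)" using that pi_less_4 by (intro mult_mono) auto
    then have x: "0 \<le> x" "x \<le> 2" using that unfolding x_def by auto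
    have "x - x ^ 3 / 6 \<le> sin x"
    proof -
      have "(\<lambda>y. sin y - (y - y^3/6)) 0 \<le> (\<lambda>y. sin y - (y - y^3/6)) x"
      proof (rule DERIV_nonneg_imp_nondecreasing[OF x(1)])
        fix y :: real
        have "cos y \<ge> 1 - y^2/2"
        proof -
          have "\<bar>sin (y/2)\<bar> \<le> \<bar>y/2\<bar>" by (rule abs_sin_x_le_abs_x)
          then have "(sin (y/2))^2 \<le> (y/2)^2" by (simp only: abs_le_square_iff)
          then show ?thesis using cos_double_sin[of "y/2"] by (simp add: power2_eq_square)
        qed
        then show "\<exists>z. ((\<lambda>y. sin y - (y - y^3/6)) has_real_derivative z) (at y) \<and> z \<ge> 0"
          by (intro exI[of _ "cos y - (1 - y^2/2)"])
             (auto intro!: derivative_eq_intros simp: power2_eq_square)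
      qed
      then show ?thesis by simp
    qed
    moreover have "x ^ 3 / 6 \<le> x * (2/3)"
    proof -
      have "x * x \<le> 2 * 2" using x by (intro mult_mono) auto
      then have "x * (x * x) \<le> x * 4" using x by (intro mult_left_mono) auto
      then show ?thesis by (simp add: power3_eq_cube)
    qed
    moreover have "3 * v \<le> x" unfolding x_def using pi_gt3 that by (intro mult_right_mono) auto
    ultimately show ?thesis unfolding x_def by linarith
  qed
  have "\<bar>u\<bar> \<le> \<bar>sin (pi * u)\<bar>"
  proof (cases "u \<ge> 0")
    case True then show ?thesis using *[of u] u by auto
  next
    case False then show ?thesis using *[of "- u"] u by auto
  qed
  then have "\<bar>u\<bar> \<le> norm (ec u - 1)" unfolding norm_ec_minus_1 by simp
  then show ?thesis by (simp add: e nd_def u_def)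
qed

text \<open>Geometric series. The denominator stands on the left so that \<open>nd t = 0\<close> is
  no special case.\<close>

lemma norm_sum_ec: "norm (\<Sum>j<n. ec (t * of_nat j + s)) * nd t \<le> 2"
proof -
  have "(\<Sum>j<n. ec (t * of_nat j + s)) = ec s * (\<Sum>j<n. ec t ^ j)"
    by (simp add: ec_add ec_pow sum_distrib_left mult.commute)
  then have "norm (\<Sum>j<n. ec (t * of_nat j + s)) = norm (\<Sum>j<n. ec t ^ j)"
    by (simp add: norm_mult)
  moreover have "norm (\<Sum>j<n. ec t ^ j) * norm (ec t - 1) \<le> 2"
  proof -
    have "(ec t - 1) * (\<Sum>j<n. ec t ^ j) = ec t ^ n - 1" by (simp add: power_diff_1_eq)
    then have "norm (\<Sum>j<n. ec t ^ j) * norm (ec t - 1) = norm (ec t ^ n - 1)"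
      by (metis mult.commute norm_mult)
    also have "\<dots> \<le> norm (ec t ^ n) + norm (1::complex)" by (rule norm_triangle_ineq4)
    also have "\<dots> \<le> 2" by (simp add: norm_power)
    finally show ?thesis .
  qed
  moreover have "norm (\<Sum>j<n. ec t ^ j) * nd t \<le> norm (\<Sum>j<n. ec t ^ j) * norm (ec t - 1)"
    by (intro mult_left_mono norm_ec_minus_1_ge) auto
  ultimately show ?thesis by simp
qed

section \<open>Recurrence: linear phases that are near integers on a dense set\<close>

lemma card_windows_le:
  fixes A :: "nat set" and B :: real
  assumes A: "A \<subseteq> {..<n}" and T: "0 < T" "T \<le> n"
    and B: "\<And>a. real (card (A \<inter> {a..<a + T})) \<le> B"
  shows "real (card A) * real T \<le> 2 * real n * B"
proof -
  have "real (card (A \<inter> {..<i * T})) \<le> real i * B" for i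
  proof (induction i)
    case 0 then show ?case by simp
  next
    case (Suc i)
    have "A \<inter> {..<Suc i * T} \<subseteq> (A \<inter> {..<i * T}) \<union> (A \<inter> {i * T..<i * T + T})" by auto
    then have "card (A \<inter> {..<Suc i * T}) \<le> card ((A \<inter> {..<i * T}) \<union> (A \<inter> {i * T..<i * T + T}))"
      by (intro card_mono) auto
    also have "\<dots> \<le> card (A \<inter> {..<i * T}) + card (A \<inter> {i * T..<i * T + T})" by (rule card_Un_le)
    finally show ?case using Suc B[of "i * T"] by (simp add: algebra_simps)
  qed
  from this[of "n div T + 1"] have 1: "real (card (A \<inter> {..<(n div T + 1) * T})) \<le> real (n div T + 1) * B" .
  have "n < (n div T + 1) * T" using dividend_less_div_times[of T n] T by (simp add: algebra_simps)
  then have 2: "A \<inter> {..<(n div T + 1) * T} = A" using A by auto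
  have B0: "B \<ge> 0" using B[of 0] by (meson of_nat_0_le_iff order_trans)
  have "n div T * T \<le> n" by simp
  then have "(n div T + 1) * T \<le> 2 * n" using T unfolding add_mult_distrib by linarith
  then have 3: "real (n div T + 1) * real T \<le> 2 * real n"
    by (metis of_nat_le_iff of_nat_mult of_nat_numeral)
  have "real (card A) * real T \<le> real (n div T + 1) * B * real T"
    using 1 2 by (intro mult_right_mono) auto
  also have "\<dots> = real (n div T + 1) * real T * B" by simp
  also have "\<dots> \<le> 2 * real n * B" using 3 B0 by (intro mult_right_mono) auto
  finally show ?thesis .
qed

lemma dense_window:
  fixes A :: "nat set"
  assumes A: "A \<subseteq> {..<n}" and T: "0 < T" "T \<le> n" and c: "real (card A) * K \<ge> real n" "K > 0" "n > 0"
  obtains a where "real (card (A \<inter> {a..<a + T})) * (2 * K) \<ge> real T"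
proof (rule ccontr)
  assume neg: "\<not> thesis"
  have *: "real (card (A \<inter> {a..<a + T})) * (2 * K) < real T" for a
    using that[of a] neg by (meson not_le)
  \<comment> \<open>Only finitely many windows meet \<open>A\<close>, so the strict bounds attain a
    maximum; it stays strictly below the threshold and is the uniform bound needed for
    \<open>card_windows_le\<close>.\<close>
  define X where "X = Max ((\<lambda>a. real (card (A \<inter> {a..<a + T}))) ` {..n})"
  have X: "real (card (A \<inter> {a..<a + T})) \<le> X" for a
  proof (cases "a \<le> n")
    case True then show ?thesis unfolding X_def by (intro Max_ge) auto
  next
    case False
    then have "A \<inter> {a..<a + T} = {}" using A by auto
    moreover have "real (card (A \<inter> {0..<0 + T})) \<le> X" unfolding X_def by (intro Max_ge imageI) auto
    ultimately show ?thesis by (metis card.empty of_nat_0 of_nat_0_le_iff order_trans)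
  qed
  have "X \<in> (\<lambda>a. real (card (A \<inter> {a..<a + T}))) ` {..n}" unfolding X_def by (intro Max_in) auto
  then have X2: "X * (2 * K) < real T" using * by auto
  have "real (card A) * real T \<le> 2 * real n * X" by (rule card_windows_le[OF A T X])
  then have "real (card A) * real T * K \<le> 2 * real n * X * K" using c(2) by (intro mult_right_mono) auto
  moreover have "2 * real n * X * K = real n * (X * (2 * K))" by simp
  moreover have "real n * (X * (2 * K)) < real n * real T" using X2 c(3) by (intro mult_strict_left_mono) auto
  moreover have "real n * real T \<le> real (card A) * K * real T" using c by (intro mult_right_mono) auto
  ultimately show False by (simp add: mult_ac)
qed

lemma two_far_apart:
  fixes B :: "nat set"
  assumes "finite B" "card B \<ge> 2"
  obtains x y where "x \<in> B" "y \<in> B" "x < y" "card B \<le> y - x + 1"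
proof -
  have ne: "B \<noteq> {}" using assms by auto
  have "B \<subseteq> {Min B..Max B}" using assms by auto
  then have "card B \<le> card {Min B..Max B}" by (intro card_mono) auto
  then have "card B \<le> Max B - Min B + 1" using assms by (auto simp: card_atLeastAtMost)
  moreover from this have "Min B < Max B" using assms by linarith
  ultimately show ?thesis using that[of "Min B" "Max B"] assms ne by auto
qed


text \<open>Vinogradov's lemma. Two elements of \<open>S\<close> in a window of length
  \<open>4 * K\<close> give a small \<open>c\<close> for which \<open>\<alpha> * c\<close> is within
  2\<rho> of an integer; along a residue class modulo \<open>c\<close> the phase then drifts by a
  tiny amount \<beta> per step. Since the phase has to stay near one point modulo 1 for a positive
  proportion of the class, the total drift over a length \<open>L\<close> is only O(K^2 \<rho>),
  which improves the first bound for \<beta> by a factor of order L.\<close>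

lemma vinogradov:
  fixes \<alpha> \<gamma> \<rho> :: real
  assumes K: "K \<ge> (1::nat)" and S: "S \<subseteq> {..<L}" "card S * K \<ge> L"
    and L: "L \<ge> 64 * K ^ 2"
    and \<rho>: "\<rho> \<ge> 0" "128 * real K * \<rho> < 1"
    and nd: "\<And>k. k \<in> S \<Longrightarrow> nd (\<alpha> * real k + \<gamma>) \<le> \<rho>"
  obtains c where "1 \<le> c" "c \<le> 4 * K" "nd (\<alpha> * real c) \<le> 128 * real K ^ 2 * \<rho> / real L"
proof -
  have K2: "K \<le> K ^ 2" "1 \<le> K ^ 2" using K by (auto simp: power2_eq_square)
  then have "L > 0" using L by linarith
  have finS: "finite S" using S(1) finite_subset by blast
  have "4 * K \<le> L" using L K2 by linarith
  moreover have "real (card S) * real K \<ge> real L" using S(2) by (metis of_nat_le_iff of_nat_mult)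
  ultimately obtain a where a: "real (card (S \<inter> {a..<a + 4 * K})) * (2 * real K) \<ge> real (4 * K)"
    using dense_window[of S L "4 * K" "real K"] S(1) K \<open>L > 0\<close> by auto
  have "card (S \<inter> {a..<a + 4 * K}) \<ge> 2"
  proof (rule ccontr)
    assume "\<not> ?thesis"
    then have "real (card (S \<inter> {a..<a + 4 * K})) \<le> 1" by linarith
    then have "real (card (S \<inter> {a..<a + 4 * K})) * (2 * real K) \<le> 1 * (2 * real K)" by (intro mult_right_mono) auto
    then show False using a K by simp
  qed
  then obtain x y where xy: "x \<in> S" "y \<in> S" "x < y" "x \<in> {a..<a + 4 * K}" "y \<in> {a..<a + 4 * K}"
    using two_far_apart[of "S \<inter> {a..<a + 4 * K}"] finS by (metis IntD1 IntD2 finite_Int)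
  define c where "c = y - x"
  have c: "1 \<le> c" "c \<le> 4 * K" using xy by (auto simp: c_def)
  have diff: "nd (\<alpha> * real (v - u)) \<le> 2 * \<rho>" if "u \<in> S" "v \<in> S" "u \<le> v" for u v
  proof -
    have "\<alpha> * real (v - u) = (\<alpha> * real v + \<gamma>) - (\<alpha> * real u + \<gamma>)"
      using that by (simp add: of_nat_diff algebra_simps)
    then have "nd (\<alpha> * real (v - u)) \<le> nd (\<alpha> * real v + \<gamma>) + nd (\<alpha> * real u + \<gamma>)" by (metis nd_diff)
    then show ?thesis using nd[OF that(1)] nd[OF that(2)] by linarith
  qed
  define \<beta> where "\<beta> = \<alpha> * real c - of_int (round (\<alpha> * real c))"
  have nb: "nd (\<alpha> * real c) = \<bar>\<beta>\<bar>" by (simp add: nd_def \<beta>_def)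
  have b2: "\<bar>\<beta>\<bar> \<le> 2 * \<rho>" using diff[OF xy(1,2)] xy(3) by (simp add: c_def nb[symmetric])
  have mult: "nd (\<alpha> * real (c * m)) = nd (\<beta> * real m)" for m
  proof -
    have "\<alpha> * real (c * m) = \<beta> * real m + of_int (round (\<alpha> * real c) * int m)" by (simp add: \<beta>_def algebra_simps)
    then show ?thesis by (metis nd_add_int)
  qed
  \<comment> \<open>Work in the residue class modulo \<open>c\<close> in which \<open>S\<close> is
    densest; there \<open>\<alpha>\<close> acts like \<beta> modulo 1.\<close>
  define A where "A r = {m. c * m + r \<in> S}" for r
  define n where "n = L div c + 1"
  have An: "A r \<subseteq> {..<n}" for r
  proof
    fix m assume "m \<in> A r"
    then have "c * m < L" using S(1) by (auto simp: A_def)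
    then have "m \<le> L div c" using c by (simp add: less_eq_div_iff_mult_less_eq mult.commute)
    then show "m \<in> {..<n}" by (simp add: n_def)
  qed
  have finA: "finite (A r)" for r using An finite_subset by blast
  have cardS: "card S \<le> (\<Sum>r<c. card (A r))"
  proof -
    have "S \<subseteq> (\<Union>r\<in>{..<c}. (\<lambda>m. c * m + r) ` A r)"
    proof
      fix s assume "s \<in> S"
      then have "s div c \<in> A (s mod c)" by (simp add: A_def)
      moreover have "s mod c < c" using c by simp
      ultimately show "s \<in> (\<Union>r\<in>{..<c}. (\<lambda>m. c * m + r) ` A r)"
        by (intro UN_I[of "s mod c"] image_eqI[of _ _ "s div c"]) auto
    qed
    then have "card S \<le> card (\<Union>r\<in>{..<c}. (\<lambda>m. c * m + r) ` A r)" by (intro card_mono) (auto simp: finA)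
    also have "\<dots> \<le> (\<Sum>r<c. card ((\<lambda>m. c * m + r) ` A r))" by (rule card_UN_le) simp
    also have "\<dots> \<le> (\<Sum>r<c. card (A r))" by (intro sum_mono card_image_le finA)
    finally show ?thesis .
  qed
  obtain r where r: "card S \<le> c * card (A r)"
  proof (rule ccontr)
    assume "\<not> thesis"
    then have "\<forall>r. c * card (A r) < card S" using that by (meson not_le)
    then have "(\<Sum>r<c. c * card (A r)) < (\<Sum>r<c. card S)" using c by (intro sum_strict_mono) (auto simp: lessThan_empty_iff)
    then have "c * (\<Sum>r<c. card (A r)) < c * card S" by (simp add: sum_distrib_left)
    then show False using cardS by (simp add: not_less)
  qed
  have Lc: "L \<le> c * K * card (A r)"
  proof -
    have "L \<le> card S * K" by (rule S(2))
    also have "\<dots> \<le> (c * card (A r)) * K" using r by (rule mult_right_mono) simp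
    finally show ?thesis by (simp add: mult_ac)
  qed
  have cn: "c * n \<le> 2 * L"
  proof -
    have "c * (L div c) \<le> L" by simp
    moreover have "c \<le> L" using c \<open>4 * K \<le> L\<close> by linarith
    moreover have "c * n = c * (L div c) + c" by (simp add: n_def)
    ultimately show ?thesis by linarith
  qed
  have dens: "real (card (A r)) * (2 * real K) \<ge> real n"
  proof -
    have "c * n \<le> 2 * (c * K * card (A r))" using cn Lc by linarith
    also have "\<dots> = c * (2 * K * card (A r))" by simp
    finally have "c * n \<le> c * (2 * K * card (A r))" .
    then have "n \<le> 2 * K * card (A r)" using c by simp
    then have "real n \<le> real (2 * K * card (A r))" by (simp only: of_nat_le_iff)
    then show ?thesis by (simp add: mult_ac)
  qed
  have close: "\<bar>\<beta>\<bar> * real (v - u) \<le> 2 * \<rho>" if "u \<in> A r" "v \<in> A r" "u \<le> v" "\<bar>\<beta>\<bar> * real (v - u) \<le> 1/2" for u v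
  proof -
    have "nd (\<alpha> * real ((c * v + r) - (c * u + r))) \<le> 2 * \<rho>" using that by (intro diff) (auto simp: A_def)
    moreover have "(c * v + r) - (c * u + r) = c * (v - u)" by (simp add: diff_mult_distrib2)
    ultimately have *: "nd (\<beta> * real (v - u)) \<le> 2 * \<rho>" by (simp only: mult)
    have "\<bar>\<beta> * real (v - u)\<bar> \<le> 1/2" using that(4) by (simp add: abs_mult)
    then have "nd (\<beta> * real (v - u)) = \<bar>\<beta> * real (v - u)\<bar>"
    proof -
      let ?z = "\<beta> * real (v - u)"
      assume z: "\<bar>?z\<bar> \<le> 1/2"
      have "\<bar>?z\<bar> \<le> \<bar>?z - of_int m\<bar>" for m :: int
      proof (cases "m = 0")
        case False
        then have "\<bar>real_of_int m\<bar> \<ge> 1" by linarith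
        then show ?thesis using z by linarith
      qed simp
      then show ?thesis using nd_le_abs[of ?z] unfolding nd_def by (meson antisym)
    qed
    then show ?thesis using * by (simp add: abs_mult)
  qed
  have n0: "n > 0" by (simp add: n_def)
  have "\<bar>\<beta>\<bar> \<le> 128 * real K ^ 2 * \<rho> / real L"
  proof (cases "\<bar>\<beta>\<bar> * real n \<le> 1/2")
    \<comment> \<open>The phase does not wrap around the circle: two far apart elements of
      \<open>A r\<close> bound the drift at once.\<close>
    case True
    have cardA2: "real (card (A r)) \<ge> 8"
    proof -
      have "c * K * card (A r) \<le> 4 * K * K * card (A r)" using c by (intro mult_right_mono) auto
      then have "64 * K ^ 2 \<le> 4 * K * K * card (A r)" using L Lc by linarith
      then have "64 * K ^ 2 \<le> (4 * card (A r)) * K ^ 2" by (simp add: power2_eq_square mult_ac)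
      then have "16 \<le> card (A r)" using K by (simp add: mult_le_cancel2)
      then show ?thesis by simp
    qed
    then have "card (A r) \<ge> 2" by linarith
    then obtain u v where uv: "u \<in> A r" "v \<in> A r" "u < v" "card (A r) \<le> v - u + 1"
      using two_far_apart[OF finA] by blast
    have "v < n" using An uv(2) by auto
    then have "real (v - u) \<le> real n" by linarith
    then have "\<bar>\<beta>\<bar> * real (v - u) \<le> \<bar>\<beta>\<bar> * real n" by (intro mult_left_mono) auto
    then have 1: "\<bar>\<beta>\<bar> * real (v - u) \<le> 2 * \<rho>" using close[OF uv(1,2)] uv(3) True by linarith
    have "real (card (A r)) \<le> real (v - u) + 1" using uv(4) by linarith
    then have "real (card (A r)) \<le> 2 * real (v - u)" using cardA2 by linarith
    then have "\<bar>\<beta>\<bar> * real (card (A r)) \<le> \<bar>\<beta>\<bar> * (2 * real (v - u))" by (intro mult_left_mono) auto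
    then have 2: "\<bar>\<beta>\<bar> * real (card (A r)) \<le> 4 * \<rho>" using 1 by linarith
    have "c * K * card (A r) \<le> 4 * K * K * card (A r)" using c by (intro mult_right_mono) auto
    then have "L \<le> 4 * K * K * card (A r)" using Lc by linarith
    then have "real L \<le> real (4 * K * K * card (A r))" by (simp only: of_nat_le_iff)
    also have "\<dots> = 4 * real K ^ 2 * real (card (A r))" by (simp add: power2_eq_square)
    finally have "\<bar>\<beta>\<bar> * real L \<le> \<bar>\<beta>\<bar> * (4 * real K ^ 2 * real (card (A r)))" by (intro mult_left_mono) auto
    also have "\<dots> = 4 * real K ^ 2 * (\<bar>\<beta>\<bar> * real (card (A r)))" by simp
    also have "\<dots> \<le> 4 * real K ^ 2 * (4 * \<rho>)" using 2 by (intro mult_left_mono) auto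
    also have "\<dots> \<le> 128 * real K ^ 2 * \<rho>" using \<rho> by simp
    finally show ?thesis using \<open>L > 0\<close> by (simp add: field_simps)
  next
    case False
    then have b0: "\<bar>\<beta>\<bar> > 0" by (cases "\<beta> = 0") auto
    \<comment> \<open>\<open>T\<close> steps of size |\<beta>| advance by at most 1/2, so the phase
      does not wrap within a window of length \<open>T\<close>. A dense window would then force
      \<rho> >= 1/(64K), which the hypothesis on \<rho> excludes.\<close>
    define T where "T = nat \<lfloor>1 / (2 * \<bar>\<beta>\<bar>)\<rfloor>"
    have "128 * real K * \<rho> \<ge> 128 * \<rho>" using K \<rho>(1) by (simp add: mult_le_cancel_right1)
    then have b4: "\<bar>\<beta>\<bar> \<le> 1/64" using b2 \<rho> by linarith
    have T1: "real T \<le> 1 / (2 * \<bar>\<beta>\<bar>)" unfolding T_def using b0 by (simp add: of_nat_nat)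
    have T2: "real T \<ge> 1 / (2 * \<bar>\<beta>\<bar>) - 1" unfolding T_def using b0 by (simp add: of_nat_nat)
    have Tb: "\<bar>\<beta>\<bar> * real T \<le> 1/2" using T1 b0 by (simp add: field_simps)
    have Tb2: "\<bar>\<beta>\<bar> * real T \<ge> 1/2 - \<bar>\<beta>\<bar>"
    proof -
      have "\<bar>\<beta>\<bar> * (1 / (2 * \<bar>\<beta>\<bar>) - 1) \<le> \<bar>\<beta>\<bar> * real T" using T2 by (intro mult_left_mono) auto
      moreover have "\<bar>\<beta>\<bar> * (1 / (2 * \<bar>\<beta>\<bar>) - 1) = 1/2 - \<bar>\<beta>\<bar>" using b0 by (simp add: field_simps)
      ultimately show ?thesis by simp
    qed
    have T0: "0 < T" using Tb2 b4 by (cases "T = 0") auto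
    have Tn: "T \<le> n"
    proof (rule ccontr)
      assume "\<not> T \<le> n"
      then have "\<bar>\<beta>\<bar> * real n \<le> \<bar>\<beta>\<bar> * real T" by (intro mult_left_mono) auto
      then show False using False Tb by linarith
    qed
    obtain a' where a': "real (card (A r \<inter> {a'..<a' + T})) * (2 * (2 * real K)) \<ge> real T"
      using dense_window[OF An T0 Tn, of r "2 * real K"] dens n0 K by auto
    define B where "B = A r \<inter> {a'..<a' + T}"
    have finB: "finite B" by (simp add: B_def)
    have B4: "real (card B) * (4 * real K) \<ge> real T" using a' by (simp add: B_def)
    have Tbig: "\<bar>\<beta>\<bar> * real T \<ge> 1/4" using Tb2 b4 by linarith
    have "\<bar>\<beta>\<bar> * real (card B) \<le> 2 * \<rho> + \<bar>\<beta>\<bar>"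
    proof (cases "card B \<ge> 2")
      case True
      then obtain u v where uv: "u \<in> B" "v \<in> B" "u < v" "card B \<le> v - u + 1"
        using two_far_apart[OF finB] by blast
      have "real (v - u) \<le> real T" using uv unfolding B_def by auto
      then have "\<bar>\<beta>\<bar> * real (v - u) \<le> \<bar>\<beta>\<bar> * real T" by (intro mult_left_mono) auto
      then have 1: "\<bar>\<beta>\<bar> * real (v - u) \<le> 2 * \<rho>" using close[of u v] uv Tb unfolding B_def by auto
      have "real (card B) \<le> real (v - u) + 1" using uv(4) by linarith
      then have "\<bar>\<beta>\<bar> * real (card B) \<le> \<bar>\<beta>\<bar> * (real (v - u) + 1)" by (intro mult_left_mono) auto
      then show ?thesis using 1 by (simp add: algebra_simps)
    next
      case False
      then have "real (card B) \<le> 1" by linarith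
      then have "\<bar>\<beta>\<bar> * real (card B) \<le> \<bar>\<beta>\<bar> * 1" by (intro mult_left_mono) auto
      then show ?thesis using \<rho> by simp
    qed
    then have "\<bar>\<beta>\<bar> * real (card B) \<le> 4 * \<rho>" using b2 by linarith
    then have "\<bar>\<beta>\<bar> * real (card B) * (4 * real K) \<le> 4 * \<rho> * (4 * real K)" by (intro mult_right_mono) auto
    moreover have "\<bar>\<beta>\<bar> * real T \<le> \<bar>\<beta>\<bar> * (real (card B) * (4 * real K))" using B4 by (intro mult_left_mono) auto
    ultimately have "1/4 \<le> 16 * real K * \<rho>" using Tbig by (simp add: mult_ac)
    then show ?thesis using \<rho>(2) by linarith
  qed
  then show ?thesis using that[of c] c nb by simp
qed


section \<open>Translates and local averages of sums over intervals\<close>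

lemma norm_sum_shift:
  fixes F :: "int \<Rightarrow> 'a::real_normed_vector"
  assumes B: "\<And>i. norm (F i) \<le> B"
  shows "norm ((\<Sum>i<n. F (int i + s)) - (\<Sum>i<n. F (int i))) \<le> 2 * \<bar>real_of_int s\<bar> * B"
proof -
  have step: "norm ((\<Sum>i<n. G (int i + 1)) - (\<Sum>i<n. G (int i))) \<le> 2 * B" if "\<And>i. norm (G i) \<le> B"
    for G :: "int \<Rightarrow> 'a"
  proof -
    have "(\<Sum>i<n. G (int i + 1)) - (\<Sum>i<n. G (int i)) = G (int n) - G 0"
      by (induction n) (auto simp: algebra_simps)
    also have "norm \<dots> \<le> norm (G (int n)) + norm (G 0)" by (rule norm_triangle_ineq4)
    finally show ?thesis using that[of "int n"] that[of 0] by linarith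
  qed
  have pos: "norm ((\<Sum>i<n. G (int i + int k)) - (\<Sum>i<n. G (int i))) \<le> 2 * real k * B" if G: "\<And>i. norm (G i) \<le> B"
    for G :: "int \<Rightarrow> 'a" and k
  proof (induction k)
    case 0 then show ?case by simp
  next
    case (Suc k)
    have "norm ((\<Sum>i<n. G (int i + 1 + int k)) - (\<Sum>i<n. G (int i + int k))) \<le> 2 * B"
      using step[of "\<lambda>i. G (i + int k)"] G by simp
    moreover have "norm (((\<Sum>i<n. G (int i + 1 + int k)) - (\<Sum>i<n. G (int i + int k))) +
        ((\<Sum>i<n. G (int i + int k)) - (\<Sum>i<n. G (int i))))
      \<le> norm ((\<Sum>i<n. G (int i + 1 + int k)) - (\<Sum>i<n. G (int i + int k))) +
        norm ((\<Sum>i<n. G (int i + int k)) - (\<Sum>i<n. G (int i)))" by (rule norm_triangle_ineq)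
    ultimately show ?case using Suc by (simp add: algebra_simps)
  qed
  show ?thesis
  proof (cases "s \<ge> 0")
    case True
    then show ?thesis using pos[of F "nat s"] B by simp
  next
    case False
    have "norm ((\<Sum>i<n. F (int i + s + int (nat (- s)))) - (\<Sum>i<n. F (int i + s))) \<le> 2 * real (nat (- s)) * B"
      using pos[of "\<lambda>i. F (i + s)" "nat (- s)"] B by (simp add: algebra_simps)
    then show ?thesis using False by (simp add: norm_minus_commute)
  qed
qed

text \<open>The device for localising: a sum over a long interval becomes an average of sums over
  short progressions, and only the ends of the interval are lost.\<close>

lemma norm_sum_average:
  fixes F :: "int \<Rightarrow> 'a::real_normed_vector" and s :: "nat \<Rightarrow> int"
  assumes B: "\<And>i. norm (F i) \<le> B" and s: "\<And>k. k < W \<Longrightarrow> \<bar>s k\<bar> \<le> X"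
  shows "norm ((\<Sum>i<n. \<Sum>k<W. F (int i + s k)) - of_nat W *\<^sub>R (\<Sum>i<n. F (int i))) \<le> 2 * real W * real_of_int X * B"
proof -
  have B0: "B \<ge> 0" using B[of 0] norm_ge_zero order_trans by blast
  have "(\<Sum>i<n. \<Sum>k<W. F (int i + s k)) - of_nat W *\<^sub>R (\<Sum>i<n. F (int i))
      = (\<Sum>k<W. (\<Sum>i<n. F (int i + s k)) - (\<Sum>i<n. F (int i)))"
    by (subst sum.swap) (simp add: sum_subtractf sum_constant_scaleR)
  also have "norm \<dots> \<le> (\<Sum>k<W. 2 * real_of_int X * B)"
  proof (rule sum_norm_le)
    fix k assume "k \<in> {..<W}"
    then have "\<bar>real_of_int (s k)\<bar> \<le> real_of_int X" using s[of k] by (metis lessThan_iff of_int_abs of_int_le_iff)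
    then have "2 * \<bar>real_of_int (s k)\<bar> * B \<le> 2 * real_of_int X * B" using B0 by (intro mult_right_mono) auto
    with norm_sum_shift[of F B "s k" n] B
    show "norm ((\<Sum>i<n. F (int i + s k)) - (\<Sum>i<n. F (int i))) \<le> 2 * real_of_int X * B" by simp
  qed
  finally show ?thesis by (simp add: mult_ac)
qed

section \<open>Weyl sums and bilinear Fourier analysis\<close>

lemma many_large:
  fixes x :: "'a \<Rightarrow> real"
  assumes "finite A" and x: "\<And>a. a \<in> A \<Longrightarrow> x a \<le> B" and s: "(\<Sum>a\<in>A. x a) \<ge> C * real (card A)" and "B > 0" "C \<ge> 0"
  shows "real (card {a\<in>A. x a \<ge> C / 2}) * (2 * B) \<ge> C * real (card A)"
proof -
  let ?S = "{a\<in>A. x a \<ge> C / 2}"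
  have "(\<Sum>a\<in>A. x a) \<le> (\<Sum>a\<in>A. (if a \<in> ?S then B else 0) + C / 2)"
    using x assms(4,5) by (intro sum_mono) force
  also have "\<dots> = real (card ?S) * B + real (card A) * (C / 2)"
    using assms(1) by (simp add: sum.distrib sum.If_cases Int_def conj_commute)
  finally show ?thesis using s by (simp add: algebra_simps)
qed

text \<open>Differencing and \<open>vinogradov\<close> settle the quadratic coefficient. Once c
  \<alpha> is almost integral, the phase is almost linear on progressions of difference
  \<open>c\<close>, and a linear sum is large only if c \<nu> is almost integral as well. The
  exponents are generous: because of \<open>K \<ge> 2\<close> every numerical factor is absorbed by
  a power of \<open>K\<close>.\<close>

lemma weyl:
  fixes \<alpha> \<nu> :: real
  assumes K: "K \<ge> (2::nat)" and L: "L \<ge> K ^ 80"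
    and big: "norm (\<Sum>j<L. ec (\<alpha> * real j ^ 2 + \<nu> * real j)) \<ge> real L / real K"
  obtains c where "1 \<le> c" "c \<le> K ^ 10" "nd (\<alpha> * real c) \<le> real K ^ 30 / real L ^ 2"
    "nd (\<nu> * real c) \<le> real K ^ 60 / real L"
proof -
  have K1: "real K \<ge> 2" using K by simp
  have pw: "K ^ a \<le> K ^ b" if "a \<le> b" for a b :: nat using K that by (intro power_increasing) auto
  have pwr: "real K ^ a \<le> real K ^ b" if "a \<le> b" for a b :: nat using K that by (intro power_increasing) auto
  have two: "(2::nat) ^ a \<le> K ^ a" for a using K by (intro power_mono) auto
  have twor: "(2::real) ^ a \<le> real K ^ a" for a using K by (intro power_mono) auto
  have L0: "L > 0" using L K by (metis gr0I le_zero_eq power_not_zero zero_neq_numeral not_numeral_le_zero)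
  have Lr: "real L \<ge> real K ^ 80" using L by (metis of_nat_le_iff of_nat_power)
  let ?f = "\<lambda>j. ec (\<alpha> * real j ^ 2 + \<nu> * real j)"
  let ?g = "\<lambda>h. norm (\<Sum>j<L - h. ec ((2 * \<alpha> * real h) * real j))"
  have expand: "(norm (\<Sum>j<L. ?f j)) ^ 2 \<le> 2 * (\<Sum>h<L. ?g h)"
  proof -
    let ?P = "\<lambda>j k. ?f j * cnj (?f k)"
    have sq: "complex_of_real ((norm (\<Sum>j<L. ?f j)) ^ 2) = (\<Sum>j<L. \<Sum>k<L. ?P j k)"
      unfolding complex_norm_square by (simp add: sum_product)
    have split: "(\<Sum>j<L. \<Sum>k<L. ?P j k) = (\<Sum>h<L. \<Sum>k<L - h. ?P (k + h) k) + (\<Sum>h\<in>{1..<L}. \<Sum>k<L - h. ?P k (k + h))"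
    proof -
      have "(\<Sum>j<L. \<Sum>k<L. ?P j k) = (\<Sum>(j,k)\<in>{..<L} \<times> {..<L}. ?P j k)"
        by (simp add: sum.cartesian_product)
      also have "{..<L} \<times> {..<L} = {(j,k). j < L \<and> k \<le> j} \<union> {(j,k). k < L \<and> j < k}" by auto
      also have "(\<Sum>(j,k)\<in>\<dots>. ?P j k) = (\<Sum>(j,k)\<in>{(j,k). j < L \<and> k \<le> j}. ?P j k) + (\<Sum>(j,k)\<in>{(j,k). k < L \<and> j < k}. ?P j k)"
        by (intro sum.union_disjoint) (auto intro: finite_subset[of _ "{..<L} \<times> {..<L}"])
      also have "(\<Sum>(j,k)\<in>{(j,k). j < L \<and> k \<le> j}. ?P j k) = (\<Sum>(h,k)\<in>(SIGMA h:{..<L}. {..<L - h}). ?P (k + h) k)"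
        by (rule sum.reindex_bij_witness[of _ "\<lambda>(h,k). (k + h, k)" "\<lambda>(j,k). (j - k, k)"]) auto
      also have "\<dots> = (\<Sum>h<L. \<Sum>k<L - h. ?P (k + h) k)" by (simp add: sum.Sigma)
      also have "(\<Sum>(j,k)\<in>{(j,k). k < L \<and> j < k}. ?P j k) = (\<Sum>(h,k)\<in>(SIGMA h:{1..<L}. {..<L - h}). ?P k (k + h))"
        by (rule sum.reindex_bij_witness[of _ "\<lambda>(h,k). (k, k + h)" "\<lambda>(j,k). (k - j, j)"]) auto
      also have "\<dots> = (\<Sum>h\<in>{1..<L}. \<Sum>k<L - h. ?P k (k + h))" by (simp add: sum.Sigma)
      finally show ?thesis .
    qed
    have P1: "?P (k + h) k = ec (\<alpha> * real h ^ 2 + \<nu> * real h) * ec ((2 * \<alpha> * real h) * real k)" for k h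
      unfolding cnj_ec ec_add[symmetric] by (rule arg_cong[of _ _ ec]) (simp add: algebra_simps power2_eq_square)
    have n1: "norm (\<Sum>k<L - h. ?P (k + h) k) = ?g h" for h
      unfolding P1 sum_distrib_left[symmetric] by (simp add: norm_mult)
    have n2: "norm (\<Sum>k<L - h. ?P k (k + h)) = ?g h" for h
    proof -
      have "(\<Sum>k<L - h. ?P k (k + h)) = cnj (\<Sum>k<L - h. ?P (k + h) k)" by (simp add: mult.commute)
      then show ?thesis by (simp only: complex_mod_cnj n1)
    qed
    have "(norm (\<Sum>j<L. ?f j)) ^ 2 = norm (complex_of_real ((norm (\<Sum>j<L. ?f j)) ^ 2))" by (simp add: norm_power)
    also have "\<dots> \<le> norm (\<Sum>h<L. \<Sum>k<L - h. ?P (k + h) k) + norm (\<Sum>h\<in>{1..<L}. \<Sum>k<L - h. ?P k (k + h))"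
      unfolding sq split by (rule norm_triangle_ineq)
    also have "\<dots> \<le> (\<Sum>h<L. ?g h) + (\<Sum>h\<in>{1..<L}. ?g h)"
      by (intro add_mono sum_norm_le) (simp_all only: n1 n2 order_refl)
    also have "(\<Sum>h\<in>{1..<L}. ?g h) \<le> (\<Sum>h<L. ?g h)" by (intro sum_mono2) auto
    finally show ?thesis by simp
  qed
  have "(real L / real K) ^ 2 \<le> (norm (\<Sum>j<L. ?f j)) ^ 2" using big by (intro power_mono) auto
  then have "(\<Sum>h<L. ?g h) \<ge> (real L / (2 * real K ^ 2)) * real (card {..<L})"
    using expand by (simp add: power2_eq_square)
  moreover have "?g h \<le> real L" for h
  proof -
    have "?g h \<le> (\<Sum>j<L - h. norm (ec ((2 * \<alpha> * real h) * real j)))" by (rule norm_sum)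
    then show ?thesis by simp
  qed
  ultimately have *: "real (card {h\<in>{..<L}. ?g h \<ge> real L / (2 * real K ^ 2) / 2}) * (2 * real L) \<ge> real L / (2 * real K ^ 2) * real (card {..<L})"
    using L0 by (intro many_large) auto
  define S where "S = {h\<in>{..<L}. ?g h \<ge> real L / (2 * real K ^ 2) / 2}"
  define K' where "K' = 4 * K ^ 2"
  have cS: "card S * K' \<ge> L"
  proof -
    have "real (card S) * (2 * real L) * (2 * real K ^ 2) \<ge> real L * real L" using * K1 by (simp add: S_def field_simps)
    then have "real L * (real (card S) * (4 * real K ^ 2)) \<ge> real L * real L" by (simp add: mult_ac)
    then have "real (card S) * (4 * real K ^ 2) \<ge> real L" using L0 by simp
    then have "real (card S * K') \<ge> real L" by (simp add: K'_def)
    then show ?thesis by (simp only: of_nat_le_iff)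
  qed
  define \<rho> where "\<rho> = 8 * real K ^ 2 / real L"
  have ndS: "nd ((2 * \<alpha>) * real h + 0) \<le> \<rho>" if "h \<in> S" for h
  proof -
    have g: "?g h \<ge> real L / (4 * real K ^ 2)" using that by (simp add: S_def)
    have "?g h * nd (2 * \<alpha> * real h) \<le> 2" using norm_sum_ec[of "2 * \<alpha> * real h" 0 "L - h"] by simp
    moreover have "real L / (4 * real K ^ 2) * nd (2 * \<alpha> * real h) \<le> ?g h * nd (2 * \<alpha> * real h)"
      using g by (intro mult_right_mono) auto
    ultimately have "real L / (4 * real K ^ 2) * nd (2 * \<alpha> * real h) \<le> 2" by linarith
    then show ?thesis using L0 K1 by (simp add: \<rho>_def field_simps)
  qed
  have K'4: "K' \<le> K ^ 4"
  proof -
    have "2 ^ 2 * K ^ 2 \<le> K ^ 2 * K ^ 2" using two[of 2] by (rule mult_right_mono) simp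
    then show ?thesis by (simp add: K'_def flip: power_add)
  qed
  have r4: "real K' \<le> real K ^ 4" using K'4 by (metis of_nat_le_iff of_nat_power)
  have L64: "L \<ge> 64 * K' ^ 2"
  proof -
    have "64 * K' ^ 2 \<le> K ^ 6 * (K ^ 4) ^ 2" using two[of 6] K'4 by (intro mult_mono power_mono) auto
    also have "\<dots> = K ^ 14" by (simp flip: power_mult power_add)
    also have "\<dots> \<le> L" using pw[of 14 80] L by linarith
    finally show ?thesis .
  qed
  have r1: "8 * real K ^ 2 \<le> real K ^ 5"
  proof -
    have "2 ^ 3 * real K ^ 2 \<le> real K ^ 3 * real K ^ 2" using twor[of 3] by (rule mult_right_mono) simp
    then show ?thesis by (simp flip: power_add)
  qed
  have rho5: "\<rho> \<le> real K ^ 5 / real L" unfolding \<rho>_def using r1 by (intro divide_right_mono) auto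
  have rho0: "0 \<le> \<rho>" by (simp add: \<rho>_def)
  have rhosmall: "128 * real K' * \<rho> < 1"
  proof -
    have "128 * real K' * \<rho> \<le> real K ^ 7 * real K ^ 4 * (real K ^ 5 / real L)"
      using twor[of 7] r4 rho5 rho0 by (intro mult_mono) auto
    also have "\<dots> = real K ^ 16 / real L" by (simp flip: power_add)
    also have "\<dots> < 1"
    proof -
      have "real K ^ 16 < real K ^ 80" using K1 by (intro power_strict_increasing) auto
      then have "real K ^ 16 < real L" using Lr by linarith
      then show ?thesis using L0 by (simp add: divide_less_eq)
    qed
    finally show ?thesis .
  qed
  have K'1: "K' \<ge> 1" using K by (simp add: K'_def)
  have SL: "S \<subseteq> {..<L}" by (auto simp: S_def)
  obtain c0 where c0: "1 \<le> c0" "c0 \<le> 4 * K'" "nd ((2 * \<alpha>) * real c0) \<le> 128 * real K' ^ 2 * \<rho> / real L"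
    using vinogradov[OF K'1 SL cS L64 rho0 rhosmall ndS] by blast
  \<comment> \<open>Differencing by \<open>h\<close> leaves the slope
    \<open>2 * \<alpha> * h\<close>, so \<open>c0\<close> is a denominator of
    \<open>2 * \<alpha>\<close>.\<close>
  define c where "c = 2 * c0"
  have c1: "1 \<le> c" using c0 by (simp add: c_def)
  have c10: "c \<le> K ^ 10"
  proof -
    have "c \<le> 8 * K'" using c0 by (simp add: c_def)
    also have "\<dots> \<le> K ^ 3 * K ^ 4" using two[of 3] K'4 by (intro mult_mono) auto
    also have "\<dots> \<le> K ^ 10" using pw[of 7 10] by (simp flip: power_add)
    finally show ?thesis .
  qed
  have c10r: "real c \<le> real K ^ 10" using c10 by (metis of_nat_le_iff of_nat_power)
  have nda: "nd (\<alpha> * real c) \<le> real K ^ 20 / real L ^ 2"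
  proof -
    have "128 * real K' ^ 2 * \<rho> \<le> real K ^ 7 * (real K ^ 4) ^ 2 * (real K ^ 5 / real L)"
      using twor[of 7] r4 rho5 rho0 by (intro mult_mono power_mono) auto
    also have "\<dots> = real K ^ 20 / real L" by (simp flip: power_add power_mult)
    finally have "128 * real K' ^ 2 * \<rho> / real L \<le> real K ^ 20 / real L / real L" by (rule divide_right_mono) simp
    then show ?thesis using c0(3) by (simp add: c_def power2_eq_square mult_ac)
  qed
  define \<beta> where "\<beta> = \<alpha> * real c - of_int (round (\<alpha> * real c))"
  have b: "\<bar>\<beta>\<bar> \<le> real K ^ 20 / real L ^ 2" using nda by (simp add: nd_def \<beta>_def)
  \<comment> \<open>Length of the progressions of difference \<open>c\<close>. The ratio
    \<open>L' / L \<le> 1 / K ^ 40\<close> beats the factor \<open>K ^ 20\<close> in the bound for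
    \<beta>, which keeps the non-linear part of the phase harmless; the length loses only a power of
    \<open>K\<close>.\<close>
  define L' where "L' = L div K ^ 40"
  have L'1: "real L' \<le> real L / real K ^ 40" unfolding L'_def by (metis of_nat_div_le_of_nat of_nat_power)
  have L'2: "real L' \<ge> real L / real K ^ 41"
  proof -
    have "L < (L' + 1) * K ^ 40" unfolding L'_def using dividend_less_div_times[of "K ^ 40" L] K by simp
    then have "real L < (real L' + 1) * real K ^ 40" by (metis of_nat_1 of_nat_add of_nat_less_iff of_nat_mult of_nat_power)
    moreover have "L' \<ge> 1"
    proof -
      have "K ^ 40 \<le> L" using pw[of 40 80] L by linarith
      then show ?thesis unfolding L'_def using K by (simp add: Suc_le_eq div_greater_zero_iff)
    qed
    then have "(real L' + 1) * real K ^ 40 \<le> (real L' * real K) * real K ^ 40"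
    proof -
      assume "L' \<ge> 1"
      then have "real L' * real K \<ge> real L' * 2" using K1 by (intro mult_left_mono) auto
      then have "real L' + 1 \<le> real L' * real K" using \<open>L' \<ge> 1\<close> by linarith
      then show ?thesis by (intro mult_right_mono) auto
    qed
    moreover have "real L' * real K ^ 41 = (real L' * real K) * real K ^ 40" by (simp add: mult.assoc flip: power_Suc)
    ultimately have "real L < real L' * real K ^ 41" by linarith
    then show ?thesis using K1 by (simp add: field_simps)
  qed
  have "real L / real K ^ 41 > 0" using L0 K by simp
  then have "real L' > 0" using L'2 by linarith
  then have L'0: "L' > 0" by simp
  define F where "F = (\<lambda>i::int. ec (\<alpha> * real_of_int i ^ 2 + \<nu> * real_of_int i))"
  have "norm ((\<Sum>i<L. \<Sum>k<L'. F (int i + int c * int k)) - of_nat L' *\<^sub>R (\<Sum>i<L. F (int i))) \<le> 2 * real L' * real_of_int (int (c * L')) * 1"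
  proof (rule norm_sum_average)
    show "norm (F i) \<le> 1" for i by (simp add: F_def)
    fix k assume "k < L'"
    then show "\<bar>int c * int k\<bar> \<le> int (c * L')" by (simp add: abs_mult mult_left_mono)
  qed
  moreover have "(\<Sum>i<L. F (int i)) = (\<Sum>j<L. ?f j)" by (simp add: F_def)
  moreover have "real L' * norm (\<Sum>j<L. ?f j) \<ge> real L' * (real L / real K)" using big by (intro mult_left_mono) auto
  ultimately have A: "norm (\<Sum>i<L. \<Sum>k<L'. F (int i + int c * int k)) \<ge> real L' * (real L / real K) - 2 * real L' * (real c * real L')"
  proof -
    let ?X = "\<Sum>i<L. \<Sum>k<L'. F (int i + int c * int k)" and ?Y = "of_nat L' *\<^sub>R (\<Sum>i<L. F (int i))"
    assume a: "norm (?X - ?Y) \<le> 2 * real L' * real_of_int (int (c * L')) * 1"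
      and e: "(\<Sum>i<L. F (int i)) = (\<Sum>j<L. ?f j)" and g: "real L' * norm (\<Sum>j<L. ?f j) \<ge> real L' * (real L / real K)"
    have "norm ?Y \<le> norm ?X + norm (?Y - ?X)" by (rule norm_triangle_sub)
    then have "norm ?Y \<le> norm ?X + norm (?X - ?Y)" by (simp only: norm_minus_commute)
    moreover have "norm ?Y = real L' * norm (\<Sum>j<L. ?f j)" unfolding e by simp
    moreover have "2 * real L' * real_of_int (int (c * L')) * 1 = 2 * real L' * (real c * real L')" by simp
    ultimately show ?thesis using a g by linarith
  qed
  have cL: "2 * (real c * real L') \<le> real L / (2 * real K)"
  proof -
    have "2 * (real c * real L') \<le> 2 * (real K ^ 10 * (real L / real K ^ 40))" using c10r L'1 by (intro mult_left_mono mult_mono) auto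
    also have "\<dots> = 2 * real L / real K ^ 30" using K1 by (simp add: field_simps flip: power_add)
    also have "\<dots> \<le> 2 * real L / (4 * real K)"
    proof (rule divide_left_mono)
      have "4 * real K \<le> real K ^ 2 * real K" using twor[of 2] K1 by (intro mult_right_mono) auto
      also have "\<dots> \<le> real K ^ 30" using pwr[of 3 30] by (simp add: power2_eq_square power3_eq_cube)
      finally show "4 * real K \<le> real K ^ 30" .
    qed (use K1 in auto)
    finally show ?thesis by (simp add: field_simps)
  qed
  have "norm (\<Sum>i<L. \<Sum>k<L'. F (int i + int c * int k)) \<ge> real L * (real L' / (2 * real K))"
  proof -
    have "real L' * (2 * (real c * real L')) \<le> real L' * (real L / (2 * real K))" using cL by (intro mult_left_mono) auto
    moreover have "real L' * (real L / real K) - real L' * (real L / (2 * real K)) = real L * (real L' / (2 * real K))"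
      using K1 by (simp add: field_simps)
    ultimately show ?thesis using A by linarith
  qed
  then have "(\<Sum>i<L. norm (\<Sum>k<L'. F (int i + int c * int k))) \<ge> real L * (real L' / (2 * real K))"
    using norm_sum[of "\<lambda>i. \<Sum>k<L'. F (int i + int c * int k)" "{..<L}"] by linarith
  then obtain j where j: "j < L" "norm (\<Sum>k<L'. F (int j + int c * int k)) \<ge> real L' / (2 * real K)"
  proof -
    assume *: "(\<Sum>i<L. norm (\<Sum>k<L'. F (int i + int c * int k))) \<ge> real L * (real L' / (2 * real K))"
    have "\<exists>j<L. norm (\<Sum>k<L'. F (int j + int c * int k)) \<ge> real L' / (2 * real K)"
    proof (rule ccontr)
      assume "\<not> ?thesis"
      then have "(\<Sum>i<L. norm (\<Sum>k<L'. F (int i + int c * int k))) < (\<Sum>i<L. real L' / (2 * real K))"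
        using L0 by (intro sum_strict_mono) (auto simp: lessThan_empty_iff not_le)
      then show False using * by simp
    qed
    then show ?thesis using that by blast
  qed
  define m where "m = round (\<alpha> * real c)"
  have ac: "\<alpha> * real c = \<beta> + of_int m" by (simp add: \<beta>_def m_def)
  \<comment> \<open>The integer part \<open>m\<close> of \<open>\<alpha> * c\<close> contributes
    only integers to the phase, so the cross term and the square carry the small \<beta> in place of
    \<open>\<alpha> * c\<close>.\<close>
  have Fk: "F (int j + int c * int k) = ec (\<alpha> * real j ^ 2 + \<nu> * real j) * (ec ((\<nu> * real c) * real k) * ec (2 * \<beta> * real j * real k + \<beta> * real c * real k ^ 2))" for k
  proof -
    have "\<alpha> * real_of_int (int j + int c * int k) ^ 2 + \<nu> * real_of_int (int j + int c * int k)
      = \<alpha> * real j ^ 2 + \<nu> * real j + ((\<nu> * real c) * real k + (2 * (\<alpha> * real c) * real j * real k + (\<alpha> * real c) * real c * real k ^ 2))"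
      by (simp add: algebra_simps power2_eq_square)
    also have "\<dots> = (\<alpha> * real j ^ 2 + \<nu> * real j + ((\<nu> * real c) * real k + (2 * \<beta> * real j * real k + \<beta> * real c * real k ^ 2)))
      + of_int (2 * m * int j * int k + m * int c * int k ^ 2)"
      unfolding ac by (simp add: algebra_simps)
    finally show ?thesis unfolding F_def by (simp only: ec_cong_int) (simp only: ec_add)
  qed
  have small: "norm (ec (2 * \<beta> * real j * real k + \<beta> * real c * real k ^ 2) - 1) \<le> 1 / (4 * real K)" if "k < L'" for k
  proof -
    have "2 * \<beta> * real j * real k + \<beta> * real c * real k ^ 2 = \<beta> * (2 * real j * real k + real c * real k ^ 2)"
      by (simp add: algebra_simps)
    then have "\<bar>2 * \<beta> * real j * real k + \<beta> * real c * real k ^ 2\<bar> = \<bar>\<beta>\<bar> * (2 * real j * real k + real c * real k ^ 2)"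
      by (simp only: abs_mult) simp
    also have "\<dots> \<le> (real K ^ 20 / real L ^ 2) * (2 * real L * real L' + real L * real L')"
    proof -
      have 1: "2 * real j * real k \<le> 2 * real L * real L'" using j that by (intro mult_mono) auto
      have "real c * real k ^ 2 = (real c * real k) * real k" by (simp add: power2_eq_square)
      also have "\<dots> \<le> (real c * real L') * real L'" using that by (intro mult_mono) auto
      also have "\<dots> \<le> real L * real L'"
      proof (rule mult_right_mono)
        have "real L / (2 * real K) \<le> 2 * real L" using K1 L0 by (simp add: field_simps)
        then show "real c * real L' \<le> real L" using cL by linarith
      qed simp
      finally have "real c * real k ^ 2 \<le> real L * real L'" .
      with 1 show ?thesis using b by (intro mult_mono) auto
    qed
    also have "\<dots> = 3 * real K ^ 20 * (real L' / real L)" using L0 by (simp add: field_simps power2_eq_square)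
    also have "\<dots> \<le> 3 * real K ^ 20 * (1 / real K ^ 40)"
      using L'1 L0 by (intro mult_left_mono) (auto simp: field_simps)
    also have "\<dots> = 3 / real K ^ 20" using K1 by (simp add: field_simps flip: power_add)
    finally have "norm (ec (2 * \<beta> * real j * real k + \<beta> * real c * real k ^ 2) - 1) \<le> 21 / real K ^ 20"
      using norm_ec_minus_1_le[of "2 * \<beta> * real j * real k + \<beta> * real c * real k ^ 2"] by simp
    also have "\<dots> \<le> 1 / (4 * real K)"
    proof -
      have "84 * real K \<le> real K ^ 7 * real K" using twor[of 7] K1 by (intro mult_right_mono) auto
      also have "\<dots> \<le> real K ^ 20" using pwr[of 8 20] by (simp flip: power_Suc2)
      finally show ?thesis using K1 by (simp add: field_simps)
    qed
    finally show ?thesis .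
  qed
  have "norm (\<Sum>k<L'. ec ((\<nu> * real c) * real k)) \<ge> real L' / (4 * real K)"
  proof -
    let ?r = "\<lambda>k. ec (2 * \<beta> * real j * real k + \<beta> * real c * real k ^ 2)"
    have "norm (\<Sum>k<L'. F (int j + int c * int k)) = norm (\<Sum>k<L'. ec ((\<nu> * real c) * real k) * ?r k)"
      unfolding Fk sum_distrib_left[symmetric] by (simp add: norm_mult)
    also have "(\<Sum>k<L'. ec ((\<nu> * real c) * real k) * ?r k) = (\<Sum>k<L'. ec ((\<nu> * real c) * real k)) + (\<Sum>k<L'. ec ((\<nu> * real c) * real k) * (?r k - 1))"
      by (simp add: algebra_simps sum.distrib sum_subtractf)
    also have "norm \<dots> \<le> norm (\<Sum>k<L'. ec ((\<nu> * real c) * real k)) + norm (\<Sum>k<L'. ec ((\<nu> * real c) * real k) * (?r k - 1))"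
      by (rule norm_triangle_ineq)
    also have "norm (\<Sum>k<L'. ec ((\<nu> * real c) * real k) * (?r k - 1)) \<le> (\<Sum>k<L'. 1 / (4 * real K))"
      using small by (intro sum_norm_le) (simp add: norm_mult)
    finally show ?thesis using j(2) by (simp add: field_simps)
  qed
  moreover have "norm (\<Sum>k<L'. ec ((\<nu> * real c) * real k)) * nd (\<nu> * real c) \<le> 2"
    using norm_sum_ec[of "\<nu> * real c" 0 L'] by simp
  ultimately have "real L' / (4 * real K) * nd (\<nu> * real c) \<le> 2"
    by (meson dual_order.trans mult_right_mono nd_nonneg)
  then have "nd (\<nu> * real c) \<le> 8 * real K / real L'" using L'0 K1 by (simp add: field_simps)
  also have "\<dots> \<le> 8 * real K / (real L / real K ^ 41)" using L'2 L0 K1 L'0 by (intro divide_left_mono) (auto intro!: mult_pos_pos divide_pos_pos)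
  also have "\<dots> = 8 * real K ^ 42 / real L" using K1 L0 by (simp add: field_simps flip: power_Suc)
  also have "\<dots> \<le> real K ^ 60 / real L"
  proof (rule divide_right_mono)
    have "8 * real K ^ 42 \<le> real K ^ 3 * real K ^ 42" using twor[of 3] by (intro mult_right_mono) auto
    also have "\<dots> \<le> real K ^ 60" using pwr[of 45 60] by (simp flip: power_add)
    finally show "8 * real K ^ 42 \<le> real K ^ 60" .
  qed simp
  finally have ndl: "nd (\<nu> * real c) \<le> real K ^ 60 / real L" .
  have "real K ^ 20 / real L ^ 2 \<le> real K ^ 30 / real L ^ 2" using pwr[of 20 30] by (intro divide_right_mono) auto
  then show ?thesis using that[OF c1 c10 _ ndl] nda by linarith
qed


section \<open>Fourier analysis on a cyclic group and bilinear forms\<close>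

lemma sum_ec_orthogonal:
  assumes "P > 0" and n: "\<bar>n\<bar> < int P"
  shows "(\<Sum>k<P. ec (real k * (real_of_int n / real P))) = (if n = 0 then of_nat P else 0)"
proof (cases "n = 0")
  case False
  define t where "t = real_of_int n / real P"
  have "ec t ^ P = ec (t * real P)" by (simp add: ec_pow)
  also have "\<dots> = 1" using assms by (simp add: t_def)
  finally have 1: "ec t ^ P = 1" .
  have "ec t \<noteq> 1"
  proof
    assume "ec t = 1"
    then have "nd t \<le> 0" using norm_ec_minus_1_ge[of t] by simp
    then have "t = of_int (round t)" by (simp add: nd_def)
    then have "real_of_int n = of_int (round t) * real P" using assms unfolding t_def by (simp add: field_simps)
    then have "real_of_int n = real_of_int (round t * int P)" by simp
    then have "n = round t * int P" by (simp only: of_int_eq_iff)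
    then show False using n False by (simp add: abs_mult)
  qed
  moreover have "(ec t - 1) * (\<Sum>k<P. ec t ^ k) = 0" using 1 by (simp add: power_diff_1_eq[symmetric])
  ultimately have "(\<Sum>k<P. ec t ^ k) = 0" by simp
  then show ?thesis using False by (simp add: t_def[symmetric] mult.commute ec_pow[symmetric])
qed simp

lemma norm_sum_mult_le:
  fixes a b :: "'a \<Rightarrow> complex"
  shows "norm (\<Sum>i\<in>I. a i * b i) ^ 2 \<le> (\<Sum>i\<in>I. norm (a i) ^ 2) * (\<Sum>i\<in>I. norm (b i) ^ 2)"
proof -
  have "norm (\<Sum>i\<in>I. a i * b i) \<le> (\<Sum>i\<in>I. norm (a i) * norm (b i))"
    by (rule order_trans[OF norm_sum]) (simp add: norm_mult)
  then have "norm (\<Sum>i\<in>I. a i * b i) ^ 2 \<le> (\<Sum>i\<in>I. norm (a i) * norm (b i)) ^ 2"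
    by (intro power_mono) auto
  also have "\<dots> \<le> (\<Sum>i\<in>I. norm (a i) ^ 2) * (\<Sum>i\<in>I. norm (b i) ^ 2)" by (rule Cauchy_Schwarz_ineq_sum)
  finally show ?thesis .
qed

lemma norm_sum_mult_bounded_le:
  fixes a b :: "'a \<Rightarrow> complex"
  assumes "finite I" and a: "\<And>i. i \<in> I \<Longrightarrow> norm (a i) \<le> 1"
  shows "norm (\<Sum>i\<in>I. a i * b i) ^ 2 \<le> real (card I) * (\<Sum>i\<in>I. norm (b i) ^ 2)"
proof -
  have "(\<Sum>i\<in>I. norm (a i) ^ 2) \<le> (\<Sum>i\<in>I. 1)" using a by (intro sum_mono) (simp add: power_le_one)
  then have "(\<Sum>i\<in>I. norm (a i) ^ 2) * (\<Sum>i\<in>I. norm (b i) ^ 2) \<le> real (card I) * (\<Sum>i\<in>I. norm (b i) ^ 2)"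
    by (intro mult_right_mono) (auto intro: sum_nonneg)
  with norm_sum_mult_le[of a b I] show ?thesis by linarith
qed

text \<open>Since \<open>i + j < 2 * W\<close>, the sum of indices does not wrap in the cyclic group
  of order \<open>2 * W\<close>, where the form is diagonal; Cauchy--Schwarz and Parseval dispose of
  the arbitrary bounded \<open>\<beta>\<close> and \<open>\<gamma>\<close>. The frequency is taken
  from a finite set, so that a maximal one can later be chosen for each point.\<close>

lemma bilinear_fourier:
  fixes b \<beta> \<gamma> :: "nat \<Rightarrow> complex"
  assumes W: "W > 0" and \<beta>: "\<And>j. norm (\<beta> j) \<le> 1" and \<gamma>: "\<And>j. norm (\<gamma> j) \<le> 1"
  obtains \<theta> where "norm (\<Sum>i<W. \<Sum>j<W. b (i + j) * \<beta> i * \<gamma> j) \<le> real W * norm (\<Sum>n<2 * W. b n * ec (\<theta> * real n))"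
    "\<exists>k<2 * W. \<theta> = real k / real (2 * W)"
proof -
  define P where "P = 2 * W"
  let ?BB = "\<Sum>i<W. \<Sum>j<W. b (i + j) * \<beta> i * \<gamma> j"
  have P: "P > 0" using W by (simp add: P_def)
  define B where "B k = (\<Sum>n<P. b n * ec ((real k / real P) * real n))" for k
  define C where "C k = (\<Sum>i<W. \<beta> i * ec (- (real k / real P) * real i))" for k
  define D where "D k = (\<Sum>j<W. \<gamma> j * ec (- (real k / real P) * real j))" for k
  have pars: "(\<Sum>k<P. norm (\<Sum>i<W. f i * ec (- (real k / real P) * real i)) ^ 2) \<le> real P * real W"
    if f: "\<And>j. norm (f j) \<le> 1" for f :: "nat \<Rightarrow> complex"
  proof -
    have "complex_of_real (\<Sum>k<P. norm (\<Sum>i<W. f i * ec (- (real k / real P) * real i)) ^ 2)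
      = (\<Sum>k<P. \<Sum>i<W. \<Sum>j<W. (f i * ec (- (real k / real P) * real i)) * cnj (f j * ec (- (real k / real P) * real j)))"
      unfolding of_real_sum complex_norm_square by (simp add: sum_product)
    also have "\<dots> = (\<Sum>i<W. \<Sum>j<W. \<Sum>k<P. (f i * ec (- (real k / real P) * real i)) * cnj (f j * ec (- (real k / real P) * real j)))"
      by (subst sum.swap, rule sum.cong[OF refl], subst sum.swap, rule refl)
    also have "\<dots> = (\<Sum>i<W. \<Sum>j<W. f i * cnj (f j) * (if int j - int i = 0 then of_nat P else 0))"
    proof (intro sum.cong refl)
      fix i j assume ij: "i \<in> {..<W}" "j \<in> {..<W}"
      have "(\<Sum>k<P. (f i * ec (- (real k / real P) * real i)) * cnj (f j * ec (- (real k / real P) * real j)))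
        = f i * cnj (f j) * (\<Sum>k<P. ec (real k * (real_of_int (int j - int i) / real P)))"
        unfolding sum_distrib_left
      proof (intro sum.cong refl)
        fix k
        have "ec (- (real k / real P) * real i) * ec (real k / real P * real j) = ec (real k * (real_of_int (int j - int i) / real P))"
          unfolding ec_add[symmetric] by (rule arg_cong[of _ _ ec]) (simp add: algebra_simps diff_divide_distrib add_divide_distrib)
        then show "(f i * ec (- (real k / real P) * real i)) * cnj (f j * ec (- (real k / real P) * real j))
          = f i * cnj (f j) * ec (real k * (real_of_int (int j - int i) / real P))"
          by (simp add: cnj_ec mult_ac)
      qed
      also have "\<dots> = f i * cnj (f j) * (if int j - int i = 0 then of_nat P else 0)"
        using ij by (subst sum_ec_orthogonal[OF P]) (auto simp: P_def)
      finally show "(\<Sum>k<P. (f i * ec (- (real k / real P) * real i)) * cnj (f j * ec (- (real k / real P) * real j)))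
        = f i * cnj (f j) * (if int j - int i = 0 then of_nat P else 0)" .
    qed
    also have "\<dots> = (\<Sum>i<W. of_nat P * (f i * cnj (f i)))"
    proof (intro sum.cong refl)
      fix i assume i: "i \<in> {..<W}"
      have "(\<Sum>j<W. f i * cnj (f j) * (if int j - int i = 0 then of_nat P else 0)) = (\<Sum>j<W. if j = i then of_nat P * (f i * cnj (f i)) else 0)"
        by (intro sum.cong refl) auto
      then show "(\<Sum>j<W. f i * cnj (f j) * (if int j - int i = 0 then of_nat P else 0)) = of_nat P * (f i * cnj (f i))"
        using i by simp
    qed
    also have "\<dots> = complex_of_real (\<Sum>i<W. real P * norm (f i) ^ 2)"
      by (simp add: complex_norm_square[symmetric])
    finally have "(\<Sum>k<P. norm (\<Sum>i<W. f i * ec (- (real k / real P) * real i)) ^ 2) = (\<Sum>i<W. real P * norm (f i) ^ 2)"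
      by (simp only: of_real_eq_iff)
    also have "\<dots> \<le> (\<Sum>i<W. real P * 1)" using f by (intro sum_mono mult_left_mono) (simp_all add: power_le_one)
    finally show ?thesis by (simp add: mult.commute)
  qed
  have main: "of_nat P * ?BB = (\<Sum>k<P. B k * (C k * D k))"
  proof -
    have "(\<Sum>k<P. B k * (C k * D k)) = (\<Sum>k<P. \<Sum>n<P. \<Sum>i<W. \<Sum>j<W. b n * \<beta> i * \<gamma> j * ec (real k * (real_of_int (int n - int i - int j) / real P)))"
    proof (intro sum.cong refl)
      fix k
      have "B k * (C k * D k) = (\<Sum>n<P. \<Sum>i<W. \<Sum>j<W. (b n * ec ((real k / real P) * real n)) * ((\<beta> i * ec (- (real k / real P) * real i)) * (\<gamma> j * ec (- (real k / real P) * real j))))"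
      proof -
        have CD: "C k * D k = (\<Sum>i<W. \<Sum>j<W. (\<beta> i * ec (- (real k / real P) * real i)) * (\<gamma> j * ec (- (real k / real P) * real j)))"
          by (simp only: C_def D_def sum_product)
        show ?thesis by (simp only: CD B_def sum_distrib_right) (simp only: sum_distrib_left)
      qed
      also have "\<dots> = (\<Sum>n<P. \<Sum>i<W. \<Sum>j<W. b n * \<beta> i * \<gamma> j * ec (real k * (real_of_int (int n - int i - int j) / real P)))"
      proof (intro sum.cong refl)
        fix n i j
        have "ec ((real k / real P) * real n) * (ec (- (real k / real P) * real i) * ec (- (real k / real P) * real j))
          = ec (real k * (real_of_int (int n - int i - int j) / real P))"
          unfolding ec_add[symmetric] by (rule arg_cong[of _ _ ec]) (simp add: algebra_simps diff_divide_distrib add_divide_distrib)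
        then show "(b n * ec ((real k / real P) * real n)) * ((\<beta> i * ec (- (real k / real P) * real i)) * (\<gamma> j * ec (- (real k / real P) * real j)))
          = b n * \<beta> i * \<gamma> j * ec (real k * (real_of_int (int n - int i - int j) / real P))"
          by (simp add: mult_ac)
      qed
      finally show "B k * (C k * D k) = (\<Sum>n<P. \<Sum>i<W. \<Sum>j<W. b n * \<beta> i * \<gamma> j * ec (real k * (real_of_int (int n - int i - int j) / real P)))" .
    qed
    also have "\<dots> = (\<Sum>n<P. \<Sum>i<W. \<Sum>j<W. \<Sum>k<P. b n * \<beta> i * \<gamma> j * ec (real k * (real_of_int (int n - int i - int j) / real P)))"
      by (subst sum.swap, rule sum.cong[OF refl], subst sum.swap, rule sum.cong[OF refl], subst sum.swap, rule refl)
    also have "\<dots> = (\<Sum>n<P. \<Sum>i<W. \<Sum>j<W. if n = i + j then of_nat P * (b (i + j) * \<beta> i * \<gamma> j) else 0)"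
    proof (intro sum.cong refl)
      fix n i j assume "n \<in> {..<P}" "i \<in> {..<W}" "j \<in> {..<W}"
      then have "\<bar>int n - int i - int j\<bar> < int P" by (auto simp: P_def)
      then show "(\<Sum>k<P. b n * \<beta> i * \<gamma> j * ec (real k * (real_of_int (int n - int i - int j) / real P))) = (if n = i + j then of_nat P * (b (i + j) * \<beta> i * \<gamma> j) else 0)"
        by (simp only: sum_distrib_left[symmetric] sum_ec_orthogonal[OF P]) auto
    qed
    also have "\<dots> = (\<Sum>i<W. \<Sum>j<W. \<Sum>n<P. if n = i + j then of_nat P * (b (i + j) * \<beta> i * \<gamma> j) else 0)"
      by (subst sum.swap, rule sum.cong[OF refl], subst sum.swap, rule refl)
    also have "\<dots> = (\<Sum>i<W. \<Sum>j<W. of_nat P * (b (i + j) * \<beta> i * \<gamma> j))"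
      by (intro sum.cong refl) (auto simp: P_def)
    finally show ?thesis by (simp add: sum_distrib_left)
  qed
  define X where "X = Max ((\<lambda>k. norm (B k)) ` {..<P})"
  have "X \<in> (\<lambda>k. norm (B k)) ` {..<P}" unfolding X_def using P by (intro Max_in) auto
  then obtain k0 where k0: "k0 < P" "X = norm (B k0)" by auto
  have BX: "norm (B k) \<le> X" if "k < P" for k unfolding X_def using that by (intro Max_ge) auto
  have "real P * norm ?BB = norm (of_nat P * ?BB)"
    by (simp add: norm_mult)
  also have "\<dots> \<le> (\<Sum>k<P. X * (norm (C k) * norm (D k)))"
    unfolding main using BX by (intro sum_norm_le) (simp add: norm_mult mult_right_mono)
  also have "\<dots> = X * (\<Sum>k<P. norm (C k) * norm (D k))" by (simp add: sum_distrib_left)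
  also have "\<dots> \<le> X * (real P * real W)"
  proof (rule mult_left_mono)
    have "(\<Sum>k<P. norm (C k) * norm (D k)) ^ 2 \<le> (\<Sum>k<P. norm (C k) ^ 2) * (\<Sum>k<P. norm (D k) ^ 2)" by (rule Cauchy_Schwarz_ineq_sum)
    also have "\<dots> \<le> (real P * real W) * (real P * real W)"
      unfolding C_def D_def by (intro mult_mono pars \<beta> \<gamma>) (auto intro: sum_nonneg)
    finally have "(\<Sum>k<P. norm (C k) * norm (D k)) ^ 2 \<le> (real P * real W) ^ 2" by (simp add: power2_eq_square)
    then show "(\<Sum>k<P. norm (C k) * norm (D k)) \<le> real P * real W" by (rule power2_le_imp_le) simp
    show "0 \<le> X" using k0 by simp
  qed
  finally have "norm ?BB \<le> real W * X" using P by (simp add: mult_ac)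
  then show ?thesis using that[of "real k0 / real P"] k0 unfolding B_def P_def by auto
qed

section \<open>Box and cube inequalities, Fejer averages\<close>

lemma sum_pair: "(\<Sum>i\<in>A. \<Sum>j\<in>B. f i j) = (\<Sum>p\<in>A \<times> B. f (fst p) (snd p))"
  by (simp add: sum.cartesian_product case_prod_unfold)

lemma sum_pow4_le:
  fixes x :: "'a \<Rightarrow> real"
  assumes "\<And>i. i \<in> I \<Longrightarrow> 0 \<le> x i"
  shows "(\<Sum>i\<in>I. x i) ^ 4 \<le> real (card I) ^ 3 * (\<Sum>i\<in>I. x i ^ 4)"
proof -
  have "(\<Sum>i\<in>I. x i) ^ 4 = ((\<Sum>i\<in>I. x i) ^ 2) ^ 2" by (simp flip: power_mult)
  also have "\<dots> \<le> (real (card I) * (\<Sum>i\<in>I. x i ^ 2)) ^ 2"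
    using sum_squared_le_sum_of_squares[of x I] by (intro power_mono) (auto simp: mult.commute)
  also have "\<dots> = real (card I) ^ 2 * (\<Sum>i\<in>I. x i ^ 2) ^ 2" by (simp add: power_mult_distrib)
  also have "\<dots> \<le> real (card I) ^ 2 * (real (card I) * (\<Sum>i\<in>I. (x i ^ 2) ^ 2))"
    using sum_squared_le_sum_of_squares[of "\<lambda>i. x i ^ 2" I] by (intro mult_left_mono) (auto simp: mult.commute)
  also have "\<dots> = real (card I) ^ 3 * (\<Sum>i\<in>I. x i ^ 4)"
  proof -
    have "(x i ^ 2) ^ 2 = x i ^ 4" for i by (simp flip: power_mult)
    moreover have "real (card I) ^ 3 = real (card I) ^ 2 * real (card I)" by (simp add: power2_eq_square power3_eq_cube)
    ultimately show ?thesis by (simp only: mult.assoc)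
  qed
  finally show ?thesis .
qed

lemma sum_pow8_le:
  fixes x :: "'a \<Rightarrow> real"
  assumes "\<And>i. i \<in> I \<Longrightarrow> 0 \<le> x i"
  shows "(\<Sum>i\<in>I. x i) ^ 8 \<le> real (card I) ^ 7 * (\<Sum>i\<in>I. x i ^ 8)"
proof -
  have "(\<Sum>i\<in>I. x i) ^ 8 = ((\<Sum>i\<in>I. x i) ^ 4) ^ 2" by (simp flip: power_mult)
  also have "\<dots> \<le> (real (card I) ^ 3 * (\<Sum>i\<in>I. x i ^ 4)) ^ 2"
    using assms by (intro power_mono sum_pow4_le zero_le_power sum_nonneg)
  also have "\<dots> = real (card I) ^ 6 * (\<Sum>i\<in>I. x i ^ 4) ^ 2" by (simp add: power_mult_distrib flip: power_mult)
  also have "\<dots> \<le> real (card I) ^ 6 * (real (card I) * (\<Sum>i\<in>I. (x i ^ 4) ^ 2))"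
    using sum_squared_le_sum_of_squares[of "\<lambda>i. x i ^ 4" I] by (intro mult_left_mono) (auto simp: mult.commute)
  also have "\<dots> = real (card I) ^ 7 * (\<Sum>i\<in>I. x i ^ 8)"
    by (simp flip: power_mult power_Suc2)
  finally show ?thesis .
qed

text \<open>One Cauchy--Schwarz step per bounded factor: over \<open>j\<close> to remove \<beta>,
  then over the pairs (i, i') to remove \<alpha>.\<close>

lemma box_ineq:
  fixes \<alpha> \<beta> :: "nat \<Rightarrow> complex" and \<gamma> :: "nat \<Rightarrow> nat \<Rightarrow> complex"
  assumes A: "finite A" "finite B" and \<alpha>: "\<And>i. i \<in> A \<Longrightarrow> norm (\<alpha> i) \<le> 1" and \<beta>: "\<And>j. j \<in> B \<Longrightarrow> norm (\<beta> j) \<le> 1"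
  shows "norm (\<Sum>i\<in>A. \<Sum>j\<in>B. \<alpha> i * \<beta> j * \<gamma> i j) ^ 4
    \<le> real (card A) ^ 2 * real (card B) ^ 2 * (\<Sum>i\<in>A. \<Sum>i'\<in>A. norm (\<Sum>j\<in>B. \<gamma> i j * cnj (\<gamma> i' j)) ^ 2)"
proof -
  let ?X = "\<Sum>i\<in>A. \<Sum>j\<in>B. \<alpha> i * \<beta> j * \<gamma> i j"
  let ?G = "\<lambda>i i'. \<Sum>j\<in>B. \<gamma> i j * cnj (\<gamma> i' j)"
  have "?X = (\<Sum>j\<in>B. \<beta> j * (\<Sum>i\<in>A. \<alpha> i * \<gamma> i j))"
    by (subst sum.swap) (simp add: sum_distrib_left mult_ac)
  then have 1: "norm ?X ^ 2 \<le> real (card B) * (\<Sum>j\<in>B. norm (\<Sum>i\<in>A. \<alpha> i * \<gamma> i j) ^ 2)"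
    using norm_sum_mult_bounded_le[of B \<beta> "\<lambda>j. \<Sum>i\<in>A. \<alpha> i * \<gamma> i j"] A \<beta> by simp
  have "complex_of_real (\<Sum>j\<in>B. norm (\<Sum>i\<in>A. \<alpha> i * \<gamma> i j) ^ 2) = (\<Sum>j\<in>B. \<Sum>i\<in>A. \<Sum>i'\<in>A. (\<alpha> i * \<gamma> i j) * cnj (\<alpha> i' * \<gamma> i' j))"
    unfolding of_real_sum complex_norm_square by (simp add: sum_product)
  also have "\<dots> = (\<Sum>i\<in>A. \<Sum>i'\<in>A. (\<alpha> i * cnj (\<alpha> i')) * ?G i i')"
    by (subst sum.swap, rule sum.cong[OF refl], subst sum.swap) (simp add: sum_distrib_left mult_ac)
  also have "\<dots> = (\<Sum>p\<in>A \<times> A. (\<alpha> (fst p) * cnj (\<alpha> (snd p))) * ?G (fst p) (snd p))"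
    by (simp add: sum.cartesian_product case_prod_unfold)
  finally have "(\<Sum>j\<in>B. norm (\<Sum>i\<in>A. \<alpha> i * \<gamma> i j) ^ 2) = norm (\<Sum>p\<in>A \<times> A. (\<alpha> (fst p) * cnj (\<alpha> (snd p))) * ?G (fst p) (snd p))"
    by (metis (no_types, lifting) abs_of_nonneg norm_of_real sum_nonneg zero_le_power2)
  then have 2: "(\<Sum>j\<in>B. norm (\<Sum>i\<in>A. \<alpha> i * \<gamma> i j) ^ 2) ^ 2 \<le> real (card (A \<times> A)) * (\<Sum>p\<in>A \<times> A. norm (?G (fst p) (snd p)) ^ 2)"
  proof -
    have "norm (\<alpha> (fst p) * cnj (\<alpha> (snd p))) \<le> 1" if "p \<in> A \<times> A" for p
      using \<alpha>[of "fst p"] \<alpha>[of "snd p"] that by (auto simp: norm_mult intro!: mult_le_one)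
    then show ?thesis
      using norm_sum_mult_bounded_le[of "A \<times> A" "\<lambda>p. \<alpha> (fst p) * cnj (\<alpha> (snd p))" "\<lambda>p. ?G (fst p) (snd p)"] A
        \<open>(\<Sum>j\<in>B. norm (\<Sum>i\<in>A. \<alpha> i * \<gamma> i j) ^ 2) = norm (\<Sum>p\<in>A \<times> A. (\<alpha> (fst p) * cnj (\<alpha> (snd p))) * ?G (fst p) (snd p))\<close>
      by (simp only: finite_cartesian_product)
  qed
  have "norm ?X ^ 4 = (norm ?X ^ 2) ^ 2" by (simp flip: power_mult)
  also have "\<dots> \<le> (real (card B) * (\<Sum>j\<in>B. norm (\<Sum>i\<in>A. \<alpha> i * \<gamma> i j) ^ 2)) ^ 2" using 1 by (intro power_mono) auto
  also have "\<dots> = real (card B) ^ 2 * (\<Sum>j\<in>B. norm (\<Sum>i\<in>A. \<alpha> i * \<gamma> i j) ^ 2) ^ 2" by (simp add: power_mult_distrib)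
  also have "\<dots> \<le> real (card B) ^ 2 * (real (card (A \<times> A)) * (\<Sum>p\<in>A \<times> A. norm (?G (fst p) (snd p)) ^ 2))"
    using 2 by (intro mult_left_mono) auto
  also have "\<dots> = real (card A) ^ 2 * real (card B) ^ 2 * (\<Sum>i\<in>A. \<Sum>i'\<in>A. norm (?G i i') ^ 2)"
    by (simp add: sum.cartesian_product case_prod_unfold card_cartesian_product power2_eq_square)
  finally show ?thesis .
qed

lemma box_expand:
  fixes \<gamma> :: "nat \<Rightarrow> nat \<Rightarrow> complex"
  shows "complex_of_real (\<Sum>i\<in>A. \<Sum>i'\<in>A. norm (\<Sum>j\<in>B. \<gamma> i j * cnj (\<gamma> i' j)) ^ 2)
    = (\<Sum>i\<in>A. \<Sum>i'\<in>A. \<Sum>j\<in>B. \<Sum>j'\<in>B. (\<gamma> i j * cnj (\<gamma> i' j)) * cnj (\<gamma> i j' * cnj (\<gamma> i' j')))"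
  unfolding of_real_sum complex_norm_square by (simp add: sum_product)

text \<open>Each bounded factor misses one of the three variables. Cauchy--Schwarz over (b, c)
  removes \<open>H1\<close> and doubles \<open>a\<close>; for a fixed pair (a, a') the two other
  factors are a function of \<open>b\<close> and a function of \<open>c\<close>, which
  \<open>box_ineq\<close> removes.\<close>

lemma cube_ineq:
  fixes G :: "nat \<Rightarrow> nat \<Rightarrow> nat \<Rightarrow> complex" and H1 H2 H3 :: "nat \<Rightarrow> nat \<Rightarrow> complex"
  assumes H1: "\<And>b c. norm (H1 b c) \<le> 1" and H2: "\<And>b c. norm (H2 b c) \<le> 1" and H3: "\<And>b c. norm (H3 b c) \<le> 1"
  shows "norm (\<Sum>a<R. \<Sum>b<R. \<Sum>c<R. G a b c * H1 b c * H2 a c * H3 a b) ^ 8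
    \<le> real R ^ 18 * (\<Sum>a<R. \<Sum>a'<R. \<Sum>b<R. \<Sum>b'<R. norm (\<Sum>c<R. (G a b c * cnj (G a' b c)) * cnj (G a b' c * cnj (G a' b' c))) ^ 2)"
proof -
  let ?X = "\<Sum>a<R. \<Sum>b<R. \<Sum>c<R. G a b c * H1 b c * H2 a c * H3 a b"
  let ?I = "{..<R} \<times> {..<R}"
  let ?Z = "\<lambda>p. \<Sum>a<R. G a (fst p) (snd p) * H2 a (snd p) * H3 a (fst p)"
  let ?\<Gamma> = "\<lambda>p b c. G (fst p) b c * cnj (G (snd p) b c)"
  let ?Y = "\<lambda>p. \<Sum>b<R. \<Sum>c<R. (H3 (fst p) b * cnj (H3 (snd p) b)) * (H2 (fst p) c * cnj (H2 (snd p) c)) * ?\<Gamma> p b c"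
  have "?X = (\<Sum>b<R. \<Sum>c<R. \<Sum>a<R. G a b c * H1 b c * H2 a c * H3 a b)"
    by (subst sum.swap, rule sum.cong[OF refl], rule sum.swap)
  also have "\<dots> = (\<Sum>p\<in>?I. H1 (fst p) (snd p) * ?Z p)"
    by (subst sum_pair) (simp add: sum_distrib_left mult_ac)
  finally have 1: "norm ?X ^ 2 \<le> real (card ?I) * (\<Sum>p\<in>?I. norm (?Z p) ^ 2)"
    using norm_sum_mult_bounded_le[of ?I "\<lambda>p. H1 (fst p) (snd p)" ?Z] H1 by simp
  have "complex_of_real (\<Sum>p\<in>?I. norm (?Z p) ^ 2) = (\<Sum>b<R. \<Sum>c<R. \<Sum>a<R. \<Sum>a'<R. (G a b c * H2 a c * H3 a b) * cnj (G a' b c * H2 a' c * H3 a' b))"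
    unfolding of_real_sum complex_norm_square by (subst sum_pair) (simp add: sum_product)
  also have "\<dots> = (\<Sum>a<R. \<Sum>a'<R. \<Sum>b<R. \<Sum>c<R. (G a b c * H2 a c * H3 a b) * cnj (G a' b c * H2 a' c * H3 a' b))"
  proof -
    have "(\<Sum>b<R. \<Sum>c<R. \<Sum>a<R. \<Sum>a'<R. F a a' b c) = (\<Sum>a<R. \<Sum>a'<R. \<Sum>b<R. \<Sum>c<R. F a a' b c)" for F :: "nat \<Rightarrow> nat \<Rightarrow> nat \<Rightarrow> nat \<Rightarrow> complex"
    proof -
      have "(\<Sum>b<R. \<Sum>c<R. \<Sum>a<R. \<Sum>a'<R. F a a' b c) = (\<Sum>b<R. \<Sum>a<R. \<Sum>c<R. \<Sum>a'<R. F a a' b c)"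
        by (rule sum.cong[OF refl], rule sum.swap)
      also have "\<dots> = (\<Sum>b<R. \<Sum>a<R. \<Sum>a'<R. \<Sum>c<R. F a a' b c)"
        by (rule sum.cong[OF refl], rule sum.cong[OF refl], rule sum.swap)
      also have "\<dots> = (\<Sum>a<R. \<Sum>b<R. \<Sum>a'<R. \<Sum>c<R. F a a' b c)" by (rule sum.swap)
      also have "\<dots> = (\<Sum>a<R. \<Sum>a'<R. \<Sum>b<R. \<Sum>c<R. F a a' b c)"
        by (rule sum.cong[OF refl], rule sum.swap)
      finally show ?thesis .
    qed
    then show ?thesis .
  qed
  also have "\<dots> = (\<Sum>p\<in>?I. ?Y p)"
    by (subst sum_pair) (simp add: mult_ac)
  finally have "(\<Sum>p\<in>?I. norm (?Z p) ^ 2) = norm (\<Sum>p\<in>?I. ?Y p)"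
    by (metis (no_types, lifting) abs_of_nonneg norm_of_real sum_nonneg zero_le_power2)
  also have "\<dots> \<le> (\<Sum>p\<in>?I. norm (?Y p))" by (rule norm_sum)
  finally have 2: "(\<Sum>p\<in>?I. norm (?Z p) ^ 2) \<le> (\<Sum>p\<in>?I. norm (?Y p))" .
  have 3: "norm (?Y p) ^ 4 \<le> real R ^ 2 * real R ^ 2 * (\<Sum>b<R. \<Sum>b'<R. norm (\<Sum>c<R. ?\<Gamma> p b c * cnj (?\<Gamma> p b' c)) ^ 2)" for p
    using box_ineq[of "{..<R}" "{..<R}" "\<lambda>b. H3 (fst p) b * cnj (H3 (snd p) b)" "\<lambda>c. H2 (fst p) c * cnj (H2 (snd p) c)" "?\<Gamma> p"] H2 H3
    by (simp add: norm_mult mult_le_one)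
  have cI: "real (card ?I) = real R ^ 2" by (simp add: card_cartesian_product power2_eq_square)
  have "norm ?X ^ 8 = (norm ?X ^ 2) ^ 4" by (simp flip: power_mult)
  also have "\<dots> \<le> (real R ^ 2 * (\<Sum>p\<in>?I. norm (?Y p))) ^ 4"
  proof (rule power_mono)
    have "norm ?X ^ 2 \<le> real R ^ 2 * (\<Sum>p\<in>?I. norm (?Z p) ^ 2)" using 1 unfolding cI .
    also have "\<dots> \<le> real R ^ 2 * (\<Sum>p\<in>?I. norm (?Y p))" using 2 by (rule mult_left_mono) simp
    finally show "norm ?X ^ 2 \<le> real R ^ 2 * (\<Sum>p\<in>?I. norm (?Y p))" .
  qed simp
  also have "\<dots> = real R ^ 8 * (\<Sum>p\<in>?I. norm (?Y p)) ^ 4" by (simp add: power_mult_distrib flip: power_mult)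
  also have "\<dots> \<le> real R ^ 8 * (real (card ?I) ^ 3 * (\<Sum>p\<in>?I. norm (?Y p) ^ 4))"
    by (intro mult_left_mono sum_pow4_le) auto
  also have "\<dots> \<le> real R ^ 8 * (real (card ?I) ^ 3 * (\<Sum>p\<in>?I. real R ^ 2 * real R ^ 2 * (\<Sum>b<R. \<Sum>b'<R. norm (\<Sum>c<R. ?\<Gamma> p b c * cnj (?\<Gamma> p b' c)) ^ 2)))"
    using 3 by (intro mult_left_mono sum_mono) auto
  also have "\<dots> = real R ^ 18 * (\<Sum>p\<in>?I. \<Sum>b<R. \<Sum>b'<R. norm (\<Sum>c<R. ?\<Gamma> p b c * cnj (?\<Gamma> p b' c)) ^ 2)"
    unfolding cI by (simp add: sum_distrib_left[symmetric] mult.assoc[symmetric] flip: power_mult power_add)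
  also have "(\<Sum>p\<in>?I. \<Sum>b<R. \<Sum>b'<R. norm (\<Sum>c<R. ?\<Gamma> p b c * cnj (?\<Gamma> p b' c)) ^ 2)
    = (\<Sum>a<R. \<Sum>a'<R. \<Sum>b<R. \<Sum>b'<R. norm (\<Sum>c<R. (G a b c * cnj (G a' b c)) * cnj (G a b' c * cnj (G a' b' c))) ^ 2)"
    by (rule sum_pair[symmetric])
  finally show ?thesis .
qed

text \<open>Fejer mean; for autocorrelations it is a mean square, see \<open>fj_rr\<close> below.\<close>

definition fj :: "nat \<Rightarrow> (int \<Rightarrow> real) \<Rightarrow> real" where
  "fj R f = (\<Sum>m<R. \<Sum>m'<R. f (int m' - int m)) / real R ^ 2"

lemma fj_mono: "(\<And>a. f a \<le> g a) \<Longrightarrow> fj R f \<le> fj R g"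
  unfolding fj_def by (intro divide_right_mono sum_mono) auto

lemma fj_nonneg: "(\<And>a. 0 \<le> f a) \<Longrightarrow> 0 \<le> fj R f"
  unfolding fj_def by (intro divide_nonneg_nonneg sum_nonneg) auto

lemma fj_const: "R > 0 \<Longrightarrow> fj R (\<lambda>_. c) = c"
  by (simp add: fj_def power2_eq_square)

lemma fj_le: "R > 0 \<Longrightarrow> (\<And>a. f a \<le> c) \<Longrightarrow> fj R f \<le> c"
  using fj_mono[of f "\<lambda>_. c" R] by (simp add: fj_const)

lemma fj_cmult: "fj R (\<lambda>a. c * f a) = c * fj R f"
  by (simp add: fj_def sum_distrib_left)

lemma fj_sum: "fj R (\<lambda>a. \<Sum>i\<in>I. f i a) = (\<Sum>i\<in>I. fj R (f i))"
proof -
  have "(\<Sum>m<R. \<Sum>m'<R. \<Sum>i\<in>I. f i (int m' - int m)) = (\<Sum>i\<in>I. \<Sum>m<R. \<Sum>m'<R. f i (int m' - int m))"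
    by (simp only: sum.swap[of _ I])
  then show ?thesis by (simp add: fj_def sum_divide_distrib)
qed

lemma fj_swap: "fj R (\<lambda>a. fj R' (\<lambda>b. f a b)) = fj R' (\<lambda>b. fj R (\<lambda>a. f a b))"
proof -
  have "fj R (\<lambda>a. fj R' (\<lambda>b. f a b)) = fj R (\<lambda>a. \<Sum>m<R'. \<Sum>m'<R'. f a (int m' - int m)) / real R' ^ 2"
    by (simp add: fj_def sum_divide_distrib mult.commute)
  also have "\<dots> = (\<Sum>m<R'. \<Sum>m'<R'. fj R (\<lambda>a. f a (int m' - int m))) / real R' ^ 2"
    by (simp only: fj_sum)
  also have "\<dots> = fj R' (\<lambda>b. fj R (\<lambda>a. f a b))" by (simp only: fj_def)
  finally show ?thesis .
qed

lemma fj_uminus: "fj R (\<lambda>a. f (- a)) = fj R f"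
proof -
  have "(\<Sum>m<R. \<Sum>m'<R. f (- (int m' - int m))) = (\<Sum>m'<R. \<Sum>m<R. f (- (int m' - int m)))" by (rule sum.swap)
  then show ?thesis by (simp add: fj_def)
qed

lemma fj_square_le: "R > 0 \<Longrightarrow> (fj R f) ^ 2 \<le> fj R (\<lambda>a. f a ^ 2)"
proof -
  assume R: "R > 0"
  have "(\<Sum>m<R. \<Sum>m'<R. f (int m' - int m)) ^ 2 = (\<Sum>p\<in>{..<R} \<times> {..<R}. f (int (snd p) - int (fst p))) ^ 2"
    by (simp add: sum.cartesian_product case_prod_unfold)
  also have "\<dots> \<le> (\<Sum>p\<in>{..<R} \<times> {..<R}. f (int (snd p) - int (fst p)) ^ 2) * real (card ({..<R} \<times> {..<R}))"
    by (rule sum_squared_le_sum_of_squares)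
  also have "\<dots> = (\<Sum>m<R. \<Sum>m'<R. f (int m' - int m) ^ 2) * real R ^ 2"
    by (simp add: sum.cartesian_product case_prod_unfold card_cartesian_product power2_eq_square)
  finally have "(\<Sum>m<R. \<Sum>m'<R. f (int m' - int m)) ^ 2 / (real R ^ 2) ^ 2 \<le> (\<Sum>m<R. \<Sum>m'<R. f (int m' - int m) ^ 2) * real R ^ 2 / (real R ^ 2) ^ 2"
    by (rule divide_right_mono) simp
  then show ?thesis using R by (simp add: fj_def power_divide power2_eq_square)
qed

lemma fj_le_sum:
  assumes "\<And>a. 0 \<le> f a" and R: "R > 0"
  shows "fj R f \<le> (\<Sum>a\<in>{- int R<..<int R}. f a) / real R"
proof -
  have "(\<Sum>m'<R. f (int m' - int m)) \<le> (\<Sum>a\<in>{- int R<..<int R}. f a)" if "m < R" for m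
  proof -
    have "(\<Sum>m'<R. f (int m' - int m)) = (\<Sum>a\<in>(\<lambda>m'. int m' - int m) ` {..<R}. f a)"
      by (subst sum.reindex) (auto simp: inj_on_def)
    also have "\<dots> \<le> (\<Sum>a\<in>{- int R<..<int R}. f a)" using that assms by (intro sum_mono2) auto
    finally show ?thesis .
  qed
  then have "(\<Sum>m<R. \<Sum>m'<R. f (int m' - int m)) \<le> (\<Sum>m<R. \<Sum>a\<in>{- int R<..<int R}. f a)" by (intro sum_mono) auto
  then have "(\<Sum>m<R. \<Sum>m'<R. f (int m' - int m)) / real R ^ 2 \<le> (real R * (\<Sum>a\<in>{- int R<..<int R}. f a)) / real R ^ 2"
    by (intro divide_right_mono) auto
  then show ?thesis using R by (simp add: fj_def power2_eq_square)
qed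

lemma sum_le_fj:
  assumes f: "\<And>a. 0 \<le> f a" and V: "V > 0"
  shows "(\<Sum>v\<in>{- int V..int V}. f v) \<le> 4 * real V * fj (2 * V) f"
proof -
  \<comment> \<open>A difference \<open>v\<close> with |v| <= V belongs to at least \<open>V\<close>
    pairs of numbers below \<open>2 * V\<close>; this map lists \<open>V\<close> of them for each
    \<open>v\<close>.\<close>
  let ?\<phi> = "\<lambda>(v, i). if v \<ge> 0 then (i, i + nat v) else (i + nat (- v), i)"
  have inj: "inj_on ?\<phi> ({- int V..int V} \<times> {..<V})"
    by (auto simp: inj_on_def split: if_splits)
  have "real V * (\<Sum>v\<in>{- int V..int V}. f v) = (\<Sum>v\<in>{- int V..int V}. \<Sum>i<V. f v)" by (simp add: sum_distrib_left)
  also have "\<dots> = (\<Sum>p\<in>{- int V..int V} \<times> {..<V}. f (fst p))" by (rule sum_pair)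
  also have "\<dots> = (\<Sum>p\<in>{- int V..int V} \<times> {..<V}. f (int (snd (?\<phi> p)) - int (fst (?\<phi> p))))"
    by (intro sum.cong refl) (auto simp: split: if_splits)
  also have "\<dots> = (\<Sum>q\<in>?\<phi> ` ({- int V..int V} \<times> {..<V}). f (int (snd q) - int (fst q)))"
    by (subst sum.reindex[OF inj]) simp
  also have "\<dots> \<le> (\<Sum>q\<in>{..<2 * V} \<times> {..<2 * V}. f (int (snd q) - int (fst q)))"
    using f by (intro sum_mono2) (auto split: if_splits)
  also have "\<dots> = (\<Sum>m<2 * V. \<Sum>m'<2 * V. f (int m' - int m))" by (simp add: sum.cartesian_product case_prod_unfold)
  finally have "real V * (\<Sum>v\<in>{- int V..int V}. f v) \<le> (2 * real V) ^ 2 * fj (2 * V) f" using V by (simp add: fj_def)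
  then have "real V * (\<Sum>v\<in>{- int V..int V}. f v) \<le> real V * (4 * real V * fj (2 * V) f)" by (simp add: power2_eq_square mult_ac)
  then show ?thesis using V by simp
qed

lemma card_congruent_le:
  fixes A :: "int set"
  assumes A: "A \<subseteq> {- int R<..<int R}" and k: "k > 0" and c: "\<And>a b. a \<in> A \<Longrightarrow> b \<in> A \<Longrightarrow> k dvd a - b"
  shows "real (card A) \<le> 2 * real R / real_of_int k + 1"
proof (cases "A = {}")
  case False
  have finA: "finite A" using A finite_subset by blast
  let ?m = "Min A"
  have m: "?m \<in> A" "\<And>a. a \<in> A \<Longrightarrow> ?m \<le> a" using False finA by auto
  have "inj_on (\<lambda>a. (a - ?m) div k) A"
  proof (rule inj_onI)
    fix a b assume ab: "a \<in> A" "b \<in> A" "(a - ?m) div k = (b - ?m) div k"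
    have "a - ?m = k * ((a - ?m) div k)" "b - ?m = k * ((b - ?m) div k)" using c[OF ab(1) m(1)] c[OF ab(2) m(1)] by auto
    then show "a = b" using ab(3) by (metis diff_add_cancel)
  qed
  then have "card A = card ((\<lambda>a. (a - ?m) div k) ` A)" by (simp add: card_image)
  also have "\<dots> \<le> card {0..(2 * int R) div k}"
  proof (rule card_mono)
    show "(\<lambda>a. (a - ?m) div k) ` A \<subseteq> {0..(2 * int R) div k}"
    proof
      fix x assume "x \<in> (\<lambda>a. (a - ?m) div k) ` A"
      then obtain a where a: "a \<in> A" "x = (a - ?m) div k" by auto
      have "0 \<le> a - ?m" "a - ?m \<le> 2 * int R"
        using m(2)[OF a(1)] subsetD[OF A a(1)] subsetD[OF A m(1)] by auto
      then show "x \<in> {0..(2 * int R) div k}" using a(2) k by (auto simp: pos_imp_zdiv_nonneg_iff intro: zdiv_mono1)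
    qed
  qed simp
  also have "\<dots> = nat ((2 * int R) div k + 1)" by simp
  finally have "card A \<le> nat ((2 * int R) div k + 1)" .
  moreover have "(2 * int R) div k \<ge> 0" using k by (simp add: pos_imp_zdiv_nonneg_iff)
  ultimately have "real (card A) \<le> real_of_int ((2 * int R) div k) + 1" by linarith
  also have "real_of_int ((2 * int R) div k) \<le> real_of_int (2 * int R) / real_of_int k" by (rule real_of_int_div4)
  finally show ?thesis by simp
qed (use k in auto)

text \<open>The linear form \<open>l' * b - l * a\<close> takes each value only O(R gcd(l, l') /
  |l'|) times: \<open>b\<close> is determined by \<open>a\<close>, and \<open>a\<close> is
  determined modulo |l'| / gcd(l, l'). The resulting factor is bounded if |l'| is comparable to
  \<open>X\<close> and the gcd is bounded, and the moduli below are chosen to achieve this.\<close>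

lemma fj_fj_le:
  fixes h :: "int \<Rightarrow> real" and l l' :: int
  assumes h: "\<And>v. 0 \<le> h v" and R: "\<bar>l'\<bar> \<le> int R" and l0: "l' \<noteq> 0" and X: "\<bar>l\<bar> \<le> int X" "\<bar>l'\<bar> \<le> int X"
  shows "fj R (\<lambda>a. fj R (\<lambda>b. h (l' * b - l * a))) \<le> 24 * real_of_int (gcd l l') * real X / real_of_int \<bar>l'\<bar> * fj (4 * X * R) h"
proof -
  let ?J = "{- int R<..<int R}"
  let ?V = "2 * X * R"
  have R0: "R > 0" using R l0 by auto
  have X0: "X > 0" using X l0 by auto
  define k where "k = \<bar>l'\<bar> div gcd l l'"
  have g0: "gcd l l' > 0" using l0 by simp
  have kg: "\<bar>l'\<bar> = k * gcd l l'" unfolding k_def by simp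
  have k0: "k > 0" using kg l0 g0 by (metis abs_not_less_zero mult_nonpos_nonneg not_less abs_le_zero_iff less_le_not_le)
  have "fj R (\<lambda>a. fj R (\<lambda>b. h (l' * b - l * a))) \<le> (\<Sum>a\<in>?J. fj R (\<lambda>b. h (l' * b - l * a))) / real R"
    using h R0 by (intro fj_le_sum fj_nonneg) auto
  also have "\<dots> \<le> (\<Sum>a\<in>?J. (\<Sum>b\<in>?J. h (l' * b - l * a)) / real R) / real R"
    using h R0 by (intro divide_right_mono sum_mono fj_le_sum) auto
  also have "\<dots> = (\<Sum>a\<in>?J. \<Sum>b\<in>?J. h (l' * b - l * a)) / real R ^ 2" by (simp add: sum_divide_distrib power2_eq_square)
  also have "(\<Sum>a\<in>?J. \<Sum>b\<in>?J. h (l' * b - l * a)) = (\<Sum>p\<in>?J \<times> ?J. h (l' * snd p - l * fst p))"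
    by (simp add: sum.cartesian_product case_prod_unfold)
  also have "\<dots> = (\<Sum>v\<in>{- int ?V..int ?V}. \<Sum>p\<in>{p\<in>?J \<times> ?J. l' * snd p - l * fst p = v}. h (l' * snd p - l * fst p))"
  proof (rule sum.group[symmetric])
    show "(\<lambda>p. l' * snd p - l * fst p) ` (?J \<times> ?J) \<subseteq> {- int ?V..int ?V}"
    proof clarify
      fix a b assume ab: "a \<in> ?J" "b \<in> ?J"
      have "\<bar>l' * b\<bar> \<le> int X * int R" unfolding abs_mult using X ab by (intro mult_mono) auto
      moreover have "\<bar>l * a\<bar> \<le> int X * int R" unfolding abs_mult using X ab by (intro mult_mono) auto
      moreover have "int ?V = 2 * (int X * int R)" by simp
      ultimately show "l' * snd (a, b) - l * fst (a, b) \<in> {- int ?V..int ?V}" unfolding atLeastAtMost_iff fst_conv snd_conv by linarith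
    qed
  qed auto
  also have "\<dots> \<le> (\<Sum>v\<in>{- int ?V..int ?V}. (3 * real R / real_of_int k) * h v)"
  proof (rule sum_mono)
    fix v
    let ?P = "{p\<in>?J \<times> ?J. l' * snd p - l * fst p = v}"
    have inj: "inj_on fst ?P"
      using l0 by (auto simp: inj_on_def)
    have "real (card ?P) = real (card (fst ` ?P))" by (simp add: card_image[OF inj])
    also have "\<dots> \<le> 2 * real R / real_of_int k + 1"
    proof (rule card_congruent_le[OF _ k0])
      show "fst ` ?P \<subseteq> ?J" by auto
      fix a a' assume "a \<in> fst ` ?P" "a' \<in> fst ` ?P"
      then obtain b b' where "l' * b - l * a = v" "l' * b' - l * a' = v" by auto
      then have "l * (a - a') = l' * (b - b')" by (simp add: algebra_simps)
      then have "l' dvd l * (a - a')" by simp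
      then have "\<bar>l'\<bar> dvd l * (a - a')" by simp
      then have "k * gcd l l' dvd l * (a - a')" using kg by simp
      moreover have "coprime k (l div gcd l l')"
      proof -
        have "coprime (l div gcd l l') (l' div gcd l l')" using l0 by (intro div_gcd_coprime) auto
        moreover have "k dvd l' div gcd l l'" unfolding k_def by (simp add: abs_div flip: abs_div)
        ultimately show ?thesis by (meson coprime_commute coprime_divisors dvd_refl)
      qed
      moreover have "l = (l div gcd l l') * gcd l l'" by simp
      ultimately have "k * gcd l l' dvd ((l div gcd l l') * (a - a')) * gcd l l'" by (metis mult.commute mult.left_commute)
      then have "k dvd (l div gcd l l') * (a - a')" using g0 l0 by simp
      then show "k dvd a - a'" using \<open>coprime k (l div gcd l l')\<close> by (simp add: coprime_dvd_mult_right_iff)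
    qed
    also have "\<dots> \<le> 3 * real R / real_of_int k"
    proof -
      have "k * 1 \<le> k * gcd l l'" using g0 k0 by (intro mult_left_mono) linarith+
      then have "k \<le> \<bar>l'\<bar>" using kg by linarith
      then have "real_of_int k \<le> real R" using R by linarith
      then have "1 \<le> real R / real_of_int k" using k0 by simp
      then show ?thesis by (simp add: add_divide_distrib[symmetric])
    qed
    finally have c: "real (card ?P) \<le> 3 * real R / real_of_int k" .
    have "(\<Sum>p\<in>?P. h (l' * snd p - l * fst p)) = (\<Sum>p\<in>?P. h v)" by (intro sum.cong) auto
    also have "\<dots> = real (card ?P) * h v" by simp
    also have "\<dots> \<le> (3 * real R / real_of_int k) * h v" using c h by (rule mult_right_mono)
    finally show "(\<Sum>p\<in>?P. h (l' * snd p - l * fst p)) \<le> (3 * real R / real_of_int k) * h v" .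
  qed
  also have "\<dots> = (3 * real R / real_of_int k) * (\<Sum>v\<in>{- int ?V..int ?V}. h v)" by (simp add: sum_distrib_left)
  also have "\<dots> \<le> (3 * real R / real_of_int k) * (4 * real ?V * fj (2 * ?V) h)"
    using k0 h R0 X0 by (intro mult_left_mono sum_le_fj) auto
  finally have "fj R (\<lambda>a. fj R (\<lambda>b. h (l' * b - l * a))) \<le> (3 * real R / real_of_int k) * (4 * real ?V * fj (2 * ?V) h) / real R ^ 2"
    by (simp add: divide_right_mono)
  also have "\<dots> = 24 * real X / real_of_int k * fj (4 * X * R) h"
    using R0 k0 by (simp add: power2_eq_square field_simps)
  also have "real X / real_of_int k = real_of_int (gcd l l') * real X / real_of_int \<bar>l'\<bar>"
    unfolding kg using g0 k0 by (simp add: field_simps)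
  then have "24 * real X / real_of_int k * fj (4 * X * R) h = 24 * real_of_int (gcd l l') * real X / real_of_int \<bar>l'\<bar> * fj (4 * X * R) h"
    by (metis times_divide_eq_right mult.assoc)
  finally show ?thesis .
qed

section \<open>Two commuting actions\<close>

lemma sum_Times: "sum f (A \<times> B) = (\<Sum>a\<in>A. \<Sum>b\<in>B. f (a, b))"
  by (simp add: sum.cartesian_product)

lemma fj_times: "R > 0 \<Longrightarrow> real R ^ 2 * fj R f = (\<Sum>m<R. \<Sum>m'<R. f (int m' - int m))"
  by (simp add: fj_def)

text \<open>The abstract setting serves several pairs of actions: on the torus there is one pair for
  every modulus, and both the pair with \<open>S\<close> inverted and the pair with exchanged roles
  are used. The group laws hold for all points, not only in \<open>Om\<close>, so that identities
  between functions such as \<open>Dl_commute\<close> need no membership conditions.\<close>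

locale two_actions =
  fixes Om :: "'w set" and T S :: "int \<Rightarrow> 'w \<Rightarrow> 'w"
  assumes finite_Om: "finite Om" and Om_ne: "Om \<noteq> {}"
    and T_add: "T m (T n w) = T (m + n) w" and S_add: "S m (S n w) = S (m + n) w"
    and T_0: "T 0 w = w" and S_0: "S 0 w = w"
    and S_T: "S m (T n w) = T n (S m w)"
    and T_in: "w \<in> Om \<Longrightarrow> T n w \<in> Om" and S_in: "w \<in> Om \<Longrightarrow> S n w \<in> Om"
begin

abbreviation N :: real where "N \<equiv> real (card Om)"

lemma N_pos: "N > 0" using finite_Om Om_ne by (simp add: card_gt_0_iff)

lemma sum_T: "(\<Sum>w\<in>Om. F (T n w)) = (\<Sum>w\<in>Om. F w)"
  by (rule sum.reindex_bij_witness[of _ "T (- n)" "T n"]) (auto simp: T_add T_0 T_in)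

lemma sum_S: "(\<Sum>w\<in>Om. F (S n w)) = (\<Sum>w\<in>Om. F w)"
  by (rule sum.reindex_bij_witness[of _ "S (- n)" "S n"]) (auto simp: S_add S_0 S_in)

section \<open>Autocorrelations and third differences along orbits of \<open>S\<close>\<close>

definition Dl :: "int \<Rightarrow> ('w \<Rightarrow> complex) \<Rightarrow> 'w \<Rightarrow> complex" where
  "Dl v g w = g w * cnj (g (S v w))"

definition rr :: "('w \<Rightarrow> complex) \<Rightarrow> int \<Rightarrow> real" where
  "rr B v = Re (\<Sum>w\<in>Om. Dl v B w)"

text \<open>A Gowers-type correlation (its real part) over the eight vertices of a cube with edges
  \<open>a\<close>, \<open>b\<close>, \<open>c\<close>. It is symmetric in the edges, so each of
  them can be made the argument of \<open>rr\<close> and handled by the mean square formula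
  \<open>fj_rr\<close>.\<close>

definition KR :: "('w \<Rightarrow> complex) \<Rightarrow> int \<Rightarrow> int \<Rightarrow> int \<Rightarrow> real" where
  "KR g a b c = rr (Dl b (Dl c g)) a"

lemma Dl_commute: "Dl u (Dl v g) = Dl v (Dl u g)"
  by (rule ext) (simp add: Dl_def S_add add.commute mult_ac)

lemma KR_12: "KR g a b c = KR g b a c"
  unfolding KR_def rr_def by (subst Dl_commute) (rule refl)

lemma KR_23: "KR g a b c = KR g a c b"
  unfolding KR_def by (subst Dl_commute) (rule refl)

lemma norm_Dl_le: "(\<And>w. norm (g w) \<le> 1) \<Longrightarrow> norm (Dl v g w) \<le> 1"
  by (simp add: Dl_def norm_mult mult_le_one)

lemma rr_le: assumes "\<And>w. norm (B w) \<le> 1" shows "rr B v \<le> N"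
proof -
  have "rr B v \<le> norm (\<Sum>w\<in>Om. Dl v B w)" unfolding rr_def by (rule complex_Re_le_cmod)
  also have "\<dots> \<le> (\<Sum>w\<in>Om. 1)" using norm_Dl_le[OF assms] by (intro sum_norm_le) auto
  finally show ?thesis by simp
qed

lemma KR_le: "(\<And>w. norm (g w) \<le> 1) \<Longrightarrow> KR g a b c \<le> N"
  unfolding KR_def by (intro rr_le norm_Dl_le)

lemma sum_Dl_shift: "(\<Sum>w\<in>Om. B (S u w) * cnj (B (S v w))) = (\<Sum>w\<in>Om. Dl (v - u) B w)"
proof -
  have "(\<Sum>w\<in>Om. Dl (v - u) B w) = (\<Sum>w\<in>Om. Dl (v - u) B (S u w))" by (rule sum_S[symmetric])
  then show ?thesis by (simp add: Dl_def S_add)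
qed

lemma energy_family:
  assumes "finite I"
  shows "(\<Sum>w\<in>Om. norm (\<Sum>i\<in>I. B (S (s i) w)) ^ 2) = (\<Sum>i\<in>I. \<Sum>i'\<in>I. rr B (s i' - s i))"
proof -
  have "complex_of_real (\<Sum>w\<in>Om. norm (\<Sum>i\<in>I. B (S (s i) w)) ^ 2)
    = (\<Sum>w\<in>Om. \<Sum>i\<in>I. \<Sum>i'\<in>I. B (S (s i) w) * cnj (B (S (s i') w)))"
    unfolding of_real_sum complex_norm_square by (simp add: sum_product)
  also have "\<dots> = (\<Sum>i\<in>I. \<Sum>i'\<in>I. \<Sum>w\<in>Om. B (S (s i) w) * cnj (B (S (s i') w)))"
    by (subst sum.swap, rule sum.cong[OF refl], rule sum.swap)
  also have "\<dots> = (\<Sum>i\<in>I. \<Sum>i'\<in>I. \<Sum>w\<in>Om. Dl (s i' - s i) B w)" by (simp only: sum_Dl_shift)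
  finally have "Re (complex_of_real (\<Sum>w\<in>Om. norm (\<Sum>i\<in>I. B (S (s i) w)) ^ 2)) = Re (\<Sum>i\<in>I. \<Sum>i'\<in>I. \<Sum>w\<in>Om. Dl (s i' - s i) B w)"
    by (rule arg_cong)
  then show ?thesis by (simp add: rr_def)
qed

lemma fj_rr: "fj R (\<lambda>a. rr B (l * a)) = (\<Sum>w\<in>Om. norm (\<Sum>m<R. B (S (l * int m) w)) ^ 2) / real R ^ 2"
  using energy_family[of "{..<R}" B "\<lambda>m. l * int m"] by (simp add: fj_def right_diff_distrib)

lemma fj_rr_nonneg: "0 \<le> fj R (\<lambda>a. rr B (l * a))"
  unfolding fj_rr by (intro divide_nonneg_nonneg sum_nonneg) auto

lemma sum_norm_block_le:
  fixes B :: "'w \<Rightarrow> complex"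
  shows "(\<Sum>w\<in>Om. norm (\<Sum>i<k. \<Sum>m<R. B (S (c * int m) (S (e * int i) w))) ^ 2)
    \<le> real k ^ 2 * (\<Sum>w\<in>Om. norm (\<Sum>m<R. B (S (c * int m) w)) ^ 2)"
proof -
  let ?G = "\<lambda>w. \<Sum>m<R. B (S (c * int m) w)"
  have "norm (\<Sum>i<k. ?G (S (e * int i) w)) ^ 2 \<le> real k * (\<Sum>i<k. norm (?G (S (e * int i) w)) ^ 2)" for w
    using norm_sum_mult_bounded_le[of "{..<k}" "\<lambda>_. 1" "\<lambda>i. ?G (S (e * int i) w)"] by simp
  then have "(\<Sum>w\<in>Om. norm (\<Sum>i<k. ?G (S (e * int i) w)) ^ 2) \<le> (\<Sum>w\<in>Om. real k * (\<Sum>i<k. norm (?G (S (e * int i) w)) ^ 2))"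
    by (rule sum_mono)
  also have "\<dots> = real k * (\<Sum>i<k. \<Sum>w\<in>Om. norm (?G (S (e * int i) w)) ^ 2)"
    by (subst sum.swap) (simp add: sum_distrib_left)
  also have "\<dots> = real k * (\<Sum>i<k. \<Sum>w\<in>Om. norm (?G w) ^ 2)"
    by (simp only: sum_S[of "\<lambda>w. norm (?G w) ^ 2"])
  finally show ?thesis by (simp add: power2_eq_square)
qed

lemma sum_lessThan_mult: "(\<Sum>m<k * R. f m) = (\<Sum>i<k. \<Sum>m<R. f (i * R + m))" for f :: "nat \<Rightarrow> 'b::comm_monoid_add"
proof -
  have "(\<Sum>m<k * R. f m) = (\<Sum>i<k. sum f {i * R..<i * R + R})" by (rule sum.nat_group[symmetric])
  also have "\<dots> = (\<Sum>i<k. \<Sum>m<R. f (i * R + m))"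
  proof (rule sum.cong[OF refl])
    fix i
    show "sum f {i * R..<i * R + R} = (\<Sum>m<R. f (i * R + m))"
      using sum.shift_bounds_nat_ivl[of f 0 "i * R" R] by (simp add: lessThan_atLeast0 add.commute)
  qed
  finally show ?thesis .
qed

text \<open>A progression of length \<open>k * R\<close> splits into \<open>k\<close> blocks of
  length \<open>R\<close>; a mean over it is an average of block means, and squaring is
  convex.\<close>

lemma fj_rr_shorten:
  assumes "k > 0" "R > 0"
  shows "fj (k * R) (\<lambda>a. rr B (l * a)) \<le> fj R (\<lambda>a. rr B (l * a))"
proof -
  have "(\<Sum>m<k * R. B (S (l * int m) w)) = (\<Sum>i<k. \<Sum>m<R. B (S (l * int m) (S (l * int R * int i) w)))" for w
    unfolding sum_lessThan_mult by (simp add: S_add algebra_simps)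
  then have "(\<Sum>w\<in>Om. norm (\<Sum>m<k * R. B (S (l * int m) w)) ^ 2) \<le> real k ^ 2 * (\<Sum>w\<in>Om. norm (\<Sum>m<R. B (S (l * int m) w)) ^ 2)"
    using sum_norm_block_le[where c = l and e = "l * int R"] by simp
  then show ?thesis unfolding fj_rr using assms by (simp add: field_simps power_mult_distrib)
qed

text \<open>The same argument with the residue classes modulo \<open>k\<close> in place of
  blocks.\<close>

lemma fj_rr_coarsen:
  assumes "k > 0" "R > 0"
  shows "fj (k * R) (\<lambda>a. rr B (l * a)) \<le> fj R (\<lambda>a. rr B (l * int k * a))"
proof -
  have "(\<Sum>m<k * R. B (S (l * int m) w)) = (\<Sum>i<k. \<Sum>m<R. B (S (l * int k * int m) (S (l * int i) w)))" for w
  proof -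
    have "(\<Sum>m<k * R. B (S (l * int m) w)) = (\<Sum>i<R. \<Sum>m<k. B (S (l * int (i * k + m)) w))"
      using sum_lessThan_mult[of "\<lambda>m. B (S (l * int m) w)" R k] by (simp only: mult.commute[of k R])
    also have "\<dots> = (\<Sum>m<k. \<Sum>i<R. B (S (l * int (i * k + m)) w))" by (rule sum.swap)
    finally show ?thesis by (simp add: S_add algebra_simps)
  qed
  then have "(\<Sum>w\<in>Om. norm (\<Sum>m<k * R. B (S (l * int m) w)) ^ 2) \<le> real k ^ 2 * (\<Sum>w\<in>Om. norm (\<Sum>m<R. B (S (l * int k * int m) w)) ^ 2)"
    using sum_norm_block_le[where c = "l * int k" and e = l] by simp
  then show ?thesis unfolding fj_rr using assms by (simp add: field_simps power_mult_distrib)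
qed

text \<open>Trades an unknown small step for a known one: write
  \<open>D = \<bar>k\<bar> * j\<close>, shorten by |k| and coarsen by \<open>j\<close>. The new step
  is the same for all divisors \<open>k\<close> of \<open>D\<close>, up to a sign that Fejer means
  do not see.\<close>

lemma fj_rr_common_multiple:
  assumes k: "k \<noteq> 0" "nat \<bar>k\<bar> dvd D" and D: "D > 0" "R > 0"
  shows "fj (D * R) (\<lambda>a. rr B (l * k * a)) \<le> fj R (\<lambda>a. rr B (l * int D * a))"
proof -
  obtain j where j: "D = nat \<bar>k\<bar> * j" using k(2) by (rule dvdE)
  then have j0: "j > 0" using D by (cases j) auto
  have "fj (D * R) (\<lambda>a. rr B (l * k * a)) = fj (nat \<bar>k\<bar> * (j * R)) (\<lambda>a. rr B (l * k * a))" by (simp add: j mult.assoc)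
  also have "\<dots> \<le> fj (j * R) (\<lambda>a. rr B (l * k * a))" using k j0 D by (intro fj_rr_shorten) auto
  also have "\<dots> \<le> fj R (\<lambda>a. rr B (l * k * int j * a))" by (rule fj_rr_coarsen[OF j0 D(2)])
  also have "\<dots> = fj R (\<lambda>a. rr B (l * int D * a))"
  proof -
    have Dj: "int D = \<bar>k\<bar> * int j" by (simp add: j)
    show ?thesis
  proof (cases "k \<ge> 0")
    case True
    then have "l * k * int j = l * int D" by (simp add: Dj)
    then show ?thesis by (simp only:)
  next
    case False
    then have "l * k * int j * a = l * int D * (- a)" for a by (simp add: Dj)
    then have "fj R (\<lambda>a. rr B (l * k * int j * a)) = fj R (\<lambda>a. rr B (l * int D * (- a)))" by simp
    also have "\<dots> = fj R (\<lambda>a. rr B (l * int D * a))" by (rule fj_uminus)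
    finally show ?thesis .
  qed
  qed
  finally show ?thesis .
qed

text \<open>The inequality is what Cauchy--Schwarz gives when \<open>h\<close> is an average of autocorrelations
  \<open>rr B\<close>; the pair smoothing below uses nothing else about \<open>h\<close>.\<close>

definition sq :: "(int \<Rightarrow> real) \<Rightarrow> bool" where
  "sq h \<longleftrightarrow> (\<forall>\<Lambda> R \<theta>. finite \<Lambda> \<longrightarrow> R > 0 \<longrightarrow>
     (\<Sum>l\<in>\<Lambda>. fj R (\<lambda>a. h (\<theta> * (l * a)))) ^ 2
     \<le> N * (\<Sum>l\<in>\<Lambda>. \<Sum>l'\<in>\<Lambda>. fj R (\<lambda>a. fj R (\<lambda>b. h (\<theta> * (l' * b - l * a))))))"

lemma sum_rr_square_le:
  assumes B: "\<And>w. norm (B w) \<le> 1" and I: "finite I"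
  shows "(\<Sum>i\<in>I. rr B (s i)) ^ 2 \<le> N * (\<Sum>i\<in>I. \<Sum>i'\<in>I. rr B (s i' - s i))"
proof -
  have "(\<Sum>i\<in>I. rr B (s i)) = Re (\<Sum>w\<in>Om. B w * cnj (\<Sum>i\<in>I. B (S (s i) w)))"
    unfolding rr_def Dl_def by (simp only: Re_sum[symmetric], subst sum.swap) (simp add: sum_distrib_left)
  then have "\<bar>\<Sum>i\<in>I. rr B (s i)\<bar> \<le> norm (\<Sum>w\<in>Om. B w * cnj (\<Sum>i\<in>I. B (S (s i) w)))"
    by (simp only: abs_Re_le_cmod)
  then have "\<bar>\<Sum>i\<in>I. rr B (s i)\<bar> ^ 2 \<le> norm (\<Sum>w\<in>Om. B w * cnj (\<Sum>i\<in>I. B (S (s i) w))) ^ 2" by (rule power_mono) simp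
  also have "\<dots> \<le> N * (\<Sum>w\<in>Om. norm (cnj (\<Sum>i\<in>I. B (S (s i) w))) ^ 2)"
    using B finite_Om by (intro norm_sum_mult_bounded_le)
  also have "\<dots> = N * (\<Sum>i\<in>I. \<Sum>i'\<in>I. rr B (s i' - s i))" by (simp only: complex_mod_cnj energy_family[OF I])
  finally show ?thesis by simp
qed

lemma sq_rr: assumes B: "\<And>w. norm (B w) \<le> 1" shows "sq (rr B)"
  unfolding sq_def
proof (intro allI impI)
  fix \<Lambda> :: "int set" and R :: nat and \<theta> :: int
  assume fin: "finite \<Lambda>" and R: "R > 0"
  let ?I = "\<Lambda> \<times> ({..<R} \<times> {..<R})"
  let ?s = "\<lambda>i. \<theta> * (fst i * (int (snd (snd i)) - int (fst (snd i))))"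
  have 1: "(\<Sum>i\<in>?I. rr B (?s i)) = real R ^ 2 * (\<Sum>l\<in>\<Lambda>. fj R (\<lambda>a. rr B (\<theta> * (l * a))))"
  proof -
    have "(\<Sum>i\<in>?I. rr B (?s i)) = (\<Sum>l\<in>\<Lambda>. \<Sum>m<R. \<Sum>m'<R. rr B (\<theta> * (l * (int m' - int m))))"
      by (simp add: sum_pair)
    then show ?thesis using R by (simp add: fj_times sum_distrib_left)
  qed
  have 2: "(\<Sum>i\<in>?I. \<Sum>i'\<in>?I. rr B (?s i' - ?s i)) = real R ^ 4 * (\<Sum>l\<in>\<Lambda>. \<Sum>l'\<in>\<Lambda>. fj R (\<lambda>a. fj R (\<lambda>b. rr B (\<theta> * (l' * b - l * a)))))"
  proof -
    have "(\<Sum>i\<in>?I. \<Sum>i'\<in>?I. rr B (?s i' - ?s i))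
      = (\<Sum>l\<in>\<Lambda>. \<Sum>m<R. \<Sum>m'<R. \<Sum>l'\<in>\<Lambda>. \<Sum>n<R. \<Sum>n'<R. rr B (\<theta> * (l' * (int n' - int n) - l * (int m' - int m))))"
      by (simp only: sum_Times fst_conv snd_conv right_diff_distrib[of \<theta>])
    also have "\<dots> = (\<Sum>l\<in>\<Lambda>. \<Sum>l'\<in>\<Lambda>. \<Sum>m<R. \<Sum>m'<R. \<Sum>n<R. \<Sum>n'<R. rr B (\<theta> * (l' * (int n' - int n) - l * (int m' - int m))))"
      by (simp only: sum.swap[of _ \<Lambda> "{..<R}"])
    also have "\<dots> = real R ^ 4 * (\<Sum>l\<in>\<Lambda>. \<Sum>l'\<in>\<Lambda>. fj R (\<lambda>a. fj R (\<lambda>b. rr B (\<theta> * (l' * b - l * a)))))"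
    proof -
      have "(\<Sum>m<R. \<Sum>m'<R. \<Sum>n<R. \<Sum>n'<R. rr B (\<theta> * (l' * (int n' - int n) - l * (int m' - int m))))
        = real R ^ 4 * fj R (\<lambda>a. fj R (\<lambda>b. rr B (\<theta> * (l' * b - l * a))))" for l l'
      proof -
        have "real R ^ 4 * fj R (\<lambda>a. fj R (\<lambda>b. rr B (\<theta> * (l' * b - l * a))))
          = real R ^ 2 * fj R (\<lambda>a. real R ^ 2 * fj R (\<lambda>b. rr B (\<theta> * (l' * b - l * a))))"
          by (simp only: fj_cmult mult.assoc[symmetric]) (simp flip: power_add)
        then show ?thesis using R by (simp add: fj_times)
      qed
      then show ?thesis by (simp add: sum_distrib_left)
    qed
    finally show ?thesis .
  qed
  have "(real R ^ 2 * (\<Sum>l\<in>\<Lambda>. fj R (\<lambda>a. rr B (\<theta> * (l * a))))) ^ 2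
    \<le> N * (real R ^ 4 * (\<Sum>l\<in>\<Lambda>. \<Sum>l'\<in>\<Lambda>. fj R (\<lambda>a. fj R (\<lambda>b. rr B (\<theta> * (l' * b - l * a))))))"
    using sum_rr_square_le[where B = B and I = ?I and s = ?s, OF B] fin unfolding 1 2 by simp
  then have "real R ^ 4 * (\<Sum>l\<in>\<Lambda>. fj R (\<lambda>a. rr B (\<theta> * (l * a)))) ^ 2
    \<le> real R ^ 4 * (N * (\<Sum>l\<in>\<Lambda>. \<Sum>l'\<in>\<Lambda>. fj R (\<lambda>a. fj R (\<lambda>b. rr B (\<theta> * (l' * b - l * a))))))"
    by (simp add: power_mult_distrib mult_ac flip: power_mult)
  then show "(\<Sum>l\<in>\<Lambda>. fj R (\<lambda>a. rr B (\<theta> * (l * a)))) ^ 2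
    \<le> N * (\<Sum>l\<in>\<Lambda>. \<Sum>l'\<in>\<Lambda>. fj R (\<lambda>a. fj R (\<lambda>b. rr B (\<theta> * (l' * b - l * a)))))"
    using R by simp
qed

text \<open>By convexity (\<open>fj_square_le\<close>) the square may be moved inside the outer
  average, where the inequality holds for each \<open>c\<close>.\<close>

lemma sq_fj:
  assumes sq: "\<And>c. sq (\<lambda>v. f v c)" and R': "R' > 0"
  shows "sq (\<lambda>v. fj R' (\<lambda>c. f v c))"
  unfolding sq_def
proof (intro allI impI)
  fix \<Lambda> :: "int set" and R :: nat and \<theta> :: int
  assume fin: "finite \<Lambda>" and R: "R > 0"
  have "(\<Sum>l\<in>\<Lambda>. fj R (\<lambda>a. fj R' (\<lambda>c. f (\<theta> * (l * a)) c))) = fj R' (\<lambda>c. \<Sum>l\<in>\<Lambda>. fj R (\<lambda>a. f (\<theta> * (l * a)) c))"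
    unfolding fj_sum by (rule sum.cong[OF refl], rule fj_swap)
  then have "(\<Sum>l\<in>\<Lambda>. fj R (\<lambda>a. fj R' (\<lambda>c. f (\<theta> * (l * a)) c))) ^ 2 \<le> fj R' (\<lambda>c. (\<Sum>l\<in>\<Lambda>. fj R (\<lambda>a. f (\<theta> * (l * a)) c)) ^ 2)"
    using fj_square_le[OF R'] by simp
  also have "\<dots> \<le> fj R' (\<lambda>c. N * (\<Sum>l\<in>\<Lambda>. \<Sum>l'\<in>\<Lambda>. fj R (\<lambda>a. fj R (\<lambda>b. f (\<theta> * (l' * b - l * a)) c))))"
    using sq fin R unfolding sq_def by (intro fj_mono) blast
  also have "\<dots> = N * (\<Sum>l\<in>\<Lambda>. \<Sum>l'\<in>\<Lambda>. fj R' (\<lambda>c. fj R (\<lambda>a. fj R (\<lambda>b. f (\<theta> * (l' * b - l * a)) c))))"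
    by (simp only: fj_cmult fj_sum)
  also have "\<dots> = N * (\<Sum>l\<in>\<Lambda>. \<Sum>l'\<in>\<Lambda>. fj R (\<lambda>a. fj R (\<lambda>b. fj R' (\<lambda>c. f (\<theta> * (l' * b - l * a)) c))))"
  proof -
    have "fj R' (\<lambda>c. fj R (\<lambda>a. fj R (\<lambda>b. F a b c))) = fj R (\<lambda>a. fj R (\<lambda>b. fj R' (\<lambda>c. F a b c)))" for F
    proof -
      have "fj R' (\<lambda>c. fj R (\<lambda>a. fj R (\<lambda>b. F a b c))) = fj R (\<lambda>a. fj R' (\<lambda>c. fj R (\<lambda>b. F a b c)))" by (rule fj_swap)
      also have "\<dots> = fj R (\<lambda>a. fj R (\<lambda>b. fj R' (\<lambda>c. F a b c)))" by (rule arg_cong[of _ _ "fj R"], rule ext, rule fj_swap)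
      finally show ?thesis .
    qed
    then show ?thesis by simp
  qed
  finally show "(\<Sum>l\<in>\<Lambda>. fj R (\<lambda>a. fj R' (\<lambda>c. f (\<theta> * (l * a)) c))) ^ 2
    \<le> N * (\<Sum>l\<in>\<Lambda>. \<Sum>l'\<in>\<Lambda>. fj R (\<lambda>a. fj R (\<lambda>b. fj R' (\<lambda>c. f (\<theta> * (l' * b - l * a)) c))))" .
qed

text \<open>Turns many moduli \<open>l\<close> into a single one. After \<open>sq h\<close> only the
  forms \<open>l' * b - l * a\<close> occur. The diagonal pairs amount to at most half of the lower
  bound because of \<open>card \<Lambda> \<ge> 2 * K ^ 2\<close>, and for the other pairs
  \<open>fj_fj_le\<close> yields a Fejer mean that no longer depends on the pair.\<close>

lemma pair_smoothing:
  fixes h :: "int \<Rightarrow> real" and \<Lambda> :: "int set" and K C :: real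
  assumes sq: "sq h" and h0: "\<And>v. 0 \<le> h v" and hN: "\<And>v. h v \<le> N"
    and K: "K \<ge> 1" and C: "C > 0" and fin: "finite \<Lambda>" and n: "real (card \<Lambda>) \<ge> 2 * K ^ 2"
    and big: "\<And>l. l \<in> \<Lambda> \<Longrightarrow> fj R (\<lambda>a. h (\<theta> * (l * a))) \<ge> N / K"
    and R0: "R > 0" and l0: "\<And>l. l \<in> \<Lambda> \<Longrightarrow> l \<noteq> 0 \<and> \<bar>l\<bar> \<le> int R \<and> \<bar>l\<bar> \<le> int X"
    and gcd: "\<And>l l'. l \<in> \<Lambda> \<Longrightarrow> l' \<in> \<Lambda> \<Longrightarrow> l \<noteq> l' \<Longrightarrow> 24 * real_of_int (gcd l l') * real X / real_of_int \<bar>l'\<bar> \<le> C"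
  shows "fj (4 * X * R) (\<lambda>v. h (\<theta> * v)) \<ge> N / (2 * K ^ 2 * C)"
proof -
  let ?n = "real (card \<Lambda>)"
  let ?y = "fj (4 * X * R) (\<lambda>v. h (\<theta> * v))"
  have n0: "?n > 0" using n K by (smt (verit) one_le_power)
  have y0: "?y \<ge> 0" using h0 by (intro fj_nonneg)
  have pair: "fj R (\<lambda>a. fj R (\<lambda>b. h (\<theta> * (l' * b - l * a)))) \<le> (if l = l' then N else 0) + C * ?y" if "l \<in> \<Lambda>" "l' \<in> \<Lambda>" for l l'
  proof (cases "l = l'")
    case True
    have "fj R (\<lambda>a. fj R (\<lambda>b. h (\<theta> * (l' * b - l * a)))) \<le> N" using hN R0 by (intro fj_le)
    moreover have "0 \<le> C * ?y" using C y0 by simp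
    ultimately show ?thesis using True by simp
  next
    case False
    have "fj R (\<lambda>a. fj R (\<lambda>b. h (\<theta> * (l' * b - l * a)))) \<le> 24 * real_of_int (gcd l l') * real X / real_of_int \<bar>l'\<bar> * ?y"
      using fj_fj_le[of "\<lambda>v. h (\<theta> * v)" l' R l X] h0 l0[OF that(1)] l0[OF that(2)] by auto
    also have "\<dots> \<le> C * ?y" using gcd[OF that False] y0 by (intro mult_right_mono)
    finally show ?thesis using False by simp
  qed
  have "(?n * (N / K)) ^ 2 \<le> (\<Sum>l\<in>\<Lambda>. fj R (\<lambda>a. h (\<theta> * (l * a)))) ^ 2"
  proof (rule power_mono)
    have "(\<Sum>l\<in>\<Lambda>. N / K) \<le> (\<Sum>l\<in>\<Lambda>. fj R (\<lambda>a. h (\<theta> * (l * a))))" using big by (rule sum_mono)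
    then show "?n * (N / K) \<le> (\<Sum>l\<in>\<Lambda>. fj R (\<lambda>a. h (\<theta> * (l * a))))" by simp
  qed (use n0 N_pos K in auto)
  also have "\<dots> \<le> N * (\<Sum>l\<in>\<Lambda>. \<Sum>l'\<in>\<Lambda>. fj R (\<lambda>a. fj R (\<lambda>b. h (\<theta> * (l' * b - l * a)))))"
    using sq fin R0 unfolding sq_def by blast
  also have "\<dots> \<le> N * (\<Sum>l\<in>\<Lambda>. \<Sum>l'\<in>\<Lambda>. (if l = l' then N else 0) + C * ?y)"
    using pair N_pos by (intro mult_left_mono sum_mono) auto
  also have "\<dots> = N * (?n * N + ?n * ?n * (C * ?y))"
  proof -
    have "(\<Sum>l'\<in>\<Lambda>. (if l = l' then N else 0) + C * ?y) = N + ?n * (C * ?y)" if "l \<in> \<Lambda>" for l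
      using fin that by (simp add: sum.distrib)
    then have "(\<Sum>l\<in>\<Lambda>. \<Sum>l'\<in>\<Lambda>. (if l = l' then N else 0) + C * ?y) = (\<Sum>l\<in>\<Lambda>. N + ?n * (C * ?y))" by simp
    then show ?thesis by (simp add: algebra_simps)
  qed
  finally have "N * ?n * (?n * N / K ^ 2) \<le> N * ?n * (N + ?n * (C * ?y))"
    by (simp add: power2_eq_square field_simps)
  then have "?n * N / K ^ 2 \<le> N + ?n * (C * ?y)" using n0 N_pos by (simp only: mult_le_cancel_left_pos mult_pos_pos)
  moreover have "N \<le> ?n * N / K ^ 2 / 2"
  proof -
    have "2 * K ^ 2 * N \<le> ?n * N" using n N_pos by (intro mult_right_mono) auto
    then show ?thesis using K by (simp add: field_simps)
  qed
  ultimately have "?n * N / K ^ 2 / 2 \<le> ?n * (C * ?y)" by linarith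
  then have "?n * (N / K ^ 2 / 2) \<le> ?n * (C * ?y)" by simp
  then have "N / K ^ 2 / 2 \<le> C * ?y" using n0 by (simp only: mult_le_cancel_left_pos)
  then show ?thesis using C K by (simp add: field_simps)
qed

end

section \<open>Uniform differences\<close>

context two_actions
begin

lemma sq_KR: "(\<And>w. norm (g w) \<le> 1) \<Longrightarrow> sq (\<lambda>v. KR g v b c)"
  unfolding KR_def by (rule sq_rr) (intro norm_Dl_le)

lemma KR_middle: "KR g x b y = rr (Dl x (Dl y g)) b"
  by (subst KR_12) (simp add: KR_def)

lemma fj_KR_swap: "fj R (\<lambda>b. fj R' (\<lambda>a. KR g x (f a) (k b))) = fj R' (\<lambda>a. fj R (\<lambda>b. KR g x (k b) (f a)))"
proof -
  have "KR g x (f a) (k b) = KR g x (k b) (f a)" for a b by (rule KR_23)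
  then show ?thesis by (subst fj_swap) simp
qed

lemma fj_KR_nonneg: "0 \<le> fj R (\<lambda>a. KR g (l * a) b c)"
  unfolding KR_def by (rule fj_rr_nonneg)

lemma fj_KR_common_multiple:
  assumes "k \<noteq> 0" "nat \<bar>k\<bar> dvd D" "D > 0" "R > 0"
  shows "fj (D * R) (\<lambda>a. KR g x (l * k * a) y) \<le> fj R (\<lambda>a. KR g x (l * int D * a) y)"
  unfolding KR_middle by (rule fj_rr_common_multiple[OF assms])

lemma abs_gcd_le:
  fixes a b :: int
  assumes "a \<noteq> 0 \<or> b \<noteq> 0" "gcd a b dvd c" "c \<noteq> 0" "\<bar>c\<bar> \<le> m"
  shows "gcd a b \<le> m"
  using assms(2-4) dvd_imp_le_int[of c "gcd a b"] by auto

text \<open>The moduli are 2(tk - sq), 2tk and 2sq. A common multiple \<open>D\<close> of all small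
  numbers takes the place of \<open>k\<close> in the second and of \<open>q\<close> in the third.
  Now only the first modulus depends on \<open>k\<close>, and smoothing over \<open>k\<close>
  removes it.\<close>

lemma third_difference_uniform:
  fixes t s q :: int and Bs :: "int set" and J D R2 X :: nat and K C :: real
  assumes g: "\<And>w. norm (g w) \<le> 1" and K: "K \<ge> 1" and C: "C > 0"
    and Bs: "finite Bs" "real (card Bs) \<ge> 2 * K ^ 2" "\<And>k. k \<in> Bs \<Longrightarrow> k \<noteq> 0 \<and> \<bar>k\<bar> < int J"
    and q: "q \<noteq> 0" "\<bar>q\<bar> < int J" and st: "coprime s t" "t \<ge> 1" "s \<ge> 2 * int J * t"
    and D: "D > 0" "\<And>k. k > 0 \<Longrightarrow> k < J \<Longrightarrow> k dvd D" and R2: "R2 > 0"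
    and X: "4 * int J * s \<le> int X" "X \<le> D * R2" and CX: "96 * real J ^ 2 * real X / real_of_int s \<le> C"
    and big: "\<And>k. k \<in> Bs \<Longrightarrow> fj (D * R2) (\<lambda>c. fj (D * R2) (\<lambda>b. fj (D * R2) (\<lambda>a.
        KR g (2 * (t * k - s * q) * c) (2 * t * k * a) (2 * s * q * b)))) \<ge> N / K"
  shows "fj (4 * X * (D * R2)) (\<lambda>v. fj R2 (\<lambda>a. fj R2 (\<lambda>b. KR g v (2 * t * int D * a) (2 * s * int D * b)))) \<ge> N / (2 * K ^ 2 * C)"
proof -
  let ?R = "D * R2"
  define h where "h v = fj R2 (\<lambda>a. fj R2 (\<lambda>b. KR g v (2 * t * int D * a) (2 * s * int D * b)))" for v
  have dvdD: "nat \<bar>k\<bar> dvd D" if "k \<noteq> 0" "\<bar>k\<bar> < int J" for k using that by (intro D(2)) auto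
  have sqh: "sq h" unfolding h_def using g R2 by (intro sq_fj sq_KR)
  have h0: "0 \<le> h v" for v
    unfolding h_def by (subst fj_swap) (unfold KR_middle, intro fj_nonneg fj_rr_nonneg)
  have hN: "h v \<le> N" for v unfolding h_def using g R2 by (intro fj_le KR_le)
  let ?l = "\<lambda>k. 2 * (t * k - s * q)"
  have bigh: "fj ?R (\<lambda>c. h (?l k * c)) \<ge> N / K" if k: "k \<in> Bs" for k
  proof -
    have k': "k \<noteq> 0" "\<bar>k\<bar> < int J" using Bs(3)[OF k] by auto
    have "N / K \<le> fj ?R (\<lambda>c. fj ?R (\<lambda>b. fj ?R (\<lambda>a. KR g (?l k * c) (2 * t * k * a) (2 * s * q * b))))"
      by (rule big[OF k])
    also have "\<dots> \<le> fj ?R (\<lambda>c. fj ?R (\<lambda>b. fj R2 (\<lambda>a. KR g (?l k * c) (2 * t * int D * a) (2 * s * q * b))))"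
      using k' dvdD[OF k'] D(1) R2 by (intro fj_mono fj_KR_common_multiple)
    also have "\<dots> = fj ?R (\<lambda>c. fj R2 (\<lambda>a. fj ?R (\<lambda>b. KR g (?l k * c) (2 * s * q * b) (2 * t * int D * a))))"
      unfolding fj_KR_swap by (rule refl)
    also have "\<dots> \<le> fj ?R (\<lambda>c. fj R2 (\<lambda>a. fj R2 (\<lambda>b. KR g (?l k * c) (2 * s * int D * b) (2 * t * int D * a))))"
      using q dvdD[OF q] D(1) R2 by (intro fj_mono fj_KR_common_multiple)
    also have "\<dots> = fj ?R (\<lambda>c. h (?l k * c))" unfolding h_def by (intro arg_cong[where f = "fj _"] ext KR_23)
    finally show ?thesis .
  qed
  have t2: "2 * (t * int J) \<le> s" using st(3) by (simp add: mult_ac)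
  have J1: "int J \<ge> 1" using q by linarith
  have "1 * 1 \<le> t * int J" using st(2) J1 by (intro mult_mono) auto
  then have tJ: "t * int J \<le> s" and s1: "s \<ge> 1" using t2 by linarith+
  have small: "\<bar>t * k\<bar> \<le> t * int J" if "k \<in> Bs" for k
    unfolding abs_mult using Bs(3)[OF that] st(2) by (intro mult_mono) auto
  have sq1: "\<bar>s * q\<bar> \<ge> s" using q s1 by (simp add: abs_mult mult_le_cancel_left1)
  have sqJ: "\<bar>s * q\<bar> \<le> s * int J" unfolding abs_mult using q s1 by (intro mult_mono) auto
  \<comment> \<open>\<open>s \<ge> 2 * J * t\<close> makes \<open>s * q\<close> dominate
    \<open>t * k\<close>, so that all moduli have absolute value between \<open>s\<close> and
    \<open>X\<close>.\<close>
  have low: "z \<le> \<bar>2 * (x - y)\<bar>" if "\<bar>x\<bar> \<le> a" "z \<le> \<bar>y\<bar>" "2 * a \<le> z" for x y z a :: int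
  proof -
    have x: "x \<le> a" "- x \<le> a" using that(1) by (simp_all add: abs_le_iff)
    show ?thesis
    proof (cases "y \<ge> 0")
      case True
      then have "z \<le> - (2 * (x - y))" using x that(2,3) by simp
      then show ?thesis using abs_ge_minus_self order_trans by blast
    next
      case False
      then have "z \<le> 2 * (x - y)" using x that(2,3) by simp
      then show ?thesis using abs_ge_self order_trans by blast
    qed
  qed
  have upp: "\<bar>2 * (x - y)\<bar> \<le> 4 * b" if "\<bar>x\<bar> \<le> a" "\<bar>y\<bar> \<le> b" "a \<le> b" for x y a b :: int
    using that unfolding abs_le_iff by simp
  have lbd: "s \<le> \<bar>?l k\<bar>" if "k \<in> Bs" for k by (rule low[OF small[OF that] sq1 t2])
  have ubd: "\<bar>?l k\<bar> \<le> int X" if "k \<in> Bs" for k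
  proof -
    have "s * 1 \<le> s * int J" using J1 s1 by (intro mult_left_mono) auto
    then have "t * int J \<le> s * int J" using tJ by linarith
    then have "\<bar>?l k\<bar> \<le> 4 * (s * int J)" by (rule upp[OF small[OF that] sqJ])
    then show ?thesis using X(1) by (simp add: mult_ac)
  qed
  have inj: "inj_on ?l Bs" using st(2) by (auto simp: inj_on_def)
  \<comment> \<open>A common divisor divides both \<open>t\<close> and \<open>s\<close> times
    \<open>2 * q * (k - k')\<close>. As \<open>s\<close> and \<open>t\<close> are coprime, it
    divides this number itself, which is of size O(J^2) although \<open>s\<close> and
    \<open>t\<close> are large.\<close>
  have gb: "gcd (?l k) (?l k') \<le> 4 * int J ^ 2" if k: "k \<in> Bs" "k' \<in> Bs" "k \<noteq> k'" for k k'
  proof (rule abs_gcd_le)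
    show "?l k \<noteq> 0 \<or> ?l k' \<noteq> 0" using lbd[OF k(1)] s1 by linarith
    let ?d = "gcd (?l k) (?l k')"
    have d1: "?d dvd ?l k - ?l k'" by (intro dvd_diff) auto
    have e1: "?l k - ?l k' = 2 * t * (k - k')" by (simp add: algebra_simps)
    have A: "?d dvd t * (2 * q * (k - k'))" using dvd_mult2[OF d1[unfolded e1], of q] by (simp add: mult_ac)
    have "?d dvd ?l k * (k - k')" by simp
    moreover have "?d dvd (2 * t * (k - k')) * k" using d1 unfolding e1 by (rule dvd_mult2)
    ultimately have "?d dvd (2 * t * (k - k')) * k - ?l k * (k - k')" by (rule dvd_diff[rotated])
    then have B: "?d dvd s * (2 * q * (k - k'))" by (simp add: algebra_simps)
    have "?d dvd gcd (s * (2 * q * (k - k'))) (t * (2 * q * (k - k')))" using A B by (rule gcd_greatest[rotated])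
    then have "?d dvd normalize (gcd t s * (2 * q * (k - k')))" by (simp only: gcd_mult_right)
    then show "?d dvd 2 * q * (k - k')" using st(1) by (simp add: coprime_commute coprime_iff_gcd_eq_1)
    show "2 * q * (k - k') \<noteq> 0" using q k by simp
    have "\<bar>k - k'\<bar> \<le> 2 * int J" using Bs(3)[OF k(1)] Bs(3)[OF k(2)] by linarith
    then have "\<bar>q\<bar> * \<bar>k - k'\<bar> \<le> int J * (2 * int J)" using q by (intro mult_mono) auto
    then show "\<bar>2 * q * (k - k')\<bar> \<le> 4 * int J ^ 2" by (simp add: abs_mult power2_eq_square)
  qed
  have "fj (4 * X * ?R) (\<lambda>v. h (1 * v)) \<ge> N / (2 * K ^ 2 * C)"
  proof (rule pair_smoothing[where \<Lambda> = "?l ` Bs" and \<theta> = 1, OF sqh h0 hN K C])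
    show "finite (?l ` Bs)" using Bs by simp
    show "2 * K ^ 2 \<le> real (card (?l ` Bs))" using Bs(2) by (simp only: card_image[OF inj])
    show "N / K \<le> fj ?R (\<lambda>a. h (1 * (l * a)))" if "l \<in> ?l ` Bs" for l using that bigh by auto
    show "?R > 0" using D R2 by simp
    show "l \<noteq> 0 \<and> \<bar>l\<bar> \<le> int ?R \<and> \<bar>l\<bar> \<le> int X" if "l \<in> ?l ` Bs" for l
    proof -
      obtain k where k: "k \<in> Bs" "l = ?l k" using \<open>l \<in> ?l ` Bs\<close> by auto
      have "int X \<le> int ?R" using X(2) by (simp only: of_nat_le_iff)
      then show ?thesis using lbd[OF k(1)] ubd[OF k(1)] s1 unfolding k(2) by linarith
    qed
    show "24 * real_of_int (gcd l l') * real X / real_of_int \<bar>l'\<bar> \<le> C" if l: "l \<in> ?l ` Bs" "l' \<in> ?l ` Bs" "l \<noteq> l'" for l l'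
    proof -
      obtain k k' where k: "k \<in> Bs" "l = ?l k" "k' \<in> Bs" "l' = ?l k'" "k \<noteq> k'" using l by auto
      have "real_of_int (gcd l l') \<le> real_of_int (4 * int J ^ 2)" using gb[OF k(1,3,5)] unfolding k(2,4) by (simp only: of_int_le_iff)
      then have 1: "24 * real_of_int (gcd l l') * real X \<le> 24 * (4 * real J ^ 2) * real X"
        by (intro mult_right_mono mult_left_mono) auto
      have "real_of_int s \<le> real_of_int \<bar>l'\<bar>" using lbd[OF k(3)] unfolding k(4) by (simp only: of_int_le_iff)
      then have "24 * real_of_int (gcd l l') * real X / real_of_int \<bar>l'\<bar> \<le> 24 * (4 * real J ^ 2) * real X / real_of_int s"
        using 1 s1 by (intro frac_le) auto
      also have "\<dots> \<le> C" using CX by simp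
      finally show ?thesis .
    qed
  qed
  then show ?thesis by (simp add: h_def)
qed

text \<open>Smoothing for one inner modulus. By the symmetry of \<open>KR\<close> it serves for the
  second as well as for the third difference.\<close>

lemma difference_uniform:
  fixes Ts :: "int set" and K C :: real and \<theta> :: int
  assumes g: "\<And>w. norm (g w) \<le> 1" and K: "K \<ge> 1" and C: "C > 0" and pos: "V > 0" "R' > 0" "R2 > 0"
    and Ts: "finite Ts" "real (card Ts) \<ge> 2 * K ^ 2" "\<And>t. t \<in> Ts \<Longrightarrow> 0 < t \<and> t \<le> int R2 \<and> t \<le> int X"
    and CX: "\<And>t t'. t \<in> Ts \<Longrightarrow> t' \<in> Ts \<Longrightarrow> t \<noteq> t' \<Longrightarrow> 24 * real_of_int (gcd t t') * real X / real_of_int t' \<le> C"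
    and big: "\<And>t. t \<in> Ts \<Longrightarrow> fj V (\<lambda>v. fj R' (\<lambda>b. fj R2 (\<lambda>a. KR g v (\<theta> * (t * a)) (f b)))) \<ge> N / K"
  shows "fj V (\<lambda>v. fj R' (\<lambda>b. fj (4 * X * R2) (\<lambda>a. KR g v (\<theta> * a) (f b)))) \<ge> N / (2 * K ^ 2 * C)"
proof -
  define h where "h u = fj V (\<lambda>v. fj R' (\<lambda>b. KR g v u (f b)))" for u
  have sqh: "sq h" unfolding h_def KR_middle using g pos by (intro sq_fj sq_rr norm_Dl_le)
  have h0: "0 \<le> h u" for u
  proof -
    have "h u = fj R' (\<lambda>b. fj V (\<lambda>v. KR g (1 * v) u (f b)))" unfolding h_def by (subst fj_swap) simp
    also have "\<dots> \<ge> 0" by (intro fj_nonneg fj_KR_nonneg)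
    finally show ?thesis .
  qed
  have hN: "h u \<le> N" for u unfolding h_def using g pos by (intro fj_le KR_le)
  have comm: "fj V (\<lambda>v. fj R' (\<lambda>b. fj R (\<lambda>a. KR g v (F a) (f b)))) = fj R (\<lambda>a. h (F a))" for R F
  proof -
    have "fj V (\<lambda>v. fj R' (\<lambda>b. fj R (\<lambda>a. KR g v (F a) (f b)))) = fj V (\<lambda>v. fj R (\<lambda>a. fj R' (\<lambda>b. KR g v (F a) (f b))))"
      by (rule arg_cong[of _ _ "fj V"], rule ext, rule fj_swap)
    also have "\<dots> = fj R (\<lambda>a. h (F a))" unfolding h_def by (rule fj_swap)
    finally show ?thesis .
  qed
  have "fj (4 * X * R2) (\<lambda>v. h (\<theta> * v)) \<ge> N / (2 * K ^ 2 * C)"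
  proof (rule pair_smoothing[where \<Lambda> = Ts, OF sqh h0 hN K C Ts(1,2) _ pos(3)])
    show "N / K \<le> fj R2 (\<lambda>a. h (\<theta> * (t * a)))" if "t \<in> Ts" for t using big[OF that] unfolding comm .
    show "t \<noteq> 0 \<and> \<bar>t\<bar> \<le> int R2 \<and> \<bar>t\<bar> \<le> int X" if "t \<in> Ts" for t using Ts(3)[OF that] by auto
    show "24 * real_of_int (gcd t t') * real X / real_of_int \<bar>t'\<bar> \<le> C" if "t \<in> Ts" "t' \<in> Ts" "t \<noteq> t'" for t t'
      using CX[OF that] Ts(3)[OF that(2)] by simp
  qed
  then show ?thesis unfolding comm .
qed

text \<open>The moduli of the third differences depend on the parameters \<open>t\<close> and \<open>s\<close>.  Smoothing over
  \<open>k\<close>, then over \<open>t\<close>, then over \<open>s\<close> replaces one modulus after the other by a fixed one.  The factorial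
  in \<open>t0\<close> makes the numbers \<open>s = (B + j) * t0 + 1\<close> coprime to those \<open>t\<close> that are used.\<close>

lemma uniform_differences:
  fixes K1 J \<tau> K2 Jt K3 Js B K4 Y t0 R2 D R :: nat
  assumes g: "\<And>w. norm (g w) \<le> 1" and pos: "K1 \<ge> 1" "J \<ge> 1" "\<tau> \<ge> 1"
    and K2: "K2 = 3072 * K1 ^ 2 * J ^ 3" and Jt: "Jt = 2 * K2 ^ 2" and K3: "K3 = 96 * K2 ^ 2 * Jt"
    and Js: "Js = 2 * K3 ^ 2" and B: "B = 4 * J * Js" and K4: "K4 = 192 * K3 ^ 2 * Js"
    and Y: "Y = 2 * B * Jt" and t0: "t0 = fact Y * \<tau>" and R2: "R2 = 4 * B * t0"
    and D: "D = 4 * J * fact J" and R: "R = D * R2"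
    and big: "\<And>t s. int t0 \<le> t \<Longrightarrow> t \<le> 2 * int t0 \<Longrightarrow> 2 * int J * t \<le> s \<Longrightarrow> s \<le> 4 * int B * int t0 \<Longrightarrow> \<exists>q Bs. q \<noteq> 0 \<and> \<bar>q\<bar> < int J \<and> finite Bs \<and> card Bs \<ge> 2 * K1 ^ 2 \<and>
      (\<forall>k\<in>Bs. k \<noteq> 0 \<and> \<bar>k\<bar> < int J \<and>
       fj R (\<lambda>c. fj R (\<lambda>b. fj R (\<lambda>a. KR g (2 * (t * k - s * q) * c) (2 * t * k * a) (2 * s * q * b)))) \<ge> N / real K1)"
  shows "fj (4 * (16 * J * B * t0) * R) (\<lambda>v. fj (8 * t0 * R2) (\<lambda>a. fj (8 * t0 * R2) (\<lambda>b. KR g v (2 * int D * a) (2 * int D * b)))) \<ge> N / real K4"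
proof -
  let ?V = "4 * (16 * J * B * t0) * R"
  define Ts where "Ts = (\<lambda>i. int (t0 + i)) ` {..<Jt}"
  define Ss where "Ss = (\<lambda>j. int ((B + j) * t0 + 1)) ` {..<Js}"
  have K2p: "K2 \<ge> 1" using pos by (simp add: K2)
  have Jtp: "Jt \<ge> 1" using K2p by (simp add: Jt)
  have K3p: "K3 \<ge> 1" using K2p Jtp by (simp add: K3)
  have Jsp: "Js \<ge> 1" using K3p by (simp add: Js)
  have Bp: "B \<ge> 4 * J" "B \<ge> Js" "B \<ge> 1" using Jsp pos by (auto simp: B)
  have Y1: "Y \<ge> Jt" "Y \<ge> 1" using Bp Jtp by (auto simp: Y)
  have "fact Y \<ge> Y" by (rule fact_ge_self)
  moreover have "fact Y * 1 \<le> fact Y * \<tau>" using pos by (intro mult_left_mono) auto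
  ultimately have t0Y: "t0 \<ge> Y" unfolding t0 mult_1_right by (rule order_trans)
  then have t0p: "t0 \<ge> 1" "t0 \<ge> Jt" using Y1 by auto
  have R2p: "R2 > 0" using Bp t0p by (simp add: R2)
  have Dp: "D > 0" using pos by (simp add: D)
  have Ts: "finite Ts" "card Ts = Jt" by (auto simp: Ts_def card_image inj_on_def)
  have Ss: "finite Ss" "card Ss = Js" using t0p by (auto simp: Ss_def card_image inj_on_def)
  have Tb: "int t0 \<le> t \<and> t \<le> 2 * int t0" if "t \<in> Ts" for t using that t0p by (auto simp: Ts_def)
  have Sb: "int B * int t0 \<le> s \<and> s \<le> 4 * int B * int t0" if s: "s \<in> Ss" for s
  proof -
    obtain j where j: "j < Js" "s = int ((B + j) * t0 + 1)" using s by (auto simp: Ss_def)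
    have "(B + j) * t0 + 1 \<le> (2 * B) * t0 + 1 * (2 * t0)" using j Bp t0p by (intro add_mono mult_right_mono) auto
    also have "\<dots> \<le> (2 * B) * t0 + B * (2 * t0)" using Bp by (intro add_left_mono mult_right_mono) auto
    finally have "(B + j) * t0 + 1 \<le> 4 * B * t0" by simp
    moreover have "B * t0 \<le> (B + j) * t0 + 1" by (simp add: add_mult_distrib)
    ultimately show ?thesis unfolding j(2) by (simp flip: of_nat_mult add: of_nat_le_iff)  (metis of_nat_le_iff of_nat_mult of_nat_numeral of_nat_Suc)
  qed
  have Sp: "0 < s" if s: "s \<in> Ss" for s
  proof -
    obtain j where "s = int ((B + j) * t0 + 1)" using s by (auto simp: Ss_def)
    then have "s = int ((B + j) * t0) + 1" by simp
    then show ?thesis by linarith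
  qed
  have cop: "coprime s t" if st: "s \<in> Ss" "t \<in> Ts" for s t
  proof -
    obtain j where j: "j < Js" "s = int ((B + j) * t0 + 1)" using st by (auto simp: Ss_def)
    obtain i where i: "i < Jt" "t = int (t0 + i)" using st by (auto simp: Ts_def)
    \<comment> \<open>A common divisor of \<open>s\<close> and \<open>t\<close> divides this number,
      in which \<open>t0\<close> has cancelled; it is non-zero and at most \<open>Y\<close> in
      absolute value. Hence the divisor divides \<open>fact Y\<close>, therefore \<open>t0\<close>,
      and therefore \<open>s - (B + j) * t0 = 1\<close>.\<close>
    let ?c = "1 - int (B + j) * int i"
    have e: "s - int (B + j) * t = ?c" unfolding i j by (simp add: algebra_simps)
    have c0: "?c \<noteq> 0"
    proof
      assume "?c = 0"
      then have "int (B + j) dvd 1" by (metis dvd_triv_left eq_iff_diff_eq_0)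
      then have "B + j = 1" by auto
      then show False using Bp pos by auto
    qed
    have cY: "\<bar>?c\<bar> \<le> int Y"
    proof -
      have "(B + j) * i \<le> (2 * B) * Jt" using i j Bp by (intro mult_mono) auto
      then have "int ((B + j) * i) \<le> int Y" unfolding Y by (simp only: of_nat_le_iff)
      then have "int (B + j) * int i \<le> int Y" by (simp only: of_nat_mult)
      moreover have "int (B + j) * int i \<ge> 0" by simp
      ultimately show ?thesis using Y1 by linarith
    qed
    show ?thesis
    proof (rule coprimeI)
      fix d assume d: "d dvd s" "d dvd t"
      then have "d dvd ?c" unfolding e[symmetric] by (intro dvd_diff dvd_mult)
      then have "nat \<bar>d\<bar> \<le> Y" "d \<noteq> 0" using c0 cY dvd_imp_le_int[of ?c d] by auto
      then have "nat \<bar>d\<bar> dvd fact Y" by (intro dvd_fact) auto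
      then have "d dvd int (fact Y)" by (metis dvd_abs_iff abs_dvd_iff int_dvd_int_iff nat_0_le abs_ge_zero)
      then have "d dvd int (B + j) * int t0" unfolding t0 by simp
      moreover have "s - int (B + j) * int t0 = 1" unfolding j by simp
      ultimately show "is_unit d" using d(1) by (metis dvd_diff)
    qed
  qed
  have Tg: "gcd t t' \<le> int Jt" if "t \<in> Ts" "t' \<in> Ts" "t \<noteq> t'" for t t'
  proof (rule abs_gcd_le)
    show "t \<noteq> 0 \<or> t' \<noteq> 0" using Tb[OF that(1)] t0p by linarith
    show "gcd t t' dvd t - t'" by (intro dvd_diff) auto
    show "t - t' \<noteq> 0" using that by simp
    show "\<bar>t - t'\<bar> \<le> int Jt" using that by (auto simp: Ts_def)
  qed
  have Sg: "gcd s s' \<le> int Js" if s: "s \<in> Ss" "s' \<in> Ss" "s \<noteq> s'" for s s'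
  proof -
    obtain j j' where j: "j < Js" "s = int ((B + j) * t0 + 1)" "j' < Js" "s' = int ((B + j') * t0 + 1)"
      using s by (auto simp: Ss_def)
    show ?thesis
    proof (rule abs_gcd_le)
      show "s \<noteq> 0 \<or> s' \<noteq> 0" using Sp[OF s(1)] by simp
      \<comment> \<open>This combination cancels \<open>t0\<close>, so the gcd of two of the large
        numbers \<open>s\<close> is bounded by \<open>Js\<close>.\<close>
      have "int (B + j') * s - int (B + j) * s' = int j' - int j" unfolding j by (simp add: algebra_simps)
      then show "gcd s s' dvd int j' - int j" by (metis dvd_diff dvd_mult gcd_dvd1 gcd_dvd2)
      show "int j' - int j \<noteq> 0" using s(3) j by auto
      show "\<bar>int j' - int j\<bar> \<le> int Js" using j by auto
    qed
  qed
  have s2J: "2 * int J * t \<le> s" if "s \<in> Ss" "t \<in> Ts" for s t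
  proof -
    have "2 * int J * t \<le> 2 * int J * (2 * int t0)" using Tb[OF that(2)] by (intro mult_left_mono) auto
    also have "\<dots> = int (4 * J) * int t0" by simp
    also have "\<dots> \<le> int B * int t0" using Bp(1) by (intro mult_right_mono) linarith+
    also have "\<dots> \<le> s" using Sb[OF that(1)] by simp
    finally show ?thesis .
  qed
  have st1: "fj ?V (\<lambda>v. fj R2 (\<lambda>a. fj R2 (\<lambda>b. KR g v (2 * t * int D * a) (2 * s * int D * b)))) \<ge> N / real K2"
    if s: "s \<in> Ss" and t: "t \<in> Ts" for s t
  proof -
    obtain q Bs where q: "q \<noteq> 0" "\<bar>q\<bar> < int J" and Bs: "finite Bs" "card Bs \<ge> 2 * K1 ^ 2"
      "\<And>k. k \<in> Bs \<Longrightarrow> k \<noteq> 0 \<and> \<bar>k\<bar> < int J" 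
      "\<And>k. k \<in> Bs \<Longrightarrow> fj R (\<lambda>c. fj R (\<lambda>b. fj R (\<lambda>a. KR g (2 * (t * k - s * q) * c) (2 * t * k * a) (2 * s * q * b)))) \<ge> N / real K1"
      using big[of t s] Tb[OF t] Sb[OF s] s2J[OF s t] by blast
    have "fj (4 * (16 * J * B * t0) * (D * R2)) (\<lambda>v. fj R2 (\<lambda>a. fj R2 (\<lambda>b. KR g v (2 * t * int D * a) (2 * s * int D * b))))
      \<ge> N / (2 * real K1 ^ 2 * (1536 * real J ^ 3))"
    proof (rule third_difference_uniform[OF g _ _ Bs(1) _ Bs(3) q cop[OF s t] _ s2J[OF s t] Dp])
      show "1 \<le> real K1" "0 < 1536 * real J ^ 3" using pos by auto
      show "2 * real K1 ^ 2 \<le> real (card Bs)" using Bs(2) by (metis of_nat_le_iff of_nat_mult of_nat_numeral of_nat_power)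
      show "1 \<le> t" using Tb[OF t] t0p by linarith
      show "k dvd D" if "k > 0" "k < J" for k unfolding D using that by (intro dvd_mult dvd_fact) auto
      show "R2 > 0" by (rule R2p)
      have "4 * int J * s \<le> 4 * int J * (4 * int B * int t0)" using Sb[OF s] by (intro mult_left_mono) auto
      then show "4 * int J * s \<le> int (16 * J * B * t0)" by simp
      have "(4 * J) * (4 * B * t0) * 1 \<le> (4 * J) * (4 * B * t0) * fact J" by (intro mult_left_mono) auto
      then show "16 * J * B * t0 \<le> D * R2" unfolding D R2 by (simp add: mult_ac)
      have "real B * real t0 \<le> real_of_int s" using Sb[OF s] by (metis of_int_le_iff of_int_mult of_int_of_nat_eq)
      moreover have "real B * real t0 > 0" using Bp t0p by simp
      ultimately have "96 * real J ^ 2 * real (16 * J * B * t0) / real_of_int s \<le> 96 * real J ^ 2 * real (16 * J * B * t0) / (real B * real t0)"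
        by (intro divide_left_mono) auto
      also have "\<dots> = 1536 * real J ^ 3" using Bp t0p by (simp add: field_simps power2_eq_square power3_eq_cube)
      finally show "96 * real J ^ 2 * real (16 * J * B * t0) / real_of_int s \<le> 1536 * real J ^ 3" .
      show "N / real K1 \<le> fj (D * R2) (\<lambda>c. fj (D * R2) (\<lambda>b. fj (D * R2) (\<lambda>a.
        KR g (2 * (t * k - s * q) * c) (2 * t * k * a) (2 * s * q * b))))" if "k \<in> Bs" for k
        using Bs(4)[OF that] unfolding R .
    qed
    then show ?thesis by (simp add: R K2 mult_ac)
  qed
  have st2: "fj ?V (\<lambda>v. fj R2 (\<lambda>b. fj (4 * (2 * t0) * R2) (\<lambda>a. KR g v ((2 * int D) * a) (2 * s * int D * b)))) \<ge> N / real K3"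
    if s: "s \<in> Ss" for s
  proof -
    have "fj ?V (\<lambda>v. fj R2 (\<lambda>b. fj (4 * (2 * t0) * R2) (\<lambda>a. KR g v ((2 * int D) * a) (2 * s * int D * b)))) \<ge> N / (2 * real K2 ^ 2 * (48 * real Jt))"
    proof (rule difference_uniform[OF g _ _ _ R2p R2p Ts(1)])
      show "1 \<le> real K2" "0 < 48 * real Jt" using K2p Jtp by auto
      show "?V > 0" using pos Bp t0p R2p Dp by (simp add: R)
      show "2 * real K2 ^ 2 \<le> real (card Ts)" by (simp add: Ts Jt)
      show "0 < t \<and> t \<le> int R2 \<and> t \<le> int (2 * t0)" if "t \<in> Ts" for t
      proof -
        have "2 * t0 \<le> R2" using Bp unfolding R2 by simp
        then show ?thesis using Tb[OF that] t0p by linarith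
      qed
      show "24 * real_of_int (gcd t t') * real (2 * t0) / real_of_int t' \<le> 48 * real Jt" if "t \<in> Ts" "t' \<in> Ts" "t \<noteq> t'" for t t'
      proof -
        have "real_of_int (gcd t t') \<le> real Jt" using Tg[OF that] by linarith
        moreover have "real t0 \<le> real_of_int t'" using Tb[OF that(2)] by linarith
        ultimately have "24 * real_of_int (gcd t t') * real (2 * t0) / real_of_int t' \<le> 24 * real Jt * real (2 * t0) / real t0"
          using t0p by (intro frac_le mult_right_mono mult_left_mono) auto
        then show ?thesis using t0p by simp
      qed
      show "N / real K2 \<le> fj ?V (\<lambda>v. fj R2 (\<lambda>b. fj R2 (\<lambda>a. KR g v (2 * int D * (t * a)) (2 * s * int D * b))))" if t: "t \<in> Ts" for t
      proof -
        have "fj ?V (\<lambda>v. fj R2 (\<lambda>a. fj R2 (\<lambda>b. KR g v (2 * t * int D * a) (2 * s * int D * b))))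
          = fj ?V (\<lambda>v. fj R2 (\<lambda>b. fj R2 (\<lambda>a. KR g v (2 * int D * (t * a)) (2 * s * int D * b))))"
          by (subst fj_swap) (simp add: mult_ac)
        then show ?thesis using st1[OF s t] by simp
      qed
    qed
    then show ?thesis by (simp add: K3 mult_ac)
  qed
  let ?W = "8 * t0 * R2"
  have st3: "fj ?V (\<lambda>v. fj ?W (\<lambda>b. fj (4 * (4 * B * t0) * R2) (\<lambda>a. KR g v ((2 * int D) * a) (2 * int D * b)))) \<ge> N / real K4"
  proof -
    have "fj ?V (\<lambda>v. fj ?W (\<lambda>b. fj (4 * (4 * B * t0) * R2) (\<lambda>a. KR g v ((2 * int D) * a) (2 * int D * b)))) \<ge> N / (2 * real K3 ^ 2 * (96 * real Js))"
    proof (rule difference_uniform[OF g _ _ _ _ R2p Ss(1)])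
      show "1 \<le> real K3" "0 < 96 * real Js" using K3p Jsp by auto
      show "?V > 0" "?W > 0" using pos Bp t0p R2p Dp by (simp_all add: R)
      show "2 * real K3 ^ 2 \<le> real (card Ss)" by (simp add: Ss Js)
      show "0 < s \<and> s \<le> int R2 \<and> s \<le> int (4 * B * t0)" if "s \<in> Ss" for s
      proof -
        show ?thesis using Sb[OF that] Sp[OF that] unfolding R2 by simp
      qed
      show "24 * real_of_int (gcd s s') * real (4 * B * t0) / real_of_int s' \<le> 96 * real Js" if "s \<in> Ss" "s' \<in> Ss" "s \<noteq> s'" for s s'
      proof -
        have "real_of_int (gcd s s') \<le> real Js" using Sg[OF that] by linarith
        moreover have "real B * real t0 \<le> real_of_int s'" using Sb[OF that(2)] by (metis of_int_le_iff of_int_mult of_int_of_nat_eq)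
        moreover have "real B * real t0 > 0" using Bp t0p by simp
        ultimately have "24 * real_of_int (gcd s s') * real (4 * B * t0) / real_of_int s' \<le> 24 * real Js * real (4 * B * t0) / (real B * real t0)"
          by (intro frac_le mult_right_mono mult_left_mono) auto
        then show ?thesis using t0p Bp by simp
      qed
      show "N / real K3 \<le> fj ?V (\<lambda>v. fj ?W (\<lambda>b. fj R2 (\<lambda>a. KR g v (2 * int D * (s * a)) (2 * int D * b))))" if s: "s \<in> Ss" for s
      proof -
        have "fj ?V (\<lambda>v. fj R2 (\<lambda>b. fj (4 * (2 * t0) * R2) (\<lambda>a. KR g v ((2 * int D) * a) (2 * s * int D * b))))
          = fj ?V (\<lambda>v. fj ?W (\<lambda>b. fj R2 (\<lambda>a. KR g v (2 * int D * (s * a)) (2 * int D * b))))"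
          unfolding fj_KR_swap[of R2 _ g _ "\<lambda>a. (2 * int D) * a" "\<lambda>b. 2 * s * int D * b"] by (simp add: mult_ac)
        then show ?thesis using st2[OF s] by simp
      qed
    qed
    then show ?thesis by (simp add: K4 mult_ac)
  qed
  also have "fj ?V (\<lambda>v. fj ?W (\<lambda>b. fj (4 * (4 * B * t0) * R2) (\<lambda>a. KR g v ((2 * int D) * a) (2 * int D * b))))
    \<le> fj ?V (\<lambda>v. fj ?W (\<lambda>b. fj ?W (\<lambda>a. KR g v ((2 * int D) * a) (2 * int D * b))))"
  proof (intro fj_mono)
    fix v b
    have e: "4 * (4 * B * t0) * R2 = (2 * B) * ?W" by simp
    show "fj (4 * (4 * B * t0) * R2) (\<lambda>a. KR g v ((2 * int D) * a) (2 * int D * b)) \<le> fj ?W (\<lambda>a. KR g v ((2 * int D) * a) (2 * int D * b))"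
      unfolding e KR_middle using Bp t0p R2p by (intro fj_rr_shorten) auto
  qed
  also have "fj ?V (\<lambda>v. fj ?W (\<lambda>b. fj ?W (\<lambda>a. KR g v ((2 * int D) * a) (2 * int D * b))))
    = fj ?V (\<lambda>v. fj ?W (\<lambda>a. fj ?W (\<lambda>b. KR g v (2 * int D * a) (2 * int D * b))))"
    by (intro arg_cong[where f = "fj _"] ext KR_23)
  finally show ?thesis .
qed

end

section \<open>PET induction\<close>

lemma norm_double_sum_diff_le:
  fixes F :: "nat \<Rightarrow> nat \<Rightarrow> complex"
  assumes "\<And>a b. a < J \<Longrightarrow> b < J \<Longrightarrow> norm (F a b - L) \<le> e"
  shows "norm ((\<Sum>a<J. \<Sum>b<J. F a b) - of_nat J * (of_nat J * L)) \<le> real J * (real J * e)"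
proof -
  have "(\<Sum>a<J. \<Sum>b<J. F a b) - of_nat J * (of_nat J * L) = (\<Sum>a<J. \<Sum>b<J. F a b - L)"
    by (simp add: sum_subtractf)
  also have "norm \<dots> \<le> (\<Sum>a<J. \<Sum>b<J. e)" using assms by (intro sum_norm_le) auto
  finally show ?thesis by simp
qed

context two_actions
begin

lemma norm_sum_Om_le: "(\<And>w. norm (F w) \<le> 1) \<Longrightarrow> norm (\<Sum>w\<in>Om. F w) \<le> N" for F :: "'w \<Rightarrow> complex"
  using sum_norm_le[of Om F "\<lambda>_. 1"] by simp

text \<open>The four corners of a box, left over after both bounded factors have been removed and
  translated so that the first corner is \<open>w\<close>. The exponents are the differences (d +
  p)^2 - d^2, (d - q)^2 - d^2 and (d + p - q)^2 - d^2; they are linear in \<open>d\<close>, which is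
  the gain of this step.\<close>

definition Q4 :: "('w \<Rightarrow> complex) \<Rightarrow> int \<Rightarrow> int \<Rightarrow> int \<Rightarrow> complex" where
  "Q4 g p q d = (\<Sum>w\<in>Om. g w * cnj (g (S (2 * d * p + p\<^sup>2) w)) *
     cnj (g (T q (S (q\<^sup>2 - 2 * d * q) w))) * g (T q (S (2 * d * (p - q) + (p - q)\<^sup>2) w)))"

lemma norm_mult4_le:
  fixes a b c d :: complex
  assumes "norm a \<le> 1" "norm b \<le> 1" "norm c \<le> 1" "norm d \<le> 1"
  shows "norm (a * b * c * d) \<le> 1"
  using assms by (simp add: norm_mult mult_le_one)

lemma norm_Q4_le: "(\<And>w. norm (g w) \<le> 1) \<Longrightarrow> norm (Q4 g p q d) \<le> N"
  unfolding Q4_def by (intro norm_sum_Om_le norm_mult4_le) auto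

text \<open>After \<open>w\<close> is replaced by \<open>T (s * a) w\<close> and \<open>d\<close> by \<open>d + t * b - s * a\<close>, the first factor depends
  on \<open>a\<close> only and the second one on \<open>b\<close> only, so that Cauchy--Schwarz removes both.\<close>

lemma pet_box:
  fixes f0 f1 g :: "'w \<Rightarrow> complex" and K J M :: nat and s t c :: int
  defines "G \<equiv> \<lambda>d. \<Sum>w\<in>Om. f0 w * f1 (T d w) * g (S (d\<^sup>2) w)"
  assumes b: "\<And>w. norm (f0 w) \<le> 1" "\<And>w. norm (f1 w) \<le> 1" "\<And>w. norm (g w) \<le> 1"
    and K: "K \<ge> 1" and J: "J > 128 * K ^ 4" and st: "s \<ge> 1" "t \<ge> 1" "64 * int K ^ 4 * (int J * (s + t)) \<le> int M"
    and big: "norm (\<Sum>i<M. G (c + int i)) \<ge> real M * N / real K"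
  obtains q Bs where "q \<noteq> 0" "\<bar>q\<bar> < int J" "finite Bs" "real (card Bs) * (128 * real K ^ 4) \<ge> real J"
    "\<And>k. k \<in> Bs \<Longrightarrow> k \<noteq> 0 \<and> \<bar>k\<bar> < int J \<and> norm (\<Sum>i<M. Q4 g (t * k) (s * q) (c + int i)) \<ge> real M * N / (128 * real K ^ 4)"
proof -
  let ?X = "real_of_int (int J * (s + t))"
  let ?GG = "\<Sum>a<J. \<Sum>b<J. \<Sum>i<M. G (c + int i + (t * int b - s * int a))"
  have Kr: "real K \<ge> 1" using K by simp
  have Jr: "real J > 128 * real K ^ 4" using J by (metis of_nat_less_iff of_nat_mult of_nat_numeral of_nat_power)
  have J0: "real J > 0" using J by simp
  have X64: "64 * real K ^ 4 * ?X \<le> real M"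
  proof -
    have "real_of_int (64 * int K ^ 4 * (int J * (s + t))) \<le> real_of_int (int M)" using st(3) by (simp only: of_int_le_iff)
    then show ?thesis by simp
  qed
  have "0 \<le> int J * (s + t)" using st by simp
  then have X0: "?X \<ge> 0" by (simp only: of_int_0_le_iff)
  have shift: "\<bar>real_of_int (t * int j - s * int i)\<bar> \<le> ?X" if "i < J" "j < J" for i j
  proof -
    have "t * int j \<le> t * int J" "s * int i \<le> s * int J" "0 \<le> t * int j" "0 \<le> s * int i" "0 \<le> t * int J" "0 \<le> s * int J"
      using that st by (auto intro: mult_left_mono)
    then have "\<bar>t * int j - s * int i\<bar> \<le> int J * (s + t)" by (simp add: algebra_simps)
    then show ?thesis by (metis of_int_abs of_int_le_iff)
  qed
  have normG: "norm (G d) \<le> N" for d unfolding G_def using b by (intro norm_sum_Om_le) (simp add: norm_mult mult_le_one)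
  have Gshift: "norm ((\<Sum>i<M. G (c + int i + (t * int b - s * int a))) - (\<Sum>i<M. G (c + int i))) \<le> 2 * ?X * N"
    if "a < J" "b < J" for a b
  proof -
    have "norm ((\<Sum>i<M. G (c + (int i + (t * int b - s * int a)))) - (\<Sum>i<M. G (c + int i))) \<le> 2 * \<bar>real_of_int (t * int b - s * int a)\<bar> * N"
      by (rule norm_sum_shift[where F = "\<lambda>i. G (c + i)"]) (rule normG)
    also have "\<dots> \<le> 2 * ?X * N" using shift[OF that] by (intro mult_right_mono mult_left_mono) auto
    finally show ?thesis by (simp only: add.assoc)
  qed
  let ?al = "\<lambda>w a. f0 (T (s * int a) w)"
  let ?be = "\<lambda>d w b. f1 (T (d + t * int b) w)"
  let ?ga = "\<lambda>d w a b. g (T (s * int a) (S ((d + (t * int b - s * int a))\<^sup>2) w))"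
  let ?x = "\<lambda>p. norm (\<Sum>a<J. \<Sum>b<J. ?al (snd p) a * ?be (c + int (fst p)) (snd p) b * ?ga (c + int (fst p)) (snd p) a b)"
  let ?P = "{..<M} \<times> Om"
  have Gexp: "G (d + (t * int b - s * int a)) = (\<Sum>w\<in>Om. ?al w a * ?be d w b * ?ga d w a b)" for d a b
  proof -
    have "G (d + (t * int b - s * int a)) = (\<Sum>w\<in>Om. (\<lambda>w. f0 w * f1 (T (d + (t * int b - s * int a)) w) * g (S ((d + (t * int b - s * int a))\<^sup>2) w)) (T (s * int a) w))"
      unfolding G_def by (rule sum_T[symmetric])
    then show ?thesis by (simp add: T_add S_T algebra_simps)
  qed
  have sumx: "(\<Sum>p\<in>?P. ?x p) \<ge> real J ^ 2 * (real M * N / (2 * real K))"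
  proof -
    let ?L = "\<Sum>i<M. G (c + int i)"
    have 1: "norm (?GG - of_nat J * (of_nat J * ?L)) \<le> real J * (real J * (2 * ?X * N))"
      using Gshift by (rule norm_double_sum_diff_le)
    have 2: "norm (of_nat J * (of_nat J * ?L)) = real J * (real J * norm ?L)" by (simp add: norm_mult)
    have 3: "real J * (real J * norm ?L) \<ge> real J * (real J * (real M * N / real K))" using big by (intro mult_left_mono) auto
    have 4: "real J * (real J * (2 * ?X * N)) \<le> real J * (real J * (real M * N / (2 * real K)))"
    proof (intro mult_left_mono)
      have "real K \<le> real K ^ 4" using Kr by (simp add: self_le_power)
      then have "4 * real K \<le> 64 * real K ^ 4" using Kr by linarith
      then have "4 * real K * ?X \<le> 64 * real K ^ 4 * ?X" using X0 by (rule mult_right_mono)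
      then have "4 * real K * ?X \<le> real M" using X64 by linarith
      then have "2 * ?X \<le> real M / (2 * real K)" using Kr by (simp add: field_simps)
      then have "2 * ?X * N \<le> real M / (2 * real K) * N" by (intro mult_right_mono) auto
      then show "2 * ?X * N \<le> real M * N / (2 * real K)" by simp
    qed auto
    have 5: "norm (of_nat J * (of_nat J * ?L)) \<le> norm ?GG + real J * (real J * (2 * ?X * N))"
      using 1 norm_triangle_sub[of "of_nat J * (of_nat J * ?L)" "?GG"]
      by (simp add: norm_minus_commute)
    have 6: "?GG = (\<Sum>p\<in>?P. \<Sum>a<J. \<Sum>b<J. ?al (snd p) a * ?be (c + int (fst p)) (snd p) b * ?ga (c + int (fst p)) (snd p) a b)"
    proof -
      have "?GG = (\<Sum>a<J. \<Sum>b<J. \<Sum>i<M. \<Sum>w\<in>Om. ?al w a * ?be (c + int i) w b * ?ga (c + int i) w a b)"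
        by (simp only: Gexp)
      also have "\<dots> = (\<Sum>a<J. \<Sum>b<J. \<Sum>p\<in>?P. ?al (snd p) a * ?be (c + int (fst p)) (snd p) b * ?ga (c + int (fst p)) (snd p) a b)"
        by (simp only: sum_Times fst_conv snd_conv)
      also have "\<dots> = (\<Sum>p\<in>?P. \<Sum>a<J. \<Sum>b<J. ?al (snd p) a * ?be (c + int (fst p)) (snd p) b * ?ga (c + int (fst p)) (snd p) a b)"
        by (simp only: sum.swap[of _ ?P])
      finally show ?thesis .
    qed
    have 7: "norm (\<Sum>p\<in>?P. \<Sum>a<J. \<Sum>b<J. ?al (snd p) a * ?be (c + int (fst p)) (snd p) b * ?ga (c + int (fst p)) (snd p) a b) \<le> (\<Sum>p\<in>?P. ?x p)"
      by (rule norm_sum)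
    have 8: "real J * (real J * (real M * N / real K)) - real J * (real J * (real M * N / (2 * real K))) = real J ^ 2 * (real M * N / (2 * real K))"
      using Kr by (simp add: field_simps power2_eq_square)
    from 2 3 4 5 7 8 show ?thesis unfolding 6 by linarith
  qed
  let ?Bx = "\<lambda>p. \<Sum>a<J. \<Sum>a'<J. norm (\<Sum>b<J. ?ga (c + int (fst p)) (snd p) a b * cnj (?ga (c + int (fst p)) (snd p) a' b)) ^ 2"
  have M0: "M > 0"
  proof -
    have "1 \<le> int K ^ 4" using K by simp
    moreover have "1 * 1 \<le> int J * (s + t)" using J0 st by (intro mult_mono) auto
    ultimately have "1 * 1 \<le> int K ^ 4 * (int J * (s + t))" by (intro mult_mono) auto
    then show ?thesis using st(3) by linarith
  qed
  have cP: "real (card ?P) = real M * N" by (simp add: card_cartesian_product)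
  have MN0: "real M * N > 0" using M0 N_pos by simp
  have sumB: "(\<Sum>p\<in>?P. ?Bx p) \<ge> real J ^ 4 * (real M * N) / (16 * real K ^ 4)"
  proof -
    have "?x p ^ 4 \<le> real J ^ 4 * ?Bx p" for p
      using box_ineq[of "{..<J}" "{..<J}" "?al (snd p)" "?be (c + int (fst p)) (snd p)" "?ga (c + int (fst p)) (snd p)"] b
      by (simp flip: power_add)
    then have "(\<Sum>p\<in>?P. ?x p ^ 4) \<le> real J ^ 4 * (\<Sum>p\<in>?P. ?Bx p)" unfolding sum_distrib_left by (intro sum_mono)
    then have "real (card ?P) ^ 3 * (\<Sum>p\<in>?P. ?x p ^ 4) \<le> (real M * N) ^ 3 * (real J ^ 4 * (\<Sum>p\<in>?P. ?Bx p))"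
      unfolding cP by (intro mult_left_mono) auto
    moreover have "(\<Sum>p\<in>?P. ?x p) ^ 4 \<le> real (card ?P) ^ 3 * (\<Sum>p\<in>?P. ?x p ^ 4)" by (rule sum_pow4_le) simp
    moreover have "(real J ^ 2 * (real M * N / (2 * real K))) ^ 4 \<le> (\<Sum>p\<in>?P. ?x p) ^ 4" using sumx MN0 Kr by (intro power_mono) auto
    ultimately have "(real J ^ 2 * (real M * N / (2 * real K))) ^ 4 \<le> (real M * N) ^ 3 * (real J ^ 4 * (\<Sum>p\<in>?P. ?Bx p))" by linarith
    moreover have "(real J ^ 2 * (real M * N / (2 * real K))) ^ 4 = ((real M * N) ^ 3 * real J ^ 4) * (real J ^ 4 * (real M * N) / (16 * real K ^ 4))"
    proof -
      have "(x ^ 2 * (y / (2 * z))) ^ 4 = (y ^ 3 * x ^ 4) * (x ^ 4 * y / (16 * z ^ 4))" for x y z :: real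
        by (simp add: power_mult_distrib power_divide eval_nat_numeral)
      then show ?thesis .
    qed
    ultimately have "((real M * N) ^ 3 * real J ^ 4) * (real J ^ 4 * (real M * N) / (16 * real K ^ 4)) \<le> ((real M * N) ^ 3 * real J ^ 4) * (\<Sum>p\<in>?P. ?Bx p)"
      by (simp only: mult.assoc)
    then show ?thesis using MN0 J0 by (simp only: mult_le_cancel_left_pos mult_pos_pos zero_less_power)
  qed
  let ?z = "\<lambda>a a' b b'. norm (\<Sum>i<M. Q4 g (t * (int b' - int b)) (s * (int a' - int a)) (c + int i))"
  have Bexp: "(\<Sum>p\<in>?P. ?Bx p) \<le> (\<Sum>a<J. \<Sum>a'<J. \<Sum>b<J. \<Sum>b'<J. ?z a a' b b' + 2 * ?X * N)"
  proof -
    let ?pr = "\<lambda>d w a a' b b'. (?ga d w a b * cnj (?ga d w a' b)) * cnj (?ga d w a b' * cnj (?ga d w a' b'))"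
    have "complex_of_real (\<Sum>p\<in>?P. ?Bx p) = (\<Sum>p\<in>?P. \<Sum>a<J. \<Sum>a'<J. \<Sum>b<J. \<Sum>b'<J. ?pr (c + int (fst p)) (snd p) a a' b b')"
      unfolding of_real_sum[of _ ?P] by (rule sum.cong[OF refl], rule box_expand)
    also have "\<dots> = (\<Sum>a<J. \<Sum>a'<J. \<Sum>b<J. \<Sum>b'<J. \<Sum>p\<in>?P. ?pr (c + int (fst p)) (snd p) a a' b b')"
      by (simp only: sum.swap[of _ ?P])
    also have "\<dots> = (\<Sum>a<J. \<Sum>a'<J. \<Sum>b<J. \<Sum>b'<J. \<Sum>i<M. \<Sum>w\<in>Om. ?pr (c + int i) w a a' b b')"
      by (simp only: sum_Times fst_conv snd_conv)
    also have "\<dots> = (\<Sum>a<J. \<Sum>a'<J. \<Sum>b<J. \<Sum>b'<J. \<Sum>i<M. Q4 g (t * (int b' - int b)) (s * (int a' - int a)) (c + (int i + (t * int b - s * int a))))"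
    proof (intro sum.cong refl)
      fix a a' b b' i
      let ?d = "c + int i" and ?p = "t * (int b' - int b)" and ?q = "s * (int a' - int a)"
      let ?e = "?d + (t * int b - s * int a)"
      \<comment> \<open>Translation by \<open>S (- (?e\<^sup>2))\<close> and
        \<open>T (- (s * int a))\<close> moves the corner with indices (a, b) to
        \<open>w\<close>.\<close>
      have "(\<Sum>w\<in>Om. ?pr ?d w a a' b b') = (\<Sum>w\<in>Om. ?pr ?d (S (- (?e\<^sup>2)) w) a a' b b')"
        by (rule sum_S[symmetric])
      also have "\<dots> = (\<Sum>w\<in>Om. ?pr ?d (S (- (?e\<^sup>2)) (T (- (s * int a)) w)) a a' b b')"
        by (rule sum_T[symmetric])
      also have "\<dots> = Q4 g ?p ?q ?e" unfolding Q4_def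
      proof (rule sum.cong[OF refl])
        fix w
        have e: "?d + (t * int b' - s * int a) = ?e + ?p" "?d + (t * int b - s * int a') = ?e - ?q"
          "?d + (t * int b' - s * int a') = ?e + ?p - ?q" by (simp_all add: algebra_simps)
        have q: "s * int a' + - (s * int a) = ?q" by (simp add: algebra_simps)
        have sq: "(?e + ?p)\<^sup>2 + - (?e\<^sup>2) = 2 * ?e * ?p + ?p\<^sup>2" "(?e - ?q)\<^sup>2 + - (?e\<^sup>2) = ?q\<^sup>2 - 2 * ?e * ?q"
          "(?e + ?p - ?q)\<^sup>2 + - (?e\<^sup>2) = 2 * ?e * (?p - ?q) + (?p - ?q)\<^sup>2"
          by (simp_all add: power2_eq_square algebra_simps)
        have 1: "?ga ?d (S (- (?e\<^sup>2)) (T (- (s * int a)) w)) a b = g w" by (simp add: S_add S_T T_add S_0 T_0)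
        have 2: "?ga ?d (S (- (?e\<^sup>2)) (T (- (s * int a)) w)) a b' = g (S (2 * ?e * ?p + ?p\<^sup>2) w)"
          by (simp only: e S_add S_T T_add T_0 sq add.right_inverse)
        have 3: "?ga ?d (S (- (?e\<^sup>2)) (T (- (s * int a)) w)) a' b = g (T ?q (S (?q\<^sup>2 - 2 * ?e * ?q) w))"
          by (simp only: e S_add S_T T_add sq q)
        have 4: "?ga ?d (S (- (?e\<^sup>2)) (T (- (s * int a)) w)) a' b' = g (T ?q (S (2 * ?e * (?p - ?q) + (?p - ?q)\<^sup>2) w))"
          by (simp only: e S_add S_T T_add sq q)
        show "?pr ?d (S (- (?e\<^sup>2)) (T (- (s * int a)) w)) a a' b b' = g w * cnj (g (S (2 * ?e * ?p + ?p\<^sup>2) w)) *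
          cnj (g (T ?q (S (?q\<^sup>2 - 2 * ?e * ?q) w))) * g (T ?q (S (2 * ?e * (?p - ?q) + (?p - ?q)\<^sup>2) w))"
          unfolding 1 2 3 4 by simp
      qed
      finally show "(\<Sum>w\<in>Om. ?pr ?d w a a' b b') = Q4 g ?p ?q (c + (int i + (t * int b - s * int a)))" by (simp only: add.assoc)
    qed
    finally have "complex_of_real (\<Sum>p\<in>?P. ?Bx p) = (\<Sum>a<J. \<Sum>a'<J. \<Sum>b<J. \<Sum>b'<J. \<Sum>i<M. Q4 g (t * (int b' - int b)) (s * (int a' - int a)) (c + (int i + (t * int b - s * int a))))" .
    then have "norm (complex_of_real (\<Sum>p\<in>?P. ?Bx p)) \<le> (\<Sum>a<J. \<Sum>a'<J. \<Sum>b<J. \<Sum>b'<J. ?z a a' b b' + 2 * ?X * N)"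
    proof (simp only:, intro sum_norm_le)
      fix a a' b b' assume ab: "a \<in> {..<J}" "a' \<in> {..<J}" "b \<in> {..<J}" "b' \<in> {..<J}"
      let ?q = "Q4 g (t * (int b' - int b)) (s * (int a' - int a))"
      have "norm ((\<Sum>i<M. ?q (c + (int i + (t * int b - s * int a)))) - (\<Sum>i<M. ?q (c + int i))) \<le> 2 * \<bar>real_of_int (t * int b - s * int a)\<bar> * N"
        by (rule norm_sum_shift[where F = "\<lambda>i. ?q (c + i)"]) (rule norm_Q4_le[OF b(3)])
      also have "\<dots> \<le> 2 * ?X * N" using shift ab by (intro mult_right_mono mult_left_mono) auto
      finally show "norm (\<Sum>i<M. ?q (c + (int i + (t * int b - s * int a)))) \<le> ?z a a' b b' + 2 * ?X * N"
        using norm_triangle_sub[of "\<Sum>i<M. ?q (c + (int i + (t * int b - s * int a)))" "\<Sum>i<M. ?q (c + int i)"] by linarith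
    qed
    then show ?thesis unfolding norm_of_real by (rule order_trans[OF abs_ge_self])
  qed
  let ?th = "real M * N / (128 * real K ^ 4)"
  have zle: "?z a a' b b' \<le> real M * N" for a a' b b'
    using sum_norm_le[of "{..<M}" "\<lambda>i. Q4 g (t * (int b' - int b)) (s * (int a' - int a)) (c + int i)" "\<lambda>_. N"] norm_Q4_le[OF b(3)] by simp
  define Z where "Z a a' b = {b'. b' < J \<and> b' \<noteq> b \<and> ?z a a' b b' \<ge> ?th}" for a a' b
  have finZ: "finite (Z a a' b)" for a a' b by (rule finite_subset[of _ "{..<J}"]) (auto simp: Z_def)
  \<comment> \<open>Pigeonhole for one triple (a, a', b): the difference \<open>a' - a\<close>
    becomes \<open>q\<close>, and the differences \<open>b' - b\<close> become the numbers
    \<open>k\<close>. The terms with \<open>a = a'\<close> or \<open>b = b'\<close> are estimated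
    trivially; their proportion is O(1/J), and \<open>J > 128 * K ^ 4\<close> makes it
    negligible.\<close>
  have "\<exists>a a' b. a < J \<and> a' < J \<and> b < J \<and> a \<noteq> a' \<and> real (card (Z a a' b)) * (128 * real K ^ 4) \<ge> real J"
  proof (rule ccontr)
    assume neg: "\<not> ?thesis"
    let ?k = "real J / (128 * real K ^ 4)"
    have K4: "128 * real K ^ 4 > 0" using Kr by simp
    have zb: "(\<Sum>b'<J. ?z a a' b b') \<le> (if a = a' then real J * (real M * N) else 0) + (1 + 2 * ?k) * (real M * N)" if "a < J" "a' < J" "b < J" for a a' b
    proof (cases "a = a'")
      case True
      have "(\<Sum>b'<J. ?z a a' b b') \<le> (\<Sum>b'<J. real M * N)" using zle by (rule sum_mono)
      moreover have "0 \<le> (1 + 2 * ?k) * (real M * N)" using MN0 J0 K4 by (intro mult_nonneg_nonneg add_nonneg_nonneg) auto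
      moreover have "(\<Sum>b'<J. real M * N) = real J * (real M * N)" by simp
      ultimately show ?thesis unfolding if_P[OF True] by linarith
    next
      case False
      then have "real (card (Z a a' b)) * (128 * real K ^ 4) < real J" using neg that by (meson not_le)
      then have cz: "real (card (Z a a' b)) \<le> ?k" using K4 by (simp add: field_simps)
      have "(\<Sum>b'<J. ?z a a' b b') \<le> (\<Sum>b'<J. ((if b' = b then real M * N else 0) + (if b' \<in> Z a a' b then real M * N else 0)) + ?th)"
      proof (rule sum_mono)
        fix b' assume "b' \<in> {..<J}"
        then show "?z a a' b b' \<le> ((if b' = b then real M * N else 0) + (if b' \<in> Z a a' b then real M * N else 0)) + ?th"
        proof -
          have t0: "0 \<le> ?th" using MN0 K4 by (intro divide_nonneg_pos) linarith+
          consider "b' = b" | "b' \<noteq> b" "b' \<in> Z a a' b" | "b' \<noteq> b" "b' \<notin> Z a a' b" by blast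
          then show ?thesis
          proof cases
            case 1
            have "0 \<le> (if b' \<in> Z a a' b then real M * N else 0)" using MN0 by simp
            then show ?thesis unfolding if_P[OF 1] using zle[of b' b a' a] t0 by linarith
          next
            case 2
            then show ?thesis unfolding if_not_P[OF 2(1)] if_P[OF 2(2)] using zle[of b' b a' a] t0 by linarith
          next
            case 3
            then show ?thesis using \<open>b' \<in> {..<J}\<close> by (auto simp: Z_def)
          qed
        qed
      qed
      also have "\<dots> = (real M * N + real (card (Z a a' b)) * (real M * N)) + real J * ?th"
      proof -
        have "{..<J} \<inter> Z a a' b = Z a a' b" by (auto simp: Z_def)
        then have "(\<Sum>b'<J. if b' \<in> Z a a' b then real M * N else 0) = real (card (Z a a' b)) * (real M * N)"
          by (simp add: sum.If_cases)
        then show ?thesis using that by (simp add: sum.distrib)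
      qed
      also have "\<dots> \<le> (real M * N + ?k * (real M * N)) + real J * ?th"
        using cz MN0 by (intro add_mono mult_right_mono) auto
      also have "real J * ?th = ?k * (real M * N)" by simp
      finally have "(\<Sum>b'<J. ?z a a' b b') \<le> (1 + 2 * ?k) * (real M * N)" by (simp add: algebra_simps)
      then show ?thesis unfolding if_not_P[OF False] by simp
    qed
    have "real J ^ 4 * (real M * N) / (16 * real K ^ 4) \<le> (\<Sum>a<J. \<Sum>a'<J. \<Sum>b<J. \<Sum>b'<J. ?z a a' b b' + 2 * ?X * N)"
      using sumB Bexp by linarith
    also have "\<dots> = (\<Sum>a<J. \<Sum>a'<J. \<Sum>b<J. (\<Sum>b'<J. ?z a a' b b') + real J * (2 * ?X * N))" by (simp add: sum.distrib)
    also have "\<dots> \<le> (\<Sum>a<J. \<Sum>a'<J. \<Sum>b<J. ((if a = a' then real J * (real M * N) else 0) + (1 + 2 * ?k) * (real M * N)) + real J * (2 * ?X * N))"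
      using zb by (intro sum_mono add_right_mono) auto
    also have "\<dots> = real J ^ 3 * (real M * N) + real J ^ 3 * ((1 + 2 * ?k) * (real M * N)) + real J ^ 4 * (2 * ?X * N)"
    proof -
      have "(\<Sum>a'<J. (if a = a' then real J * (real M * N) else 0)) = real J * (real M * N)" if "a < J" for a using that by simp
      then have "(\<Sum>a<J. \<Sum>a'<J. (if a = a' then real J * (real M * N) else 0)) = real J * (real J * (real M * N))" by simp
      moreover have "(\<Sum>a<J. \<Sum>a'<J. \<Sum>b<J. (y a a' + u) + v) = real J * (\<Sum>a<J. \<Sum>a'<J. y a a') + real J ^ 3 * u + real J ^ 3 * v" for y and u v :: real
        by (simp add: sum.distrib sum_distrib_left power3_eq_cube algebra_simps)
      ultimately show ?thesis by (simp only:) (simp only: power3_eq_cube power4_eq_xxxx mult.assoc)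
    qed
    finally have fin: "real J ^ 4 * (real M * N) / (16 * real K ^ 4) \<le> real J ^ 3 * (real M * N) + real J ^ 3 * ((1 + 2 * ?k) * (real M * N)) + real J ^ 4 * (2 * ?X * N)" .
    have "2 * ?X \<le> real M / (32 * real K ^ 4)" using X64 Kr by (simp add: field_simps)
    then have "2 * ?X * N \<le> real M / (32 * real K ^ 4) * N" by (intro mult_right_mono) auto
    then have "real J ^ 4 * (2 * ?X * N) \<le> real J ^ 4 * (real M * N / (32 * real K ^ 4))" by (intro mult_left_mono) auto
    then have "real J ^ 4 * (real M * N) / (16 * real K ^ 4) - real J ^ 4 * (real M * N / (32 * real K ^ 4)) \<le> real J ^ 3 * (real M * N) * (2 + 2 * ?k)"
      using fin by (simp add: algebra_simps)
    then have "real J ^ 3 * (real M * N) * (real J / (32 * real K ^ 4)) \<le> real J ^ 3 * (real M * N) * (2 + 2 * ?k)"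
      using Kr by (simp add: field_simps eval_nat_numeral)
    then have "real J / (32 * real K ^ 4) \<le> 2 + 2 * ?k" using J0 MN0 by (simp only: mult_le_cancel_left_pos mult_pos_pos zero_less_power)
    then have "real J \<le> 128 * real K ^ 4" using Kr by (simp add: field_simps)
    then show False using Jr by simp
  qed
  then obtain a a' b where ab: "a < J" "a' < J" "b < J" "a \<noteq> a'" and Zc: "real (card (Z a a' b)) * (128 * real K ^ 4) \<ge> real J" by blast
  let ?Bs = "(\<lambda>b'. int b' - int b) ` Z a a' b"
  show thesis
  proof (rule that[of "int a' - int a" ?Bs])
    show "int a' - int a \<noteq> 0" "\<bar>int a' - int a\<bar> < int J" using ab by auto
    show "finite ?Bs" using finZ by simp
    have "inj_on (\<lambda>b'. int b' - int b) (Z a a' b)" by (auto simp: inj_on_def)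
    then show "real J \<le> real (card ?Bs) * (128 * real K ^ 4)" using Zc by (simp only: card_image)
    show "k \<noteq> 0 \<and> \<bar>k\<bar> < int J \<and> norm (\<Sum>i<M. Q4 g (t * k) (s * (int a' - int a)) (c + int i)) \<ge> ?th" if "k \<in> ?Bs" for k
      using that ab by (auto simp: Z_def)
  qed
qed


text \<open>Replacing \<open>d\<close> by \<open>d + a + b + c\<close> creates a cube in
  \<open>a\<close>, \<open>b\<close>, \<open>c\<close>. Since the exponents in \<open>Q4\<close> are
  linear in \<open>d\<close>, \<open>cube_ineq\<close> removes three of the four factors, and the
  eight copies of the remaining one form a third difference whose edges are multiples of the three
  slopes.\<close>

lemma pet_cube:
  fixes g :: "'w \<Rightarrow> complex" and p q c :: int and M R :: nat and X :: real
  assumes g: "\<And>w. norm (g w) \<le> 1" and X: "X > 0" and R: "R > 0" "12 * real R * X \<le> real M"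
    and big: "norm (\<Sum>i<M. Q4 g p q (c + int i)) \<ge> real M * N / X"
  shows "fj R (\<lambda>c. fj R (\<lambda>b. fj R (\<lambda>a. KR g (2 * (p - q) * c) (2 * p * a) (2 * q * b)))) \<ge> N / (2 * X) ^ 8"
proof -
  let ?I = "{..<R} \<times> ({..<R} \<times> {..<R})"
  let ?s = "\<lambda>m. int (fst m) + int (fst (snd m)) + int (snd (snd m))"
  let ?QQ = "\<Sum>m\<in>?I. \<Sum>i<M. Q4 g p q (c + int i + ?s m)"
  let ?L = "\<Sum>i<M. Q4 g p q (c + int i)"
  have MX: "real M > 0" using R X by (smt (verit) mult_pos_pos of_nat_0_less_iff zero_less_numeral)
  have sh: "norm ((\<Sum>i<M. Q4 g p q (c + int i + ?s m)) - ?L) \<le> 6 * real R * N" if "m \<in> ?I" for m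
  proof -
    have "norm ((\<Sum>i<M. Q4 g p q (c + (int i + ?s m))) - ?L) \<le> 2 * \<bar>real_of_int (?s m)\<bar> * N"
      by (rule norm_sum_shift[where F = "\<lambda>i. Q4 g p q (c + i)"]) (rule norm_Q4_le[OF g])
    also have "\<dots> \<le> 2 * (3 * real R) * N" using that by (intro mult_right_mono mult_left_mono) auto
    finally show ?thesis by (simp add: add.assoc)
  qed
  have cI: "real (card ?I) = real R ^ 3" by (simp add: card_cartesian_product power3_eq_cube)
  have "norm (?QQ - of_nat (card ?I) * ?L) \<le> real (card ?I) * (6 * real R * N)"
  proof -
    have "?QQ - of_nat (card ?I) * ?L = (\<Sum>m\<in>?I. (\<Sum>i<M. Q4 g p q (c + int i + ?s m)) - ?L)"
      by (simp only: sum_subtractf sum_constant)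
    also have "norm \<dots> \<le> (\<Sum>m\<in>?I. 6 * real R * N)" using sh by (rule sum_norm_le)
    finally show ?thesis by (simp only: sum_constant)
  qed
  then have "real R ^ 3 * norm ?L \<le> norm ?QQ + real R ^ 3 * (6 * real R * N)"
    using norm_triangle_sub[of "of_nat (card ?I) * ?L" "?QQ"]
    unfolding norm_minus_commute[of "of_nat (card ?I) * ?L"] norm_mult[of "of_nat (card ?I)" ?L] norm_of_nat cI
    by linarith
  moreover have "real R ^ 3 * (real M * N / X) \<le> real R ^ 3 * norm ?L" using big by (intro mult_left_mono) auto
  moreover have "real R ^ 3 * (6 * real R * N) \<le> real R ^ 3 * (real M * N / (2 * X))"
  proof (rule mult_left_mono)
    have "6 * real R \<le> real M / (2 * X)" using R(2) X by (simp add: field_simps)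
    then have "6 * real R * N \<le> real M / (2 * X) * N" by (rule mult_right_mono) simp
    then show "6 * real R * N \<le> real M * N / (2 * X)" by simp
  qed simp
  moreover have "real R ^ 3 * (real M * N / X) - real R ^ 3 * (real M * N / (2 * X)) = real M * (real R ^ 3 * N / (2 * X))"
    using X by (simp add: field_simps)
  ultimately have 1: "norm ?QQ \<ge> real M * (real R ^ 3 * N / (2 * X))" by linarith
  have "norm ?QQ \<le> (\<Sum>i<M. norm (\<Sum>m\<in>?I. Q4 g p q (c + int i + ?s m)))"
    by (subst sum.swap) (rule norm_sum)
  then obtain i where i: "i < M" "norm (\<Sum>m\<in>?I. Q4 g p q (c + int i + ?s m)) \<ge> real R ^ 3 * N / (2 * X)"
  proof -
    assume a: "norm ?QQ \<le> (\<Sum>i<M. norm (\<Sum>m\<in>?I. Q4 g p q (c + int i + ?s m)))"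
    have "\<exists>i<M. norm (\<Sum>m\<in>?I. Q4 g p q (c + int i + ?s m)) \<ge> real R ^ 3 * N / (2 * X)"
    proof (rule ccontr)
      assume "\<not> ?thesis"
      then have "(\<Sum>i<M. norm (\<Sum>m\<in>?I. Q4 g p q (c + int i + ?s m))) < (\<Sum>i<M. real R ^ 3 * N / (2 * X))"
        using MX by (intro sum_strict_mono) (auto simp: lessThan_empty_iff not_le)
      then show False using a 1 by simp
    qed
    then show ?thesis using that by blast
  qed
  define d where "d = c + int i"
  \<comment> \<open>The slopes in \<open>d\<close> of the three exponents. After translation by
    \<open>- (l1 * a + l2 * b + l3 * c)\<close> the factor of slope \<open>l1\<close> does not
    depend on \<open>a\<close>, that of slope \<open>l2\<close> not on \<open>b\<close>, and that of
    slope \<open>l3\<close> not on \<open>c\<close>, while the first factor carries all three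
    variables.\<close>
  define l1 l2 l3 where "l1 = 2 * p" and "l2 = - (2 * q)" and "l3 = 2 * (p - q)"
  define G where "G w a b c = g (S (- (l1 * int a + l2 * int b + l3 * int c)) w)" for w a b c
  define H1 where "H1 w b c = cnj (g (S (p\<^sup>2 + (l1 * d + (l1 - l2) * int b + (l1 - l3) * int c)) w))" for w b c
  define H2 where "H2 w a c = cnj (g (T q (S (q\<^sup>2 + (l2 * d + (l2 - l1) * int a + (l2 - l3) * int c)) w)))" for w a c
  define H3 where "H3 w a b = g (T q (S ((p - q)\<^sup>2 + (l3 * d + (l3 - l1) * int a + (l3 - l2) * int b)) w))" for w a b
  let ?Y = "\<lambda>w. \<Sum>a<R. \<Sum>b<R. \<Sum>c<R. G w a b c * H1 w b c * H2 w a c * H3 w a b"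
  have "(\<Sum>m\<in>?I. Q4 g p q (c + int i + ?s m)) = (\<Sum>a<R. \<Sum>b<R. \<Sum>c<R. Q4 g p q (d + (int a + int b + int c)))"
    by (simp only: sum_Times fst_conv snd_conv d_def)
  also have "\<dots> = (\<Sum>a<R. \<Sum>b<R. \<Sum>c<R. \<Sum>w\<in>Om. G w a b c * H1 w b c * H2 w a c * H3 w a b)"
  proof (intro sum.cong[OF refl])
    fix a b c
    let ?n = "d + (int a + int b + int c)"
    have "Q4 g p q ?n = (\<Sum>w\<in>Om. (\<lambda>w. g w * cnj (g (S (2 * ?n * p + p\<^sup>2) w)) *
     cnj (g (T q (S (q\<^sup>2 - 2 * ?n * q) w))) * g (T q (S (2 * ?n * (p - q) + (p - q)\<^sup>2) w))) (S (- (l1 * int a + l2 * int b + l3 * int c)) w))"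
      unfolding Q4_def by (rule sum_S[symmetric])
    also have "\<dots> = (\<Sum>w\<in>Om. G w a b c * H1 w b c * H2 w a c * H3 w a b)"
    proof (rule sum.cong[OF refl])
      fix w
      have e: "2 * ?n * p + p\<^sup>2 + - (l1 * int a + l2 * int b + l3 * int c) = p\<^sup>2 + (l1 * d + (l1 - l2) * int b + (l1 - l3) * int c)"
        "q\<^sup>2 - 2 * ?n * q + - (l1 * int a + l2 * int b + l3 * int c) = q\<^sup>2 + (l2 * d + (l2 - l1) * int a + (l2 - l3) * int c)"
        "2 * ?n * (p - q) + (p - q)\<^sup>2 + - (l1 * int a + l2 * int b + l3 * int c) = (p - q)\<^sup>2 + (l3 * d + (l3 - l1) * int a + (l3 - l2) * int b)"
        unfolding l1_def l2_def l3_def by (simp_all add: algebra_simps)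
      show "(\<lambda>w. g w * cnj (g (S (2 * ?n * p + p\<^sup>2) w)) * cnj (g (T q (S (q\<^sup>2 - 2 * ?n * q) w))) *
          g (T q (S (2 * ?n * (p - q) + (p - q)\<^sup>2) w))) (S (- (l1 * int a + l2 * int b + l3 * int c)) w)
        = G w a b c * H1 w b c * H2 w a c * H3 w a b"
        unfolding G_def H1_def H2_def H3_def S_add e by (rule refl)
    qed
    finally show "Q4 g p q ?n = (\<Sum>w\<in>Om. G w a b c * H1 w b c * H2 w a c * H3 w a b)" .
  qed
  also have "\<dots> = (\<Sum>w\<in>Om. ?Y w)" by (simp only: sum.swap[of _ Om])
  finally have "(\<Sum>w\<in>Om. norm (?Y w)) \<ge> real R ^ 3 * N / (2 * X)" using i(2) norm_sum[of ?Y Om] by simp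
  then have "(real R ^ 3 * N / (2 * X)) ^ 8 \<le> (\<Sum>w\<in>Om. norm (?Y w)) ^ 8" using X by (intro power_mono) auto
  also have "\<dots> \<le> N ^ 7 * (\<Sum>w\<in>Om. norm (?Y w) ^ 8)" by (rule sum_pow8_le) simp
  also have "\<dots> \<le> N ^ 7 * (\<Sum>w\<in>Om. real R ^ 18 * (\<Sum>a<R. \<Sum>a'<R. \<Sum>b<R. \<Sum>b'<R. norm (\<Sum>c<R. (G w a b c * cnj (G w a' b c)) * cnj (G w a b' c * cnj (G w a' b' c))) ^ 2))"
    by (intro mult_left_mono sum_mono cube_ineq) (auto simp: H1_def H2_def H3_def g)
  also have "\<dots> = N ^ 7 * real R ^ 18 * (\<Sum>a<R. \<Sum>a'<R. \<Sum>b<R. \<Sum>b'<R. \<Sum>w\<in>Om. norm (\<Sum>c<R. (G w a b c * cnj (G w a' b c)) * cnj (G w a b' c * cnj (G w a' b' c))) ^ 2)"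
    by (simp only: sum_distrib_left[symmetric] sum.swap[of _ Om] mult.assoc)
  also have "(\<Sum>a<R. \<Sum>a'<R. \<Sum>b<R. \<Sum>b'<R. \<Sum>w\<in>Om. norm (\<Sum>c<R. (G w a b c * cnj (G w a' b c)) * cnj (G w a b' c * cnj (G w a' b' c))) ^ 2)
    = (\<Sum>a<R. \<Sum>a'<R. \<Sum>b<R. \<Sum>b'<R. real R ^ 2 * fj R (\<lambda>c. KR g (- l3 * c) (- l1 * (int a' - int a)) (- l2 * (int b' - int b))))"
  proof (intro sum.cong[OF refl])
    fix a a' b b'
    define P where "P = Dl (- l1 * (int a' - int a)) (Dl (- l2 * (int b' - int b)) g)"
    have "(\<Sum>w\<in>Om. norm (\<Sum>c<R. (G w a b c * cnj (G w a' b c)) * cnj (G w a b' c * cnj (G w a' b' c))) ^ 2)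
      = (\<Sum>w\<in>Om. (\<lambda>w. norm (\<Sum>c<R. P (S (- l3 * int c) w)) ^ 2) (S (- (l1 * int a + l2 * int b)) w))"
    proof (rule sum.cong[OF refl])
      fix w
      have "(G w a b c * cnj (G w a' b c)) * cnj (G w a b' c * cnj (G w a' b' c)) = P (S (- l3 * int c) (S (- (l1 * int a + l2 * int b)) w))" for c
      proof -
        have e: "- l3 * int c + - (l1 * int a + l2 * int b) = - (l1 * int a + l2 * int b + l3 * int c)"
          "- l1 * (int a' - int a) + - (l1 * int a + l2 * int b + l3 * int c) = - (l1 * int a' + l2 * int b + l3 * int c)"
          "- l2 * (int b' - int b) + - (l1 * int a + l2 * int b + l3 * int c) = - (l1 * int a + l2 * int b' + l3 * int c)"
          "- l2 * (int b' - int b) + (- l1 * (int a' - int a) + - (l1 * int a + l2 * int b + l3 * int c)) = - (l1 * int a' + l2 * int b' + l3 * int c)"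
          "- l2 * (int b' - int b) + - (l1 * int a' + l2 * int b + l3 * int c) = - (l1 * int a' + l2 * int b' + l3 * int c)"
          by (simp_all add: algebra_simps)
        show ?thesis unfolding P_def Dl_def G_def S_add e
          by (simp only: complex_cnj_mult complex_cnj_cnj mult_ac)
      qed
      then show "norm (\<Sum>c<R. (G w a b c * cnj (G w a' b c)) * cnj (G w a b' c * cnj (G w a' b' c))) ^ 2
        = (\<lambda>w. norm (\<Sum>c<R. P (S (- l3 * int c) w)) ^ 2) (S (- (l1 * int a + l2 * int b)) w)" by simp
    qed
    also have "\<dots> = (\<Sum>w\<in>Om. norm (\<Sum>c<R. P (S (- l3 * int c) w)) ^ 2)" by (rule sum_S)
    also have "\<dots> = real R ^ 2 * fj R (\<lambda>c. rr P (- l3 * c))" using R(1) unfolding fj_rr by simp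
    finally show "(\<Sum>w\<in>Om. norm (\<Sum>c<R. (G w a b c * cnj (G w a' b c)) * cnj (G w a b' c * cnj (G w a' b' c))) ^ 2)
      = real R ^ 2 * fj R (\<lambda>c. KR g (- l3 * c) (- l1 * (int a' - int a)) (- l2 * (int b' - int b)))"
      by (simp only: P_def KR_def)
  qed
  also have "\<dots> = real R ^ 2 * (real R ^ 2 * (real R ^ 2 * fj R (\<lambda>a. fj R (\<lambda>b. fj R (\<lambda>c. KR g (- l3 * c) (- l1 * a) (- l2 * b))))))"
  proof -
    have F: "(\<Sum>a<R. \<Sum>a'<R. \<Sum>b<R. \<Sum>b'<R. r * F (int a' - int a) (int b' - int b)) = r * (real R ^ 2 * (real R ^ 2 * fj R (\<lambda>a. fj R (F a))))"
      for r and F :: "int \<Rightarrow> int \<Rightarrow> real"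
    proof -
      have "(\<Sum>a<R. \<Sum>a'<R. \<Sum>b<R. \<Sum>b'<R. F (int a' - int a) (int b' - int b)) = real R ^ 2 * (real R ^ 2 * fj R (\<lambda>a. fj R (F a)))"
        unfolding fj_times[OF R(1), symmetric] sum_distrib_left[symmetric] fj_times[OF R(1), of "\<lambda>x. fj R (F x)", symmetric] by (rule refl)
      then show ?thesis by (simp only: sum_distrib_left[symmetric])
    qed
    show ?thesis by (rule F)
  qed
  finally have 2: "(real R ^ 3 * N / (2 * X)) ^ 8 \<le> N ^ 7 * real R ^ 18 * (real R ^ 2 * (real R ^ 2 * (real R ^ 2 * fj R (\<lambda>a. fj R (\<lambda>b. fj R (\<lambda>c. KR g (- l3 * c) (- l1 * a) (- l2 * b)))))))" .
  have 3: "fj R (\<lambda>a. fj R (\<lambda>b. fj R (\<lambda>c. KR g (- l3 * c) (- l1 * a) (- l2 * b)))) = fj R (\<lambda>c. fj R (\<lambda>b. fj R (\<lambda>a. KR g (2 * (p - q) * c) (2 * p * a) (2 * q * b))))"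
    (is "?A = ?B")
  proof -
    have "?A = fj R (\<lambda>a. fj R (\<lambda>b. fj R (\<lambda>c. KR g (l3 * (- c)) (l1 * (- a)) (2 * q * b))))" by (simp add: l2_def)
    also have "\<dots> = fj R (\<lambda>a. fj R (\<lambda>b. fj R (\<lambda>c. KR g (l3 * c) (l1 * (- a)) (2 * q * b))))"
      by (rule arg_cong[where f = "fj R"], rule ext, rule arg_cong[where f = "fj R"], rule ext, rule fj_uminus)
    also have "\<dots> = fj R (\<lambda>a. fj R (\<lambda>b. fj R (\<lambda>c. KR g (l3 * c) (l1 * a) (2 * q * b))))" by (rule fj_uminus)
    also have "\<dots> = fj R (\<lambda>a. fj R (\<lambda>c. fj R (\<lambda>b. KR g (l3 * c) (l1 * a) (2 * q * b))))"
      by (rule arg_cong[where f = "fj R"], rule ext, rule fj_swap)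
    also have "\<dots> = fj R (\<lambda>c. fj R (\<lambda>a. fj R (\<lambda>b. KR g (l3 * c) (l1 * a) (2 * q * b))))" by (rule fj_swap)
    also have "\<dots> = fj R (\<lambda>c. fj R (\<lambda>b. fj R (\<lambda>a. KR g (l3 * c) (l1 * a) (2 * q * b))))"
      by (rule arg_cong[where f = "fj R"], rule ext, rule fj_swap)
    finally show ?thesis by (simp add: l1_def l3_def)
  qed
  have "(real R ^ 24 * N ^ 7) * (N / (2 * X) ^ 8) \<le> (real R ^ 24 * N ^ 7) * ?B"
  proof -
    have "(x ^ 3 * n / y) ^ 8 = (x ^ 24 * n ^ 7) * (n / y ^ 8)" for x n y :: real
      by (simp add: power_divide power_mult_distrib flip: power_mult power_Suc2)
    moreover have "n ^ 7 * x ^ 18 * (x ^ 2 * (x ^ 2 * (x ^ 2 * f))) = (x ^ 24 * n ^ 7) * f" for x n f :: real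
      by (simp add: mult_ac flip: power_add)
    ultimately show ?thesis using 2 unfolding 3 by (simp only:)
  qed
  then show ?thesis using R N_pos by (simp only: mult_le_cancel_left_pos mult_pos_pos zero_less_power of_nat_0_less_iff)
qed

end

section \<open>Inverse theorem for the cube average\<close>

text \<open>Parameters of \<open>uniform_differences\<close>: the lengths there are \<open>c_V K * \<tau>\<^sup>2\<close> and \<open>c_W K * \<tau>\<^sup>2\<close>, and
  \<open>c_e K * \<tau>\<close> is the number of values of \<open>d\<close> that is needed.\<close>

definition c_K1 :: "nat \<Rightarrow> nat" where "c_K1 K = (256 * K ^ 4) ^ 8"
definition c_J :: "nat \<Rightarrow> nat" where "c_J K = 256 * K ^ 4 * c_K1 K ^ 2"
definition c_K2 :: "nat \<Rightarrow> nat" where "c_K2 K = 3072 * c_K1 K ^ 2 * c_J K ^ 3"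
definition c_Jt :: "nat \<Rightarrow> nat" where "c_Jt K = 2 * c_K2 K ^ 2"
definition c_K3 :: "nat \<Rightarrow> nat" where "c_K3 K = 96 * c_K2 K ^ 2 * c_Jt K"
definition c_Js :: "nat \<Rightarrow> nat" where "c_Js K = 2 * c_K3 K ^ 2"
definition c_B :: "nat \<Rightarrow> nat" where "c_B K = 4 * c_J K * c_Js K"
definition c_K4 :: "nat \<Rightarrow> nat" where "c_K4 K = 192 * c_K3 K ^ 2 * c_Js K"
definition c_Y :: "nat \<Rightarrow> nat" where "c_Y K = fact (2 * c_B K * c_Jt K)"
definition c_D :: "nat \<Rightarrow> nat" where "c_D K = 4 * c_J K * fact (c_J K)"
definition c_V :: "nat \<Rightarrow> nat" where "c_V K = 256 * c_J K * c_B K ^ 2 * c_Y K ^ 2 * c_D K"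
definition c_W :: "nat \<Rightarrow> nat" where "c_W K = 32 * c_B K * c_Y K ^ 2"
definition c_e :: "nat \<Rightarrow> nat" where "c_e K = 6144 * K ^ 4 * c_J K * c_B K * c_Y K * c_D K"

lemma pet_consts_pos:
  assumes "K \<ge> 1"
  shows "c_K1 K > 0" "c_J K > 0" "c_B K > 0" "c_Y K > 0" "c_D K > 0" "c_V K > 0" "c_W K > 0" "c_K4 K > 0" "c_e K > 0"
proof -
  show 1: "c_K1 K > 0" using assms by (simp add: c_K1_def)
  then show 2: "c_J K > 0" using assms by (simp add: c_J_def)
  have 3: "c_K2 K > 0" using 1 2 by (simp add: c_K2_def)
  then have 4: "c_Jt K > 0" by (simp add: c_Jt_def)
  then have 5: "c_K3 K > 0" using 3 by (simp add: c_K3_def)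
  then have 6: "c_Js K > 0" by (simp add: c_Js_def)
  then show 7: "c_B K > 0" using 2 by (simp add: c_B_def)
  show 8: "c_Y K > 0" by (simp add: c_Y_def)
  show 9: "c_D K > 0" using 2 by (simp add: c_D_def)
  show "c_V K > 0" "c_W K > 0" "c_K4 K > 0" "c_e K > 0"
    using 2 5 6 7 8 9 assms by (simp_all add: c_V_def c_W_def c_K4_def c_e_def)
qed

lemma ex_ge_average:
  fixes f :: "nat \<Rightarrow> real"
  assumes "n > 0" "(\<Sum>i<n. f i) \<ge> real n * A"
  obtains i where "i < n" "f i \<ge> A"
proof -
  have "\<exists>i<n. f i \<ge> A"
  proof (rule ccontr)
    assume "\<not> ?thesis"
    then have "(\<Sum>i<n. f i) < (\<Sum>i<n. A)" using assms(1) by (intro sum_strict_mono) (auto simp: lessThan_empty_iff not_le)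
    then show False using assms by simp
  qed
  then show ?thesis using that by blast
qed

context two_actions
begin

text \<open>\<open>t\<close> and \<open>s\<close> are free parameters of \<open>pet_box\<close>, so
  a single correlation produces large third differences for all of them in the range required by
  \<open>uniform_differences\<close>. The number \<open>q\<close> and the set of \<open>k\<close>
  may vary with (t, s).\<close>

lemma pet_uniform:
  fixes f0 f1 g :: "'w \<Rightarrow> complex" and K M \<tau> :: nat and c :: int
  assumes b: "\<And>w. norm (f0 w) \<le> 1" "\<And>w. norm (f1 w) \<le> 1" "\<And>w. norm (g w) \<le> 1"
    and K: "K \<ge> 1" and \<tau>: "\<tau> \<ge> 1" "c_e K * \<tau> \<le> M"
    and big: "norm (\<Sum>i<M. \<Sum>w\<in>Om. f0 w * f1 (T (c + int i) w) * g (S ((c + int i)\<^sup>2) w)) \<ge> real M * N / real K"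
  shows "fj (c_V K * \<tau> ^ 2) (\<lambda>v. fj (c_W K * \<tau> ^ 2) (\<lambda>a. fj (c_W K * \<tau> ^ 2) (\<lambda>b.
    KR g v (2 * int (c_D K) * a) (2 * int (c_D K) * b)))) \<ge> N / real (c_K4 K)"
proof -
  define t0 R2 R where "t0 = c_Y K * \<tau>" and "R2 = 4 * c_B K * t0" and "R = c_D K * R2"
  note pos = pet_consts_pos[OF K]
  have V: "c_V K * \<tau> ^ 2 = 4 * (16 * c_J K * c_B K * t0) * R"
    by (simp add: c_V_def R_def R2_def t0_def power2_eq_square)
  have W: "c_W K * \<tau> ^ 2 = 8 * t0 * R2" by (simp add: c_W_def R2_def t0_def power2_eq_square)
  show ?thesis unfolding V W
  proof (rule uniform_differences[OF b(3) _ _ \<tau>(1) c_K2_def c_Jt_def c_K3_def c_Js_def c_B_def c_K4_def refl _ R2_def c_D_def R_def])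
    show "c_K1 K \<ge> 1" "c_J K \<ge> 1" using pos by auto
    show "t0 = fact (2 * c_B K * c_Jt K) * \<tau>" by (simp add: t0_def c_Y_def)
    have t0p: "t0 \<ge> 1" using pos \<tau> by (simp add: t0_def)
    fix t s :: int
    assume ts: "int t0 \<le> t" "t \<le> 2 * int t0" "2 * int (c_J K) * t \<le> s" "s \<le> 4 * int (c_B K) * int t0"
    have t1: "t \<ge> 1" using ts t0p by linarith
    have "2 * 1 * 1 \<le> 2 * int (c_J K) * t" using pos t1 by (intro mult_mono) auto
    then have s1: "s \<ge> 1" using ts by linarith
    have "2 * int t0 \<le> 2 * int (c_B K) * int t0" using pos t0p by (intro mult_right_mono) auto
    then have st: "s + t \<le> 6 * int (c_B K) * int t0" using ts by linarith
    have D1: "1 \<le> c_D K" using pos by simp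
    have M1: "64 * int K ^ 4 * (int (c_J K) * (s + t)) \<le> int M"
    proof -
      have "64 * int K ^ 4 * (int (c_J K) * (s + t)) \<le> 64 * int K ^ 4 * (int (c_J K) * (6 * int (c_B K) * int t0))"
        using st by (intro mult_left_mono) auto
      also have "\<dots> = int (384 * K ^ 4 * c_J K * c_B K * t0 * 1)" by simp
      also have "\<dots> \<le> int (6144 * K ^ 4 * c_J K * c_B K * t0 * c_D K)"
        unfolding of_nat_le_iff by (intro mult_mono) (use D1 in auto)
      also have "\<dots> = int (c_e K * \<tau>)" by (simp add: c_e_def t0_def)
      finally show ?thesis using \<tau>(2) by linarith
    qed
    have M2: "12 * real R * (128 * real K ^ 4) \<le> real M"
    proof -
      have "12 * R * (128 * K ^ 4) = 6144 * K ^ 4 * 1 * c_B K * c_Y K * c_D K * \<tau>"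
        by (simp add: R_def R2_def t0_def)
      also have "\<dots> \<le> 6144 * K ^ 4 * c_J K * c_B K * c_Y K * c_D K * \<tau>"
        using pos by (intro mult_mono) auto
      also have "\<dots> \<le> M" using \<tau>(2) by (simp add: c_e_def)
      finally have "real (12 * R * (128 * K ^ 4)) \<le> real M" by (simp only: of_nat_le_iff)
      then show ?thesis by simp
    qed
    have JK: "c_J K > 128 * K ^ 4"
    proof -
      have "1 \<le> c_K1 K ^ 2" using pos by simp
      then have "256 * K ^ 4 * 1 \<le> c_J K" unfolding c_J_def by (intro mult_left_mono) auto
      moreover have "128 * K ^ 4 < 256 * K ^ 4" using K by simp
      ultimately show ?thesis by linarith
    qed
    obtain q Bs where q: "q \<noteq> 0" "\<bar>q\<bar> < int (c_J K)" "finite Bs" "real (card Bs) * (128 * real K ^ 4) \<ge> real (c_J K)"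
      and Bs: "\<And>k. k \<in> Bs \<Longrightarrow> k \<noteq> 0 \<and> \<bar>k\<bar> < int (c_J K) \<and> norm (\<Sum>i<M. Q4 g (t * k) (s * q) (c + int i)) \<ge> real M * N / (128 * real K ^ 4)"
      using pet_box[OF b K JK s1 t1 M1 big] by blast
    have K4: "128 * real K ^ 4 > 0" using K by simp
    have card: "card Bs \<ge> 2 * c_K1 K ^ 2"
    proof -
      have "real (2 * c_K1 K ^ 2) * (128 * real K ^ 4) = real (c_J K)" by (simp add: c_J_def)
      then have "real (2 * c_K1 K ^ 2) * (128 * real K ^ 4) \<le> real (card Bs) * (128 * real K ^ 4)" using q(4) by linarith
      then have "real (2 * c_K1 K ^ 2) \<le> real (card Bs)" using K4 by (rule mult_right_le_imp_le)
      then show ?thesis by (simp only: of_nat_le_iff)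
    qed
    have R0: "R > 0" using pos t0p by (simp add: R_def R2_def)
    have "k \<noteq> 0 \<and> \<bar>k\<bar> < int (c_J K) \<and>
       fj R (\<lambda>c. fj R (\<lambda>b. fj R (\<lambda>a. KR g (2 * (t * k - s * q) * c) (2 * t * k * a) (2 * s * q * b)))) \<ge> N / real (c_K1 K)" if k: "k \<in> Bs" for k
    proof -
      have "N / (2 * (128 * real K ^ 4)) ^ 8 \<le> fj R (\<lambda>c. fj R (\<lambda>b. fj R (\<lambda>a. KR g (2 * (t * k - s * q) * c) (2 * (t * k) * a) (2 * (s * q) * b))))"
        using Bs[OF k] by (intro pet_cube[OF b(3) K4 R0 M2]) auto
      moreover have "(2 * (128 * real K ^ 4)) ^ 8 = real (c_K1 K)" by (simp add: c_K1_def)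
      ultimately show ?thesis using Bs[OF k] by (simp only: mult.assoc) simp
    qed
    then show "\<exists>q Bs. q \<noteq> 0 \<and> \<bar>q\<bar> < int (c_J K) \<and> finite Bs \<and> card Bs \<ge> 2 * c_K1 K ^ 2 \<and>
      (\<forall>k\<in>Bs. k \<noteq> 0 \<and> \<bar>k\<bar> < int (c_J K) \<and>
       fj R (\<lambda>c. fj R (\<lambda>b. fj R (\<lambda>a. KR g (2 * (t * k - s * q) * c) (2 * t * k * a) (2 * s * q * b)))) \<ge> N / real (c_K1 K))"
      using q card by blast
  qed
qed

section \<open>Local Fourier coefficients along orbits of \<open>S\<close>\<close>

lemma max_phase:
  fixes a :: "'w \<Rightarrow> nat \<Rightarrow> complex"
  assumes "W > 0"
  obtains \<theta> where "\<And>w k. k < 2 * W \<Longrightarrow> norm (\<Sum>n<2 * W. a w n * ec (real k / real (2 * W) * real n)) \<le> norm (\<Sum>n<2 * W. a w n * ec (\<theta> w * real n))"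
proof -
  let ?f = "\<lambda>w k. norm (\<Sum>n<2 * W. a w n * ec (real k / real (2 * W) * real n))"
  have "\<exists>j<2 * W. \<forall>k<2 * W. ?f w k \<le> ?f w j" for w
  proof -
    have "Max (?f w ` {..<2 * W}) \<in> ?f w ` {..<2 * W}" using assms by (intro Max_in) (auto simp: lessThan_empty_iff)
    then obtain j where j: "j < 2 * W" "?f w j = Max (?f w ` {..<2 * W})" by auto
    have "?f w k \<le> ?f w j" if "k < 2 * W" for k unfolding j(2) using that by (intro Max_ge) auto
    then show ?thesis using j(1) by blast
  qed
  then have "\<forall>w. \<exists>j. \<forall>k<2 * W. ?f w k \<le> ?f w j" by blast
  then obtain j where "\<forall>w. \<forall>k<2 * W. ?f w k \<le> ?f w (j w)" using choice[of "\<lambda>w j. \<forall>k<2 * W. ?f w k \<le> ?f w j"] by blast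
  then show ?thesis using that[of "\<lambda>w. real (j w) / real (2 * W)"] by blast
qed

text \<open>For fixed \<open>j'\<close> and \<open>k'\<close> the average is a bilinear form in
  \<open>j\<close> and \<open>k\<close> whose kernel depends on \<open>j + k\<close>, so
  \<open>bilinear_fourier\<close> bounds it by a Fourier coefficient on the orbit of
  \<open>w\<close>. The frequency \<open>\<theta> w\<close> is maximal for the orbit and independent
  of \<open>j'\<close> and \<open>k'\<close>, hence one bound holds for all of them.\<close>

lemma u2_inverse:
  fixes G :: "'w \<Rightarrow> complex"
  assumes G: "\<And>w. norm (G w) \<le> 1" and W: "W > 0"
    and \<theta>: "\<And>w k. k < 2 * W \<Longrightarrow> norm (\<Sum>n<2 * W. G (S (Q * int n) w) * ec (real k / real (2 * W) * real n)) \<le> norm (\<Sum>n<2 * W. G (S (Q * int n) w) * ec (\<theta> w * real n))"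
  shows "fj W (\<lambda>a. fj W (\<lambda>b. rr (Dl (Q * a) G) (Q * b))) \<le> (\<Sum>w\<in>Om. norm (\<Sum>n<2 * W. G (S (Q * int n) w) * ec (\<theta> w * real n))) / real W"
proof -
  let ?m = "\<lambda>w. norm (\<Sum>n<2 * W. G (S (Q * int n) w) * ec (\<theta> w * real n))"
  let ?g = "\<lambda>w n. G (S (Q * int n) w)"
  let ?t = "\<lambda>w j j' k k'. ?g w (j + k) * cnj (?g w (j' + k)) * cnj (?g w (j + k') * cnj (?g w (j' + k')))"
  have rr: "rr (Dl (Q * (int j' - int j)) G) (Q * (int k' - int k)) = Re (\<Sum>w\<in>Om. ?t w j j' k k')" for j j' k k'
  proof -
    have "(\<Sum>w\<in>Om. Dl (Q * (int k' - int k)) (Dl (Q * (int j' - int j)) G) w)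
      = (\<Sum>w\<in>Om. Dl (Q * (int k' - int k)) (Dl (Q * (int j' - int j)) G) (S (Q * int (j + k)) w))" by (rule sum_S[symmetric])
    also have "\<dots> = (\<Sum>w\<in>Om. ?t w j j' k k')"
    proof (rule sum.cong[OF refl])
      fix w
      have e: "Q * (int j' - int j) + Q * int (j + k) = Q * int (j' + k)" "Q * (int k' - int k) + Q * int (j + k) = Q * int (j + k')"
        "Q * (int j' - int j) + Q * int (j + k') = Q * int (j' + k')" by (simp_all add: algebra_simps)
      show "Dl (Q * (int k' - int k)) (Dl (Q * (int j' - int j)) G) (S (Q * int (j + k)) w) = ?t w j j' k k'"
        unfolding Dl_def S_add e by (simp only: mult.assoc)
    qed
    finally show ?thesis by (simp only: rr_def)
  qed
  have inner: "norm (\<Sum>j<W. \<Sum>k<W. ?t w j j' k k') \<le> real W * ?m w" for w j' k'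
  proof -
    obtain th where th: "norm (\<Sum>k<W. \<Sum>j<W. ?g w (k + j) * cnj (?g w (j' + k)) * cnj (?g w (j + k'))) \<le> real W * norm (\<Sum>n<2 * W. ?g w n * ec (th * real n))"
      "\<exists>k<2 * W. th = real k / real (2 * W)"
      using bilinear_fourier[OF W, of "\<lambda>k. cnj (?g w (j' + k))" "\<lambda>j. cnj (?g w (j + k'))" "?g w"] G by auto
    have "(\<Sum>j<W. \<Sum>k<W. ?t w j j' k k') = (\<Sum>k<W. \<Sum>j<W. ?g w (k + j) * cnj (?g w (j' + k)) * cnj (?g w (j + k'))) * ?g w (j' + k')"
    proof -
      have "(\<Sum>j<W. \<Sum>k<W. ?t w j j' k k') = (\<Sum>k<W. \<Sum>j<W. ?t w j j' k k')" by (rule sum.swap)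
      also have "\<dots> = (\<Sum>k<W. \<Sum>j<W. (?g w (k + j) * cnj (?g w (j' + k)) * cnj (?g w (j + k'))) * ?g w (j' + k'))"
      proof (intro sum.cong[OF refl])
        fix j k show "?t w j j' k k' = (?g w (k + j) * cnj (?g w (j' + k)) * cnj (?g w (j + k'))) * ?g w (j' + k')"
          unfolding complex_cnj_mult complex_cnj_cnj add.commute[of j k] by (simp only: mult_ac)
      qed
      finally show ?thesis by (simp only: sum_distrib_right)
    qed
    then have "norm (\<Sum>j<W. \<Sum>k<W. ?t w j j' k k') = norm (\<Sum>k<W. \<Sum>j<W. ?g w (k + j) * cnj (?g w (j' + k)) * cnj (?g w (j + k'))) * norm (?g w (j' + k'))"
      by (simp only: norm_mult)
    also have "\<dots> \<le> norm (\<Sum>k<W. \<Sum>j<W. ?g w (k + j) * cnj (?g w (j' + k)) * cnj (?g w (j + k')))"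
      using G by (intro mult_right_le_one_le) auto
    also have "\<dots> \<le> real W * norm (\<Sum>n<2 * W. ?g w n * ec (th * real n))" by (rule th(1))
    also have "\<dots> \<le> real W * ?m w" using th(2) \<theta> by (intro mult_left_mono) auto
    finally show ?thesis .
  qed
  have Fd: "fj W (\<lambda>a. fj W (\<lambda>b. H a b)) = (\<Sum>j<W. \<Sum>j'<W. \<Sum>k<W. \<Sum>k'<W. H (int j' - int j) (int k' - int k)) / real W ^ 4" for H
    by (simp add: fj_def sum_divide_distrib flip: power_add)
  have "fj W (\<lambda>a. fj W (\<lambda>b. rr (Dl (Q * a) G) (Q * b))) = Re (\<Sum>j<W. \<Sum>j'<W. \<Sum>k<W. \<Sum>k'<W. \<Sum>w\<in>Om. ?t w j j' k k') / real W ^ 4"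
    unfolding Fd rr by (simp only: Re_sum)
  also have "(\<Sum>j<W. \<Sum>j'<W. \<Sum>k<W. \<Sum>k'<W. \<Sum>w\<in>Om. ?t w j j' k k') = (\<Sum>w\<in>Om. \<Sum>j<W. \<Sum>j'<W. \<Sum>k<W. \<Sum>k'<W. ?t w j j' k k')"
    by (simp only: sum.swap[of _ Om])
  also have "\<dots> = (\<Sum>w\<in>Om. \<Sum>j'<W. \<Sum>k'<W. \<Sum>j<W. \<Sum>k<W. ?t w j j' k k')"
  proof (rule sum.cong[OF refl])
    fix w
    have "(\<Sum>j<W. \<Sum>j'<W. \<Sum>k<W. \<Sum>k'<W. ?t w j j' k k') = (\<Sum>j'<W. \<Sum>j<W. \<Sum>k'<W. \<Sum>k<W. ?t w j j' k k')"
      by (rule trans[OF sum.swap]) (intro sum.cong[OF refl] sum.swap)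
    also have "\<dots> = (\<Sum>j'<W. \<Sum>k'<W. \<Sum>j<W. \<Sum>k<W. ?t w j j' k k')"
      by (intro sum.cong[OF refl] sum.swap)
    finally show "(\<Sum>j<W. \<Sum>j'<W. \<Sum>k<W. \<Sum>k'<W. ?t w j j' k k') = (\<Sum>j'<W. \<Sum>k'<W. \<Sum>j<W. \<Sum>k<W. ?t w j j' k k')" .
  qed
  also have "Re \<dots> / real W ^ 4 \<le> (\<Sum>w\<in>Om. \<Sum>j'<W. \<Sum>k'<W. real W * ?m w) / real W ^ 4"
  proof (rule divide_right_mono)
    have "Re (\<Sum>w\<in>Om. \<Sum>j'<W. \<Sum>k'<W. \<Sum>j<W. \<Sum>k<W. ?t w j j' k k') \<le> norm (\<Sum>w\<in>Om. \<Sum>j'<W. \<Sum>k'<W. \<Sum>j<W. \<Sum>k<W. ?t w j j' k k')"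
      by (rule complex_Re_le_cmod)
    also have "\<dots> \<le> (\<Sum>w\<in>Om. \<Sum>j'<W. \<Sum>k'<W. real W * ?m w)" by (intro sum_norm_le inner)
    finally show "Re (\<Sum>w\<in>Om. \<Sum>j'<W. \<Sum>k'<W. \<Sum>j<W. \<Sum>k<W. ?t w j j' k k') \<le> (\<Sum>w\<in>Om. \<Sum>j'<W. \<Sum>k'<W. real W * ?m w)" .
  qed simp
  also have "\<dots> = (real W ^ 3 * (\<Sum>w\<in>Om. ?m w)) / real W ^ 4" by (simp add: sum_distrib_left power3_eq_cube mult_ac)
  also have "\<dots> = (\<Sum>w\<in>Om. ?m w) / real W" using W by (simp add: eval_nat_numeral)
  finally show ?thesis .
qed

text \<open>\<open>u2_inverse\<close> is applied to \<open>Dl v g\<close> for each \<open>v\<close>.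
  The Fejer mean over \<open>v\<close> is a double sum over \<open>m\<close> and \<open>m0\<close>;
  fixing a good \<open>m0\<close> leaves a plain sum over an interval, which can be averaged over
  translates in \<open>lowering\<close>.\<close>

lemma u3_inverse:
  fixes g :: "'w \<Rightarrow> complex"
  assumes g: "\<And>w. norm (g w) \<le> 1" and W: "W > 0" and V: "V > 0"
    and big: "fj V (\<lambda>v. fj W (\<lambda>a. fj W (\<lambda>b. KR g v (Q * a) (Q * b)))) \<ge> N / K"
  obtains m0 \<theta> where "m0 < V"
    "(\<Sum>m<V. \<Sum>w\<in>Om. norm (\<Sum>n<2 * W. Dl (int m - int m0) g (S (Q * int n) w) * ec (\<theta> (int m - int m0) w * real n))) \<ge> real V * (real W * (N / K))"
proof -
  have ex: "\<exists>\<theta>. \<forall>w k. k < 2 * W \<longrightarrow> norm (\<Sum>n<2 * W. Dl v g (S (Q * int n) w) * ec (real k / real (2 * W) * real n)) \<le> norm (\<Sum>n<2 * W. Dl v g (S (Q * int n) w) * ec (\<theta> w * real n))" for v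
    by (rule max_phase[OF W, of "\<lambda>w n. Dl v g (S (Q * int n) w)"], rule exI, intro allI impI)
  have "\<exists>\<theta>. \<forall>v w k. k < 2 * W \<longrightarrow> norm (\<Sum>n<2 * W. Dl v g (S (Q * int n) w) * ec (real k / real (2 * W) * real n)) \<le> norm (\<Sum>n<2 * W. Dl v g (S (Q * int n) w) * ec (\<theta> v w * real n))"
    by (rule choice, rule allI, rule ex)
  then obtain \<theta> where \<theta>': "\<forall>v w k. k < 2 * W \<longrightarrow> norm (\<Sum>n<2 * W. Dl v g (S (Q * int n) w) * ec (real k / real (2 * W) * real n)) \<le> norm (\<Sum>n<2 * W. Dl v g (S (Q * int n) w) * ec (\<theta> v w * real n))" ..
  have \<theta>: "norm (\<Sum>n<2 * W. Dl v g (S (Q * int n) w) * ec (real k / real (2 * W) * real n)) \<le> norm (\<Sum>n<2 * W. Dl v g (S (Q * int n) w) * ec (\<theta> v w * real n))" if "k < 2 * W" for v w k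
    using \<theta>' that by (elim allE impE)
  let ?h = "\<lambda>v. \<Sum>w\<in>Om. norm (\<Sum>n<2 * W. Dl v g (S (Q * int n) w) * ec (\<theta> v w * real n))"
  have "fj V (\<lambda>v. fj W (\<lambda>a. fj W (\<lambda>b. KR g v (Q * a) (Q * b)))) \<le> fj V (\<lambda>v. ?h v / real W)"
  proof (rule fj_mono)
    fix v
    have "KR g v (Q * a) (Q * b) = rr (Dl (Q * a) (Dl v g)) (Q * b)" for a b
    proof -
      have "KR g v (Q * a) (Q * b) = KR g v (Q * b) (Q * a)" by (rule KR_23)
      also have "\<dots> = KR g (Q * b) v (Q * a)" by (rule KR_12)
      also have "\<dots> = KR g (Q * b) (Q * a) v" by (rule KR_23)
      finally show ?thesis by (simp only: KR_def)
    qed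
    then show "fj W (\<lambda>a. fj W (\<lambda>b. KR g v (Q * a) (Q * b))) \<le> ?h v / real W"
      using u2_inverse[OF norm_Dl_le[OF g] W \<theta>] by simp
  qed
  then have "fj V (\<lambda>v. ?h v / real W) \<ge> N / K" using big by linarith
  then have "real V ^ 2 * fj V (\<lambda>v. ?h v / real W) \<ge> real V ^ 2 * (N / K)" by (intro mult_left_mono) auto
  then have "(\<Sum>m0<V. \<Sum>m<V. ?h (int m - int m0) / real W) \<ge> real V * (real V * (N / K))"
    unfolding fj_times[OF V] by (simp add: power2_eq_square)
  then obtain m0 where m0: "m0 < V" "(\<Sum>m<V. ?h (int m - int m0) / real W) \<ge> real V * (N / K)"
    by (rule ex_ge_average[OF V])
  have "real W * (real V * (N / K)) \<le> real W * (\<Sum>m<V. ?h (int m - int m0) / real W)" using m0(2) by (intro mult_left_mono) auto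
  also have "\<dots> = (\<Sum>m<V. ?h (int m - int m0))" using W by (simp flip: sum_divide_distrib)
  finally have "real V * (real W * (N / K)) \<le> (\<Sum>m<V. ?h (int m - int m0))" by (simp only: mult.left_commute[of "real V"])
  then show ?thesis by (rule that[OF m0(1)])
qed

end

section \<open>Phase functions\<close>

lemma le_double_diff: "x = 2 * y \<Longrightarrow> e \<le> y \<Longrightarrow> y \<le> x - e" for x y e :: real
  by linarith

lemma norm_ge_of_close:
  fixes x z :: "'a::real_normed_vector"
  assumes c: "norm (x - r *\<^sub>R z) \<le> r * e" and "norm z \<ge> A" "r \<ge> 0"
  shows "norm x \<ge> r * (A - e)"
proof -
  have "r * A \<le> r * norm z" using assms by (intro mult_left_mono) auto
  moreover have "norm (r *\<^sub>R z) = r * norm z" using assms by simp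
  moreover have "r * (A - e) = r * A - r * e" by (rule right_diff_distrib)
  ultimately show ?thesis using norm_triangle_sub[of "r *\<^sub>R z" x] c
    unfolding norm_minus_commute[of "r *\<^sub>R z"] by linarith
qed

lemma norm_ec_diff_le: "norm (ec (a * real k) - ec (b * real k)) \<le> 7 * (nd (a - b) * real k)"
proof -
  let ?e = "a - b - of_int (round (a - b))"
  have "ec (a * real k) - ec (b * real k) = ec (b * real k) * (ec (?e * real k + of_int (round (a - b) * int k)) - 1)"
    by (simp add: algebra_simps flip: ec_add)
  then have "norm (ec (a * real k) - ec (b * real k)) = norm (ec (?e * real k) - 1)"
    by (simp only: norm_mult norm_ec ec_cong_int mult_1)
  also have "\<dots> \<le> 7 * \<bar>?e * real k\<bar>" by (rule norm_ec_minus_1_le)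
  finally show ?thesis by (simp add: nd_def abs_mult)
qed

text \<open>On progressions of difference \<open>q\<close> the frequency \<open>\<theta>\<close>
  acts as \<open>q * \<theta>\<close>, which is \<open>\<eta>\<close> up to \<open>\<rho>\<close>;
  over \<open>W3\<close> steps the error grows only to \<rho> W3, which is negligible. This
  exchanges an unknown frequency for a prescribed one.\<close>

lemma subprogression:
  fixes a :: "int \<Rightarrow> complex" and q K W W3 :: nat
  assumes a: "\<And>n. norm (a n) \<le> 1" and K: "K \<ge> 1"
    and q: "8 * K * q * W3 \<le> W" and \<rho>: "28 * real K * \<rho> * real W3 \<le> 1"
    and nd: "nd (real q * \<theta> - \<eta>) \<le> \<rho>"
    and big: "norm (\<Sum>n<W. a (int n) * ec (\<theta> * real n)) \<ge> real W / real K"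
  shows "(\<Sum>n<W. norm (\<Sum>k<W3. a (int n + int q * int k) * ec (\<eta> * real k))) \<ge> real W * real W3 / (2 * real K)"
proof -
  let ?F = "\<lambda>n. a n * ec (\<theta> * real_of_int n)"
  have 1: "norm ((\<Sum>n<W. \<Sum>k<W3. ?F (int n + int q * int k)) - of_nat W3 *\<^sub>R (\<Sum>n<W. ?F (int n))) \<le> 2 * real W3 * real_of_int (int q * int W3) * 1"
    by (rule norm_sum_average) (use a in \<open>auto simp: norm_mult abs_mult intro!: mult_left_mono\<close>)
  have Kr: "real K \<ge> 1" using K by simp
  have 4: "2 * real W3 * real_of_int (int q * int W3) * 1 \<le> real W3 * (real W / (4 * real K))"
  proof -
    have "real (8 * K * q * W3) \<le> real W" using q by (simp only: of_nat_le_iff)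
    then have "2 * (real q * real W3) \<le> real W / (4 * real K)" using Kr by (simp add: field_simps)
    then have "real W3 * (2 * (real q * real W3)) \<le> real W3 * (real W / (4 * real K))" by (rule mult_left_mono) simp
    then show ?thesis by (simp add: mult_ac)
  qed
  have 5: "norm (\<Sum>n<W. \<Sum>k<W3. ?F (int n + int q * int k)) \<le> (\<Sum>n<W. norm (\<Sum>k<W3. ?F (int n + int q * int k)))"
    by (rule norm_sum)
  have 6: "norm (\<Sum>k<W3. ?F (int n + int q * int k)) \<le> norm (\<Sum>k<W3. a (int n + int q * int k) * ec (\<eta> * real k)) + real W3 / (4 * real K)" for n
  proof -
    have "(\<Sum>k<W3. ?F (int n + int q * int k)) = ec (\<theta> * real n) * (\<Sum>k<W3. a (int n + int q * int k) * ec (real q * \<theta> * real k))"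
    proof -
      have "a (int n + int q * int k) * ec (\<theta> * real_of_int (int n + int q * int k)) = ec (\<theta> * real n) * (a (int n + int q * int k) * ec (real q * \<theta> * real k))" for k
      proof -
        have "\<theta> * real_of_int (int n + int q * int k) = \<theta> * real n + real q * \<theta> * real k" by (simp add: algebra_simps)
        then show ?thesis by (simp only: ec_add mult_ac)
      qed
      then show ?thesis by (simp only: sum_distrib_left)
    qed
    then have e: "norm (\<Sum>k<W3. ?F (int n + int q * int k)) = norm (\<Sum>k<W3. a (int n + int q * int k) * ec (real q * \<theta> * real k))"
      by (simp only: norm_mult norm_ec mult_1)
    have "norm ((\<Sum>k<W3. a (int n + int q * int k) * ec (real q * \<theta> * real k)) - (\<Sum>k<W3. a (int n + int q * int k) * ec (\<eta> * real k)))
      = norm (\<Sum>k<W3. a (int n + int q * int k) * (ec (real q * \<theta> * real k) - ec (\<eta> * real k)))"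
      by (simp only: right_diff_distrib sum_subtractf)
    also have "\<dots> \<le> (\<Sum>k<W3. 1 / (4 * real K))"
    proof (rule sum_norm_le)
      fix k assume k: "k \<in> {..<W3}"
      have "norm (a (int n + int q * int k) * (ec (real q * \<theta> * real k) - ec (\<eta> * real k))) \<le> norm (ec (real q * \<theta> * real k) - ec (\<eta> * real k))"
        unfolding norm_mult using a by (intro mult_left_le_one_le) auto
      also have "\<dots> \<le> 7 * (nd (real q * \<theta> - \<eta>) * real k)" by (rule norm_ec_diff_le)
      also have "\<dots> \<le> 7 * (\<rho> * real W3)" using nd k order_trans[OF nd_nonneg nd] by (intro mult_left_mono mult_mono) auto
      also have "\<dots> \<le> 1 / (4 * real K)" using \<rho> Kr by (simp add: field_simps)
      finally show "norm (a (int n + int q * int k) * (ec (real q * \<theta> * real k) - ec (\<eta> * real k))) \<le> 1 / (4 * real K)" .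
    qed
    also have "\<dots> = real W3 / (4 * real K)" by simp
    finally show ?thesis unfolding e
      using norm_triangle_sub[of "\<Sum>k<W3. a (int n + int q * int k) * ec (real q * \<theta> * real k)" "\<Sum>k<W3. a (int n + int q * int k) * ec (\<eta> * real k)"] by linarith
  qed
  have 7: "(\<Sum>n<W. norm (\<Sum>k<W3. ?F (int n + int q * int k))) \<le> (\<Sum>n<W. norm (\<Sum>k<W3. a (int n + int q * int k) * ec (\<eta> * real k))) + real W * (real W3 / (4 * real K))"
    using sum_mono[of "{..<W}", OF 6] by (simp add: sum.distrib)
  have 8: "real W3 * (real W / real K) - real W3 * (real W / (4 * real K)) - real W * (real W3 / (4 * real K)) = real W * real W3 / (2 * real K)"
    using Kr by (simp add: field_simps)
  have "norm (\<Sum>n<W. \<Sum>k<W3. ?F (int n + int q * int k)) \<ge> real W3 * (real W / real K - 2 * real_of_int (int q * int W3))"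
    by (rule norm_ge_of_close[where z = "\<Sum>n<W. ?F (int n)"]) (use 1 big in \<open>simp_all add: mult_ac\<close>)
  then show ?thesis using 4 5 7 8 by (simp only: right_diff_distrib mult_ac) 
qed

text \<open>The factorials are common multiples of all denominators that can come from
  \<open>weyl\<close> (at most \<open>(8 * K ^ 2) ^ 10\<close>) and from \<open>vinogradov\<close>
  (at most \<open>4 * (8 * K ^ 2)\<close>), so that one multiplier suits every point. The
  coefficient \<open>2 * Q ^ 2\<close> is produced by the elimination in
  \<open>phase_system\<close>.\<close>

definition ph_q :: "nat \<Rightarrow> nat \<Rightarrow> nat" where
  "ph_q Q K = 2 * Q ^ 2 * fact ((8 * K ^ 2) ^ 10) * fact (32 * K ^ 2)"

text \<open>The accumulated error: 896 = 7 * 128, with 7 from the elimination in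
  \<open>phase_system\<close> and 128 from \<open>vinogradov\<close>.\<close>

definition ph_P :: "nat \<Rightarrow> nat \<Rightarrow> nat" where
  "ph_P Q K = 896 * Q * (8 * K ^ 2) ^ 62 * fact ((8 * K ^ 2) ^ 10) * fact (32 * K ^ 2)"

lemma nd_fact_mult: assumes "1 \<le> c" "c \<le> X" shows "nd (real (fact X) * a) \<le> real (fact X) * nd (a * real c)"
proof -
  have "c dvd fact X" using assms by (simp add: dvd_fact)
  then obtain m where m: "fact X = c * m" by (rule dvdE)
  then have "m \<le> c * m" using assms by simp
  have "real (fact X) * a = of_nat m * (a * real c)" unfolding m by (simp add: mult_ac)
  then have "nd (real (fact X) * a) \<le> real m * nd (a * real c)" by (simp only: nd_mult_nat)
  also have "\<dots> \<le> real (fact X) * nd (a * real c)" unfolding m using \<open>m \<le> c * m\<close> by (intro mult_right_mono) (simp_all only: of_nat_le_iff nd_nonneg)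
  finally show ?thesis .
qed

text \<open>By \<open>weyl\<close> the coefficients of \<open>b ^ 2\<close> and of \<open>b\<close>
  are both almost rational. These are two relations between \<open>\<psi> i\<close> and
  \<open>\<psi> i'\<close>; eliminating \<open>\<psi> i'\<close> leaves
  \<open>2 * Q ^ 2 * \<psi> i * (i - i')\<close>, a linear function of \<open>i'\<close> whose slope
  involves \<open>\<psi> i\<close> alone. As \<open>i'\<close> runs through the dense set
  \<open>A\<close>, \<open>vinogradov\<close> shows that the slope is almost rational.\<close>

lemma phase_system:
  fixes \<psi> :: "nat \<Rightarrow> real" and K Q L M i :: nat and d :: int
  assumes K: "K \<ge> 1" and Q: "Q \<ge> 1" and L: "L \<ge> (8 * K ^ 2) ^ 80" "L \<le> M" "ph_P Q K * M < L ^ 2" "Q * L \<le> M"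
    and d: "\<bar>d\<bar> \<le> 2 * int M"
    and A: "A \<subseteq> {..<L}" "card A * (8 * K ^ 2) \<ge> L"
    and big: "\<And>i'. i' \<in> A \<Longrightarrow> norm (\<Sum>b<L. ec ((real Q * (\<psi> i - \<psi> i')) * real b ^ 2
      + (2 * of_int d * (\<psi> i - \<psi> i') - 2 * real Q * (\<psi> i * real i - \<psi> i' * real i')) * real b)) \<ge> real L / real (8 * K ^ 2)"
  shows "nd (real (ph_q Q K) * \<psi> i) \<le> real (ph_P Q K) * real M / real L ^ 3"
proof -
  define K8 where "K8 = 8 * K ^ 2"
  define f where "f = real (fact (K8 ^ 10))"
  have K1: "1 \<le> K ^ 2" using K by simp
  have K8: "K8 \<ge> 2" "K8 \<ge> 1" using K1 by (simp_all add: K8_def)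
  have Lp: "1 \<le> L" using L(1) K8 unfolding K8_def[symmetric] by (meson le_trans one_le_power)
  have f1: "f \<ge> 1" by (simp add: f_def)
  let ?\<rho> = "7 * real Q * f * real K8 ^ 60 * real M / real L ^ 2"
  let ?\<alpha> = "- (2 * real Q ^ 2 * f * \<psi> i)" and ?\<gamma> = "2 * real Q ^ 2 * f * \<psi> i * real i"
  have nd1: "nd (?\<alpha> * real i' + ?\<gamma>) \<le> ?\<rho>" if i': "i' \<in> A" for i'
  proof -
    define \<delta> where "\<delta> = \<psi> i - \<psi> i'"
    define lam where "lam = 2 * of_int d * \<delta> - 2 * real Q * (\<psi> i * real i - \<psi> i' * real i')"
    obtain c where c: "1 \<le> c" "c \<le> K8 ^ 10" "nd (real Q * \<delta> * real c) \<le> real K8 ^ 30 / real L ^ 2" "nd (lam * real c) \<le> real K8 ^ 60 / real L"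
      using weyl[OF K8(1), of L "real Q * \<delta>" lam] L(1) big[OF i'] unfolding K8_def \<delta>_def lam_def by blast
    have n1: "nd (f * (real Q * \<delta>)) \<le> f * (real K8 ^ 30 / real L ^ 2)"
      using nd_fact_mult[OF c(1,2), of "real Q * \<delta>"] mult_left_mono[OF c(3), of f] f1 unfolding f_def by linarith
    have n2: "nd (f * lam) \<le> f * (real K8 ^ 60 / real L)"
      using nd_fact_mult[OF c(1,2), of lam] mult_left_mono[OF c(4), of f] f1 unfolding f_def by linarith
    \<comment> \<open>The elimination: the terms with \<open>\<psi> i'\<close> cancel, and the
      integer multipliers are bounded in terms of \<open>M\<close> and \<open>Q\<close>.\<close>
    have e: "?\<alpha> * real i' + ?\<gamma> = of_int (2 * d - 2 * int Q * int i') * (f * (real Q * \<delta>)) - of_nat Q * (f * lam)"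
      unfolding lam_def \<delta>_def by (simp add: algebra_simps power2_eq_square)
    have i'L: "i' < L" using A i' by auto
    have db: "\<bar>real_of_int (2 * d - 2 * int Q * int i')\<bar> \<le> 6 * real M"
    proof -
      have "Q * i' \<le> Q * L" using i'L by (intro mult_left_mono) auto
      then have "int Q * int i' \<le> int M" using L(4) by (simp only: of_nat_mult[symmetric] of_nat_le_iff)
      then have "\<bar>2 * d - 2 * int Q * int i'\<bar> \<le> 6 * int M" using d using mult_nonneg_nonneg[of "int Q" "int i'"] unfolding mult.assoc by linarith
      then have "real_of_int \<bar>2 * d - 2 * int Q * int i'\<bar> \<le> real_of_int (6 * int M)" by (simp only: of_int_le_iff)
      then show ?thesis by simp
    qed
    have "nd (?\<alpha> * real i' + ?\<gamma>) \<le> nd (of_int (2 * d - 2 * int Q * int i') * (f * (real Q * \<delta>))) + nd (of_nat Q * (f * lam))"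
      unfolding e by (rule nd_diff)
    also have "\<dots> \<le> 6 * real M * (f * (real K8 ^ 30 / real L ^ 2)) + real Q * (f * (real K8 ^ 60 / real L))"
    proof (rule add_mono)
      have "nd (of_int (2 * d - 2 * int Q * int i') * (f * (real Q * \<delta>))) \<le> \<bar>real_of_int (2 * d - 2 * int Q * int i')\<bar> * nd (f * (real Q * \<delta>))"
        by (rule nd_mult_int)
      also have "\<dots> \<le> 6 * real M * (f * (real K8 ^ 30 / real L ^ 2))" using db n1 by (intro mult_mono) auto
      finally show "nd (of_int (2 * d - 2 * int Q * int i') * (f * (real Q * \<delta>))) \<le> 6 * real M * (f * (real K8 ^ 30 / real L ^ 2))" .
      have "nd (of_nat Q * (f * lam)) \<le> of_nat Q * nd (f * lam)" by (rule nd_mult_nat)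
      also have "\<dots> \<le> real Q * (f * (real K8 ^ 60 / real L))" using n2 by (intro mult_left_mono) auto
      finally show "nd (of_nat Q * (f * lam)) \<le> real Q * (f * (real K8 ^ 60 / real L))" .
    qed
    also have "\<dots> \<le> ?\<rho>"
    proof -
      have "real K8 ^ 30 \<le> real K8 ^ 60" using K8 by (intro power_increasing) auto
      then have "1 * real K8 ^ 30 \<le> real Q * real K8 ^ 60" using Q by (intro mult_mono) auto
      then have "6 * real M * (f * real K8 ^ 30) \<le> 6 * real M * (f * (real Q * real K8 ^ 60))" using f1 by (intro mult_left_mono) auto
      moreover have "real L * (real Q * (f * real K8 ^ 60)) \<le> real M * (real Q * (f * real K8 ^ 60))"
        using L f1 by (intro mult_right_mono) auto
      ultimately have "(6 * real M * (f * real K8 ^ 30) + real L * (real Q * (f * real K8 ^ 60))) / real L ^ 2 \<le> (7 * real Q * f * real K8 ^ 60 * real M) / real L ^ 2"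
        by (intro divide_right_mono) (auto simp: algebra_simps)
      moreover have "6 * real M * (f * (real K8 ^ 30 / real L ^ 2)) + real Q * (f * (real K8 ^ 60 / real L)) = (6 * real M * (f * real K8 ^ 30) + real L * (real Q * (f * real K8 ^ 60))) / real L ^ 2"
        using Lp by (simp add: add_divide_distrib power2_eq_square)
      ultimately show ?thesis by linarith
    qed
    finally show ?thesis .
  qed
  have L64: "L \<ge> 64 * K8 ^ 2"
  proof -
    have "2 ^ 6 * K8 ^ 2 \<le> K8 ^ 6 * K8 ^ 2" using K8 by (intro mult_right_mono power_mono) auto
    also have "\<dots> = K8 ^ 8" by (simp flip: power_add)
    also have "\<dots> \<le> K8 ^ 80" using K8 by (intro power_increasing) auto
    also have "\<dots> \<le> L" using L(1) by (simp add: K8_def)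
    finally show ?thesis by simp
  qed
  define f2 where "f2 = real (fact (4 * K8))"
  have f21: "f2 \<ge> 1" by (simp add: f2_def)
  have P: "real (ph_P Q K) = 896 * real Q * real K8 ^ 62 * f * f2"
    unfolding ph_P_def f_def f2_def K8_def by simp
  have Pb: "128 * real K8 * (7 * real Q * f * real K8 ^ 60) \<le> real (ph_P Q K)"
  proof -
    have "real K8 ^ 61 \<le> real K8 ^ 62" using K8 by (intro power_increasing) auto
    then have "896 * real Q * real K8 ^ 61 * f * 1 \<le> 896 * real Q * real K8 ^ 62 * f * f2"
      using f1 f21 by (intro mult_mono) auto
    moreover have "128 * real K8 * (7 * real Q * f * real K8 ^ 60) = 896 * real Q * real K8 ^ 61 * f * 1"
      by (simp flip: power_Suc)
    ultimately show ?thesis unfolding P by linarith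
  qed
  have \<rho>0: "?\<rho> \<ge> 0" using f1 by simp
  have \<rho>1: "128 * real K8 * ?\<rho> < 1"
  proof -
    have "128 * real K8 * (7 * real Q * f * real K8 ^ 60) * real M \<le> real (ph_P Q K) * real M" using Pb by (rule mult_right_mono) simp
    also have "\<dots> < real L ^ 2"
    proof -
      have "real (ph_P Q K * M) < real (L ^ 2)" using L(3) by (simp only: of_nat_less_iff)
      then show ?thesis by simp
    qed
    finally show ?thesis using Lp by (simp add: divide_less_eq mult_ac)
  qed
  obtain c where c: "1 \<le> c" "c \<le> 4 * K8" "nd (?\<alpha> * real c) \<le> 128 * real K8 ^ 2 * ?\<rho> / real L"
    using vinogradov[OF K8(2) A(1) _ L64 \<rho>0 \<rho>1 nd1] A(2) unfolding K8_def by blast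
  have "real (ph_q Q K) * \<psi> i = - (f2 * ?\<alpha>)" unfolding ph_q_def f_def f2_def K8_def by simp
  then have "nd (real (ph_q Q K) * \<psi> i) = nd (f2 * ?\<alpha>)" by (simp only: nd_minus)
  also have "\<dots> \<le> f2 * nd (?\<alpha> * real c)" unfolding f2_def using c(1,2) by (rule nd_fact_mult)
  also have "\<dots> \<le> f2 * (128 * real K8 ^ 2 * ?\<rho> / real L)" using c(3) f21 by (intro mult_left_mono) auto
  also have "\<dots> = real (ph_P Q K) * real M / real L ^ 3"
  proof -
    have "real K8 ^ 62 = real K8 ^ 2 * real K8 ^ 60" by (simp flip: power_add)
    then show ?thesis unfolding P using Lp by (simp add: field_simps power2_eq_square power3_eq_cube)
  qed
  finally show ?thesis .
qed

context two_actions
begin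

text \<open>The summand that appears when a dual function is expanded along an
  \<open>S\<close>-progression of difference \<open>Q\<close> and tested against the frequency
  \<open>\<psi> w\<close>. The bounded weight \<open>\<sigma>\<close> selects the points that
  count.\<close>

definition HH :: "('w \<Rightarrow> complex) \<Rightarrow> ('w \<Rightarrow> real) \<Rightarrow> ('w \<Rightarrow> complex) \<Rightarrow> ('w \<Rightarrow> complex) \<Rightarrow> int \<Rightarrow> 'w \<Rightarrow> int \<Rightarrow> int \<Rightarrow> complex" where
  "HH \<sigma> \<psi> b0 b1 Q w n d = \<sigma> w * ec (\<psi> w * of_int n) * b0 (S (Q * n - d\<^sup>2) w) * b1 (T d (S (Q * n - d\<^sup>2) w))"

text \<open>The substitution \<open>w \<mapsto> T (Q * a) w\<close>, \<open>d \<mapsto> d + Q * (b - a)\<close>,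
  \<open>n \<mapsto> n + 2 * d * (b - a) + Q * (b - a)\<^sup>2\<close> leaves \<open>Q * n - d\<^sup>2\<close> unchanged.  Then \<open>b1\<close> depends on \<open>b\<close> only,
  \<open>\<sigma>\<close> and \<open>b0\<close> on \<open>a\<close> only, and Cauchy--Schwarz over \<open>b\<close> leaves quadratic exponential sums.\<close>

lemma phase_lemma:
  fixes \<sigma> :: "'w \<Rightarrow> complex" and \<psi> :: "'w \<Rightarrow> real" and b0 b1 :: "'w \<Rightarrow> complex" and K Q L M W :: nat and c :: int
  assumes b: "\<And>w. norm (\<sigma> w) \<le> 1" "\<And>w. norm (b0 w) \<le> 1" "\<And>w. norm (b1 w) \<le> 1"
    and K: "K \<ge> 1" and Q: "Q \<ge> 1" and c: "\<bar>c\<bar> \<le> int M"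
    and L: "L \<ge> (8 * K ^ 2) ^ 80" "8 * K * Q * L \<le> M" "40 * K * M * L \<le> W" "ph_P Q K * M < L ^ 2"
    and big: "norm (\<Sum>w\<in>Om. \<Sum>n<W. \<Sum>i<M. HH \<sigma> \<psi> b0 b1 (int Q) w (int n) (c + int i)) \<ge> real W * real M * N / real K"
  obtains w where "w \<in> Om" "\<sigma> w \<noteq> 0" "nd (real (ph_q Q K) * \<psi> w) \<le> real (ph_P Q K) * real M / real L ^ 3"
proof -
  let ?H = "HH \<sigma> \<psi> b0 b1 (int Q)"
  have H1: "norm (?H w n d) \<le> 1" for w n d
    using b by (simp add: HH_def norm_mult mult_le_one)
  have Kr: "real K \<ge> 1" using K by simp
  have QL: "Q * L \<le> M"
  proof -
    have "1 * (Q * L) \<le> (8 * K) * (Q * L)" using K by (intro mult_right_mono) auto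
    moreover have "(8 * K) * (Q * L) = 8 * K * Q * L" by (simp only: mult.assoc)
    ultimately show ?thesis using L(2) by linarith
  qed
  have LM: "L \<le> M" using QL mult_right_mono[OF Q, of L] by linarith
  have Lp: "L \<ge> 1"
  proof -
    have "1 \<le> 8 * K ^ 2" using K by simp
    then have "1 \<le> (8 * K ^ 2) ^ 80" by (rule one_le_power)
    then show ?thesis using L(1) by linarith
  qed
  let ?Z = "\<Sum>w\<in>Om. \<Sum>i<M. \<Sum>n<W. ?H w (int n) (c + int i)"
  let ?d = "\<lambda>i. c + int i"
  let ?s = "\<lambda>a b i. 2 * ?d i * (int b - int a) + int Q * (int b - int a)\<^sup>2"
  let ?t = "\<lambda>a b. int Q * (int b - int a)"
  let ?P = "\<lambda>w i n a b. ?H (T (int Q * int a) w) (int n + ?s a b i) (?d i + ?t a b)"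
  let ?PP = "\<Sum>a<L. \<Sum>b<L. \<Sum>w\<in>Om. \<Sum>i<M. \<Sum>n<W. ?P w i n a b"
  have ZZ: "(\<Sum>w\<in>Om. \<Sum>n<W. \<Sum>i<M. HH \<sigma> \<psi> b0 b1 (int Q) w (int n) (c + int i)) = ?Z"
    by (intro sum.cong refl sum.swap)
  have db: "\<bar>?d i\<bar> \<le> 2 * int M" if "i < M" for i using c that by linarith
  have QLi: "int Q * int L \<le> int M" using QL by (simp only: of_nat_mult[symmetric] of_nat_le_iff)
  have ab: "\<bar>int b - int a\<bar> \<le> int L" if "a < L" "b < L" for a b using that by linarith
  have sb: "\<bar>real_of_int (?s a b i)\<bar> \<le> 5 * real M * real L" if "a < L" "b < L" "i < M" for a b i
  proof -
    have "\<bar>?s a b i\<bar> \<le> \<bar>2 * ?d i * (int b - int a)\<bar> + \<bar>int Q * (int b - int a)\<^sup>2\<bar>" by (rule abs_triangle_ineq)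
    also have "\<dots> = 2 * (\<bar>?d i\<bar> * \<bar>int b - int a\<bar>) + int Q * \<bar>int b - int a\<bar> * \<bar>int b - int a\<bar>"
      unfolding abs_mult power2_eq_square by (simp add: mult.assoc)
    also have "\<dots> \<le> 2 * (2 * int M * int L) + int Q * int L * int L"
      using db[OF that(3)] ab[OF that(1,2)] by (intro add_mono mult_mono mult_left_mono) auto
    also have "\<dots> \<le> 2 * (2 * int M * int L) + int M * int L" using QLi by (intro add_left_mono mult_right_mono) auto
    finally have "real_of_int \<bar>?s a b i\<bar> \<le> real_of_int (2 * (2 * int M * int L) + int M * int L)" by (simp only: of_int_le_iff)
    moreover have "real_of_int (2 * (2 * int M * int L) + int M * int L) = 5 * real M * real L" by simp
    ultimately show ?thesis unfolding of_int_abs by linarith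
  qed
  have tb: "\<bar>real_of_int (?t a b)\<bar> \<le> real Q * real L" if "a < L" "b < L" for a b
  proof -
    have "\<bar>?t a b\<bar> \<le> int Q * int L" using ab[OF that] by (simp add: abs_mult mult_left_mono)
    then have "real_of_int \<bar>?t a b\<bar> \<le> real_of_int (int Q * int L)" by (simp only: of_int_le_iff)
    then show ?thesis by simp
  qed
  let ?e = "N * (real M * (2 * (5 * real M * real L) * 1) + 2 * (real Q * real L) * real W)"
  have Zab: "norm ((\<Sum>w\<in>Om. \<Sum>i<M. \<Sum>n<W. ?P w i n a b) - ?Z) \<le> ?e" if abL: "a < L" "b < L" for a b
  proof -
    have "(\<Sum>w\<in>Om. \<Sum>i<M. \<Sum>n<W. ?P w i n a b) = (\<Sum>w\<in>Om. \<Sum>i<M. \<Sum>n<W. ?H w (int n + ?s a b i) (?d i + ?t a b))"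
      using sum_T[of "\<lambda>w. \<Sum>i<M. \<Sum>n<W. ?H w (int n + ?s a b i) (?d i + ?t a b)" "int Q * int a"] .
    then have "norm ((\<Sum>w\<in>Om. \<Sum>i<M. \<Sum>n<W. ?P w i n a b) - ?Z) = norm (\<Sum>w\<in>Om. (\<Sum>i<M. \<Sum>n<W. ?H w (int n + ?s a b i) (?d i + ?t a b)) - (\<Sum>i<M. \<Sum>n<W. ?H w (int n) (?d i)))"
      by (simp only: sum_subtractf)
    also have "\<dots> \<le> (\<Sum>w\<in>Om. real M * (2 * (5 * real M * real L) * 1) + 2 * (real Q * real L) * real W)"
    proof (rule sum_norm_le)
      fix w
      have 1: "norm ((\<Sum>i<M. \<Sum>n<W. ?H w (int n + ?s a b i) (?d i + ?t a b)) - (\<Sum>i<M. \<Sum>n<W. ?H w (int n) (?d i + ?t a b))) \<le> real M * (2 * (5 * real M * real L) * 1)"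
      proof -
        have "norm (\<Sum>i<M. (\<Sum>n<W. ?H w (int n + ?s a b i) (?d i + ?t a b)) - (\<Sum>n<W. ?H w (int n) (?d i + ?t a b))) \<le> (\<Sum>i<M. 2 * (5 * real M * real L) * 1)"
        proof (rule sum_norm_le)
          fix i assume i: "i \<in> {..<M}"
          have "norm ((\<Sum>n<W. ?H w (int n + ?s a b i) (?d i + ?t a b)) - (\<Sum>n<W. ?H w (int n) (?d i + ?t a b))) \<le> 2 * \<bar>real_of_int (?s a b i)\<bar> * 1"
            by (rule norm_sum_shift[where F = "\<lambda>n. ?H w n (?d i + ?t a b)"]) (rule H1)
          also have "\<dots> \<le> 2 * (5 * real M * real L) * 1" using sb[OF abL] i by (intro mult_right_mono mult_left_mono) auto
          finally show "norm ((\<Sum>n<W. ?H w (int n + ?s a b i) (?d i + ?t a b)) - (\<Sum>n<W. ?H w (int n) (?d i + ?t a b))) \<le> 2 * (5 * real M * real L) * 1" .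
        qed
        then show ?thesis by (simp add: sum_subtractf)
      qed
      have 2: "norm ((\<Sum>i<M. \<Sum>n<W. ?H w (int n) (?d i + ?t a b)) - (\<Sum>i<M. \<Sum>n<W. ?H w (int n) (?d i))) \<le> 2 * (real Q * real L) * real W"
      proof -
        have "norm ((\<Sum>i<M. \<Sum>n<W. ?H w (int n) (c + (int i + ?t a b))) - (\<Sum>i<M. \<Sum>n<W. ?H w (int n) (?d i))) \<le> 2 * \<bar>real_of_int (?t a b)\<bar> * real W"
        proof (rule norm_sum_shift[where F = "\<lambda>i. \<Sum>n<W. ?H w (int n) (c + i)"])
          show "norm (\<Sum>n<W. ?H w (int n) (c + i)) \<le> real W" for i
            using sum_norm_le[of "{..<W}" "\<lambda>n. ?H w (int n) (c + i)" "\<lambda>_. 1"] H1 by simp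
        qed
        also have "\<dots> \<le> 2 * (real Q * real L) * real W" using tb[OF abL] by (intro mult_right_mono mult_left_mono) auto
        finally show ?thesis by (simp only: add.assoc)
      qed
      show "norm ((\<Sum>i<M. \<Sum>n<W. ?H w (int n + ?s a b i) (?d i + ?t a b)) - (\<Sum>i<M. \<Sum>n<W. ?H w (int n) (?d i))) \<le> real M * (2 * (5 * real M * real L) * 1) + 2 * (real Q * real L) * real W"
        using norm_diff_triangle_le[OF 1 2] .
    qed
    also have "\<dots> = ?e" by simp
    finally show ?thesis .
  qed
  \<comment> \<open>Translating \<open>n\<close> and translating \<open>d\<close> each cost at most
    a quarter of the lower bound; the conditions \<open>40 * K * M * L \<le> W\<close> and
    \<open>8 * K * Q * L \<le> M\<close> are made for this.\<close>
  have e_le: "?e \<le> real W * real M * N / (2 * real K)"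
  proof -
    have l3: "real (40 * K * M * L) \<le> real W" "real (8 * K * Q * L) \<le> real M" using L by (simp_all only: of_nat_le_iff)
    have "2 * (5 * real M * real L) * 1 \<le> real W / (4 * real K)" using l3(1) Kr by (simp add: field_simps)
    then have 1: "real M * (2 * (5 * real M * real L) * 1) \<le> real M * (real W / (4 * real K))" by (rule mult_left_mono) simp
    have "2 * (real Q * real L) \<le> real M / (4 * real K)" using l3(2) Kr by (simp add: field_simps)
    then have 2: "2 * (real Q * real L) * real W \<le> real M / (4 * real K) * real W" by (rule mult_right_mono) simp
    have "?e \<le> N * (real M * (real W / (4 * real K)) + real M / (4 * real K) * real W)" by (rule mult_left_mono[OF add_mono[OF 1 2]]) simp
    also have "\<dots> = real W * real M * N / (2 * real K)" using Kr by (simp add: field_simps)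
    finally show ?thesis .
  qed
  have big2: "norm ?PP \<ge> real L * (real L * (real W * real M * N / (2 * real K)))"
  proof -
    have 1: "norm (?PP - of_nat L * (of_nat L * ?Z)) \<le> real L * (real L * ?e)"
      using Zab by (rule norm_double_sum_diff_le)
    have "(real L * real L) * (real W * real M * N / real K - ?e) \<le> norm ?PP"
    proof (rule norm_ge_of_close[where z = ?Z])
      have "of_nat L * (of_nat L * ?Z) = (real L * real L) *\<^sub>R ?Z" by (simp add: scaleR_conv_of_real mult.assoc)
      then show "norm (?PP - (real L * real L) *\<^sub>R ?Z) \<le> (real L * real L) * ?e"
        using 1 unfolding mult.assoc[of "real L" "real L"] by (simp only:)
      show "norm ?Z \<ge> real W * real M * N / real K" using big unfolding ZZ .
    qed simp
    moreover have "(real L * real L) * (real W * real M * N / (2 * real K)) \<le> (real L * real L) * (real W * real M * N / real K - ?e)"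
    proof (rule mult_left_mono)
      have "real W * real M * N / real K = 2 * (real W * real M * N / (2 * real K))" by simp
      then show "real W * real M * N / (2 * real K) \<le> real W * real M * N / real K - ?e" using e_le by (rule le_double_diff)
    qed simp
    ultimately show ?thesis by (simp only: mult.assoc)
  qed
  have Mp: "M > 0" using LM Lp by linarith
  have Wp: "W > 0"
  proof -
    have "0 < 40 * K * M * L" using K Mp Lp by simp
    then show ?thesis using L(3) by linarith
  qed
  have "\<exists>w i n. w \<in> Om \<and> i < M \<and> n < W \<and> norm (\<Sum>a<L. \<Sum>b<L. ?P w i n a b) \<ge> real L * (real L / (2 * real K))"
  proof (rule ccontr)
    assume neg: "\<not> ?thesis"
    have "?PP = (\<Sum>a<L. \<Sum>w\<in>Om. \<Sum>i<M. \<Sum>n<W. \<Sum>b<L. ?P w i n a b)"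
      by (simp only: sum.swap[of _ "{..<L}" Om] sum.swap[of _ "{..<L}" "{..<M}"] sum.swap[of _ "{..<L}" "{..<W}"])
    also have "\<dots> = (\<Sum>w\<in>Om. \<Sum>i<M. \<Sum>n<W. \<Sum>a<L. \<Sum>b<L. ?P w i n a b)"
      by (simp only: sum.swap[of _ "{..<L}" Om] sum.swap[of _ "{..<L}" "{..<M}"] sum.swap[of _ "{..<L}" "{..<W}"])
    finally have eq: "?PP = (\<Sum>w\<in>Om. \<Sum>i<M. \<Sum>n<W. \<Sum>a<L. \<Sum>b<L. ?P w i n a b)" .
    have "norm ?PP \<le> (\<Sum>w\<in>Om. \<Sum>i<M. \<Sum>n<W. norm (\<Sum>a<L. \<Sum>b<L. ?P w i n a b))"
      unfolding eq by (intro sum_norm_le order_trans[OF norm_sum] sum_mono order_refl)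
    also have "\<dots> < (\<Sum>w\<in>Om. \<Sum>i<M. \<Sum>n<W. real L * (real L / (2 * real K)))"
    proof -
      have ne: "{..<M} \<noteq> {}" "{..<W} \<noteq> {}" using Mp Wp by (auto simp: lessThan_empty_iff)
      have neg': "norm (\<Sum>a<L. \<Sum>b<L. ?P w i n a b) < real L * (real L / (2 * real K))"
        if "w \<in> Om" "i \<in> {..<M}" "n \<in> {..<W}" for w i n
      proof (rule ccontr)
        assume n: "\<not> ?thesis"
        have "\<exists>w i n. w \<in> Om \<and> i < M \<and> n < W \<and> norm (\<Sum>a<L. \<Sum>b<L. ?P w i n a b) \<ge> real L * (real L / (2 * real K))"
          by (rule exI[of _ w], rule exI[of _ i], rule exI[of _ n], intro conjI that(1) that(2,3)[unfolded lessThan_iff] n[unfolded not_less])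
        with neg show False by (rule notE)
      qed
      show ?thesis by (intro sum_strict_mono finite_Om Om_ne finite_lessThan ne neg')
    qed
    also have "\<dots> = real L * (real L * (real W * real M * N / (2 * real K)))" by simp
    finally show False using big2 by linarith
  qed
  then obtain w i n where win: "w \<in> Om" "i < M" "n < W" "norm (\<Sum>a<L. \<Sum>b<L. ?P w i n a b) \<ge> real L * (real L / (2 * real K))" by blast
  define d where "d = ?d i"
  define m where "m = int n"
  define w0 where "w0 = S (int Q * m - d\<^sup>2) w"
  define \<psi>a where "\<psi>a a = \<psi> (T (int Q * int a) w)" for a :: nat
  define \<sigma>a where "\<sigma>a a = \<sigma> (T (int Q * int a) w)" for a :: nat
  define \<alpha> where "\<alpha> a = \<sigma>a a * b0 (T (int Q * int a) w0)" for a :: nat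
  define \<beta> where "\<beta> b = b1 (T (d + int Q * int b) w0)" for b :: nat
  \<comment> \<open>The phase is quadratic in \<open>b\<close> with leading coefficient
    \<open>Q * \<psi>a a\<close>, so the sums over \<open>b\<close> of
    \<open>E a b * cnj (E a' b)\<close> are those of \<open>phase_system\<close>, up to a factor of
    modulus 1.\<close>
  define E where "E a b = ec (\<psi>a a * of_int (m + (2 * d * (int b - int a) + int Q * (int b - int a)\<^sup>2)))" for a b :: nat
  have P: "?P w i n a b = \<beta> b * (\<alpha> a * E a b)" for a b
  proof -
    have e: "int Q * (m + (2 * d * (int b - int a) + int Q * (int b - int a)\<^sup>2)) - (d + int Q * (int b - int a))\<^sup>2 = int Q * m - d\<^sup>2"
      by (simp add: power2_eq_square algebra_simps)
    have e2: "d + int Q * (int b - int a) + int Q * int a = d + int Q * int b" by (simp add: algebra_simps)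
    show ?thesis unfolding HH_def d_def[symmetric] m_def[symmetric] e S_T T_add e2 w0_def[symmetric]
      unfolding \<beta>_def \<alpha>_def E_def \<psi>a_def \<sigma>a_def by (simp only: mult_ac)
  qed
  have \<beta>1: "norm (\<beta> b) \<le> 1" for b by (simp add: \<beta>_def assms)
  let ?x = "\<lambda>a a'. norm (\<alpha> a) * norm (\<alpha> a') * norm (\<Sum>b<L. E a b * cnj (E a' b))"
  have sq: "(real L * (real L / (2 * real K))) ^ 2 \<le> real L * (\<Sum>a<L. \<Sum>a'<L. ?x a a')"
  proof -
    have "(\<Sum>a<L. \<Sum>b<L. ?P w i n a b) = (\<Sum>b<L. \<beta> b * (\<Sum>a<L. \<alpha> a * E a b))"
      unfolding P sum_distrib_left by (rule sum.swap)
    then have "(real L * (real L / (2 * real K))) ^ 2 \<le> norm (\<Sum>b<L. \<beta> b * (\<Sum>a<L. \<alpha> a * E a b)) ^ 2"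
      using win(4) by (intro power_mono) auto
    also have "\<dots> \<le> real (card {..<L}) * (\<Sum>b<L. norm (\<Sum>a<L. \<alpha> a * E a b) ^ 2)"
      by (rule norm_sum_mult_bounded_le) (auto simp: \<beta>1)
    also have "(\<Sum>b<L. norm (\<Sum>a<L. \<alpha> a * E a b) ^ 2) \<le> (\<Sum>a<L. \<Sum>a'<L. ?x a a')"
    proof -
      have "complex_of_real (\<Sum>b<L. norm (\<Sum>a<L. \<alpha> a * E a b) ^ 2) = (\<Sum>b<L. \<Sum>a<L. \<Sum>a'<L. (\<alpha> a * E a b) * cnj (\<alpha> a' * E a' b))"
        unfolding of_real_sum complex_norm_square by (simp only: sum_product cnj_sum)
      also have "\<dots> = (\<Sum>a<L. \<Sum>b<L. \<Sum>a'<L. (\<alpha> a * E a b) * cnj (\<alpha> a' * E a' b))" by (rule sum.swap)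
      also have "\<dots> = (\<Sum>a<L. \<Sum>a'<L. \<Sum>b<L. (\<alpha> a * E a b) * cnj (\<alpha> a' * E a' b))" by (intro sum.cong refl sum.swap)
      also have "\<dots> = (\<Sum>a<L. \<Sum>a'<L. (\<alpha> a * cnj (\<alpha> a')) * (\<Sum>b<L. E a b * cnj (E a' b)))"
        unfolding sum_distrib_left by (simp only: complex_cnj_mult mult_ac)
      finally have "norm (complex_of_real (\<Sum>b<L. norm (\<Sum>a<L. \<alpha> a * E a b) ^ 2)) = norm \<dots>" by (rule arg_cong)
      also have "\<dots> \<le> (\<Sum>a<L. \<Sum>a'<L. ?x a a')" by (intro sum_norm_le order_trans[OF norm_sum] sum_mono) (simp add: norm_mult)
      finally show ?thesis unfolding norm_of_real by (rule order_trans[OF abs_ge_self])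
    qed
    finally show ?thesis by (simp add: mult_left_mono)
  qed
  have sq2: "(\<Sum>a<L. \<Sum>a'<L. ?x a a') \<ge> real L * (real L * (real L / (4 * real K ^ 2)))"
  proof -
    have "(real L * (real L / (2 * real K))) ^ 2 = real L * (real L * (real L * (real L / (4 * real K ^ 2))))"
      by (simp add: power2_eq_square)
    then have "real L * (real L * (real L * (real L / (4 * real K ^ 2)))) \<le> real L * (\<Sum>a<L. \<Sum>a'<L. ?x a a')" using sq by linarith
    then show ?thesis using Lp by (simp only: mult_le_cancel_left_pos of_nat_0_less_iff)
  qed
  obtain a where a: "a < L" "(\<Sum>a'<L. ?x a a') \<ge> real L * (real L / (4 * real K ^ 2))"
    using ex_ge_average[OF _ sq2] Lp by auto
  have L4: "real L / (4 * real K ^ 2) > 0" using Lp Kr by simp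
  \<comment> \<open>The point found lies in the support of \<open>\<sigma>\<close>; the
    contradiction in \<open>phase_split\<close> rests on this.\<close>
  have sa: "\<sigma>a a \<noteq> 0"
  proof
    assume "\<sigma>a a = 0"
    then have "(\<Sum>a'<L. ?x a a') = 0" by (simp add: \<alpha>_def)
    moreover have "real L * (real L / (4 * real K ^ 2)) > 0" using L4 Lp by (intro mult_pos_pos) auto
    ultimately show False using a(2) by linarith
  qed
  have \<alpha>1: "norm (\<alpha> a) \<le> 1" for a using b by (simp add: \<alpha>_def \<sigma>a_def norm_mult mult_le_one)
  have xE: "?x a a' \<le> norm (\<Sum>b<L. E a b * cnj (E a' b))" for a'
    using \<alpha>1 by (intro mult_left_le_one_le mult_le_one) auto
  have EL: "norm (\<Sum>b<L. E a b * cnj (E a' b)) \<le> real L" for a'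
    using sum_norm_le[of "{..<L}" "\<lambda>b. E a b * cnj (E a' b)" "\<lambda>_. 1"] by (simp add: E_def norm_mult)
  define A where "A = {a'\<in>{..<L}. ?x a a' \<ge> real L / (4 * real K ^ 2) / 2}"
  have "real (card A) * (2 * real L) \<ge> real L / (4 * real K ^ 2) * real (card {..<L})"
    unfolding A_def by (rule many_large) (use a(2) Lp L4 order_trans[OF xE EL] in \<open>auto simp: mult.commute\<close>)
  then have "real L * (real (card A) * 2) \<ge> real L * (real L / (4 * real K ^ 2))" by (simp add: mult_ac)
  then have "real (card A) * 2 \<ge> real L / (4 * real K ^ 2)" using Lp by (simp only: mult_le_cancel_left_pos of_nat_0_less_iff)
  then have "real L \<le> real (card A) * 2 * (4 * real K ^ 2)" using Kr by (simp add: pos_divide_le_eq)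
  then have "real L \<le> real (card A * (8 * K ^ 2))" by simp
  then have cardA: "L \<le> card A * (8 * K ^ 2)" by (simp only: of_nat_le_iff)
  have "nd (real (ph_q Q K) * \<psi>a a) \<le> real (ph_P Q K) * real M / real L ^ 3"
  proof (rule phase_system[OF K Q L(1) LM L(4) QL _ _ cardA])
    show "\<bar>d\<bar> \<le> 2 * int M" using db[OF win(2)] by (simp add: d_def)
    show "A \<subseteq> {..<L}" by (auto simp: A_def)
    fix a' assume "a' \<in> A"
    then have "real L / (4 * real K ^ 2) / 2 \<le> norm (\<Sum>b<L. E a b * cnj (E a' b))"
      using xE[of a'] by (simp add: A_def)
    also have "(\<Sum>b<L. E a b * cnj (E a' b)) = (\<Sum>b<L. ec (\<psi>a a * (of_int m - 2 * of_int d * real a + real Q * real a ^ 2) - \<psi>a a' * (of_int m - 2 * of_int d * real a' + real Q * real a' ^ 2)) * ec ((real Q * (\<psi>a a - \<psi>a a')) * real b ^ 2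
      + (2 * of_int d * (\<psi>a a - \<psi>a a') - 2 * real Q * (\<psi>a a * real a - \<psi>a a' * real a')) * real b))"
      unfolding E_def cnj_ec ec_add[symmetric] by (intro sum.cong refl arg_cong[where f = ec]) (simp add: algebra_simps power2_eq_square)
    also have "norm \<dots> = norm (\<Sum>b<L. ec ((real Q * (\<psi>a a - \<psi>a a')) * real b ^ 2
      + (2 * of_int d * (\<psi>a a - \<psi>a a') - 2 * real Q * (\<psi>a a * real a - \<psi>a a' * real a')) * real b))"
      by (simp only: sum_distrib_left[symmetric] norm_mult norm_ec mult_1)
    finally show "real L / real (8 * K ^ 2) \<le> norm (\<Sum>b<L. ec ((real Q * (\<psi>a a - \<psi>a a')) * real b ^ 2
      + (2 * of_int d * (\<psi>a a - \<psi>a a') - 2 * real Q * (\<psi>a a * real a - \<psi>a a' * real a')) * real b))" by simp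
  qed
  then show thesis using that[of "T (int Q * int a) w"] sa win(1) T_in by (simp add: \<psi>a_def \<sigma>a_def)
qed

end

section \<open>The dual function\<close>

lemma cnj_sgn_mult: "cnj (sgn z) * z = of_real (norm z)" for z :: complex
proof (cases "z = 0")
  case False
  have "cnj (sgn z) * z = (z * cnj z) /\<^sub>R norm z" by (simp add: sgn_div_norm mult.commute)
  also have "\<dots> = of_real (norm z)" using False by (simp add: complex_norm_square[symmetric] power2_eq_square scaleR_conv_of_real)
  finally show ?thesis .
qed simp

lemma norm_sgn_le: "norm (sgn z) \<le> 1" for z :: complex
  by (simp add: norm_sgn)

lemma ex_average_le:
  fixes f :: "nat \<Rightarrow> real"
  assumes "n > 0"
  shows "\<exists>i<n. (\<Sum>i<n. f i) \<le> real n * f i"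
proof -
  have "(\<Sum>i<n. f i) \<ge> real n * ((\<Sum>i<n. f i) / real n)" using assms by simp
  then obtain i where "i < n" "f i \<ge> (\<Sum>i<n. f i) / real n" by (rule ex_ge_average[OF assms])
  then show ?thesis using assms by (auto simp: pos_divide_le_eq mult.commute)
qed

context two_actions
begin

text \<open>The offset \<open>c\<close> is there because the Fejer weight on differences is treated
  one translated interval at a time.\<close>

definition dual :: "('w \<Rightarrow> complex) \<Rightarrow> ('w \<Rightarrow> complex) \<Rightarrow> int \<Rightarrow> nat \<Rightarrow> 'w \<Rightarrow> complex" where
  "dual f0 f1 c M w = (\<Sum>i<M. f0 (S (- ((c + int i)\<^sup>2)) w) * f1 (T (c + int i) (S (- ((c + int i)\<^sup>2)) w))) / of_nat M"

lemma norm_dual_le: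
  assumes "\<And>w. norm (f0 w) \<le> 1" "\<And>w. norm (f1 w) \<le> 1"
  shows "norm (dual f0 f1 c M w) \<le> 1"
proof (cases "M = 0")
  case False
  have "norm (\<Sum>i<M. f0 (S (- ((c + int i)\<^sup>2)) w) * f1 (T (c + int i) (S (- ((c + int i)\<^sup>2)) w))) \<le> (\<Sum>i<M. 1)"
    using assms by (intro sum_norm_le) (simp add: norm_mult mult_le_one)
  then show ?thesis using False by (simp add: dual_def norm_divide)
qed (simp add: dual_def)

lemma dual_correlation:
  assumes "M > 0"
  shows "(\<Sum>i<M. \<Sum>w\<in>Om. f0 w * f1 (T (c + int i) w) * g (S ((c + int i)\<^sup>2) w)) = of_nat M * (\<Sum>w\<in>Om. dual f0 f1 c M w * g w)"
proof -
  have "(\<Sum>i<M. \<Sum>w\<in>Om. f0 w * f1 (T (c + int i) w) * g (S ((c + int i)\<^sup>2) w))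
    = (\<Sum>i<M. \<Sum>w\<in>Om. f0 (S (- ((c + int i)\<^sup>2)) w) * f1 (T (c + int i) (S (- ((c + int i)\<^sup>2)) w)) * g w)"
  proof (rule sum.cong[OF refl])
    fix i
    show "(\<Sum>w\<in>Om. f0 w * f1 (T (c + int i) w) * g (S ((c + int i)\<^sup>2) w)) = (\<Sum>w\<in>Om. f0 (S (- ((c + int i)\<^sup>2)) w) * f1 (T (c + int i) (S (- ((c + int i)\<^sup>2)) w)) * g w)"
      using sum_S[of "\<lambda>w. f0 w * f1 (T (c + int i) w) * g (S ((c + int i)\<^sup>2) w)" "- ((c + int i)\<^sup>2)"] by (simp only: S_add add.right_inverse S_0)
  qed
  also have "\<dots> = (\<Sum>w\<in>Om. \<Sum>i<M. f0 (S (- ((c + int i)\<^sup>2)) w) * f1 (T (c + int i) (S (- ((c + int i)\<^sup>2)) w)) * g w)"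
    by (rule sum.swap)
  also have "\<dots> = (\<Sum>w\<in>Om. of_nat M * (dual f0 f1 c M w * g w))"
    using assms by (simp add: dual_def sum_distrib_right)
  finally show ?thesis by (simp only: sum_distrib_left)
qed

text \<open>\<open>\<sigma>\<close> is split according to whether \<open>ph_q Q K * \<psi> w\<close>
  is almost integral. Where it is not, the contribution is small, since otherwise
  \<open>phase_lemma\<close> would find a point of that part with an almost integral value. The
  other part is estimated trivially by the number of its points.\<close>

lemma phase_split:
  fixes \<sigma> :: "'w \<Rightarrow> complex" and \<psi> :: "'w \<Rightarrow> real" and b0 b1 :: "'w \<Rightarrow> complex" and K Q L M W :: nat and c :: int
  assumes b: "\<And>w. norm (\<sigma> w) \<le> 1" "\<And>w. norm (b0 w) \<le> 1" "\<And>w. norm (b1 w) \<le> 1"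
    and K: "K \<ge> 1" and Q: "Q \<ge> 1" and c: "\<bar>c\<bar> \<le> int M"
    and L: "L \<ge> (8 * K ^ 2) ^ 80" "8 * K * Q * L \<le> M" "40 * K * M * L \<le> W" "ph_P Q K * M < L ^ 2"
    and \<rho>: "\<rho> = real (ph_P Q K) * real M / real L ^ 3"
  shows "norm (\<Sum>w\<in>Om. \<Sum>n<W. \<Sum>i<M. HH \<sigma> \<psi> b0 b1 (int Q) w (int n) (c + int i)) \<le> real W * real M * (N / real K)
    + real W * real M * (\<Sum>w\<in>Om. of_bool (\<sigma> w \<noteq> 0 \<and> nd (real (ph_q Q K) * \<psi> w) \<le> \<rho>))"
proof -
  let ?maj = "\<lambda>w. nd (real (ph_q Q K) * \<psi> w) \<le> \<rho>"
  define \<sigma>1 where "\<sigma>1 w = (if ?maj w then 0 else \<sigma> w)" for w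
  define \<sigma>2 where "\<sigma>2 w = (if ?maj w then \<sigma> w else 0)" for w
  let ?S = "\<lambda>\<sigma>. \<Sum>w\<in>Om. \<Sum>n<W. \<Sum>i<M. HH \<sigma> \<psi> b0 b1 (int Q) w (int n) (c + int i)"
  have s1: "norm (\<sigma>1 w) \<le> 1" for w using b(1) by (simp add: \<sigma>1_def)
  have "HH \<sigma> \<psi> b0 b1 (int Q) w n d = HH \<sigma>1 \<psi> b0 b1 (int Q) w n d + HH \<sigma>2 \<psi> b0 b1 (int Q) w n d" for w n d
    by (simp add: HH_def \<sigma>1_def \<sigma>2_def)
  then have split: "?S \<sigma> = ?S \<sigma>1 + ?S \<sigma>2" by (simp only: sum.distrib)
  have 1: "norm (?S \<sigma>1) \<le> real W * real M * N / real K"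
  proof (rule ccontr)
    assume "\<not> ?thesis"
    then have "norm (?S \<sigma>1) \<ge> real W * real M * N / real K" by linarith
    from phase_lemma[OF s1 b(2,3) K Q c L this] obtain w where "\<sigma>1 w \<noteq> 0" "nd (real (ph_q Q K) * \<psi> w) \<le> real (ph_P Q K) * real M / real L ^ 3"
      by blast
    then show False by (simp add: \<sigma>1_def \<rho>)
  qed
  have 2: "norm (?S \<sigma>2) \<le> (\<Sum>w\<in>Om. real W * (real M * of_bool (\<sigma> w \<noteq> 0 \<and> ?maj w)))"
  proof (rule sum_norm_le)
    fix w
    have "norm (\<Sum>n<W. \<Sum>i<M. HH \<sigma>2 \<psi> b0 b1 (int Q) w (int n) (c + int i)) \<le> (\<Sum>n<W. \<Sum>i<M. of_bool (\<sigma> w \<noteq> 0 \<and> ?maj w))"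
    proof (intro sum_norm_le)
      fix n i
      show "norm (HH \<sigma>2 \<psi> b0 b1 (int Q) w (int n) (c + int i)) \<le> of_bool (\<sigma> w \<noteq> 0 \<and> ?maj w)"
      proof (cases "\<sigma> w \<noteq> 0 \<and> ?maj w")
        case True
        then show ?thesis using b by (simp add: HH_def \<sigma>2_def norm_mult mult_le_one)
      next
        case False
        then have "\<sigma>2 w = 0" by (auto simp: \<sigma>2_def)
        then show ?thesis by (simp add: HH_def)
      qed
    qed
    then show "norm (\<Sum>n<W. \<Sum>i<M. HH \<sigma>2 \<psi> b0 b1 (int Q) w (int n) (c + int i)) \<le> real W * (real M * of_bool (\<sigma> w \<noteq> 0 \<and> ?maj w))" by simp
  qed
  have "norm (?S \<sigma>) \<le> norm (?S \<sigma>1) + norm (?S \<sigma>2)" unfolding split by (rule norm_triangle_ineq)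
  then show ?thesis using 1 2 by (simp only: sum_distrib_left mult.assoc times_divide_eq_right)
qed

text \<open>One of the two copies of the dual function in \<open>Dl (v m) g\<close> does not depend on \<open>m\<close>.  Cauchy--Schwarz
  removes it, and the phase lemma applies to the differences \<open>\<theta> m w - \<theta> m' w\<close>.\<close>

lemma interchange:
  fixes f0 f1 :: "'w \<Rightarrow> complex" and \<theta> :: "nat \<Rightarrow> 'w \<Rightarrow> real" and v :: "nat \<Rightarrow> int" and K Q L M W W3 V q :: nat and c :: int
  defines "g \<equiv> \<lambda>w. cnj (dual f0 f1 c M w)"
  assumes f: "\<And>w. norm (f0 w) \<le> 1" "\<And>w. norm (f1 w) \<le> 1"
    and K: "K \<ge> 1" and Q: "Q \<ge> 1" and c: "\<bar>c\<bar> \<le> int M" and V: "V > 0" and M: "M > 0" and W: "W > 0"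
    and L: "L \<ge> (8 * (8 * K ^ 2) ^ 2) ^ 80" "8 * (8 * K ^ 2) * Q * L \<le> M" "40 * (8 * K ^ 2) * M * L \<le> W" "ph_P Q (8 * K ^ 2) * M < L ^ 2"
    and \<rho>: "\<rho> = real (ph_P Q (8 * K ^ 2)) * real M / real L ^ 3" "q = ph_q Q (8 * K ^ 2)"
    and W3: "8 * (2 * K) * q * W3 \<le> W" "28 * real (2 * K) * \<rho> * real W3 \<le> 1"
    and big: "(\<Sum>m<V. \<Sum>w\<in>Om. norm (\<Sum>n<W. Dl (v m) g (S (int Q * int n) w) * ec (\<theta> m w * real n))) \<ge> real V * (real W * (N / real K))"
  obtains \<psi> where "(\<Sum>m<V. \<Sum>w\<in>Om. norm (\<Sum>k<W3. Dl (v m) g (S (int (Q * q) * int k) w) * ec (\<psi> w * real k))) \<ge> real V * (real W3 * (N / (32 * real K ^ 3)))"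
proof -
  let ?F = "dual f0 f1 c M"
  have g1: "norm (g w) \<le> 1" for w using norm_dual_le[OF f] by (simp add: g_def)
  define z where "z m w = (\<Sum>n<W. Dl (v m) g (S (int Q * int n) w) * ec (\<theta> m w * real n))" for m w
  define good where "good m w \<longleftrightarrow> norm (z m w) \<ge> real W / (2 * real K)" for m w
  define s where "s m w = (if good m w then cnj (sgn (z m w)) else 0)" for m w
  have s1: "norm (s m w) \<le> 1" for m w by (simp add: s_def norm_sgn_le)
  have sz: "norm (z m w) \<le> Re (s m w * z m w) + real W / (2 * real K)" for m w
  proof (cases "good m w")
    case True
    then have "s m w * z m w = of_real (norm (z m w))" by (simp only: s_def if_True cnj_sgn_mult)
    then show ?thesis by (simp only: Re_complex_of_real) simp
  qed (simp add: s_def good_def)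
  let ?U = "\<Sum>m<V. \<Sum>w\<in>Om. s m w * z m w"
  have U: "norm ?U \<ge> real V * (real W * (N / (2 * real K)))"
  proof -
    have "real V * (real W * (N / real K)) \<le> (\<Sum>m<V. \<Sum>w\<in>Om. norm (z m w))" using big by (simp only: z_def)
    also have "\<dots> \<le> (\<Sum>m<V. \<Sum>w\<in>Om. Re (s m w * z m w) + real W / (2 * real K))" by (intro sum_mono sz)
    also have "\<dots> = Re ?U + real V * (real W * (N / (2 * real K)))" by (simp add: sum.distrib)
    also have "real V * (real W * (N / real K)) = 2 * (real V * (real W * (N / (2 * real K))))" by simp
    finally show ?thesis using complex_Re_le_cmod[of ?U] by linarith
  qed
  let ?I = "Om \<times> ({..<W} \<times> {..<M})"
  define y where "y w n i = S (int Q * int n - (c + int i)\<^sup>2) w" for w and n i :: nat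
  define \<phi> where "\<phi> m w n i = s m w * ec (\<theta> m w * real n) * (f0 (S (v m) (y w n i)) * f1 (T (c + int i) (S (v m) (y w n i))))" for m w n i
  have MU: "of_nat M * ?U = (\<Sum>p\<in>?I. cnj (?F (S (int Q * int (fst (snd p))) (fst p))) * (\<Sum>m<V. \<phi> m (fst p) (fst (snd p)) (snd (snd p))))"
  proof -
    have 1: "of_nat M * ?F (S (v m) (S (int Q * int n) w)) = (\<Sum>i<M. f0 (S (v m) (y w n i)) * f1 (T (c + int i) (S (v m) (y w n i))))" for m n w
    proof -
      have "S (- ((c + int i)\<^sup>2)) (S (v m) (S (int Q * int n) w)) = S (v m) (y w n i)" for i
        by (simp add: y_def S_add algebra_simps)
      then show ?thesis using M by (simp add: dual_def)
    qed
    have 2: "of_nat M * (s m w * z m w) = (\<Sum>n<W. \<Sum>i<M. cnj (?F (S (int Q * int n) w)) * \<phi> m w n i)" for m w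
    proof -
      have "of_nat M * (s m w * z m w) = (\<Sum>n<W. cnj (?F (S (int Q * int n) w)) * (s m w * ec (\<theta> m w * real n)) * (of_nat M * ?F (S (v m) (S (int Q * int n) w))))"
        by (simp add: z_def Dl_def g_def sum_distrib_left mult_ac)
      also have "\<dots> = (\<Sum>n<W. \<Sum>i<M. cnj (?F (S (int Q * int n) w)) * \<phi> m w n i)"
        unfolding 1 by (simp add: sum_distrib_left \<phi>_def mult_ac)
      finally show ?thesis .
    qed
    have "of_nat M * ?U = (\<Sum>m<V. \<Sum>w\<in>Om. \<Sum>n<W. \<Sum>i<M. cnj (?F (S (int Q * int n) w)) * \<phi> m w n i)"
      by (simp only: sum_distrib_left 2)
    also have "\<dots> = (\<Sum>m<V. \<Sum>p\<in>?I. cnj (?F (S (int Q * int (fst (snd p))) (fst p))) * \<phi> m (fst p) (fst (snd p)) (snd (snd p)))"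
      by (simp only: sum_Times fst_conv snd_conv)
    also have "\<dots> = (\<Sum>p\<in>?I. \<Sum>m<V. cnj (?F (S (int Q * int (fst (snd p))) (fst p))) * \<phi> m (fst p) (fst (snd p)) (snd (snd p)))"
      by (rule sum.swap)
    finally show ?thesis by (simp only: sum_distrib_left)
  qed
  define Z where "Z m m' = (\<Sum>w\<in>Om. \<Sum>n<W. \<Sum>i<M. HH (\<lambda>w. s m w * cnj (s m' w)) (\<lambda>w. \<theta> m w - \<theta> m' w)
    (\<lambda>x. f0 (S (v m) x) * cnj (f0 (S (v m') x))) (\<lambda>x. f1 (S (v m) x) * cnj (f1 (S (v m') x))) (int Q) w (int n) (c + int i))" for m m'
  define CNT where "CNT m m' w = (of_bool (s m w * cnj (s m' w) \<noteq> 0 \<and> nd (real q * (\<theta> m w - \<theta> m' w)) \<le> \<rho>) :: real)" for m m' w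
  let ?CC = "\<Sum>m<V. \<Sum>m'<V. \<Sum>w\<in>Om. CNT m m' w"
  have Zle: "norm (Z m m') \<le> real W * real M * (N / real (8 * K ^ 2)) + real W * real M * (\<Sum>w\<in>Om. CNT m m' w)" for m m'
    unfolding Z_def CNT_def \<rho>(2)
    by (rule phase_split[OF _ _ _ _ Q c L \<rho>(1)]) (use s1 f K in \<open>auto simp: norm_mult mult_le_one\<close>)
  have cI: "real (card ?I) = real M * (real W * N)" by (simp add: card_cartesian_product)
  have quad: "norm (of_nat M * ?U) ^ 2 \<le> real M * (real W * N) * (\<Sum>m<V. \<Sum>m'<V. norm (Z m m'))"
  proof -
    have "norm (of_nat M * ?U) ^ 2 \<le> real (card ?I) * (\<Sum>p\<in>?I. norm (\<Sum>m<V. \<phi> m (fst p) (fst (snd p)) (snd (snd p))) ^ 2)"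
      unfolding MU by (rule norm_sum_mult_bounded_le) (use finite_Om norm_dual_le[OF f] in auto)
    also have "(\<Sum>p\<in>?I. norm (\<Sum>m<V. \<phi> m (fst p) (fst (snd p)) (snd (snd p))) ^ 2) \<le> (\<Sum>m<V. \<Sum>m'<V. norm (Z m m'))"
    proof -
      have "complex_of_real (\<Sum>p\<in>?I. norm (\<Sum>m<V. \<phi> m (fst p) (fst (snd p)) (snd (snd p))) ^ 2)
        = (\<Sum>p\<in>?I. \<Sum>m<V. \<Sum>m'<V. \<phi> m (fst p) (fst (snd p)) (snd (snd p)) * cnj (\<phi> m' (fst p) (fst (snd p)) (snd (snd p))))"
        unfolding of_real_sum complex_norm_square by (simp only: sum_product cnj_sum)
      also have "\<dots> = (\<Sum>m<V. \<Sum>m'<V. \<Sum>p\<in>?I. \<phi> m (fst p) (fst (snd p)) (snd (snd p)) * cnj (\<phi> m' (fst p) (fst (snd p)) (snd (snd p))))"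
        by (simp only: sum.swap[of _ ?I])
      also have "\<dots> = (\<Sum>m<V. \<Sum>m'<V. Z m m')"
      proof (intro sum.cong[OF refl])
        fix m m'
        have "\<phi> m w n i * cnj (\<phi> m' w n i) = HH (\<lambda>w. s m w * cnj (s m' w)) (\<lambda>w. \<theta> m w - \<theta> m' w)
          (\<lambda>x. f0 (S (v m) x) * cnj (f0 (S (v m') x))) (\<lambda>x. f1 (S (v m) x) * cnj (f1 (S (v m') x))) (int Q) w (int n) (c + int i)" for w n i
        proof -
          have "ec ((\<theta> m w - \<theta> m' w) * of_int (int n)) = ec (\<theta> m w * real n) * cnj (ec (\<theta> m' w * real n))"
            by (simp add: cnj_ec left_diff_distrib flip: ec_add)
          then show ?thesis unfolding \<phi>_def HH_def y_def S_T by (simp only: complex_cnj_mult mult_ac)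
        qed
        then show "(\<Sum>p\<in>?I. \<phi> m (fst p) (fst (snd p)) (snd (snd p)) * cnj (\<phi> m' (fst p) (fst (snd p)) (snd (snd p)))) = Z m m'"
          by (simp only: sum_Times fst_conv snd_conv Z_def)
      qed
      finally have "norm (complex_of_real (\<Sum>p\<in>?I. norm (\<Sum>m<V. \<phi> m (fst p) (fst (snd p)) (snd (snd p))) ^ 2)) = norm (\<Sum>m<V. \<Sum>m'<V. Z m m')"
        by (rule arg_cong)
      moreover have "norm (\<Sum>m<V. \<Sum>m'<V. Z m m') \<le> (\<Sum>m<V. \<Sum>m'<V. norm (Z m m'))"
        by (intro sum_norm_le norm_sum)
      ultimately show ?thesis unfolding norm_of_real by linarith
    qed
    finally show ?thesis unfolding cI by (simp add: mult_left_mono)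
  qed
  let ?P = "real M * (real W * N)"
  have P0: "?P > 0" using M W N_pos by simp
  have cnt: "?CC \<ge> real V * (real V * (N / (8 * real K ^ 2)))"
  proof -
    let ?X = "real V * (real V * (?P / (8 * real K ^ 2)))"
    have "(real M * (real V * (real W * (N / (2 * real K))))) ^ 2 \<le> norm (of_nat M * ?U) ^ 2"
    proof (rule power_mono)
      show "real M * (real V * (real W * (N / (2 * real K)))) \<le> norm (of_nat M * ?U)"
        using mult_left_mono[OF U, of "real M"] by (simp only: norm_mult norm_of_nat of_nat_0_le_iff)
    qed simp
    also note quad
    also have "?P * (\<Sum>m<V. \<Sum>m'<V. norm (Z m m')) \<le> ?P * (\<Sum>m<V. \<Sum>m'<V. ?P / (8 * real K ^ 2) + real W * real M * (\<Sum>w\<in>Om. CNT m m' w))"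
      using Zle by (intro mult_left_mono sum_mono) (auto simp: mult_ac)
    finally have "(real M * (real V * (real W * (N / (2 * real K))))) ^ 2 \<le> ?P * (\<Sum>m<V. \<Sum>m'<V. ?P / (8 * real K ^ 2) + real W * real M * (\<Sum>w\<in>Om. CNT m m' w))" .
    moreover have "(real M * (real V * (real W * (N / (2 * real K))))) ^ 2 = ?P * (?X + ?X)"
      by (simp add: power2_eq_square)
    ultimately have "?X + ?X \<le> (\<Sum>m<V. \<Sum>m'<V. ?P / (8 * real K ^ 2) + real W * real M * (\<Sum>w\<in>Om. CNT m m' w))"
      using P0 by (simp only: mult_le_cancel_left_pos)
    also have "\<dots> = ?X + real W * real M * ?CC"
      by (simp add: sum.distrib sum_distrib_left)
    finally have "?X \<le> real W * real M * ?CC" by linarith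
    moreover have "?X = real W * real M * (real V * (real V * (N / (8 * real K ^ 2))))" by simp
    ultimately show ?thesis using M W by (simp only: mult_le_cancel_left_pos mult_pos_pos of_nat_0_less_iff)
  qed
  \<comment> \<open>For each \<open>w\<close> separately there is a reference index
    \<open>mm w\<close> such that \<open>q * (\<theta> m w - \<theta> (mm w) w)\<close> is almost
    integral for an average share of the \<open>m\<close>. The frequency independent of
    \<open>m\<close> is then \<open>q\<close> times the one at the reference index.\<close>
  have "\<forall>w. \<exists>m'. m' < V \<and> (\<Sum>m'<V. \<Sum>m<V. CNT m m' w) \<le> real V * (\<Sum>m<V. CNT m m' w)"
    using ex_average_le[OF V] by blast
  then obtain mm where mm: "\<And>w. (\<Sum>m'<V. \<Sum>m<V. CNT m m' w) \<le> real V * (\<Sum>m<V. CNT m (mm w) w)"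
    using choice[of "\<lambda>w m'. m' < V \<and> (\<Sum>m'<V. \<Sum>m<V. CNT m m' w) \<le> real V * (\<Sum>m<V. CNT m m' w)"] by blast
  have cnt2: "(\<Sum>m<V. \<Sum>w\<in>Om. CNT m (mm w) w) \<ge> real V * (N / (8 * real K ^ 2))"
  proof -
    have "?CC = (\<Sum>w\<in>Om. \<Sum>m<V. \<Sum>m'<V. CNT m m' w)" by (simp only: sum.swap[of _ Om])
    also have "\<dots> = (\<Sum>w\<in>Om. \<Sum>m'<V. \<Sum>m<V. CNT m m' w)" by (intro sum.cong refl sum.swap)
    also have "\<dots> \<le> (\<Sum>w\<in>Om. real V * (\<Sum>m<V. CNT m (mm w) w))" by (intro sum_mono mm)
    also have "\<dots> = real V * (\<Sum>m<V. \<Sum>w\<in>Om. CNT m (mm w) w)" unfolding sum_distrib_left[symmetric] by (simp only: sum.swap[of _ Om])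
    finally have "real V * (real V * (N / (8 * real K ^ 2))) \<le> real V * (\<Sum>m<V. \<Sum>w\<in>Om. CNT m (mm w) w)" using cnt by linarith
    then show ?thesis using V by (simp only: mult_le_cancel_left_pos of_nat_0_less_iff)
  qed
  define \<eta> where "\<eta> w = real q * \<theta> (mm w) w" for w
  have sub: "CNT m (mm w) w * (real W * real W3 / (4 * real K)) \<le> (\<Sum>n<W. norm (\<Sum>k<W3. Dl (v m) g (S (int Q * (int n + int q * int k)) w) * ec (\<eta> w * real k)))" for m w
  proof (cases "CNT m (mm w) w = 0")
    case True
    then show ?thesis by (auto intro: sum_nonneg)
  next
    case False
    then have "s m w \<noteq> 0" and nd: "nd (real q * (\<theta> m w - \<theta> (mm w) w)) \<le> \<rho>" by (auto simp: CNT_def)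
    then have gd: "good m w" by (auto simp: s_def split: if_splits)
    have "real W * real W3 / (2 * real (2 * K)) \<le> (\<Sum>n<W. norm (\<Sum>k<W3. Dl (v m) g (S (int Q * (int n + int q * int k)) w) * ec (\<eta> w * real k)))"
    proof (rule subprogression[where a = "\<lambda>n. Dl (v m) g (S (int Q * n) w)" and \<theta> = "\<theta> m w", OF norm_Dl_le[OF g1] _ W3])
      show "nd (real q * \<theta> m w - \<eta> w) \<le> \<rho>" using nd by (simp only: \<eta>_def right_diff_distrib)
      show "real W / real (2 * K) \<le> norm (\<Sum>n<W. Dl (v m) g (S (int Q * int n) w) * ec (\<theta> m w * real n))"
        using gd by (simp add: good_def z_def)
    qed (use K in simp)
    moreover have "CNT m (mm w) w = 1" using False by (auto simp: CNT_def)
    ultimately show ?thesis by simp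
  qed
  let ?Y = "\<lambda>n m w. norm (\<Sum>k<W3. Dl (v m) g (S (int Q * (int n + int q * int k)) w) * ec (\<eta> w * real k))"
  have "real W * (real V * (real W3 * (N / (32 * real K ^ 3)))) = real V * (N / (8 * real K ^ 2)) * (real W * real W3 / (4 * real K))"
    by (simp add: power2_eq_square power3_eq_cube mult_ac)
  also have "\<dots> \<le> (\<Sum>m<V. \<Sum>w\<in>Om. CNT m (mm w) w) * (real W * real W3 / (4 * real K))"
    by (rule mult_right_mono[OF cnt2]) simp
  also have "\<dots> = (\<Sum>m<V. \<Sum>w\<in>Om. CNT m (mm w) w * (real W * real W3 / (4 * real K)))" by (simp only: sum_distrib_right)
  also have "\<dots> \<le> (\<Sum>m<V. \<Sum>w\<in>Om. \<Sum>n<W. ?Y n m w)" by (intro sum_mono sub)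
  also have "\<dots> = (\<Sum>m<V. \<Sum>n<W. \<Sum>w\<in>Om. ?Y n m w)" by (intro sum.cong refl sum.swap)
  also have "\<dots> = (\<Sum>n<W. \<Sum>m<V. \<Sum>w\<in>Om. ?Y n m w)" by (rule sum.swap)
  finally obtain n where n: "n < W" "(\<Sum>m<V. \<Sum>w\<in>Om. ?Y n m w) \<ge> real V * (real W3 * (N / (32 * real K ^ 3)))"
    by (rule ex_ge_average[OF W])
  have "(\<Sum>w\<in>Om. ?Y n m w) = (\<Sum>w\<in>Om. norm (\<Sum>k<W3. Dl (v m) g (S (int (Q * q) * int k) w) * ec (\<eta> (S (- (int Q * int n)) w) * real k)))" for m
  proof -
    have "(\<Sum>w\<in>Om. ?Y n m w) = (\<Sum>w\<in>Om. ?Y n m (S (- (int Q * int n)) w))" by (rule sum_S[symmetric])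
    moreover have "int Q * (int n + int q * int k) + - (int Q * int n) = int (Q * q) * int k" for k by (simp add: algebra_simps)
    ultimately show ?thesis by (simp only: S_add)
  qed
  then show thesis using n(2) by (intro that[of "\<lambda>w. \<eta> (S (- (int Q * int n)) w)"]) (simp only:)
qed

text \<open>Since the phase \<open>\<psi>\<close> does not depend on \<open>m\<close>, averaging over translates \<open>m + Q * l\<close> gives a bilinear form
  in \<open>k\<close> and \<open>l\<close> with kernel a function of \<open>k + l\<close>.\<close>

lemma lowering:
  fixes F :: "'w \<Rightarrow> complex" and K Q W V :: nat and m0 :: nat
  defines "g \<equiv> \<lambda>w. cnj (F w)"
  assumes F: "\<And>w. norm (F w) \<le> 1" and K: "K \<ge> 1" and V: "V > 0" "4 * K * Q * W \<le> V" and W: "W > 0"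
    and big: "(\<Sum>m<V. \<Sum>w\<in>Om. norm (\<Sum>k<W. Dl (int m - int m0) g (S (int Q * int k) w) * ec (\<psi> w * real k))) \<ge> real V * (real W * (N / real K))"
  obtains \<theta> where "(\<Sum>w\<in>Om. norm (\<Sum>n<2 * W. F (S (int Q * int n) w) * ec (\<theta> w * real n))) \<ge> real W * (N / (2 * real K))"
proof -
  have Kr: "real K \<ge> 1" using K by simp
  have g1: "norm (g w) \<le> 1" for w using F by (simp add: g_def)
  define z where "z u w = (\<Sum>k<W. Dl u g (S (int Q * int k) w) * ec (\<psi> w * real k))" for u w
  define s where "s u w = cnj (sgn (z u w))" for u w
  define A where "A u = (\<Sum>w\<in>Om. s u w * z u w)" for u
  have zW: "norm (z u w) \<le> real W" for u w
    using sum_norm_le[of "{..<W}" "\<lambda>k. Dl u g (S (int Q * int k) w) * ec (\<psi> w * real k)" "\<lambda>_. 1"] norm_Dl_le[OF g1]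
    by (simp add: z_def norm_mult)
  have AR: "A u = of_real (\<Sum>w\<in>Om. norm (z u w))" for u
    unfolding A_def s_def cnj_sgn_mult by simp
  have AW: "norm (A u) \<le> N * real W" for u
  proof -
    have "(\<Sum>w\<in>Om. norm (z u w)) \<le> (\<Sum>w\<in>Om. real W)" by (intro sum_mono zW)
    then show ?thesis unfolding AR norm_of_real by (simp add: sum_nonneg)
  qed
  have 1: "norm ((\<Sum>m<V. \<Sum>l<W. A (int m + int Q * int l - int m0)) - of_nat W *\<^sub>R (\<Sum>m<V. A (int m - int m0))) \<le> 2 * real W * real_of_int (int Q * int W) * (N * real W)"
    by (rule norm_sum_average[where F = "\<lambda>i. A (i - int m0)"]) (auto simp: AW abs_mult intro!: mult_left_mono)
  have 2: "norm (\<Sum>m<V. A (int m - int m0)) \<ge> real V * (real W * (N / real K))"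
  proof -
    have "(\<Sum>m<V. A (int m - int m0)) = of_real (\<Sum>m<V. \<Sum>w\<in>Om. norm (z (int m - int m0) w))" by (simp add: AR)
    then have "norm (\<Sum>m<V. A (int m - int m0)) = \<bar>\<Sum>m<V. \<Sum>w\<in>Om. norm (z (int m - int m0) w)\<bar>" by (simp only: norm_of_real)
    then show ?thesis using big unfolding z_def by linarith
  qed
  have 3: "norm (\<Sum>m<V. \<Sum>l<W. A (int m + int Q * int l - int m0)) \<ge> real W * (real V * (real W * (N / real K)) - 2 * real_of_int (int Q * int W) * (N * real W))"
    by (rule norm_ge_of_close[OF _ 2]) (use 1 in \<open>simp_all add: mult_ac\<close>)
  have 4: "2 * real_of_int (int Q * int W) * (N * real W) \<le> real V * (real W * (N / (2 * real K)))"
  proof -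
    have "real (4 * K * Q * W) \<le> real V" using V(2) by (simp only: of_nat_le_iff)
    then have "2 * (real Q * real W) \<le> real V / (2 * real K)" using Kr by (simp add: field_simps)
    then have "2 * (real Q * real W) * (N * real W) \<le> real V / (2 * real K) * (N * real W)" by (rule mult_right_mono) simp
    then show ?thesis by (simp add: mult_ac)
  qed
  have 5: "real V * (real W * (N / real K)) = 2 * (real V * (real W * (N / (2 * real K))))" by simp
  have "real V * (real W * (real W * (N / (2 * real K)))) = real W * (real V * (real W * (N / (2 * real K))))" by simp
  also have "\<dots> \<le> real W * (real V * (real W * (N / real K)) - 2 * real_of_int (int Q * int W) * (N * real W))"
    using le_double_diff[OF 5 4] by (rule mult_left_mono) simp
  also note 3
  also have "norm (\<Sum>m<V. \<Sum>l<W. A (int m + int Q * int l - int m0)) \<le> (\<Sum>m<V. norm (\<Sum>l<W. A (int m + int Q * int l - int m0)))"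
    by (rule norm_sum)
  finally obtain m where m: "m < V" "norm (\<Sum>l<W. A (int m + int Q * int l - int m0)) \<ge> real W * (real W * (N / (2 * real K)))"
    by (rule ex_ge_average[OF V(1)])
  define u0 where "u0 = int m - int m0"
  obtain \<theta> where \<theta>: "\<And>w k. k < 2 * W \<Longrightarrow> norm (\<Sum>n<2 * W. F (S (int Q * int n) w) * ec (real k / real (2 * W) * real n)) \<le> norm (\<Sum>n<2 * W. F (S (int Q * int n) w) * ec (\<theta> w * real n))"
    by (rule max_phase[OF W, of "\<lambda>w n. F (S (int Q * int n) w)"], rule that, assumption)
  let ?mx = "\<lambda>w. norm (\<Sum>n<2 * W. F (S (int Q * int n) w) * ec (\<theta> w * real n))"
  have "norm (\<Sum>l<W. A (int m + int Q * int l - int m0)) \<le> (\<Sum>w\<in>Om. real W * ?mx (S u0 w))"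
  proof -
    have "(\<Sum>l<W. A (int m + int Q * int l - int m0)) = (\<Sum>l<W. \<Sum>w\<in>Om. s (u0 + int Q * int l) w * z (u0 + int Q * int l) w)"
      unfolding A_def by (intro sum.cong refl) (simp add: u0_def algebra_simps)
    also have "\<dots> = (\<Sum>w\<in>Om. \<Sum>l<W. s (u0 + int Q * int l) w * z (u0 + int Q * int l) w)" by (rule sum.swap)
    finally have e: "(\<Sum>l<W. A (int m + int Q * int l - int m0)) = (\<Sum>w\<in>Om. \<Sum>l<W. s (u0 + int Q * int l) w * z (u0 + int Q * int l) w)" .
    show ?thesis unfolding e
    proof (rule sum_norm_le)
      fix w
      obtain th where th: "norm (\<Sum>l<W. \<Sum>k<W. F (S (int Q * int (l + k)) (S u0 w)) * s (u0 + int Q * int l) w * (g (S (int Q * int k) w) * ec (\<psi> w * real k))) \<le> real W * norm (\<Sum>n<2 * W. F (S (int Q * int n) (S u0 w)) * ec (th * real n))"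
        "\<exists>k<2 * W. th = real k / real (2 * W)"
      proof (rule bilinear_fourier[OF W, of "\<lambda>l. s (u0 + int Q * int l) w" "\<lambda>k. g (S (int Q * int k) w) * ec (\<psi> w * real k)" "\<lambda>n. F (S (int Q * int n) (S u0 w))"])
        show "norm (s (u0 + int Q * int j) w) \<le> 1" for j by (simp add: s_def norm_sgn_le)
        show "norm (g (S (int Q * int j) w) * ec (\<psi> w * real j)) \<le> 1" for j using g1 by (simp add: norm_mult)
      qed
      have "s (u0 + int Q * int l) w * z (u0 + int Q * int l) w = (\<Sum>k<W. F (S (int Q * int (l + k)) (S u0 w)) * s (u0 + int Q * int l) w * (g (S (int Q * int k) w) * ec (\<psi> w * real k)))" for l
      proof -
        have "u0 + int Q * int l + int Q * int k = int Q * int (l + k) + u0" for k by (simp add: algebra_simps)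
        then show ?thesis unfolding z_def Dl_def S_add sum_distrib_left g_def by (simp only: complex_cnj_cnj mult_ac add_ac)
      qed
      then have "norm (\<Sum>l<W. s (u0 + int Q * int l) w * z (u0 + int Q * int l) w) \<le> real W * norm (\<Sum>n<2 * W. F (S (int Q * int n) (S u0 w)) * ec (th * real n))"
        using th(1) by simp
      also have "\<dots> \<le> real W * ?mx (S u0 w)" using th(2) \<theta> by (intro mult_left_mono) auto
      finally show "norm (\<Sum>l<W. s (u0 + int Q * int l) w * z (u0 + int Q * int l) w) \<le> real W * ?mx (S u0 w)" .
    qed
  qed
  also have "\<dots> = real W * (\<Sum>w\<in>Om. ?mx (S u0 w))" by (simp only: sum_distrib_left)
  also have "(\<Sum>w\<in>Om. ?mx (S u0 w)) = (\<Sum>w\<in>Om. ?mx w)" by (rule sum_S)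
  finally have "real W * (real W * (N / (2 * real K))) \<le> real W * (\<Sum>w\<in>Om. ?mx w)" using m(2) by linarith
  then show thesis using W by (intro that[of \<theta>]) (simp only: mult_le_cancel_left_pos of_nat_0_less_iff)
qed

text \<open>The argument of \<open>interchange\<close> without a second copy of the dual function
  and without a reference frequency: here \<open>q * \<theta> w\<close> itself is almost integral on
  many points, so \<open>subprogression\<close> applies with \<eta> = 0 and leaves averages without
  any phase.\<close>

lemma major_arc_average:
  fixes f0 f1 :: "'w \<Rightarrow> complex" and K Q L M W W3 q :: nat and c :: int
  defines "F \<equiv> dual f0 f1 c M"
  assumes f: "\<And>w. norm (f0 w) \<le> 1" "\<And>w. norm (f1 w) \<le> 1"
    and K: "K \<ge> 1" and Q: "Q \<ge> 1" and c: "\<bar>c\<bar> \<le> int M" and M: "M > 0" and W: "W > 0"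
    and L: "L \<ge> (8 * (4 * K) ^ 2) ^ 80" "8 * (4 * K) * Q * L \<le> M" "40 * (4 * K) * M * L \<le> W" "ph_P Q (4 * K) * M < L ^ 2"
    and \<rho>: "\<rho> = real (ph_P Q (4 * K)) * real M / real L ^ 3" "q = ph_q Q (4 * K)"
    and W3: "8 * (2 * K) * q * W3 \<le> W" "28 * real (2 * K) * \<rho> * real W3 \<le> 1"
    and big: "(\<Sum>w\<in>Om. norm (\<Sum>n<W. F (S (int Q * int n) w) * ec (\<theta> w * real n))) \<ge> real W * (N / real K)"
  shows "(\<Sum>w\<in>Om. norm (\<Sum>k<W3. F (S (int (Q * q) * int k) w))) \<ge> real W3 * (N / (16 * real K ^ 2))"
proof -
  have F1: "norm (F w) \<le> 1" for w using norm_dual_le[OF f] by (simp add: F_def)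
  define z where "z w = (\<Sum>n<W. F (S (int Q * int n) w) * ec (\<theta> w * real n))" for w
  define good where "good w \<longleftrightarrow> norm (z w) \<ge> real W / (2 * real K)" for w
  define s where "s w = (if good w then cnj (sgn (z w)) else 0)" for w
  have s1: "norm (s w) \<le> 1" for w by (simp add: s_def norm_sgn_le)
  have sz: "norm (z w) \<le> Re (s w * z w) + real W / (2 * real K)" for w
  proof (cases "good w")
    case True
    then have "s w * z w = of_real (norm (z w))" by (simp only: s_def if_True cnj_sgn_mult)
    then show ?thesis by (simp only: Re_complex_of_real) simp
  qed (simp add: s_def good_def)
  let ?U = "\<Sum>w\<in>Om. s w * z w"
  have U: "norm ?U \<ge> real W * (N / (2 * real K))"
  proof -
    have "real W * (N / real K) \<le> (\<Sum>w\<in>Om. norm (z w))" using big by (simp only: z_def)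
    also have "\<dots> \<le> (\<Sum>w\<in>Om. Re (s w * z w) + real W / (2 * real K))" by (intro sum_mono sz)
    also have "\<dots> = Re ?U + real W * (N / (2 * real K))" by (simp add: sum.distrib)
    also have "real W * (N / real K) = 2 * (real W * (N / (2 * real K)))" by simp
    finally show ?thesis using complex_Re_le_cmod[of ?U] by linarith
  qed
  have MU: "of_nat M * ?U = (\<Sum>w\<in>Om. \<Sum>n<W. \<Sum>i<M. HH s \<theta> f0 f1 (int Q) w (int n) (c + int i))"
  proof -
    have e: "of_nat M * (F (S (int Q * int n) w)) = (\<Sum>i<M. f0 (S (int Q * int n - (c + int i)\<^sup>2) w) * f1 (T (c + int i) (S (int Q * int n - (c + int i)\<^sup>2) w)))" for n w
      using M by (simp add: F_def dual_def S_add)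
    have "of_nat M * (s w * z w) = (\<Sum>n<W. s w * ec (\<theta> w * real n) * (\<Sum>i<M. f0 (S (int Q * int n - (c + int i)\<^sup>2) w) * f1 (T (c + int i) (S (int Q * int n - (c + int i)\<^sup>2) w))))" for w
      unfolding e[symmetric] z_def sum_distrib_left by (simp only: mult_ac)
    then show ?thesis by (simp add: sum_distrib_left HH_def mult_ac)
  qed
  define CNT where "CNT w = (of_bool (s w \<noteq> 0 \<and> nd (real q * \<theta> w) \<le> \<rho>) :: real)" for w
  have "norm (of_nat M * ?U) \<le> real W * real M * (N / real (4 * K)) + real W * real M * (\<Sum>w\<in>Om. CNT w)"
    unfolding MU CNT_def \<rho>(2) by (rule phase_split[OF s1 f _ Q c L \<rho>(1)]) (use K in simp)
  moreover have "norm (of_nat M * ?U) \<ge> real M * (real W * (N / (2 * real K)))"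
    using mult_left_mono[OF U, of "real M"] by (simp only: norm_mult norm_of_nat of_nat_0_le_iff)
  moreover have "real M * (real W * (N / (2 * real K))) = 2 * (real W * real M * (N / real (4 * K)))" by simp
  ultimately have "real W * real M * (N / real (4 * K)) \<le> real W * real M * (\<Sum>w\<in>Om. CNT w)" by linarith
  then have cnt: "N / real (4 * K) \<le> (\<Sum>w\<in>Om. CNT w)" using M W by (simp only: mult_le_cancel_left_pos mult_pos_pos of_nat_0_less_iff)
  have sub: "CNT w * (real W * real W3 / (4 * real K)) \<le> (\<Sum>n<W. norm (\<Sum>k<W3. F (S (int Q * (int n + int q * int k)) w)))" for w
  proof (cases "CNT w = 0")
    case True
    then show ?thesis by (auto intro: sum_nonneg)
  next
    case False
    then have "s w \<noteq> 0" and nd: "nd (real q * \<theta> w) \<le> \<rho>" by (auto simp: CNT_def)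
    then have gd: "good w" by (auto simp: s_def split: if_splits)
    have "real W * real W3 / (2 * real (2 * K)) \<le> (\<Sum>n<W. norm (\<Sum>k<W3. F (S (int Q * (int n + int q * int k)) w) * ec (0 * real k)))"
    proof (rule subprogression[where a = "\<lambda>n. F (S (int Q * n) w)" and \<theta> = "\<theta> w", OF F1 _ W3])
      show "nd (real q * \<theta> w - 0) \<le> \<rho>" using nd by simp
      show "real W / real (2 * K) \<le> norm (\<Sum>n<W. F (S (int Q * int n) w) * ec (\<theta> w * real n))"
        using gd by (simp add: good_def z_def)
    qed (use K in simp)
    moreover have "CNT w = 1" using False by (auto simp: CNT_def)
    ultimately show ?thesis by simp
  qed
  let ?Y = "\<lambda>n w. norm (\<Sum>k<W3. F (S (int Q * (int n + int q * int k)) w))"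
  have "real W * (real W3 * (N / (16 * real K ^ 2))) = N / real (4 * K) * (real W * real W3 / (4 * real K))"
    by (simp add: power2_eq_square)
  also have "\<dots> \<le> (\<Sum>w\<in>Om. CNT w) * (real W * real W3 / (4 * real K))"
    by (rule mult_right_mono[OF cnt]) simp
  also have "\<dots> = (\<Sum>w\<in>Om. CNT w * (real W * real W3 / (4 * real K)))" by (simp only: sum_distrib_right)
  also have "\<dots> \<le> (\<Sum>w\<in>Om. \<Sum>n<W. ?Y n w)" by (intro sum_mono sub)
  also have "\<dots> = (\<Sum>n<W. \<Sum>w\<in>Om. ?Y n w)" by (rule sum.swap)
  finally obtain n where n: "n < W" "(\<Sum>w\<in>Om. ?Y n w) \<ge> real W3 * (N / (16 * real K ^ 2))"
    by (rule ex_ge_average[OF W])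
  have "(\<Sum>w\<in>Om. ?Y n w) = (\<Sum>w\<in>Om. ?Y n (S (- (int Q * int n)) w))" by (rule sum_S[symmetric])
  moreover have "int Q * (int n + int q * int k) + - (int Q * int n) = int (Q * q) * int k" for k by (simp add: algebra_simps)
  ultimately show ?thesis using n(2) by (simp only: S_add)
qed

end

section \<open>Inverse theorems\<close>

text \<open>All lengths are multiples of \<open>\<tau>\<close>: in \<open>m_conditions\<close>, \<open>a\<close> is the scale of \<open>pet_uniform\<close>, \<open>b\<close> and \<open>d\<close>
  are the lengths \<open>L\<close> in the two applications of the phase lemma, and \<open>W3\<close> and \<open>\<tau>\<^sup>2\<close> are the lengths of the
  subprogressions obtained from them; each scale is much larger than the next one.\<close>

definition m_A :: "nat \<Rightarrow> nat" where "m_A K = 2 * c_K4 K"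
definition m_k1 :: "nat \<Rightarrow> nat" where "m_k1 K = 8 * m_A K ^ 2"
definition m_Q0 :: "nat \<Rightarrow> nat" where "m_Q0 K = 2 * c_D K"
definition m_q1 :: "nat \<Rightarrow> nat" where "m_q1 K = ph_q (m_Q0 K) (m_k1 K)"
definition m_P1 :: "nat \<Rightarrow> nat" where "m_P1 K = ph_P (m_Q0 K) (m_k1 K)"
definition m_Q1 :: "nat \<Rightarrow> nat" where "m_Q1 K = m_Q0 K * m_q1 K"
definition m_B :: "nat \<Rightarrow> nat" where "m_B K = 32 * m_A K ^ 3"
definition m_C :: "nat \<Rightarrow> nat" where "m_C K = 4 * m_B K"
definition m_k2 :: "nat \<Rightarrow> nat" where "m_k2 K = 4 * m_C K"
definition m_q2 :: "nat \<Rightarrow> nat" where "m_q2 K = ph_q (m_Q1 K) (m_k2 K)"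
definition m_P2 :: "nat \<Rightarrow> nat" where "m_P2 K = ph_P (m_Q1 K) (m_k2 K)"
definition m_e :: "nat \<Rightarrow> nat" where "m_e K = c_e K + 8 * m_k1 K * m_Q0 K + 8 * m_k2 K * m_Q1 K"
definition m_h1 :: "nat \<Rightarrow> nat" where "m_h1 K = 80 * m_k1 K * m_e K"
definition m_Y :: "nat \<Rightarrow> nat" where "m_Y K = 16 * m_A K * m_q1 K + 112 * m_A K * m_P1 K * m_e K * m_h1 K + 4 * m_B K * m_Q1 K"
definition m_h2 :: "nat \<Rightarrow> nat" where "m_h2 K = 40 * m_k2 K * m_e K * m_h1 K * m_Y K"
definition m_w3 :: "nat \<Rightarrow> nat" where "m_w3 K = 40 * m_k2 K * m_e K * m_h1 K * m_h2 K"
definition m_h3 :: "nat \<Rightarrow> nat" where "m_h3 K = 16 * m_C K * m_q2 K + 112 * m_C K * m_P2 K * m_e K * m_h1 K * m_h2 K"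
definition m_T :: "nat \<Rightarrow> nat" where "m_T K = (8 * m_k1 K ^ 2) ^ 80 + (8 * m_k2 K ^ 2) ^ 80 + 2 * m_P1 K * m_e K * m_h1 K + 2 * m_P2 K * m_e K * m_h1 K * m_h2 K + 1"
definition m_E :: "nat \<Rightarrow> nat" where "m_E K = m_e K * m_h1 K * m_h2 K * m_h3 K"
definition m_Q :: "nat \<Rightarrow> nat" where "m_Q K = m_Q1 K * m_q2 K"
definition m_c :: "nat \<Rightarrow> nat" where "m_c K = 16 * m_C K ^ 2"

lemma ph_pos: "Q > 0 \<Longrightarrow> ph_q Q K > 0" "Q > 0 \<Longrightarrow> K > 0 \<Longrightarrow> ph_P Q K > 0"
  by (simp_all add: ph_q_def ph_P_def)

lemma m_pos:
  assumes "K \<ge> 1"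
  shows "m_A K > 0" "m_k1 K > 0" "m_Q0 K > 0" "m_q1 K > 0" "m_P1 K > 0" "m_Q1 K > 0" "m_B K > 0" "m_C K > 0" "m_k2 K > 0" "m_q2 K > 0"
    "m_P2 K > 0" "m_e K > 0" "m_h1 K > 0" "m_Y K > 0" "m_h2 K > 0" "m_w3 K > 0" "m_h3 K > 0" "m_E K > 0" "m_Q K > 0" "m_c K > 0"
proof -
  note c = pet_consts_pos[OF assms]
  show A: "m_A K > 0" using c by (simp add: m_A_def)
  then show k1: "m_k1 K > 0" by (simp add: m_k1_def)
  show Q0: "m_Q0 K > 0" using c by (simp add: m_Q0_def)
  then show q1: "m_q1 K > 0" by (simp add: m_q1_def ph_pos)
  show P1: "m_P1 K > 0" using Q0 k1 by (simp add: m_P1_def ph_pos)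
  show Q1: "m_Q1 K > 0" using Q0 q1 by (simp add: m_Q1_def)
  show B: "m_B K > 0" using A by (simp add: m_B_def)
  then show C: "m_C K > 0" by (simp add: m_C_def)
  then show k2: "m_k2 K > 0" by (simp add: m_k2_def)
  show q2: "m_q2 K > 0" using Q1 by (simp add: m_q2_def ph_pos)
  show P2: "m_P2 K > 0" using Q1 k2 by (simp add: m_P2_def ph_pos)
  show e: "m_e K > 0" using c by (simp add: m_e_def)
  then show h1: "m_h1 K > 0" using k1 by (simp add: m_h1_def)
  show Y: "m_Y K > 0" using A q1 by (simp add: m_Y_def)
  show h2: "m_h2 K > 0" using k2 e h1 Y by (simp add: m_h2_def)
  then show w3: "m_w3 K > 0" using k2 e h1 by (simp add: m_w3_def)
  show h3: "m_h3 K > 0" using C q2 by (simp add: m_h3_def)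
  show "m_E K > 0" "m_Q K > 0" "m_c K > 0" using e h1 h2 h3 Q1 q2 C by (simp_all add: m_E_def m_Q_def m_c_def)
qed

lemma m_conditions:
  fixes K M \<tau> :: nat
  defines "d \<equiv> m_h3 K * \<tau>"
  defines "b \<equiv> m_h2 K * d"
  defines "a \<equiv> m_h1 K * b"
  defines "W3 \<equiv> m_w3 K * d ^ 2"
  assumes K: "K \<ge> 1" and \<tau>: "m_T K \<le> \<tau>" "m_E K * \<tau> \<le> M" "M \<le> 2 * m_E K * \<tau>"
  shows "a \<ge> 1" "c_e K * a \<le> M" "b \<ge> (8 * m_k1 K ^ 2) ^ 80" "8 * m_k1 K * m_Q0 K * b \<le> M" "40 * m_k1 K * M * b \<le> 2 * (c_W K * a ^ 2)"
    "m_P1 K * M < b ^ 2" "8 * (2 * m_A K) * m_q1 K * W3 \<le> 2 * (c_W K * a ^ 2)" "56 * m_A K * m_P1 K * M * W3 \<le> b ^ 3"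
    "4 * m_B K * m_Q1 K * W3 \<le> c_V K * a ^ 2" "d \<ge> (8 * m_k2 K ^ 2) ^ 80" "8 * m_k2 K * m_Q1 K * d \<le> M" "40 * m_k2 K * M * d \<le> 2 * W3"
    "m_P2 K * M < d ^ 2" "8 * (2 * m_C K) * m_q2 K * \<tau> ^ 2 \<le> 2 * W3" "56 * m_C K * m_P2 K * M * \<tau> ^ 2 \<le> d ^ 3" "W3 > 0"
proof -
  note p = m_pos[OF K] and c = pet_consts_pos[OF K]
  have \<tau>1: "\<tau> \<ge> 1" using \<tau>(1) by (simp add: m_T_def)
  have h: "1 \<le> m_h1 K" "1 \<le> m_h2 K" "1 \<le> m_h3 K" "1 \<le> m_w3 K" "1 \<le> c_W K" "1 \<le> c_V K" using p c by simp_all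
  have d\<tau>: "\<tau> \<le> d" using mult_right_mono[OF h(3), of \<tau>] by (simp add: d_def)
  have bd: "d \<le> b" using mult_right_mono[OF h(2), of d] by (simp add: b_def)
  have ab: "b \<le> a" using mult_right_mono[OF h(1), of b] by (simp add: a_def)
  have d1: "d \<ge> 1" and b1: "b \<ge> 1" using d\<tau> bd \<tau>1 by linarith+
  show "a \<ge> 1" using ab b1 by linarith
  have E: "m_E K * \<tau> = m_e K * a" by (simp add: m_E_def a_def b_def d_def)
  have Mge: "m_e K * a \<le> M" using \<tau>(2) by (simp only: E)
  have Mle: "M \<le> 2 * (m_e K * a)" using \<tau>(3) unfolding E[symmetric] by simp
  have e: "c_e K \<le> m_e K" "8 * m_k1 K * m_Q0 K \<le> m_e K" "8 * m_k2 K * m_Q1 K \<le> m_e K" by (simp_all add: m_e_def)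
  show "c_e K * a \<le> M" using mult_right_mono[OF e(1), of a] Mge by linarith
  show "8 * m_k1 K * m_Q0 K * b \<le> M" using mult_mono[OF e(2) ab] Mge by simp
  have ad: "d \<le> a" using ab bd by linarith
  show "8 * m_k2 K * m_Q1 K * d \<le> M" using mult_mono[OF e(3) ad] Mge by simp
  show "b \<ge> (8 * m_k1 K ^ 2) ^ 80" "d \<ge> (8 * m_k2 K ^ 2) ^ 80" using \<tau>(1) d\<tau> bd by (simp_all add: m_T_def)
  have Mb: "M \<le> 2 * m_e K * m_h1 K * b" using Mle by (simp add: a_def mult_ac)
  have Md: "M \<le> 2 * m_e K * m_h1 K * m_h2 K * d" using Mle by (simp add: a_def b_def mult_ac)
  show "40 * m_k1 K * M * b \<le> 2 * (c_W K * a ^ 2)"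
  proof -
    have "40 * m_k1 K * M * b \<le> 40 * m_k1 K * (2 * (m_e K * a)) * b" using Mle by (intro mult_mono) auto
    also have "\<dots> = 1 * (1 * a ^ 2)" by (simp add: a_def m_h1_def power2_eq_square)
    also have "\<dots> \<le> 2 * (c_W K * a ^ 2)" using h by (intro mult_mono) auto
    finally show ?thesis .
  qed
  show "m_P1 K * M < b ^ 2"
  proof -
    have "m_P1 K * M \<le> m_P1 K * (2 * m_e K * m_h1 K * b)" using Mb by (rule mult_left_mono) simp
    also have "\<dots> = (2 * m_P1 K * m_e K * m_h1 K) * b" by simp
    also have "\<dots> < b * b" using \<tau>(1) d\<tau> bd b1 by (intro mult_strict_right_mono) (auto simp: m_T_def)
    finally show ?thesis by (simp add: power2_eq_square)
  qed
  show "m_P2 K * M < d ^ 2"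
  proof -
    have "m_P2 K * M \<le> m_P2 K * (2 * m_e K * m_h1 K * m_h2 K * d)" using Md by (rule mult_left_mono) simp
    also have "\<dots> = (2 * m_P2 K * m_e K * m_h1 K * m_h2 K) * d" by simp
    also have "\<dots> < d * d" using \<tau>(1) d\<tau> d1 by (intro mult_strict_right_mono) (auto simp: m_T_def)
    finally show ?thesis by (simp add: power2_eq_square)
  qed
  \<comment> \<open>\<open>W3\<close> is constrained from both sides: it has to be at least about M
    d for the second use of the phase lemma, and \<open>m_Y K * W3 \<le> b ^ 2\<close> is needed for
    the first. The definitions of \<open>m_w3\<close> and \<open>m_h2\<close> meet the two
    requirements together.\<close>
  have Yw: "m_Y K * m_w3 K = m_h2 K ^ 2" by (simp add: m_w3_def m_h2_def power2_eq_square)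
  have Y: "x * W3 \<le> b ^ 2" if "x \<le> m_Y K" for x
  proof -
    have "x * W3 \<le> m_Y K * W3" using that by (rule mult_right_mono) simp
    also have "\<dots> = m_Y K * m_w3 K * d ^ 2" by (simp add: W3_def)
    also have "\<dots> = b ^ 2" unfolding Yw by (simp add: b_def power_mult_distrib)
    finally show ?thesis .
  qed
  have ba2: "b ^ 2 \<le> a ^ 2" using ab by (rule power_mono) simp
  show "8 * (2 * m_A K) * m_q1 K * W3 \<le> 2 * (c_W K * a ^ 2)"
  proof -
    have "8 * (2 * m_A K) * m_q1 K * W3 \<le> 1 * (1 * a ^ 2)" using Y[of "8 * (2 * m_A K) * m_q1 K"] ba2 unfolding m_Y_def by linarith
    also have "\<dots> \<le> 2 * (c_W K * a ^ 2)" using h by (intro mult_mono) auto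
    finally show ?thesis .
  qed
  show "4 * m_B K * m_Q1 K * W3 \<le> c_V K * a ^ 2"
  proof -
    have "4 * m_B K * m_Q1 K * W3 \<le> 1 * a ^ 2" using Y[of "4 * m_B K * m_Q1 K"] ba2 unfolding m_Y_def by linarith
    also have "\<dots> \<le> c_V K * a ^ 2" using h by (intro mult_right_mono) auto
    finally show ?thesis .
  qed
  show "56 * m_A K * m_P1 K * M * W3 \<le> b ^ 3"
  proof -
    have "56 * m_A K * m_P1 K * M * W3 \<le> 56 * m_A K * m_P1 K * (2 * m_e K * m_h1 K * b) * W3" using Mb by (intro mult_mono) auto
    also have "\<dots> = b * ((112 * m_A K * m_P1 K * m_e K * m_h1 K) * W3)" by simp
    also have "\<dots> \<le> b * b ^ 2" by (intro mult_left_mono Y) (auto simp: m_Y_def)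
    finally show ?thesis by (simp add: power3_eq_cube power2_eq_square)
  qed
  show "40 * m_k2 K * M * d \<le> 2 * W3"
  proof -
    have "40 * m_k2 K * M * d \<le> 40 * m_k2 K * (2 * m_e K * m_h1 K * m_h2 K * d) * d" using Md by (intro mult_mono) auto
    also have "\<dots> = 2 * W3" by (simp add: W3_def m_w3_def power2_eq_square)
    finally show ?thesis .
  qed
  have h3: "16 * m_C K * m_q2 K \<le> m_h3 K" "112 * m_C K * m_P2 K * m_e K * m_h1 K * m_h2 K \<le> m_h3 K" by (simp_all add: m_h3_def)
  have h3sq: "m_h3 K \<le> m_h3 K ^ 2" using h(3) by (simp add: power2_eq_square)
  show "8 * (2 * m_C K) * m_q2 K * \<tau> ^ 2 \<le> 2 * W3"
  proof -
    have "8 * (2 * m_C K) * m_q2 K * \<tau> ^ 2 = 1 * (16 * m_C K * m_q2 K * \<tau> ^ 2)" by simp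
    also have "\<dots> \<le> (2 * m_w3 K) * (m_h3 K ^ 2 * \<tau> ^ 2)" using h3(1) h3sq h by (intro mult_mono) auto
    also have "\<dots> = 2 * W3" by (simp add: W3_def d_def power_mult_distrib)
    finally show ?thesis .
  qed
  show "56 * m_C K * m_P2 K * M * \<tau> ^ 2 \<le> d ^ 3"
  proof -
    have "56 * m_C K * m_P2 K * M * \<tau> ^ 2 \<le> 56 * m_C K * m_P2 K * (2 * m_e K * m_h1 K * m_h2 K * d) * \<tau> ^ 2" using Md by (intro mult_mono) auto
    also have "\<dots> = d * ((112 * m_C K * m_P2 K * m_e K * m_h1 K * m_h2 K) * \<tau> ^ 2)" by simp
    also have "\<dots> \<le> d * (m_h3 K ^ 2 * \<tau> ^ 2)" using h3(2) h3sq by (intro mult_left_mono mult_mono) auto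
    also have "\<dots> = d ^ 3" by (simp add: d_def power3_eq_cube power2_eq_square)
    finally show ?thesis .
  qed
  show "W3 > 0" using h(4) d1 by (simp add: W3_def)
qed

context two_actions
begin

text \<open>A dual function correlates with its own conjugate as soon as its second moment is large,
  which makes \<open>pet_uniform\<close> applicable with \<open>g\<close> the conjugate. The chain
  of lemmas then lowers third differences to local frequencies of \<open>Dl v g\<close>, to local
  frequencies of the dual function, and finally to plain averages; the loss \<open>m_c K\<close> in
  density is polynomial in \<open>K\<close>, and only the modulus and the scales are
  exponential.\<close>

lemma dual_inverse:
  fixes f0 f1 :: "'w \<Rightarrow> complex" and K M \<tau> :: nat and c :: int
  assumes f: "\<And>w. norm (f0 w) \<le> 1" "\<And>w. norm (f1 w) \<le> 1"
    and K: "K \<ge> 1" and c: "\<bar>c\<bar> \<le> int M" and \<tau>: "m_T K \<le> \<tau>" "m_E K * \<tau> \<le> M" "M \<le> 2 * m_E K * \<tau>"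
    and big: "(\<Sum>w\<in>Om. norm (dual f0 f1 c M w) ^ 2) \<ge> N / real K"
  shows "(\<Sum>w\<in>Om. norm (\<Sum>k<\<tau> ^ 2. dual f0 f1 c M (S (int (m_Q K) * int k) w))) \<ge> real \<tau> ^ 2 * (N / real (m_c K))"
proof -
  define d b a W3 where "d = m_h3 K * \<tau>" and "b = m_h2 K * d" and "a = m_h1 K * b" and "W3 = m_w3 K * d ^ 2"
  note cond = m_conditions[OF K \<tau>, folded d_def, folded b_def W3_def, folded a_def]
  note p = m_pos[OF K] and cp = pet_consts_pos[OF K]
  let ?F = "dual f0 f1 c M"
  define g where "g w = cnj (?F w)" for w
  have g1: "norm (g w) \<le> 1" for w using norm_dual_le[OF f] by (simp add: g_def)
  have Mp: "M > 0"
  proof -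
    have "1 * 1 \<le> c_e K * a" using cp cond(1) by (intro mult_mono) auto
    then show ?thesis using cond(2) by linarith
  qed
  have d1: "real d > 0" and b1: "real b > 0"
    using cond(1) by (auto simp: a_def b_def intro: Nat.gr0I)
  have "(\<Sum>w\<in>Om. ?F w * g w) = of_real (\<Sum>w\<in>Om. norm (?F w) ^ 2)"
    unfolding of_real_sum complex_norm_square g_def by (rule refl)
  then have "norm (\<Sum>i<M. \<Sum>w\<in>Om. f0 w * f1 (T (c + int i) w) * g (S ((c + int i)\<^sup>2) w)) = real M * \<bar>\<Sum>w\<in>Om. norm (?F w) ^ 2\<bar>"
    unfolding dual_correlation[OF Mp] norm_mult norm_of_nat by (simp only: norm_of_real)
  moreover have "real M * (N / real K) \<le> real M * \<bar>\<Sum>w\<in>Om. norm (?F w) ^ 2\<bar>" using big by (intro mult_left_mono) auto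
  ultimately have "norm (\<Sum>i<M. \<Sum>w\<in>Om. f0 w * f1 (T (c + int i) w) * g (S ((c + int i)\<^sup>2) w)) \<ge> real M * N / real K" by simp
  from pet_uniform[OF f g1 K cond(1,2) this]
  have u3: "N / real (c_K4 K) \<le> fj (c_V K * a ^ 2) (\<lambda>v. fj (c_W K * a ^ 2) (\<lambda>aa. fj (c_W K * a ^ 2) (\<lambda>b. KR g v (int (m_Q0 K) * aa) (int (m_Q0 K) * b))))"
    by (simp add: m_Q0_def)
  let ?W = "c_W K * a ^ 2" and ?V = "c_V K * a ^ 2"
  have Wp: "?W > 0" and Vp: "?V > 0" using cp cond(1) by auto
  obtain m0 \<theta> where u3i: "real ?V * (real ?W * (N / real (c_K4 K))) \<le> (\<Sum>m<?V. \<Sum>w\<in>Om. norm (\<Sum>n<2 * ?W. Dl (int m - int m0) g (S (int (m_Q0 K) * int n) w) * ec (\<theta> (int m - int m0) w * real n)))"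
    using u3_inverse[OF g1 Wp Vp u3] by blast
  have A1: "m_A K \<ge> 1" and Q01: "m_Q0 K \<ge> 1" and Q11: "m_Q1 K \<ge> 1" and B1: "m_B K \<ge> 1" and C1: "m_C K \<ge> 1" using p by simp_all
  have k1: "8 * m_A K ^ 2 = m_k1 K" by (simp add: m_k1_def)
  \<comment> \<open>\<open>m_A\<close> is twice \<open>c_K4\<close> because the Fourier windows have
    length \<open>2 * ?W\<close>.\<close>
  have big1: "(\<Sum>m<?V. \<Sum>w\<in>Om. norm (\<Sum>n<2 * ?W. Dl (int m - int m0) (\<lambda>w. cnj (?F w)) (S (int (m_Q0 K) * int n) w) * ec (\<theta> (int m - int m0) w * real n)))
    \<ge> real ?V * (real (2 * ?W) * (N / real (m_A K)))"
  proof -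
    have "real ?V * (real (2 * ?W) * (N / real (m_A K))) = real ?V * (real ?W * (N / real (c_K4 K)))" by (simp add: m_A_def)
    then show ?thesis using u3i unfolding g_def by linarith
  qed
  have r1: "28 * real (2 * m_A K) * (real (m_P1 K) * real M / real b ^ 3) * real W3 \<le> 1"
  proof -
    have "real (56 * m_A K * m_P1 K * M * W3) \<le> real (b ^ 3)" using cond(8) by (simp only: of_nat_le_iff)
    then show ?thesis using b1 by (simp add: divide_le_eq mult_ac)
  qed
  obtain \<psi> where i: "real ?V * (real W3 * (N / (32 * real (m_A K) ^ 3))) \<le> (\<Sum>m<?V. \<Sum>w\<in>Om. norm (\<Sum>k<W3. Dl (int m - int m0) (\<lambda>w. cnj (?F w)) (S (int (m_Q0 K * m_q1 K) * int k) w) * ec (\<psi> w * real k)))"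
  proof (rule interchange[OF f A1 Q01 c Vp Mp _ _ _ _ _ refl refl _ _ big1, where L = b and ?W3.0 = W3])
    show "0 < 2 * ?W" using Wp by simp
  qed (use cond(3-7) r1 in \<open>simp_all only: k1 m_P1_def[symmetric] m_q1_def[symmetric]\<close>)
  have big2: "real ?V * (real W3 * (N / real (m_B K))) \<le> (\<Sum>m<?V. \<Sum>w\<in>Om. norm (\<Sum>k<W3. Dl (int m - int m0) (\<lambda>w. cnj (?F w)) (S (int (m_Q1 K) * int k) w) * ec (\<psi> w * real k)))"
    using i by (simp add: m_B_def m_Q1_def)
  obtain \<theta>2 where l: "real W3 * (N / (2 * real (m_B K))) \<le> (\<Sum>w\<in>Om. norm (\<Sum>n<2 * W3. ?F (S (int (m_Q1 K) * int n) w) * ec (\<theta>2 w * real n)))"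
    by (rule lowering[OF norm_dual_le[OF f] B1 Vp cond(9) cond(16) big2])
  have big3: "real (2 * W3) * (N / real (m_C K)) \<le> (\<Sum>w\<in>Om. norm (\<Sum>n<2 * W3. ?F (S (int (m_Q1 K) * int n) w) * ec (\<theta>2 w * real n)))"
  proof -
    have "real (2 * W3) * (N / real (m_C K)) = real W3 * (N / (2 * real (m_B K)))" by (simp add: m_C_def)
    then show ?thesis using l by linarith
  qed
  have r2: "28 * real (2 * m_C K) * (real (m_P2 K) * real M / real d ^ 3) * real (\<tau> ^ 2) \<le> 1"
  proof -
    have "real (56 * m_C K * m_P2 K * M * \<tau> ^ 2) \<le> real (d ^ 3)" using cond(15) by (simp only: of_nat_le_iff)
    then show ?thesis using d1 by (simp add: divide_le_eq mult_ac)
  qed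
  have "real (\<tau> ^ 2) * (N / (16 * real (m_C K) ^ 2)) \<le> (\<Sum>w\<in>Om. norm (\<Sum>k<\<tau> ^ 2. ?F (S (int (m_Q1 K * m_q2 K) * int k) w)))"
    unfolding m_q2_def m_k2_def
  proof (rule major_arc_average[OF f C1 Q11 c Mp _ _ _ _ _ refl refl _ _ big3, where L = d])
    show "0 < 2 * W3" using cond(16) by simp
  qed (use cond(10-14) r2 in \<open>simp_all only: m_k2_def[symmetric] m_P2_def[symmetric] m_q2_def[symmetric]\<close>)
  then show ?thesis by (simp add: m_Q_def m_c_def)
qed

end

text \<open>The squares come from passing to the second moment of the dual function.\<close>

definition a_C :: "nat \<Rightarrow> nat" where "a_C K = m_c (K ^ 2)"
definition a_Q :: "nat \<Rightarrow> nat" where "a_Q K = m_Q (K ^ 2)"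
definition a_T :: "nat \<Rightarrow> nat" where "a_T K = m_T (K ^ 2)"
definition a_t :: "nat \<Rightarrow> nat" where "a_t K = 80 * a_C K * m_E (K ^ 2) * a_Q K"
definition a_E :: "nat \<Rightarrow> nat" where "a_E K = m_E (K ^ 2) * a_t K"

lemma a_pos: "K \<ge> 1 \<Longrightarrow> a_C K > 0" "K \<ge> 1 \<Longrightarrow> a_Q K > 0" "K \<ge> 1 \<Longrightarrow> a_t K > 0" "K \<ge> 1 \<Longrightarrow> a_E K > 0"
  using m_pos[of "K ^ 2"] by (simp_all add: a_C_def a_Q_def a_t_def a_E_def)

context two_actions
begin

lemma sum_norm_le_sqrt:
  fixes F :: "'w \<Rightarrow> complex"
  assumes "(\<Sum>w\<in>Om. norm (F w)) \<ge> N / real K" "K \<ge> 1"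
  shows "(\<Sum>w\<in>Om. norm (F w) ^ 2) \<ge> N / real (K ^ 2)"
proof -
  have "(N / real K) ^ 2 \<le> (\<Sum>w\<in>Om. norm (F w)) ^ 2" using assms by (intro power_mono) auto
  also have "\<dots> \<le> N * (\<Sum>w\<in>Om. norm (F w) ^ 2)"
    using Cauchy_Schwarz_ineq_sum[of "\<lambda>w. norm (F w)" "\<lambda>_. 1" Om] by (simp add: mult.commute)
  finally have "N * (N / real (K ^ 2)) \<le> N * (\<Sum>w\<in>Om. norm (F w) ^ 2)" by (simp add: power2_eq_square)
  then show ?thesis using N_pos by (simp only: mult_le_cancel_left_pos)
qed

lemma correlation_dual_average:
  fixes f0 f1 f2 :: "'w \<Rightarrow> complex" and K M \<sigma> :: nat and c :: int
  assumes f: "\<And>w. norm (f0 w) \<le> 1" "\<And>w. norm (f1 w) \<le> 1" "\<And>w. norm (f2 w) \<le> 1"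
    and K: "K \<ge> 1" and c: "\<bar>c\<bar> \<le> int M" and \<sigma>: "a_T K \<le> \<sigma>" "a_E K * \<sigma> \<le> M" "M \<le> 2 * a_E K * \<sigma>"
    and big: "norm (\<Sum>i<M. \<Sum>w\<in>Om. f0 w * f1 (T (c + int i) w) * f2 (S ((c + int i)\<^sup>2) w)) \<ge> real M * (N / real K)"
  shows "(\<Sum>w\<in>Om. norm (\<Sum>k<(a_t K * \<sigma>) ^ 2. dual f0 f1 c M (S (int (a_Q K) * int k) w))) \<ge> real (a_t K * \<sigma>) ^ 2 * (N / real (a_C K))"
    and "M > 0"
proof -
  have K2: "K ^ 2 \<ge> 1" using K by simp
  note p = a_pos[OF K]
  have s1: "\<sigma> \<ge> 1" using \<sigma>(1) by (simp add: a_T_def m_T_def)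
  have "1 * 1 \<le> a_E K * \<sigma>" using p s1 by (intro mult_mono) auto
  then show Mp: "M > 0" using \<sigma>(2) by linarith
  have ts: "1 * \<sigma> \<le> a_t K * \<sigma>" using p by (intro mult_right_mono) auto
  have "real M * (N / real K) \<le> real M * norm (\<Sum>w\<in>Om. dual f0 f1 c M w * f2 w)"
    using big unfolding dual_correlation[OF Mp] norm_mult norm_of_nat .
  then have "N / real K \<le> norm (\<Sum>w\<in>Om. dual f0 f1 c M w * f2 w)" using Mp by (simp only: mult_le_cancel_left_pos of_nat_0_less_iff)
  also have "\<dots> \<le> (\<Sum>w\<in>Om. norm (dual f0 f1 c M w))"
    using f(3) by (intro sum_norm_le) (simp add: norm_mult mult_left_le)
  finally have "N / real (K ^ 2) \<le> (\<Sum>w\<in>Om. norm (dual f0 f1 c M w) ^ 2)" using K by (rule sum_norm_le_sqrt)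
  moreover have "m_T (K ^ 2) \<le> a_t K * \<sigma>" using \<sigma>(1) ts unfolding a_T_def by linarith
  moreover have "m_E (K ^ 2) * (a_t K * \<sigma>) \<le> M" using \<sigma>(2) by (simp only: a_E_def mult.assoc)
  moreover have "M \<le> 2 * m_E (K ^ 2) * (a_t K * \<sigma>)" using \<sigma>(3) by (simp only: a_E_def mult.assoc)
  ultimately show "(\<Sum>w\<in>Om. norm (\<Sum>k<(a_t K * \<sigma>) ^ 2. dual f0 f1 c M (S (int (a_Q K) * int k) w))) \<ge> real (a_t K * \<sigma>) ^ 2 * (N / real (a_C K))"
    unfolding a_Q_def a_C_def by (intro dual_inverse[OF f(1,2) K2 c])
qed

text \<open>\<open>f2\<close> may be replaced by \<open>h\<close>, a sum of translates of the
  conjugate sign of the averages of the dual function, and \<open>h\<close> hardly changes under a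
  few steps of size \<open>a_Q K\<close> along \<open>S\<close>. Replacing \<open>d\<close> by
  \<open>d + a_Q K * e\<close> changes the square of \<open>d\<close> by a multiple of
  \<open>a_Q K\<close>, which \<open>h\<close> does not notice, whereas the argument of
  \<open>f1\<close> runs through a progression along \<open>T\<close>.\<close>

lemma f1_inverse:
  fixes f0 f1 f2 :: "'w \<Rightarrow> complex" and K M \<sigma> :: nat and c :: int
  assumes f: "\<And>w. norm (f0 w) \<le> 1" "\<And>w. norm (f1 w) \<le> 1" "\<And>w. norm (f2 w) \<le> 1"
    and K: "K \<ge> 1" and c: "\<bar>c\<bar> \<le> int M" and \<sigma>: "a_T K \<le> \<sigma>" "a_E K * \<sigma> \<le> M" "M \<le> 2 * a_E K * \<sigma>"
    and big: "norm (\<Sum>i<M. \<Sum>w\<in>Om. f0 w * f1 (T (c + int i) w) * f2 (S ((c + int i)\<^sup>2) w)) \<ge> real M * (N / real K)"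
  shows "(\<Sum>w\<in>Om. norm (\<Sum>e<\<sigma>. f1 (T (int (a_Q K) * int e) w))) \<ge> real \<sigma> * (N / real (2 * a_C K))"
proof -
  note ca = correlation_dual_average[OF f K c \<sigma> big]
  define \<tau> where "\<tau> = a_t K * \<sigma>"
  let ?Q = "int (a_Q K)" and ?F = "dual f0 f1 c M" and ?C = "real (a_C K)"
  let ?A = "\<Sum>w\<in>Om. norm (\<Sum>e<\<sigma>. f1 (T (?Q * int e) w))"
  note p = a_pos[OF K]
  have Cp: "?C > 0" using p by simp
  define s where "s w = cnj (sgn (\<Sum>k<\<tau> ^ 2. ?F (S (?Q * int k) w)))" for w
  define h where "h w = (\<Sum>k<\<tau> ^ 2. s (S (- (?Q * int k)) w))" for w
  have s1: "norm (s w) \<le> 1" for w by (simp add: s_def norm_sgn_le)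
  have h1: "norm (h w) \<le> real \<tau> ^ 2" for w
    unfolding h_def using sum_norm_le[of "{..<\<tau> ^ 2}" "\<lambda>k. s (S (- (?Q * int k)) w)" "\<lambda>_. 1"] s1 by simp
  have hs: "norm (h (S (?Q * r) w) - h w) \<le> 2 * \<bar>real_of_int r\<bar>" for r w
  proof -
    have "norm ((\<Sum>k<\<tau> ^ 2. s (S (- (?Q * (int k + - r))) w)) - (\<Sum>k<\<tau> ^ 2. s (S (- (?Q * int k)) w))) \<le> 2 * \<bar>real_of_int (- r)\<bar> * 1"
      by (rule norm_sum_shift[where F = "\<lambda>k. s (S (- (?Q * k)) w)"]) (rule s1)
    moreover have "- (?Q * int k) + ?Q * r = - (?Q * (int k + - r))" for k by (simp add: algebra_simps)
    ultimately show ?thesis by (simp only: h_def S_add of_int_minus abs_minus_cancel mult_1_right)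
  qed
  define G where "G d = (\<Sum>w\<in>Om. f0 w * f1 (T d w) * h (S (d\<^sup>2) w))" for d
  let ?GG = "\<Sum>i<M. \<Sum>e<\<sigma>. G (c + (int i + ?Q * int e))"
  have sumG: "norm (\<Sum>i<M. G (c + int i)) \<ge> real M * (real \<tau> ^ 2 * (N / ?C))"
  proof -
    have "(\<Sum>w\<in>Om. ?F w * h w) = (\<Sum>k<\<tau> ^ 2. \<Sum>w\<in>Om. ?F w * s (S (- (?Q * int k)) w))"
      unfolding h_def sum_distrib_left by (rule sum.swap)
    also have "\<dots> = (\<Sum>k<\<tau> ^ 2. \<Sum>w\<in>Om. ?F (S (?Q * int k) w) * s w)"
    proof (rule sum.cong[OF refl])
      fix k
      show "(\<Sum>w\<in>Om. ?F w * s (S (- (?Q * int k)) w)) = (\<Sum>w\<in>Om. ?F (S (?Q * int k) w) * s w)"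
        using sum_S[of "\<lambda>w. ?F w * s (S (- (?Q * int k)) w)" "?Q * int k"] by (simp add: S_add S_0)
    qed
    also have "\<dots> = (\<Sum>w\<in>Om. s w * (\<Sum>k<\<tau> ^ 2. ?F (S (?Q * int k) w)))"
      by (subst sum.swap) (simp add: sum_distrib_left mult.commute)
    also have "\<dots> = of_real (\<Sum>w\<in>Om. norm (\<Sum>k<\<tau> ^ 2. ?F (S (?Q * int k) w)))"
      unfolding s_def cnj_sgn_mult by simp
    finally have "norm (\<Sum>w\<in>Om. ?F w * h w) \<ge> real \<tau> ^ 2 * (N / ?C)" using ca(1) unfolding \<tau>_def[symmetric] by (simp only: norm_of_real abs_of_nonneg sum_nonneg norm_ge_zero)
    then have "real M * (real \<tau> ^ 2 * (N / ?C)) \<le> real M * norm (\<Sum>w\<in>Om. ?F w * h w)" by (rule mult_left_mono) simp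
    then show ?thesis unfolding G_def dual_correlation[OF ca(2)] norm_mult norm_of_nat .
  qed
  have GN: "norm (G d) \<le> N * real \<tau> ^ 2" for d
  proof -
    have "norm (G d) \<le> (\<Sum>w\<in>Om. real \<tau> ^ 2)" unfolding G_def
    proof (rule sum_norm_le)
      fix w
      have "norm (f0 w * f1 (T d w)) \<le> 1" using f by (simp add: norm_mult mult_le_one)
      then have "norm (f0 w * f1 (T d w)) * norm (h (S (d\<^sup>2) w)) \<le> 1 * real \<tau> ^ 2" using h1 by (intro mult_mono) auto
      then show "norm (f0 w * f1 (T d w) * h (S (d\<^sup>2) w)) \<le> real \<tau> ^ 2" by (simp add: norm_mult)
    qed
    then show ?thesis by simp
  qed
  have b1: "8 * a_C K * a_Q K * \<sigma> \<le> M"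
  proof -
    have "8 * a_C K * a_Q K * \<sigma> * 1 \<le> 80 * a_C K * a_Q K * \<sigma> * (m_E (K ^ 2) * m_E (K ^ 2))" using m_pos[of "K ^ 2"] K by (intro mult_mono) auto
    also have "\<dots> = a_E K * \<sigma>" by (simp add: a_E_def a_t_def)
    finally show ?thesis using \<sigma>(2) by linarith
  qed
  \<comment> \<open>As \<open>M\<close> is about \<open>m_E (K ^ 2) * \<tau>\<close>, this asks for
    \<open>\<tau> / \<sigma> = a_t K\<close> to be at least \<open>80 * a_C K * m_E (K ^ 2)\<close>,
    which explains the definition of \<open>a_t\<close>.\<close>
  have b2: "40 * a_C K * M * \<sigma> \<le> \<tau> ^ 2"
  proof -
    have "40 * a_C K * M * \<sigma> \<le> 40 * a_C K * (2 * a_E K * \<sigma>) * \<sigma>" using \<sigma>(3) by (intro mult_mono) auto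
    also have "\<dots> = 1 * (80 * a_C K * m_E (K ^ 2)) * a_t K * \<sigma> ^ 2" by (simp add: a_E_def power2_eq_square)
    also have "\<dots> \<le> a_Q K * (80 * a_C K * m_E (K ^ 2)) * a_t K * \<sigma> ^ 2" using p by (intro mult_mono) auto
    also have "\<dots> = \<tau> ^ 2" by (simp add: \<tau>_def a_t_def power2_eq_square)
    finally show ?thesis .
  qed
  have QM: "a_Q K * \<sigma> \<le> M"
  proof -
    have "1 * (a_Q K * \<sigma>) \<le> (8 * a_C K) * (a_Q K * \<sigma>)" using p by (intro mult_right_mono) auto
    then show ?thesis using b1 unfolding mult.assoc by linarith
  qed
  define G' where "G' i e = (\<Sum>w\<in>Om. f0 w * f1 (T (c + int i + ?Q * int e) w) * h (S ((c + int i)\<^sup>2) w))" for i e :: nat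
  have GG': "norm (G (c + int i + ?Q * int e) - G' i e) \<le> N * (10 * real M * real \<sigma>)" if ie: "i < M" "e < \<sigma>" for i e
  proof -
    define d where "d = c + int i"
    define r where "r = 2 * d * int e + ?Q * (int e)\<^sup>2"
    have e1: "(d + ?Q * int e)\<^sup>2 = ?Q * r + d\<^sup>2" by (simp add: r_def power2_eq_square algebra_simps)
    have rb: "\<bar>real_of_int r\<bar> \<le> 5 * real M * real \<sigma>"
    proof -
      have "\<bar>d\<bar> \<le> 2 * int M" using c ie(1) unfolding d_def by linarith
      then have "\<bar>d\<bar> * int e \<le> 2 * int M * int \<sigma>" using ie by (intro mult_mono) auto
      moreover have "?Q * int e * int e \<le> int M * int \<sigma>"
      proof (intro mult_mono)
        have "a_Q K * e \<le> a_Q K * \<sigma>" using ie by simp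
        then have "a_Q K * e \<le> M" using QM by linarith
        then show "?Q * int e \<le> int M" by (simp only: of_nat_mult[symmetric] of_nat_le_iff)
      qed (use ie in auto)
      moreover have "\<bar>r\<bar> \<le> 2 * (\<bar>d\<bar> * int e) + ?Q * int e * int e"
        using abs_triangle_ineq[of "2 * d * int e" "?Q * (int e)\<^sup>2"] by (simp add: r_def abs_mult power2_eq_square mult.assoc)
      ultimately have "\<bar>r\<bar> \<le> 5 * (int M * int \<sigma>)" by linarith
      then have "real_of_int \<bar>r\<bar> \<le> real_of_int (5 * (int M * int \<sigma>))" by (simp only: of_int_le_iff)
      then show ?thesis by simp
    qed
    have "G (d + ?Q * int e) - G' i e = (\<Sum>w\<in>Om. f0 w * f1 (T (d + ?Q * int e) w) * (h (S (?Q * r) (S (d\<^sup>2) w)) - h (S (d\<^sup>2) w)))"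
      by (simp only: G_def G'_def d_def[symmetric] e1 S_add right_diff_distrib sum_subtractf)
    also have "norm \<dots> \<le> (\<Sum>w\<in>Om. 10 * real M * real \<sigma>)"
    proof (rule sum_norm_le)
      fix w
      have "norm (f0 w * f1 (T (d + ?Q * int e) w)) \<le> 1" using f by (simp add: norm_mult mult_le_one)
      then have "norm (f0 w * f1 (T (d + ?Q * int e) w)) * norm (h (S (?Q * r) (S (d\<^sup>2) w)) - h (S (d\<^sup>2) w)) \<le> 1 * (2 * \<bar>real_of_int r\<bar>)"
        using hs by (intro mult_mono) auto
      then show "norm (f0 w * f1 (T (d + ?Q * int e) w) * (h (S (?Q * r) (S (d\<^sup>2) w)) - h (S (d\<^sup>2) w))) \<le> 10 * real M * real \<sigma>"
        unfolding norm_mult[of "f0 w * f1 (T (d + ?Q * int e) w)"] using rb by linarith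
    qed
    finally show ?thesis by (simp add: d_def)
  qed
  let ?s = "real \<sigma>"
  have 1: "norm (?GG - of_nat \<sigma> *\<^sub>R (\<Sum>i<M. G (c + int i))) \<le> 2 * real \<sigma> * real_of_int (?Q * int \<sigma>) * (N * real \<tau> ^ 2)"
    by (rule norm_sum_average[where F = "\<lambda>i. G (c + i)"]) (auto simp: GN abs_mult intro!: mult_left_mono)
  have 2: "norm ?GG \<ge> ?s * (real M * (real \<tau> ^ 2 * (N / ?C)) - 2 * real_of_int (?Q * int \<sigma>) * (N * real \<tau> ^ 2))"
    by (rule norm_ge_of_close[OF _ sumG]) (use 1 in \<open>simp_all add: mult_ac\<close>)
  have 3: "norm (?GG - (\<Sum>i<M. \<Sum>e<\<sigma>. G' i e)) \<le> (\<Sum>i<M. \<Sum>e<\<sigma>. N * (10 * real M * real \<sigma>))"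
    unfolding sum_subtractf[symmetric] by (intro sum_norm_le) (use GG' in \<open>auto simp: add.assoc\<close>)
  have 4: "norm (\<Sum>i<M. \<Sum>e<\<sigma>. G' i e) \<le> real M * (real \<tau> ^ 2 * ?A)"
  proof -
    have "norm (\<Sum>i<M. \<Sum>e<\<sigma>. G' i e) \<le> (\<Sum>i<M. real \<tau> ^ 2 * ?A)"
    proof (rule sum_norm_le)
      fix i
      have "(\<Sum>e<\<sigma>. G' i e) = (\<Sum>w\<in>Om. f0 w * h (S ((c + int i)\<^sup>2) w) * (\<Sum>e<\<sigma>. f1 (T (c + int i + ?Q * int e) w)))"
        unfolding G'_def by (subst sum.swap) (simp add: sum_distrib_left mult_ac)
      also have "norm \<dots> \<le> (\<Sum>w\<in>Om. real \<tau> ^ 2 * norm (\<Sum>e<\<sigma>. f1 (T (c + int i + ?Q * int e) w)))"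
      proof (rule sum_norm_le)
        fix w
        have "norm (f0 w) * norm (h (S ((c + int i)\<^sup>2) w)) \<le> 1 * real \<tau> ^ 2" using f h1 by (intro mult_mono) auto
        then show "norm (f0 w * h (S ((c + int i)\<^sup>2) w) * (\<Sum>e<\<sigma>. f1 (T (c + int i + ?Q * int e) w))) \<le> real \<tau> ^ 2 * norm (\<Sum>e<\<sigma>. f1 (T (c + int i + ?Q * int e) w))"
          by (simp add: norm_mult mult_right_mono)
      qed
      also have "\<dots> = real \<tau> ^ 2 * (\<Sum>w\<in>Om. norm (\<Sum>e<\<sigma>. f1 (T (?Q * int e) (T (c + int i) w))))"
        by (simp only: sum_distrib_left T_add add.commute)
      also have "(\<Sum>w\<in>Om. norm (\<Sum>e<\<sigma>. f1 (T (?Q * int e) (T (c + int i) w)))) = ?A"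
        by (rule sum_T)
      finally show "norm (\<Sum>e<\<sigma>. G' i e) \<le> real \<tau> ^ 2 * ?A" .
    qed
    then show ?thesis by simp
  qed
  let ?X = "real M * (real \<tau> ^ 2 * (N / (4 * ?C)))"
  have 5: "2 * real_of_int (?Q * int \<sigma>) * (N * real \<tau> ^ 2) \<le> ?X"
  proof -
    have "real (8 * a_C K * a_Q K * \<sigma>) \<le> real M" using b1 by (simp only: of_nat_le_iff)
    then have "2 * (real (a_Q K) * real \<sigma>) \<le> real M / (4 * ?C)" using Cp by (simp add: field_simps)
    then have "2 * (real (a_Q K) * real \<sigma>) * (N * real \<tau> ^ 2) \<le> real M / (4 * ?C) * (N * real \<tau> ^ 2)" by (rule mult_right_mono) simp
    then show ?thesis by (simp add: mult_ac)
  qed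
  have 6: "(\<Sum>i<M. \<Sum>e<\<sigma>. N * (10 * real M * real \<sigma>)) \<le> ?s * ?X"
  proof -
    have "real (40 * a_C K * M * \<sigma>) \<le> real (\<tau> ^ 2)" using b2 by (simp only: of_nat_le_iff)
    then have "10 * real M * real \<sigma> \<le> real \<tau> ^ 2 / (4 * ?C)" using Cp by (simp add: field_simps)
    then have "(real M * real \<sigma> * N) * (10 * real M * real \<sigma>) \<le> (real M * real \<sigma> * N) * (real \<tau> ^ 2 / (4 * ?C))" by (rule mult_left_mono) simp
    then show ?thesis by (simp add: mult_ac)
  qed
  have 7: "real M * (real \<tau> ^ 2 * (N / ?C)) = 4 * ?X" by simp
  have "?s * (3 * ?X) \<le> ?s * (real M * (real \<tau> ^ 2 * (N / ?C)) - 2 * real_of_int (?Q * int \<sigma>) * (N * real \<tau> ^ 2))"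
    unfolding 7 by (rule mult_left_mono) (use 5 in linarith, simp)
  then have "?s * (3 * ?X) \<le> norm ?GG" using 2 by linarith
  then have "?s * (2 * ?X) \<le> norm (\<Sum>i<M. \<Sum>e<\<sigma>. G' i e)"
    using 3 6 norm_triangle_sub[of "?GG" "\<Sum>i<M. \<Sum>e<\<sigma>. G' i e"] by linarith
  also note 4
  finally have "(real M * real \<tau> ^ 2) * (?s * (N / real (2 * a_C K))) \<le> (real M * real \<tau> ^ 2) * ?A"
    by (simp add: mult_ac)
  moreover have "\<tau> > 0" using p \<sigma>(1) by (simp add: \<tau>_def a_T_def m_T_def)
  ultimately show ?thesis using ca(2) by (simp only: mult_le_cancel_left_pos mult_pos_pos zero_less_power of_nat_0_less_iff)
qed

lemma two_actions_inverse: "two_actions Om T (\<lambda>n. S (- n))"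
  by unfold_locales (simp_all add: finite_Om Om_ne T_add S_add T_0 S_0 S_T T_in S_in add.commute)

text \<open>With the constant 1 in the middle and \<open>S\<close> inverted, \<open>h\<close> takes
  the place of \<open>f0\<close>, and the dual function is the mean of \<open>h\<close> over the
  shifts by \<open>(c + i)\<^sup>2\<close>. Its averages along a progression are means of translated
  averages of \<open>h\<close>, so the triangle inequality leads back to \<open>h\<close>.\<close>

lemma f2_inverse:
  fixes f0 h :: "'w \<Rightarrow> complex" and K M \<sigma> :: nat and c :: int
  assumes f: "\<And>w. norm (f0 w) \<le> 1" "\<And>w. norm (h w) \<le> 1"
    and K: "K \<ge> 1" and c: "\<bar>c\<bar> \<le> int M" and \<sigma>: "a_T K \<le> \<sigma>" "a_E K * \<sigma> \<le> M" "M \<le> 2 * a_E K * \<sigma>"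
    and big: "norm (\<Sum>i<M. \<Sum>w\<in>Om. f0 w * h (S ((c + int i)\<^sup>2) w)) \<ge> real M * (N / real K)"
  shows "(\<Sum>w\<in>Om. norm (\<Sum>k<(a_t K * \<sigma>) ^ 2. h (S (int (a_Q K) * int k) w))) \<ge> real (a_t K * \<sigma>) ^ 2 * (N / real (a_C K))"
proof -
  interpret inv: two_actions Om T "\<lambda>n. S (- n)" by (rule two_actions_inverse)
  let ?l = "(a_t K * \<sigma>) ^ 2" and ?Q = "int (a_Q K)"
  have eq: "(\<Sum>w\<in>Om. h w * 1 * f0 (S (- (d\<^sup>2)) w)) = (\<Sum>w\<in>Om. f0 w * h (S (d\<^sup>2) w))" for d
    using sum_S[of "\<lambda>w. h w * 1 * f0 (S (- (d\<^sup>2)) w)" "d\<^sup>2"] by (simp add: S_add S_0 mult.commute)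
  have b: "real M * (N / real K) \<le> norm (\<Sum>i<M. \<Sum>w\<in>Om. h w * (\<lambda>_. 1) (T (c + int i) w) * f0 (S (- ((c + int i)\<^sup>2)) w))"
    using big by (simp only: eq)
  note ca = inv.correlation_dual_average[OF f(2) _ f(1) K c \<sigma> b, simplified]
  have dual: "of_nat M * inv.dual h (\<lambda>_. 1) c M w = (\<Sum>i<M. h (S ((c + int i)\<^sup>2) w))" for w
    using ca(2) by (simp add: inv.dual_def)
  have "real M * (real ?l * (N / real (a_C K))) \<le> real M * (\<Sum>w\<in>Om. norm (\<Sum>k<?l. inv.dual h (\<lambda>_. 1) c M (S (- (?Q * int k)) w)))"
    using ca(1) by (intro mult_left_mono) auto
  also have "\<dots> = (\<Sum>w\<in>Om. norm (\<Sum>k<?l. of_nat M * inv.dual h (\<lambda>_. 1) c M (S (- (?Q * int k)) w)))"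
    by (simp only: sum_distrib_left[symmetric] norm_mult norm_of_nat)
  also have "\<dots> = (\<Sum>w\<in>Om. norm (\<Sum>i<M. \<Sum>k<?l. h (S ((c + int i)\<^sup>2) (S (- (?Q * int k)) w))))"
    unfolding dual by (intro sum.cong refl arg_cong[where f = norm] sum.swap)
  also have "\<dots> \<le> (\<Sum>w\<in>Om. \<Sum>i<M. norm (\<Sum>k<?l. h (S ((c + int i)\<^sup>2) (S (- (?Q * int k)) w))))"
    by (intro sum_mono norm_sum)
  also have "\<dots> = (\<Sum>i<M. \<Sum>w\<in>Om. norm (\<Sum>k<?l. h (S ((c + int i)\<^sup>2) (S (- (?Q * int k)) w))))"
    by (rule sum.swap)
  also have "\<dots> = (\<Sum>i<M. \<Sum>w\<in>Om. norm (\<Sum>k<?l. h (S (?Q * int k) w)))"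
  proof (rule sum.cong[OF refl])
    fix i
    \<comment> \<open>The inverse action runs through the progression backwards; reflecting
      \<open>k\<close> turns it into a translate of the forward progression.\<close>
    have "(\<Sum>w\<in>Om. norm (\<Sum>k<?l. h (S ((c + int i)\<^sup>2) (S (- (?Q * int k)) w))))
      = (\<Sum>w\<in>Om. norm (\<Sum>k<?l. h (S (?Q * int k) (S ((c + int i)\<^sup>2 - ?Q * (int ?l - 1)) w))))"
    proof (rule sum.cong[OF refl], rule arg_cong[where f = norm])
      fix w
      have "(\<Sum>k<?l. h (S ((c + int i)\<^sup>2) (S (- (?Q * int k)) w))) = (\<Sum>k<?l. h (S ((c + int i)\<^sup>2) (S (- (?Q * int (?l - Suc k))) w)))"
        by (rule sum.nat_diff_reindex[symmetric])
      also have "\<dots> = (\<Sum>k<?l. h (S (?Q * int k) (S ((c + int i)\<^sup>2 - ?Q * (int ?l - 1)) w)))"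
        by (intro sum.cong refl) (simp add: S_add of_nat_diff algebra_simps)
      finally show "(\<Sum>k<?l. h (S ((c + int i)\<^sup>2) (S (- (?Q * int k)) w))) = (\<Sum>k<?l. h (S (?Q * int k) (S ((c + int i)\<^sup>2 - ?Q * (int ?l - 1)) w)))" .
    qed
    then show "(\<Sum>w\<in>Om. norm (\<Sum>k<?l. h (S ((c + int i)\<^sup>2) (S (- (?Q * int k)) w)))) = (\<Sum>w\<in>Om. norm (\<Sum>k<?l. h (S (?Q * int k) w)))"
      by (simp only: sum_S[of "\<lambda>w. norm (\<Sum>k<?l. h (S (?Q * int k) w))"])
  qed
  also have "\<dots> = real M * (\<Sum>w\<in>Om. norm (\<Sum>k<?l. h (S (?Q * int k) w)))" by simp
  finally show ?thesis using ca(2) by (simp only: mult_le_cancel_left_pos of_nat_0_less_iff of_nat_power)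
qed

end

section \<open>Conditional expectations\<close>

definition cav :: "'a set \<Rightarrow> ('a \<Rightarrow> 'l) \<Rightarrow> ('a \<Rightarrow> real) \<Rightarrow> 'l \<Rightarrow> real" where
  "cav B \<phi> f l = (\<Sum>y\<in>{y\<in>B. \<phi> y = l}. f y) / real (card {y\<in>B. \<phi> y = l})"

text \<open>The value 0 outside \<open>B\<close> keeps expectations supported on the grid, as the
  comparison with the torus requires.\<close>

definition cexp :: "'a set \<Rightarrow> ('a \<Rightarrow> 'l) \<Rightarrow> ('a \<Rightarrow> real) \<Rightarrow> 'a \<Rightarrow> real" where
  "cexp B \<phi> f x = (if x \<in> B then cav B \<phi> f (\<phi> x) else 0)"

lemma sum_cexp:
  fixes g :: "'l \<Rightarrow> 'v::real_vector"
  assumes "finite B"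
  shows "(\<Sum>x\<in>B. cexp B \<phi> f x *\<^sub>R g (\<phi> x)) = (\<Sum>x\<in>B. f x *\<^sub>R g (\<phi> x))"
proof -
  have "(\<Sum>x\<in>{x\<in>B. \<phi> x = l}. cexp B \<phi> f x *\<^sub>R g (\<phi> x)) = (\<Sum>x\<in>{x\<in>B. \<phi> x = l}. f x *\<^sub>R g (\<phi> x))" if l: "l \<in> \<phi> ` B" for l
  proof -
    have c: "card {x\<in>B. \<phi> x = l} > 0" using l assms by (auto simp: card_gt_0_iff)
    have "(\<Sum>x\<in>{x\<in>B. \<phi> x = l}. cexp B \<phi> f x *\<^sub>R g (\<phi> x)) = (\<Sum>x\<in>{x\<in>B. \<phi> x = l}. cav B \<phi> f l *\<^sub>R g l)"
      by (rule sum.cong) (auto simp: cexp_def)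
    also have "\<dots> = (real (card {x\<in>B. \<phi> x = l}) * cav B \<phi> f l) *\<^sub>R g l" by (simp add: sum_constant_scaleR)
    also have "real (card {x\<in>B. \<phi> x = l}) * cav B \<phi> f l = (\<Sum>x\<in>{x\<in>B. \<phi> x = l}. f x)"
      using c by (simp add: cav_def)
    finally show ?thesis by (simp add: scaleR_sum_left)
  qed
  then show ?thesis unfolding sum.image_gen[OF assms, of _ \<phi>] by (rule sum.cong[OF refl])
qed

lemma sum_cexp_mult:
  fixes g :: "'l \<Rightarrow> real"
  assumes "finite B"
  shows "(\<Sum>x\<in>B. cexp B \<phi> f x * g (\<phi> x)) = (\<Sum>x\<in>B. f x * g (\<phi> x))"
  using sum_cexp[OF assms, of \<phi> f g] by simp

lemma cexp_bounds:
  assumes "finite B" "\<And>x. 0 \<le> f x" "\<And>x. f x \<le> 1"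
  shows "0 \<le> cexp B \<phi> f x" "cexp B \<phi> f x \<le> 1"
proof -
  show "0 \<le> cexp B \<phi> f x" using assms by (auto simp: cexp_def cav_def intro!: sum_nonneg divide_nonneg_nonneg)
  have "(\<Sum>y\<in>{y\<in>B. \<phi> y = \<phi> x}. f y) \<le> (\<Sum>y\<in>{y\<in>B. \<phi> y = \<phi> x}. 1)" using assms by (intro sum_mono) auto
  then show "cexp B \<phi> f x \<le> 1" by (auto simp: cexp_def cav_def divide_le_eq)
qed

lemma cexp_pos:
  assumes "finite B" "\<And>x. 0 \<le> f x" "f x > 0" "x \<in> B"
  shows "cexp B \<phi> f x > 0"
proof -
  have f: "finite {y\<in>B. \<phi> y = \<phi> x}" using assms by simp
  have "0 < (\<Sum>y\<in>{y\<in>B. \<phi> y = \<phi> x}. f y)" using assms f by (intro sum_pos2[of _ x]) auto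
  moreover have "card {y\<in>B. \<phi> y = \<phi> x} > 0" using f assms by (auto simp: card_gt_0_iff)
  ultimately show ?thesis using assms by (simp add: cexp_def cav_def)
qed

text \<open>Pythagoras: \<open>\<rho>\<close> computes the coarse label from the fine one, so the
  coarse expectation is measurable for the fine partition and orthogonal to the difference.\<close>

lemma cexp_energy:
  assumes B: "finite B" and \<rho>: "\<And>x. x \<in> B \<Longrightarrow> \<phi>1 x = \<rho> (\<phi>2 x)"
  shows "(\<Sum>x\<in>B. (cexp B \<phi>2 f x - cexp B \<phi>1 f x) ^ 2) = (\<Sum>x\<in>B. cexp B \<phi>2 f x ^ 2) - (\<Sum>x\<in>B. cexp B \<phi>1 f x ^ 2)"
proof -
  have "(\<Sum>x\<in>B. cexp B \<phi>2 f x * cexp B \<phi>1 f x) = (\<Sum>x\<in>B. cexp B \<phi>2 f x * cav B \<phi>1 f (\<rho> (\<phi>2 x)))"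
    by (rule sum.cong) (auto simp: cexp_def \<rho>)
  also have "\<dots> = (\<Sum>x\<in>B. f x * cav B \<phi>1 f (\<rho> (\<phi>2 x)))" by (rule sum_cexp_mult[OF B, of \<phi>2 f "\<lambda>l. cav B \<phi>1 f (\<rho> l)"])
  also have "\<dots> = (\<Sum>x\<in>B. f x * cav B \<phi>1 f (\<phi>1 x))" by (rule sum.cong) (auto simp: \<rho>)
  also have "\<dots> = (\<Sum>x\<in>B. cexp B \<phi>1 f x * cav B \<phi>1 f (\<phi>1 x))" by (rule sum_cexp_mult[OF B, symmetric])
  also have "\<dots> = (\<Sum>x\<in>B. cexp B \<phi>1 f x ^ 2)" by (rule sum.cong) (auto simp: cexp_def power2_eq_square)
  finally have "(\<Sum>x\<in>B. cexp B \<phi>2 f x * cexp B \<phi>1 f x) = (\<Sum>x\<in>B. cexp B \<phi>1 f x ^ 2)" .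
  then show ?thesis by (simp add: power2_diff sum.distrib sum_subtractf mult.assoc flip: sum_distrib_left)
qed

text \<open>The test function is constant on fine cells, so \<open>f\<close> may be replaced by its
  fine expectation. The correlation then bounds the mean of the absolute difference of two
  expectations from below, and the mean square of that difference is the gain in energy.\<close>

lemma cexp_diff_large:
  fixes g :: "'l \<Rightarrow> 'v::real_normed_vector"
  assumes B: "finite B" and \<rho>: "\<And>x. x \<in> B \<Longrightarrow> \<phi>1 x = \<rho> (\<phi>2 x)" and g: "\<And>l. norm (g l) \<le> \<Gamma>" and \<Gamma>: "\<Gamma> > 0"
    and big: "norm (\<Sum>x\<in>B. (f x - cexp B \<phi>1 f x) *\<^sub>R g (\<phi>2 x)) \<ge> \<Gamma> * (real (card B) * a)" and a: "a \<ge> 0"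
  shows "(\<Sum>x\<in>B. cexp B \<phi>2 f x ^ 2) \<ge> (\<Sum>x\<in>B. cexp B \<phi>1 f x ^ 2) + real (card B) * a ^ 2"
proof (cases "card B = 0")
  case True
  then show ?thesis using B by simp
next
  case False
  let ?D = "\<lambda>x. cexp B \<phi>2 f x - cexp B \<phi>1 f x"
  have "(\<Sum>x\<in>B. (f x - cexp B \<phi>1 f x) *\<^sub>R g (\<phi>2 x)) = (\<Sum>x\<in>B. ?D x *\<^sub>R g (\<phi>2 x))"
    unfolding scaleR_diff_left sum_subtractf sum_cexp[OF B, of \<phi>2 f] by (rule refl)
  also have "norm \<dots> \<le> (\<Sum>x\<in>B. \<Gamma> * \<bar>?D x\<bar>)"
    by (intro sum_norm_le) (use g in \<open>simp add: mult.commute[of \<Gamma>] mult_left_mono\<close>)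
  finally have "\<Gamma> * (real (card B) * a) \<le> \<Gamma> * (\<Sum>x\<in>B. \<bar>?D x\<bar>)" using big by (simp add: sum_distrib_left)
  then have "real (card B) * a \<le> (\<Sum>x\<in>B. \<bar>?D x\<bar>)" using \<Gamma> by (simp only: mult_le_cancel_left_pos)
  then have "(real (card B) * a) ^ 2 \<le> (\<Sum>x\<in>B. \<bar>?D x\<bar>) ^ 2" using a by (intro power_mono) auto
  also have "\<dots> \<le> (\<Sum>x\<in>B. ?D x ^ 2) * real (card B)"
    using Cauchy_Schwarz_ineq_sum[of "\<lambda>x. \<bar>?D x\<bar>" "\<lambda>_. 1" B] by simp
  finally have "real (card B) * (real (card B) * a ^ 2) \<le> real (card B) * (\<Sum>x\<in>B. ?D x ^ 2)"
    by (simp add: power_mult_distrib power2_eq_square mult_ac)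
  then have "real (card B) * a ^ 2 \<le> (\<Sum>x\<in>B. ?D x ^ 2)" using False by (simp only: mult_le_cancel_left_pos of_nat_0_less_iff neq0_conv)
  moreover have "(\<Sum>x\<in>B. ?D x ^ 2) = (\<Sum>x\<in>B. cexp B \<phi>2 f x ^ 2) - (\<Sum>x\<in>B. cexp B \<phi>1 f x ^ 2)"
    by (rule cexp_energy[OF B, where \<rho> = \<rho>]) (rule \<rho>)
  ultimately show ?thesis by linarith
qed

section \<open>Lower bound for the main term\<close>

lemma product_plus_inverses_ge_3:
  fixes p q :: real
  assumes "p > 0" "q > 0"
  shows "p * q + 1 / p + 1 / q \<ge> 3"
proof -
  define s where "s = sqrt (p * q)"
  have s: "s > 0" "s * s = p * q" using assms by (simp_all add: s_def)
  have "2 * s \<le> p + q" using arith_geo_mean_sqrt[of p q] assms by (simp add: s_def)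
  moreover have "0 \<le> s * ((s - 1) ^ 2 * (s + 2))" using s by simp
  ultimately have "3 * (s * s) \<le> (s * s) * (s * s) + (p + q)" by (simp add: power2_eq_square algebra_simps)
  moreover have "(p * q + 1 / p + 1 / q) * (p * q) = (p * q) * (p * q) + (p + q)" using assms by (simp add: field_simps)
  ultimately have "3 * (p * q) \<le> (p * q + 1 / p + 1 / q) * (p * q)" unfolding s(2) by linarith
  then show ?thesis using assms by (simp only: mult_le_cancel_right_pos mult_pos_pos)
qed

lemma sum_divide_cexp_le:
  assumes "finite B"
  shows "(\<Sum>x\<in>B. f x * (1 / cexp B \<phi> f x)) \<le> real (card B)"
proof -
  have "(\<Sum>x\<in>B. f x * (1 / cexp B \<phi> f x)) = (\<Sum>x\<in>B. f x * (1 / cav B \<phi> f (\<phi> x)))" by (rule sum.cong) (auto simp: cexp_def)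
  also have "\<dots> = (\<Sum>x\<in>B. cexp B \<phi> f x * (1 / cav B \<phi> f (\<phi> x)))" by (rule sum_cexp_mult[OF assms, symmetric])
  also have "\<dots> \<le> (\<Sum>x\<in>B. 1)" by (rule sum_mono) (auto simp: cexp_def)
  finally show ?thesis by simp
qed

text \<open>Divide the two expectations by the density \<delta> and call them p and q. The
  inequality p q + 1/p + 1/q >= 3 is weighted with \<open>f\<close> and summed: the left side 3
  gives 3 \<delta> times \<open>card B\<close>, and each of the two inverse terms gives at most
  \<delta> times \<open>card B\<close>, because an expectation divided by itself is at most 1. No
  relation between the two partitions is used.\<close>

lemma cexp_triple_ge:
  assumes B: "finite B" "B \<noteq> {}" and f: "\<And>x. 0 \<le> f x"
  shows "(\<Sum>x\<in>B. f x * cexp B \<phi>1 f x * cexp B \<phi>2 f x) \<ge> (\<Sum>x\<in>B. f x) ^ 3 / real (card B) ^ 2"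
proof (cases "(\<Sum>x\<in>B. f x) = 0")
  case True
  then have "f x = 0" if "x \<in> B" for x using that f B sum_nonneg_eq_0_iff[of B f] by auto
  then show ?thesis by simp
next
  case False
  let ?T = "\<Sum>x\<in>B. f x * cexp B \<phi>1 f x * cexp B \<phi>2 f x"
  define b where "b = real (card B)"
  define \<delta> where "\<delta> = (\<Sum>x\<in>B. f x) / b"
  have b: "b > 0" using B by (simp add: b_def card_gt_0_iff)
  have "(\<Sum>x\<in>B. f x) \<ge> 0" using f by (rule sum_nonneg)
  then have "(\<Sum>x\<in>B. f x) > 0" using False by linarith
  then have \<delta>: "\<delta> > 0" using b by (simp add: \<delta>_def)
  have sf: "(\<Sum>x\<in>B. f x) = \<delta> * b" using b by (simp add: \<delta>_def)
  have "3 * f x \<le> f x * cexp B \<phi>1 f x * cexp B \<phi>2 f x / \<delta> ^ 2 + \<delta> * (f x * (1 / cexp B \<phi>1 f x)) + \<delta> * (f x * (1 / cexp B \<phi>2 f x))" if x: "x \<in> B" for x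
  proof (cases "f x = 0")
    case False
    then have fx: "f x > 0" using f[of x] by linarith
    have c: "cexp B \<phi>1 f x > 0" "cexp B \<phi>2 f x > 0" using cexp_pos[where f = f and x = x, OF B(1) f fx x] by auto
    have "3 \<le> (cexp B \<phi>1 f x / \<delta>) * (cexp B \<phi>2 f x / \<delta>) + 1 / (cexp B \<phi>1 f x / \<delta>) + 1 / (cexp B \<phi>2 f x / \<delta>)"
      using c \<delta> by (intro product_plus_inverses_ge_3) auto
    then have "f x * 3 \<le> f x * ((cexp B \<phi>1 f x / \<delta>) * (cexp B \<phi>2 f x / \<delta>) + 1 / (cexp B \<phi>1 f x / \<delta>) + 1 / (cexp B \<phi>2 f x / \<delta>))"
      using fx by (intro mult_left_mono) auto
    then show ?thesis by (simp add: distrib_left power2_eq_square mult_ac)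
  qed simp
  then have "(\<Sum>x\<in>B. 3 * f x) \<le> (\<Sum>x\<in>B. f x * cexp B \<phi>1 f x * cexp B \<phi>2 f x / \<delta> ^ 2 + \<delta> * (f x * (1 / cexp B \<phi>1 f x)) + \<delta> * (f x * (1 / cexp B \<phi>2 f x)))"
    by (rule sum_mono)
  also have "\<dots> = ?T / \<delta> ^ 2 + \<delta> * (\<Sum>x\<in>B. f x * (1 / cexp B \<phi>1 f x)) + \<delta> * (\<Sum>x\<in>B. f x * (1 / cexp B \<phi>2 f x))"
    by (simp only: sum.distrib sum_distrib_left sum_divide_distrib)
  also have "\<dots> \<le> ?T / \<delta> ^ 2 + \<delta> * b + \<delta> * b"
    using sum_divide_cexp_le[OF B(1), of f \<phi>1] sum_divide_cexp_le[OF B(1), of f \<phi>2] \<delta> unfolding b_def by (intro add_mono mult_left_mono) auto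
  finally have "\<delta> * b \<le> ?T / \<delta> ^ 2" by (simp add: sf flip: sum_distrib_left)
  then have "\<delta> * b * \<delta> ^ 2 \<le> ?T" using \<delta> by (simp add: pos_le_divide_eq)
  moreover have "\<delta> * b * \<delta> ^ 2 = (\<Sum>x\<in>B. f x) ^ 3 / real (card B) ^ 2" unfolding sf b_def[symmetric] using b
    by (simp add: power_mult_distrib power2_eq_square power3_eq_cube)
  ultimately show ?thesis by linarith
qed

section \<open>Block boundaries and the passage from progressions to cells\<close>

lemma card_crossing_le:
  fixes n S D :: int
  assumes S: "S > 0" and D: "0 \<le> D" "D < S" and n: "n \<ge> 1"
  shows "int (card {x\<in>{1..n}. \<exists>e. \<bar>e\<bar> \<le> D \<and> (x div S \<noteq> (x + e) div S \<or> x + e \<notin> {1..n})}) \<le> (n div S + 3) * (2 * D + 1)"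
proof -
  let ?X = "{x\<in>{1..n}. \<exists>e. \<bar>e\<bar> \<le> D \<and> (x div S \<noteq> (x + e) div S \<or> x + e \<notin> {1..n})}"
  \<comment> \<open>Neighbourhoods of the multiples of \<open>S\<close> and of the right end
    \<open>n\<close>, which need not be a multiple; the left end is covered by the multiple
    0.\<close>
  let ?U = "(\<Union>k\<in>{0..n div S + 1}. {k * S - D..k * S + D}) \<union> {n - D..n + D}"
  have "?X \<subseteq> ?U"
  proof
    fix x assume "x \<in> ?X"
    then obtain e where x: "1 \<le> x" "x \<le> n" and e: "\<bar>e\<bar> \<le> D" and c: "x div S \<noteq> (x + e) div S \<or> x + e \<notin> {1..n}" by auto
    have nS: "0 \<le> n div S" using n S by (simp add: pos_imp_zdiv_nonneg_iff)
    consider "x + e > n" | "x + e < 1" | "1 \<le> x + e" "x + e \<le> n" "x div S \<noteq> (x + e) div S" using c by fastforce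
    then show "x \<in> ?U"
    proof cases
      case 1
      then show ?thesis using x e by auto
    next
      case 2
      then have "x \<in> {0 * S - D..0 * S + D}" using x e by auto
      then show ?thesis using nS by (intro UnI1 UN_I[of 0]) auto
    next
      case 3
      have cross: "z \<le> n \<Longrightarrow> 1 \<le> y \<Longrightarrow> y div S < z div S \<Longrightarrow> z - y \<le> D \<Longrightarrow> u \<in> {y, z} \<Longrightarrow> u \<in> ?U" for y z u
      proof -
        assume yz: "z \<le> n" "1 \<le> y" "y div S < z div S" "z - y \<le> D" and u: "u \<in> {y, z}"
        let ?k = "z div S"
        have k1: "?k * S \<le> z" using div_mult_mod_eq[of z S] pos_mod_sign[OF S, of z] by linarith
        have "y < (y div S + 1) * S" using div_mult_mod_eq[of y S] pos_mod_bound[OF S, of y] unfolding distrib_right by linarith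
        also have "\<dots> \<le> ?k * S" using yz S by (intro mult_right_mono) auto
        finally have k2: "y < ?k * S" .
        have "?k \<le> n div S" using yz S by (intro zdiv_mono1) auto
        moreover have "0 \<le> ?k" using yz S k2 k1 by (intro pos_imp_zdiv_nonneg_iff[THEN iffD2]) auto
        ultimately show ?thesis using k1 k2 yz u by (intro UnI1 UN_I[of ?k]) auto
      qed
      show ?thesis
      proof (cases "x div S < (x + e) div S")
        case True
        show ?thesis by (rule cross[of "x + e" x]) (use True 3 x e in auto)
      next
        case False
        show ?thesis by (rule cross[of x "x + e"]) (use False 3 x e in auto)
      qed
    qed
  qed
  then have "card ?X \<le> card ?U" by (intro card_mono) auto
  also have "\<dots> \<le> card (\<Union>k\<in>{0..n div S + 1}. {k * S - D..k * S + D}) + card {n - D..n + D}" by (rule card_Un_le)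
  also have "\<dots> \<le> (\<Sum>k\<in>{0..n div S + 1}. card {k * S - D..k * S + D}) + card {n - D..n + D}" by (intro add_right_mono card_UN_le) simp
  also have "\<dots> = nat (n div S + 2) * nat (2 * D + 1) + nat (2 * D + 1)" by (simp add: add.commute)
  finally have "int (card ?X) \<le> int (nat (n div S + 2) * nat (2 * D + 1) + nat (2 * D + 1))" by (simp only: of_nat_le_iff)
  also have "\<dots> = (n div S + 3) * (2 * D + 1)" using D S n by (simp add: pos_imp_zdiv_nonneg_iff algebra_simps)
  finally show ?thesis .
qed

context two_actions
begin

text \<open>By duality, large averages of \<open>h\<close> along progressions mean correlation with
  \<open>k\<close>, a sum of \<open>\<sigma>\<close> translates of a bounded function. A translation
  by \<open>Q * r\<close> changes \<open>k\<close> by at most \<open>2 * \<bar>r\<bar>\<close>, so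
  \<open>k\<close> is almost constant on cells that are short compared with \<open>\<sigma>\<close>
  and can be replaced by a function of the label.\<close>

lemma inverse_to_cells:
  fixes h :: "'w \<Rightarrow> real" and \<phi> :: "'w \<Rightarrow> 'l" and \<sigma> Q :: nat
  assumes B: "B \<subseteq> Om" and h: "\<And>w. w \<notin> B \<Longrightarrow> h w = 0" "\<And>w. \<bar>h w\<bar> \<le> 1"
    and big: "(\<Sum>w\<in>Om. norm (\<Sum>e<\<sigma>. complex_of_real (h (T (int Q * int e) w)))) \<ge> real \<sigma> * (2 * \<eta>)"
    and cells: "\<And>w w'. w \<in> B \<Longrightarrow> w' \<in> B \<Longrightarrow> \<phi> w = \<phi> w' \<Longrightarrow> \<exists>r. w' = T (int Q * r) w \<and> 2 * \<bar>real_of_int r\<bar> \<le> D"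
    and D: "D * real (card B) \<le> real \<sigma> * \<eta>"
  obtains g :: "'l \<Rightarrow> complex" where "\<And>l. norm (g l) \<le> real \<sigma>" "norm (\<Sum>w\<in>B. h w *\<^sub>R g (\<phi> w)) \<ge> real \<sigma> * \<eta>"
proof -
  define s where "s w = cnj (sgn (\<Sum>e<\<sigma>. complex_of_real (h (T (int Q * int e) w))))" for w
  define k where "k w = (\<Sum>e<\<sigma>. s (T (- (int Q * int e)) w))" for w
  have s1: "norm (s w) \<le> 1" for w by (simp add: s_def norm_sgn_le)
  have k1: "norm (k w) \<le> real \<sigma>" for w
    unfolding k_def using sum_norm_le[of "{..<\<sigma>}" "\<lambda>e. s (T (- (int Q * int e)) w)" "\<lambda>_. 1"] s1 by simp
  have ks: "norm (k (T (int Q * r) w) - k w) \<le> 2 * \<bar>real_of_int r\<bar>" for r w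
  proof -
    have "norm ((\<Sum>e<\<sigma>. s (T (- (int Q * (int e + - r))) w)) - (\<Sum>e<\<sigma>. s (T (- (int Q * int e)) w))) \<le> 2 * \<bar>real_of_int (- r)\<bar> * 1"
      by (rule norm_sum_shift[where F = "\<lambda>e. s (T (- (int Q * e)) w)"]) (rule s1)
    moreover have "- (int Q * int e) + int Q * r = - (int Q * (int e + - r))" for e by (simp add: algebra_simps)
    ultimately show ?thesis by (simp only: k_def T_add of_int_minus abs_minus_cancel mult_1_right)
  qed
  have "(\<Sum>w\<in>Om. complex_of_real (h w) * k w) = (\<Sum>e<\<sigma>. \<Sum>w\<in>Om. complex_of_real (h w) * s (T (- (int Q * int e)) w))"
    unfolding k_def sum_distrib_left by (rule sum.swap)
  also have "\<dots> = (\<Sum>e<\<sigma>. \<Sum>w\<in>Om. complex_of_real (h (T (int Q * int e) w)) * s w)"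
  proof (rule sum.cong[OF refl])
    fix e
    show "(\<Sum>w\<in>Om. complex_of_real (h w) * s (T (- (int Q * int e)) w)) = (\<Sum>w\<in>Om. complex_of_real (h (T (int Q * int e) w)) * s w)"
      using sum_T[of "\<lambda>w. complex_of_real (h w) * s (T (- (int Q * int e)) w)" "int Q * int e"] by (simp add: T_add T_0)
  qed
  also have "\<dots> = (\<Sum>w\<in>Om. s w * (\<Sum>e<\<sigma>. complex_of_real (h (T (int Q * int e) w))))"
    by (subst sum.swap) (simp add: sum_distrib_left mult.commute)
  also have "\<dots> = of_real (\<Sum>w\<in>Om. norm (\<Sum>e<\<sigma>. complex_of_real (h (T (int Q * int e) w))))"
    unfolding s_def cnj_sgn_mult by simp
  finally have "norm (\<Sum>w\<in>Om. complex_of_real (h w) * k w) \<ge> real \<sigma> * (2 * \<eta>)" using big by (simp only: norm_of_real abs_of_nonneg sum_nonneg norm_ge_zero)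
  also have "(\<Sum>w\<in>Om. complex_of_real (h w) * k w) = (\<Sum>w\<in>B. h w *\<^sub>R k w)"
    using B finite_Om h(1) by (intro sum.mono_neutral_cong_right) (auto simp: scaleR_conv_of_real)
  finally have hk: "norm (\<Sum>w\<in>B. h w *\<^sub>R k w) \<ge> real \<sigma> * (2 * \<eta>)" .
  \<comment> \<open>The value of \<open>k\<close> at a representative of the cell. For a label
    without a cell the choice is an arbitrary point, and the bound for \<open>k\<close> holds there,
    too.\<close>
  define g where "g l = k (SOME w. w \<in> B \<and> \<phi> w = l)" for l
  have diff: "norm (k w - g (\<phi> w)) \<le> D" if w: "w \<in> B" for w
  proof -
    let ?w' = "SOME v. v \<in> B \<and> \<phi> v = \<phi> w"
    have "?w' \<in> B \<and> \<phi> ?w' = \<phi> w" by (rule someI[of _ w]) (use w in simp)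
    then obtain r where "w = T (int Q * r) ?w'" "2 * \<bar>real_of_int r\<bar> \<le> D" using cells[of ?w' w] w by auto
    then show ?thesis using ks[of r ?w'] unfolding g_def by (metis order_trans)
  qed
  have "norm ((\<Sum>w\<in>B. h w *\<^sub>R k w) - (\<Sum>w\<in>B. h w *\<^sub>R g (\<phi> w))) \<le> (\<Sum>w\<in>B. D)"
    unfolding sum_subtractf[symmetric] scaleR_diff_right[symmetric]
  proof (rule sum_norm_le)
    fix w assume w: "w \<in> B"
    have "\<bar>h w\<bar> * norm (k w - g (\<phi> w)) \<le> 1 * D" using h(2) diff[OF w] by (intro mult_mono) auto
    then show "norm (h w *\<^sub>R (k w - g (\<phi> w))) \<le> D" by simp
  qed
  moreover have "(\<Sum>w\<in>B. D) = D * real (card B)" by simp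
  moreover have "real \<sigma> * (2 * \<eta>) = 2 * (real \<sigma> * \<eta>)" by simp
  ultimately have "norm (\<Sum>w\<in>B. h w *\<^sub>R g (\<phi> w)) \<ge> real \<sigma> * \<eta>"
    using hk D norm_triangle_sub[of "\<Sum>w\<in>B. h w *\<^sub>R k w" "\<Sum>w\<in>B. h w *\<^sub>R g (\<phi> w)"] by linarith
  then show thesis using that[of g] k1 by (simp add: g_def)
qed

lemma two_actions_swap: "two_actions Om S T"
  by unfold_locales (simp_all add: finite_Om Om_ne T_add S_add T_0 S_0 S_T T_in S_in)

end

text \<open>A rotation of the residues in the block of length \<open>P\<close> around \<open>x\<close>, so that the integers act on all of \<open>int\<close>
  and not only on \<open>{0..<P}\<close>.\<close>

definition sh :: "int \<Rightarrow> int \<Rightarrow> int \<Rightarrow> int" where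
  "sh P n x = P * (x div P) + (x + n) mod P"

lemma sh_0: "sh P 0 x = x"
  by (simp add: sh_def)

lemma sh_add: assumes "P > 0" shows "sh P m (sh P n x) = sh P (m + n) x"
proof -
  have "(P * (x div P) + (x + n) mod P) div P = x div P" using assms by simp
  moreover have "(P * (x div P) + (x + n) mod P + m) mod P = (x + (m + n)) mod P"
  proof -
    have "(P * (x div P) + (x + n) mod P + m) mod P = ((x + n) mod P + m) mod P" by (simp add: add.assoc)
    also have "\<dots> = (x + (m + n)) mod P" unfolding mod_add_left_eq by (simp add: add_ac)
    finally show ?thesis .
  qed
  ultimately show ?thesis by (simp add: sh_def)
qed

lemma sh_in: "P > 0 \<Longrightarrow> x \<in> {0..<P} \<Longrightarrow> sh P n x \<in> {0..<P}"
  by (simp add: sh_def)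

lemma sh_eq: "x \<in> {0..<P} \<Longrightarrow> x + n \<in> {0..<P} \<Longrightarrow> sh P n x = x + n"
  by (simp add: sh_def)

text \<open>The modulus is twice the side of the box: a shift of length at most \<open>n\<close>
  that leaves the box lands in the other half and cannot re-enter on the opposite side.\<close>

lemma sh_box:
  assumes "x \<in> {1..n}" "\<bar>d\<bar> \<le> n"
  shows "sh (2 * n) d x = x + d \<or> (sh (2 * n) d x \<notin> {1..n} \<and> x + d \<notin> {1..n})"
proof -
  have x: "x div (2 * n) = 0" using assms by auto
  consider "x + d \<in> {0..<2 * n}" | "x + d < 0" | "x + d = 2 * n" using assms by fastforce
  then show ?thesis
  proof cases
    case 1
    then show ?thesis using x by (simp add: sh_def)
  next
    case 2
    have "(x + d) mod (2 * n) = (x + d + 2 * n) mod (2 * n)" by simp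
    also have "\<dots> = x + d + 2 * n" using 2 assms by (intro mod_pos_pos_trivial) auto
    finally show ?thesis using x 2 assms by (simp add: sh_def)
  next
    case 3
    then show ?thesis using x assms by (simp add: sh_def)
  qed
qed

definition torus :: "int \<Rightarrow> int \<Rightarrow> (int \<times> int) set" where
  "torus n1 n2 = {0..<2 * n1} \<times> {0..<2 * n2}"

text \<open>Scaled so that a corner with step \<open>q * d\<close> corresponds to
  \<open>Tq n1 q d\<close> and \<open>Sq n2 q (d\<^sup>2)\<close>; the inverse theorems then apply
  for every modulus without change.\<close>

definition Tq :: "int \<Rightarrow> int \<Rightarrow> int \<Rightarrow> int \<times> int \<Rightarrow> int \<times> int" where
  "Tq n1 q d w = (sh (2 * n1) (q * d) (fst w), snd w)"

definition Sq :: "int \<Rightarrow> int \<Rightarrow> int \<Rightarrow> int \<times> int \<Rightarrow> int \<times> int" where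
  "Sq n2 q d w = (fst w, sh (2 * n2) (q\<^sup>2 * d) (snd w))"

lemma two_actions_torus:
  assumes "n1 \<ge> 1" "n2 \<ge> 1"
  shows "two_actions (torus n1 n2) (Tq n1 q) (Sq n2 q)"
proof
  show "Tq n1 q n w \<in> torus n1 n2" if "w \<in> torus n1 n2" for n w
    using that assms sh_in[of "2 * n1" "fst w"] unfolding torus_def Tq_def by auto
  show "Sq n2 q n w \<in> torus n1 n2" if "w \<in> torus n1 n2" for n w
    using that assms sh_in[of "2 * n2" "snd w"] unfolding torus_def Sq_def by auto
qed (use assms in \<open>auto simp: torus_def Tq_def Sq_def sh_add sh_0 distrib_left\<close>)

section \<open>The discrete torus\<close>

definition grid :: "int \<Rightarrow> int \<Rightarrow> (int \<times> int) set" where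
  "grid n1 n2 = {1..n1} \<times> {1..n2}"

lemma finite_grid [simp]: "finite (grid n1 n2)" by (simp add: grid_def)

lemma card_grid: "n1 \<ge> 1 \<Longrightarrow> n2 \<ge> 1 \<Longrightarrow> real (card (grid n1 n2)) = real_of_int (n1 * n2)"
  by (simp add: grid_def card_cartesian_product)

definition corr :: "int \<Rightarrow> int \<Rightarrow> int \<Rightarrow> int \<Rightarrow> (int \<times> int \<Rightarrow> real) \<Rightarrow> (int \<times> int \<Rightarrow> real) \<Rightarrow> (int \<times> int \<Rightarrow> real) \<Rightarrow> real" where
  "corr n1 n2 q d h0 h1 h2 = (\<Sum>w\<in>grid n1 n2. h0 w * h1 (fst w + q * d, snd w) * h2 (fst w, snd w + q\<^sup>2 * d\<^sup>2))"

text \<open>The double sum unfolds the weight \<open>mu\<close> (see \<open>sum_mu\<close>). For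
  each fixed \<open>j\<close> it is a sum over an interval of differences, which is the form that
  the inverse theorems accept.\<close>

definition Lam :: "int \<Rightarrow> int \<Rightarrow> int \<Rightarrow> nat \<Rightarrow> (int \<times> int \<Rightarrow> real) \<Rightarrow> (int \<times> int \<Rightarrow> real) \<Rightarrow> (int \<times> int \<Rightarrow> real) \<Rightarrow> real" where
  "Lam n1 n2 q M h0 h1 h2 = (\<Sum>j<M. \<Sum>i<M. corr n1 n2 q (int i - int j) h0 h1 h2) / real M ^ 2"

lemma supported_Tq:
  assumes "w \<in> grid n1 n2" "\<bar>q * d\<bar> \<le> n1" and h: "\<And>w. w \<notin> grid n1 n2 \<Longrightarrow> h w = (0::real)"
  shows "h (Tq n1 q d w) = h (fst w + q * d, snd w)"
proof -
  have "sh (2 * n1) (q * d) (fst w) = fst w + q * d \<or> (sh (2 * n1) (q * d) (fst w) \<notin> {1..n1} \<and> fst w + q * d \<notin> {1..n1})"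
    by (rule sh_box) (use assms in \<open>auto simp: grid_def\<close>)
  then show ?thesis unfolding Tq_def using h by (auto simp: grid_def)
qed

lemma supported_Sq:
  assumes "w \<in> grid n1 n2" "\<bar>q\<^sup>2 * d\<bar> \<le> n2" and h: "\<And>w. w \<notin> grid n1 n2 \<Longrightarrow> h w = (0::real)"
  shows "h (Sq n2 q d w) = h (fst w, snd w + q\<^sup>2 * d)"
proof -
  have "sh (2 * n2) (q\<^sup>2 * d) (snd w) = snd w + q\<^sup>2 * d \<or> (sh (2 * n2) (q\<^sup>2 * d) (snd w) \<notin> {1..n2} \<and> snd w + q\<^sup>2 * d \<notin> {1..n2})"
    by (rule sh_box) (use assms in \<open>auto simp: grid_def\<close>)
  then show ?thesis unfolding Sq_def using h by (auto simp: grid_def)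
qed

lemma Lam_large:
  assumes M: "M > 0" and big: "\<bar>Lam n1 n2 q M h0 h1 h2\<bar> \<ge> \<kappa>"
  obtains j where "j < M" "\<bar>\<Sum>i<M. corr n1 n2 q (int i - int j) h0 h1 h2\<bar> \<ge> real M * \<kappa>"
proof -
  have "real M * (real M * \<kappa>) \<le> real M * (real M * \<bar>Lam n1 n2 q M h0 h1 h2\<bar>)" using big by (intro mult_left_mono) auto
  also have "\<dots> = \<bar>\<Sum>j<M. \<Sum>i<M. corr n1 n2 q (int i - int j) h0 h1 h2\<bar>" using M by (simp add: Lam_def power2_eq_square)
  also have "\<dots> \<le> (\<Sum>j<M. \<bar>\<Sum>i<M. corr n1 n2 q (int i - int j) h0 h1 h2\<bar>)" by (rule sum_abs)
  finally show thesis by (rule ex_ge_average[OF M]) (rule that)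
qed

lemma shift_bounds:
  fixes q n1 n2 :: int and i j M :: nat
  assumes "q \<ge> 1" "q * int M \<le> n1" "q\<^sup>2 * (int M)\<^sup>2 \<le> n2" "i < M" "j < M"
  shows "\<bar>q * (int i - int j)\<bar> \<le> n1" "\<bar>q\<^sup>2 * (int i - int j)\<^sup>2\<bar> \<le> n2"
proof -
  have a: "\<bar>int i - int j\<bar> \<le> int M" using assms by auto
  then have "q * \<bar>int i - int j\<bar> \<le> q * int M" using assms by (intro mult_left_mono) auto
  then have "\<bar>q * (int i - int j)\<bar> \<le> q * int M" using assms(1) by (simp add: abs_mult)
  then show "\<bar>q * (int i - int j)\<bar> \<le> n1" using assms(2) by linarith
  have "\<bar>int i - int j\<bar>\<^sup>2 \<le> (int M)\<^sup>2" using a by (intro power_mono) auto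
  then have "q\<^sup>2 * \<bar>int i - int j\<bar>\<^sup>2 \<le> q\<^sup>2 * (int M)\<^sup>2" using assms by (intro mult_left_mono) auto
  then have "\<bar>q\<^sup>2 * (int i - int j)\<^sup>2\<bar> \<le> q\<^sup>2 * (int M)\<^sup>2" by (simp add: abs_mult)
  then show "\<bar>q\<^sup>2 * (int i - int j)\<^sup>2\<bar> \<le> n2" using assms(3) by linarith
qed

lemma corr_torus:
  assumes n: "n1 \<ge> 1" "n2 \<ge> 1" and d: "\<bar>q * d\<bar> \<le> n1" "\<bar>q\<^sup>2 * d\<^sup>2\<bar> \<le> n2"
    and h0: "\<And>w. w \<notin> grid n1 n2 \<Longrightarrow> h0 w = 0" and h1: "(\<forall>w. w \<notin> grid n1 n2 \<longrightarrow> h1 w = 0) \<or> h1 = (\<lambda>_. 1)" and h2: "\<And>w. w \<notin> grid n1 n2 \<Longrightarrow> h2 w = 0"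
  shows "(\<Sum>w\<in>torus n1 n2. complex_of_real (h0 w) * complex_of_real (h1 (Tq n1 q d w)) * complex_of_real (h2 (Sq n2 q (d\<^sup>2) w))) = complex_of_real (corr n1 n2 q d h0 h1 h2)"
proof -
  have sub: "grid n1 n2 \<subseteq> torus n1 n2" using n by (auto simp: grid_def torus_def)
  have "(\<Sum>w\<in>torus n1 n2. complex_of_real (h0 w) * complex_of_real (h1 (Tq n1 q d w)) * complex_of_real (h2 (Sq n2 q (d\<^sup>2) w)))
    = (\<Sum>w\<in>grid n1 n2. complex_of_real (h0 w * h1 (fst w + q * d, snd w) * h2 (fst w, snd w + q\<^sup>2 * d\<^sup>2)))"
  proof (rule sum.mono_neutral_cong_right[OF _ sub])
    show "finite (torus n1 n2)" by (simp add: torus_def)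
    fix w assume w: "w \<in> grid n1 n2"
    have "h1 (Tq n1 q d w) = h1 (fst w + q * d, snd w)" using h1 supported_Tq[OF w d(1), of h1] by auto
    moreover have "h2 (Sq n2 q (d\<^sup>2) w) = h2 (fst w, snd w + q\<^sup>2 * d\<^sup>2)" by (rule supported_Sq[OF w d(2) h2])
    ultimately show "complex_of_real (h0 w) * complex_of_real (h1 (Tq n1 q d w)) * complex_of_real (h2 (Sq n2 q (d\<^sup>2) w))
      = complex_of_real (h0 w * h1 (fst w + q * d, snd w) * h2 (fst w, snd w + q\<^sup>2 * d\<^sup>2))" by simp
  qed (use h0 in auto)
  then show ?thesis by (simp only: corr_def of_real_sum)
qed

lemma card_torus: "n1 \<ge> 1 \<Longrightarrow> n2 \<ge> 1 \<Longrightarrow> real (card (torus n1 n2)) = 4 * real_of_int (n1 * n2)"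
  by (simp add: torus_def card_cartesian_product)

text \<open>The torus has four times as many points as the grid, hence the factor 4 in front of
  \<open>n1 * n2 / K\<close>.\<close>

lemma Lam_inverse_1:
  fixes K M \<sigma> :: nat
  assumes n: "n1 \<ge> 1" "n2 \<ge> 1" and q: "q \<ge> 1" "q * int M \<le> n1" "q\<^sup>2 * (int M)\<^sup>2 \<le> n2"
    and s: "\<And>w. w \<notin> grid n1 n2 \<Longrightarrow> h0 w = 0" "\<And>w. w \<notin> grid n1 n2 \<Longrightarrow> h1 w = 0" "\<And>w. w \<notin> grid n1 n2 \<Longrightarrow> h2 w = 0"
    and b: "\<And>w. \<bar>h0 w\<bar> \<le> 1" "\<And>w. \<bar>h1 w\<bar> \<le> 1" "\<And>w. \<bar>h2 w\<bar> \<le> 1"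
    and K: "K \<ge> 1" and \<sigma>: "a_T K \<le> \<sigma>" "M = a_E K * \<sigma>"
    and big: "\<bar>Lam n1 n2 q M h0 h1 h2\<bar> \<ge> 4 * real_of_int (n1 * n2) / real K"
  shows "(\<Sum>w\<in>torus n1 n2. norm (\<Sum>e<\<sigma>. complex_of_real (h1 (Tq n1 q (int (a_Q K) * int e) w)))) \<ge> real \<sigma> * (2 * (real_of_int (n1 * n2) / real (a_C K)))"
proof -
  interpret two_actions "torus n1 n2" "Tq n1 q" "Sq n2 q" by (rule two_actions_torus[OF n])
  have \<sigma>1: "\<sigma> > 0" using \<sigma>(1) by (simp add: a_T_def m_T_def)
  then have M: "M > 0" using a_pos[OF K] by (simp add: \<sigma>(2))
  obtain j where j: "j < M" "\<bar>\<Sum>i<M. corr n1 n2 q (int i - int j) h0 h1 h2\<bar> \<ge> real M * (4 * real_of_int (n1 * n2) / real K)"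
    by (rule Lam_large[OF M big])
  have e: "- int j + int i = int i - int j" for i by simp
  have c: "(\<Sum>w\<in>torus n1 n2. complex_of_real (h0 w) * complex_of_real (h1 (Tq n1 q (int i - int j) w)) * complex_of_real (h2 (Sq n2 q ((int i - int j)\<^sup>2) w))) = complex_of_real (corr n1 n2 q (int i - int j) h0 h1 h2)" if "i < M" for i
    by (rule corr_torus[OF n shift_bounds[OF q that j(1)] s(1) _ s(3)]) (use s(2) in auto)
  have "(\<Sum>i<M. \<Sum>w\<in>torus n1 n2. complex_of_real (h0 w) * complex_of_real (h1 (Tq n1 q (- int j + int i) w)) * complex_of_real (h2 (Sq n2 q ((- int j + int i)\<^sup>2) w)))
    = complex_of_real (\<Sum>i<M. corr n1 n2 q (int i - int j) h0 h1 h2)"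
    unfolding e of_real_sum using c by (intro sum.cong) auto
  then have "norm (\<Sum>i<M. \<Sum>w\<in>torus n1 n2. complex_of_real (h0 w) * complex_of_real (h1 (Tq n1 q (- int j + int i) w)) * complex_of_real (h2 (Sq n2 q ((- int j + int i)\<^sup>2) w)))
    \<ge> real M * (N / real K)" using j(2) by (simp only: norm_of_real card_torus[OF n])
  moreover have "\<bar>- int j\<bar> \<le> int M" using j(1) by simp
  moreover have "a_E K * \<sigma> \<le> M" "M \<le> 2 * a_E K * \<sigma>" by (simp_all add: \<sigma>(2))
  moreover have "norm (complex_of_real (h0 w)) \<le> 1" "norm (complex_of_real (h1 w)) \<le> 1" "norm (complex_of_real (h2 w)) \<le> 1" for w
    using b by simp_all
  ultimately
  have "(\<Sum>w\<in>torus n1 n2. norm (\<Sum>e<\<sigma>. complex_of_real (h1 (Tq n1 q (int (a_Q K) * int e) w)))) \<ge> real \<sigma> * (N / real (2 * a_C K))"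
    by (intro f1_inverse[where ?f0.0 = "\<lambda>w. complex_of_real (h0 w)" and ?f1.0 = "\<lambda>w. complex_of_real (h1 w)" and ?f2.0 = "\<lambda>w. complex_of_real (h2 w)", OF _ _ _ K _ \<sigma>(1)])
  then show ?thesis by (simp add: card_torus[OF n])
qed

lemma Lam_inverse_2:
  fixes K M \<sigma> :: nat
  assumes n: "n1 \<ge> 1" "n2 \<ge> 1" and q: "q \<ge> 1" "q * int M \<le> n1" "q\<^sup>2 * (int M)\<^sup>2 \<le> n2"
    and s: "\<And>w. w \<notin> grid n1 n2 \<Longrightarrow> h0 w = 0" "\<And>w. w \<notin> grid n1 n2 \<Longrightarrow> h2 w = 0"
    and b: "\<And>w. \<bar>h0 w\<bar> \<le> 1" "\<And>w. \<bar>h2 w\<bar> \<le> 1"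
    and K: "K \<ge> 1" and \<sigma>: "a_T K \<le> \<sigma>" "M = a_E K * \<sigma>"
    and big: "\<bar>Lam n1 n2 q M h0 (\<lambda>_. 1) h2\<bar> \<ge> 4 * real_of_int (n1 * n2) / real K"
  shows "(\<Sum>w\<in>torus n1 n2. norm (\<Sum>e<(a_t K * \<sigma>) ^ 2. complex_of_real (h2 (Sq n2 q (int (a_Q K) * int e) w)))) \<ge> real ((a_t K * \<sigma>) ^ 2) * (2 * (real_of_int (n1 * n2) / real (a_C K)))"
proof -
  interpret two_actions "torus n1 n2" "Tq n1 q" "Sq n2 q" by (rule two_actions_torus[OF n])
  have \<sigma>1: "\<sigma> > 0" using \<sigma>(1) by (simp add: a_T_def m_T_def)
  then have M: "M > 0" using a_pos[OF K] by (simp add: \<sigma>(2))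
  obtain j where j: "j < M" "\<bar>\<Sum>i<M. corr n1 n2 q (int i - int j) h0 (\<lambda>_. 1) h2\<bar> \<ge> real M * (4 * real_of_int (n1 * n2) / real K)"
    by (rule Lam_large[OF M big])
  have e: "- int j + int i = int i - int j" for i by simp
  have c: "(\<Sum>w\<in>torus n1 n2. complex_of_real (h0 w) * complex_of_real (h2 (Sq n2 q ((int i - int j)\<^sup>2) w))) = complex_of_real (corr n1 n2 q (int i - int j) h0 (\<lambda>_. 1) h2)" if "i < M" for i
    using corr_torus[where ?h1.0 = "\<lambda>_. 1" and ?h0.0 = h0 and ?h2.0 = h2, OF n shift_bounds[OF q that j(1)] s(1) _ s(2)] by simp
  have "(\<Sum>i<M. \<Sum>w\<in>torus n1 n2. complex_of_real (h0 w) * complex_of_real (h2 (Sq n2 q ((- int j + int i)\<^sup>2) w)))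
    = complex_of_real (\<Sum>i<M. corr n1 n2 q (int i - int j) h0 (\<lambda>_. 1) h2)"
    unfolding e of_real_sum using c by (intro sum.cong) auto
  then have "norm (\<Sum>i<M. \<Sum>w\<in>torus n1 n2. complex_of_real (h0 w) * complex_of_real (h2 (Sq n2 q ((- int j + int i)\<^sup>2) w)))
    \<ge> real M * (N / real K)" using j(2) by (simp only: norm_of_real card_torus[OF n])
  moreover have "\<bar>- int j\<bar> \<le> int M" using j(1) by simp
  moreover have "a_E K * \<sigma> \<le> M" "M \<le> 2 * a_E K * \<sigma>" by (simp_all add: \<sigma>(2))
  moreover have "norm (complex_of_real (h0 w)) \<le> 1" "norm (complex_of_real (h2 w)) \<le> 1" for w
    using b by simp_all
  ultimately
  have 1: "(\<Sum>w\<in>torus n1 n2. norm (\<Sum>e<(a_t K * \<sigma>) ^ 2. complex_of_real (h2 (Sq n2 q (int (a_Q K) * int e) w)))) \<ge> real (a_t K * \<sigma>) ^ 2 * (N / real (a_C K))"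
    by (intro f2_inverse[where ?f0.0 = "\<lambda>w. complex_of_real (h0 w)" and h = "\<lambda>w. complex_of_real (h2 w)", OF _ _ K _ \<sigma>(1)])
  have "real ((a_t K * \<sigma>) ^ 2) * (2 * (real_of_int (n1 * n2) / real (a_C K))) \<le> real (a_t K * \<sigma>) ^ 2 * (N / real (a_C K))"
  proof -
    have "2 * (real_of_int (n1 * n2) / real (a_C K)) \<le> N / real (a_C K)"
      unfolding card_torus[OF n] using n by (simp add: divide_right_mono)
    then show ?thesis unfolding of_nat_power by (rule mult_left_mono) simp
  qed
  then show ?thesis using 1 by linarith
qed

text \<open>Cells are progressions of difference \<open>q\<close> inside a block of length
  \<open>S\<close> on one horizontal line; the whole coordinate \<open>snd w\<close> is part of the
  label, because averaging takes place in the x-direction only. In the y-direction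
  \<open>lab2\<close> uses squares, matching the steps of \<open>Sq\<close>.\<close>

definition lab1 :: "int \<Rightarrow> int \<Rightarrow> int \<times> int \<Rightarrow> int \<times> int \<times> int" where
  "lab1 q S w = (fst w mod q, fst w div S, snd w)"

definition lab2 :: "int \<Rightarrow> int \<Rightarrow> int \<times> int \<Rightarrow> int \<times> int \<times> int" where
  "lab2 q S w = (snd w mod q\<^sup>2, snd w div S\<^sup>2, fst w)"

lemma label_refine:
  fixes q q' S S' c :: int
  assumes "q dvd q'" "S = S' * c" "S' > 0" "c > 0"
  shows "(x mod q, x div S) = ((x mod q') mod q, (x div S') div c)"
  using assms by (simp add: mod_mod_cancel zdiv_zmult2_eq)

lemma card_crossing_grid_le:
  fixes n S D G :: int
  assumes G: "G \<ge> 2" "D \<ge> 1" "S = G * D" "S \<le> n"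
  shows "G * int (card {x\<in>{1..n}. \<exists>e. \<bar>e\<bar> \<le> D \<and> (x div S \<noteq> (x + e) div S \<or> x + e \<notin> {1..n})}) \<le> 12 * n"
proof -
  let ?X = "{x\<in>{1..n}. \<exists>e. \<bar>e\<bar> \<le> D \<and> (x div S \<noteq> (x + e) div S \<or> x + e \<notin> {1..n})}"
  have "1 * D < G * D" using G by (intro mult_strict_right_mono) auto
  then have DS: "D < S" "S > 0" using G by auto
  have "int (card ?X) \<le> (n div S + 3) * (2 * D + 1)" by (rule card_crossing_le[OF DS(2) _ DS(1)]) (use DS G in linarith)+
  also have "\<dots> \<le> (4 * (n div S)) * (3 * D)"
  proof -
    have "S div S \<le> n div S" using G DS by (intro zdiv_mono1) auto
    then have "1 \<le> n div S" using DS by simp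
    then show ?thesis using G by (intro mult_mono) auto
  qed
  finally have "G * int (card ?X) \<le> G * ((4 * (n div S)) * (3 * D))" using G by (intro mult_left_mono) auto
  also have "\<dots> = 12 * (n div S * S)" by (simp add: G(3))
  also have "\<dots> \<le> 12 * n" using div_mult_mod_eq[of n S] pos_mod_sign[OF DS(2), of n] by linarith
  finally show ?thesis .
qed

lemma Lam_diff_le:
  assumes "\<And>i j. i < M \<Longrightarrow> j < M \<Longrightarrow> \<bar>corr n1 n2 q (int i - int j) h0 h1 h2 - X i j\<bar> \<le> e" "M > 0"
    and X: "(\<Sum>j<M. \<Sum>i<M. X i j) = real M ^ 2 * Y"
  shows "\<bar>Lam n1 n2 q M h0 h1 h2 - Y\<bar> \<le> e"
proof -
  have "\<bar>(\<Sum>j<M. \<Sum>i<M. corr n1 n2 q (int i - int j) h0 h1 h2) - real M ^ 2 * Y\<bar> = \<bar>\<Sum>j<M. \<Sum>i<M. corr n1 n2 q (int i - int j) h0 h1 h2 - X i j\<bar>"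
    by (simp add: sum_subtractf X)
  also have "\<dots> \<le> (\<Sum>j<M. \<Sum>i<M. e)" by (intro order_trans[OF sum_abs] sum_mono) (use assms(1) in auto)
  also have "\<dots> = real M ^ 2 * e" by (simp add: power2_eq_square)
  also have "(\<Sum>j<M. \<Sum>i<M. corr n1 n2 q (int i - int j) h0 h1 h2) = real M ^ 2 * Lam n1 n2 q M h0 h1 h2"
    using assms(2) by (simp add: Lam_def)
  finally have "real M ^ 2 * \<bar>Lam n1 n2 q M h0 h1 h2 - Y\<bar> \<le> real M ^ 2 * e"
    by (simp add: abs_mult flip: right_diff_distrib)
  then show ?thesis using assms(2) by (simp only: mult_le_cancel_left_pos zero_less_power of_nat_0_less_iff)
qed

text \<open>A shift by \<open>q * d\<close> preserves residues modulo \<open>q\<close>, so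
  \<open>k\<close> changes only where the shift crosses the boundary of a block or of the grid.
  Blocks are \<open>G\<close> times as long as the largest shift, which leaves a proportion O(1/G)
  of the points. Up to this error \<open>k\<close> can be moved from the second place to the
  first.\<close>

lemma invariance_1:
  fixes G D M :: nat and q :: int
  defines "S \<equiv> int G * int D"
  assumes n: "n1 \<ge> 1" "n2 \<ge> 1" and G: "G \<ge> 2" "D \<ge> 1" and S: "S \<le> n1" and q: "q \<ge> 1" "int D = q * int M" and M: "M > 0"
    and k: "\<And>w w'. w \<in> grid n1 n2 \<Longrightarrow> w' \<in> grid n1 n2 \<Longrightarrow> lab1 q S w = lab1 q S w' \<Longrightarrow> k w = k w'"
    and kb: "\<And>w. 0 \<le> k w" "\<And>w. k w \<le> 1" "\<And>w. w \<notin> grid n1 n2 \<Longrightarrow> k w = 0" and b: "\<And>w. \<bar>h0 w\<bar> \<le> 1" "\<And>w. \<bar>h2 w\<bar> \<le> 1"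
  shows "\<bar>Lam n1 n2 q M h0 k h2 - Lam n1 n2 q M (\<lambda>w. h0 w * k w) (\<lambda>_. 1) h2\<bar> \<le> 12 * real_of_int (n1 * n2) / real G"
proof (rule Lam_diff_le[OF _ M])
  show "(\<Sum>j<M. \<Sum>i<M. corr n1 n2 q (int i - int j) (\<lambda>w. h0 w * k w) (\<lambda>_. 1) h2) = real M ^ 2 * Lam n1 n2 q M (\<lambda>w. h0 w * k w) (\<lambda>_. 1) h2"
    using M by (simp add: Lam_def)
  fix i j assume ij: "i < M" "j < M"
  define e where "e = q * (int i - int j)"
  let ?X = "{x\<in>{1..n1}. \<exists>e. \<bar>e\<bar> \<le> int D \<and> (x div S \<noteq> (x + e) div S \<or> x + e \<notin> {1..n1})}"
  have eD: "\<bar>e\<bar> \<le> int D"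
  proof -
    have "q * \<bar>int i - int j\<bar> \<le> q * int M" using ij q by (intro mult_left_mono) auto
    then show ?thesis using q by (simp add: e_def abs_mult)
  qed
  have "corr n1 n2 q (int i - int j) h0 k h2 - corr n1 n2 q (int i - int j) (\<lambda>w. h0 w * k w) (\<lambda>_. 1) h2
    = (\<Sum>w\<in>grid n1 n2. h0 w * (k (fst w + e, snd w) - k w) * h2 (fst w, snd w + q\<^sup>2 * (int i - int j)\<^sup>2))"
    unfolding corr_def sum_subtractf[symmetric] e_def by (intro sum.cong) (auto simp: algebra_simps)
  then have "\<bar>corr n1 n2 q (int i - int j) h0 k h2 - corr n1 n2 q (int i - int j) (\<lambda>w. h0 w * k w) (\<lambda>_. 1) h2\<bar> = \<bar>(\<Sum>w\<in>grid n1 n2. h0 w * (k (fst w + e, snd w) - k w) * h2 (fst w, snd w + q\<^sup>2 * (int i - int j)\<^sup>2))\<bar>" by (rule arg_cong)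
  also have "\<dots> \<le> (\<Sum>w\<in>grid n1 n2. of_bool (fst w \<in> ?X))"
  proof (intro order_trans[OF sum_abs] sum_mono)
    fix w assume w: "w \<in> grid n1 n2"
    let ?v = "h0 w * (k (fst w + e, snd w) - k w) * h2 (fst w, snd w + q\<^sup>2 * (int i - int j)\<^sup>2)"
    show "\<bar>?v\<bar> \<le> of_bool (fst w \<in> ?X)"
    proof (cases "fst w \<in> ?X")
      case True
      have "\<bar>k (fst w + e, snd w) - k w\<bar> \<le> 1" using kb(1,2)[of "(fst w + e, snd w)"] kb(1,2)[of w] by (simp add: abs_le_iff)
      then have "\<bar>h0 w\<bar> * \<bar>k (fst w + e, snd w) - k w\<bar> * \<bar>h2 (fst w, snd w + q\<^sup>2 * (int i - int j)\<^sup>2)\<bar> \<le> 1 * 1 * 1"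
        using b by (intro mult_mono) auto
      then show ?thesis using True by (simp add: abs_mult)
    next
      case False
      have fw: "fst w \<in> {1..n1}" "snd w \<in> {1..n2}" using w by (auto simp: grid_def)
      then have "fst w div S = (fst w + e) div S" "fst w + e \<in> {1..n1}" using False eD by auto
      moreover have "fst w mod q = (fst w + e) mod q" by (simp add: e_def)
      ultimately have "k w = k (fst w + e, snd w)" using fw w by (intro k) (auto simp: lab1_def grid_def)
      then show ?thesis by simp
    qed
  qed
  also have "\<dots> = real (card ?X) * real_of_int n2"
  proof -
    have "(\<Sum>w\<in>grid n1 n2. of_bool (fst w \<in> ?X)) = real (card (grid n1 n2 \<inter> {w. fst w \<in> ?X}))"
      by (simp add: of_bool_def sum.If_cases)
    also have "grid n1 n2 \<inter> {w. fst w \<in> ?X} = ?X \<times> {1..n2}" by (auto simp: grid_def)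
    finally show ?thesis using n by (simp add: card_cartesian_product)
  qed
  also have "\<dots> \<le> 12 * real_of_int (n1 * n2) / real G"
  proof -
    have "int G * int (card ?X) \<le> 12 * n1" by (rule card_crossing_grid_le) (use G S in \<open>auto simp: S_def\<close>)
    then have "real_of_int (int G * int (card ?X)) \<le> real_of_int (12 * n1)" by (simp only: of_int_le_iff)
    then have "real (card ?X) \<le> 12 * real_of_int n1 / real G" using G by (simp add: field_simps)
    then have "real (card ?X) * real_of_int n2 \<le> 12 * real_of_int n1 / real G * real_of_int n2" using n by (intro mult_right_mono) auto
    then show ?thesis by (simp add: mult_ac)
  qed
  finally show "\<bar>corr n1 n2 q (int i - int j) h0 k h2 - corr n1 n2 q (int i - int j) (\<lambda>w. h0 w * k w) (\<lambda>_. 1) h2\<bar> \<le> 12 * real_of_int (n1 * n2) / real G" .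
qed

text \<open>The same in the y-direction, where shifts are at most the square of \<open>D\<close> and
  blocks have length the square of \<open>S\<close>. With the constant in the second place, nothing
  depends on the difference any more, and the count becomes a single sum over the grid.\<close>

lemma invariance_2:
  fixes G D M :: nat and q :: int
  defines "S \<equiv> int G * int D"
  assumes n: "n1 \<ge> 1" "n2 \<ge> 1" and G: "G \<ge> 2" "D \<ge> 1" and S: "S\<^sup>2 \<le> n2" and q: "q \<ge> 1" "int D = q * int M" and M: "M > 0"
    and k: "\<And>w w'. w \<in> grid n1 n2 \<Longrightarrow> w' \<in> grid n1 n2 \<Longrightarrow> lab2 q S w = lab2 q S w' \<Longrightarrow> k w = k w'"
    and kb: "\<And>w. 0 \<le> k w" "\<And>w. k w \<le> 1" "\<And>w. w \<notin> grid n1 n2 \<Longrightarrow> k w = 0" and b: "\<And>w. \<bar>h0 w\<bar> \<le> 1"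
  shows "\<bar>Lam n1 n2 q M h0 (\<lambda>_. 1) k - (\<Sum>w\<in>grid n1 n2. h0 w * k w)\<bar> \<le> 12 * real_of_int (n1 * n2) / real G"
proof (rule Lam_diff_le[OF _ M])
  show "(\<Sum>j<M. \<Sum>i<M. (\<Sum>w\<in>grid n1 n2. h0 w * k w)) = real M ^ 2 * (\<Sum>w\<in>grid n1 n2. h0 w * k w)"
    by (simp add: power2_eq_square)
  fix i j assume ij: "i < M" "j < M"
  define e where "e = q\<^sup>2 * (int i - int j)\<^sup>2"
  let ?X = "{x\<in>{1..n2}. \<exists>e. \<bar>e\<bar> \<le> (int D)\<^sup>2 \<and> (x div S\<^sup>2 \<noteq> (x + e) div S\<^sup>2 \<or> x + e \<notin> {1..n2})}"
  have eD: "\<bar>e\<bar> \<le> (int D)\<^sup>2"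
  proof -
    have "\<bar>int i - int j\<bar>\<^sup>2 \<le> (int M)\<^sup>2" using ij by (intro power_mono) auto
    then have "q\<^sup>2 * \<bar>int i - int j\<bar>\<^sup>2 \<le> q\<^sup>2 * (int M)\<^sup>2" by (intro mult_left_mono) auto
    then show ?thesis using q by (simp add: e_def abs_mult power_mult_distrib)
  qed
  have "corr n1 n2 q (int i - int j) h0 (\<lambda>_. 1) k - (\<Sum>w\<in>grid n1 n2. h0 w * k w)
    = (\<Sum>w\<in>grid n1 n2. h0 w * (k (fst w, snd w + e) - k w))"
    unfolding corr_def sum_subtractf[symmetric] e_def by (intro sum.cong) (auto simp: algebra_simps)
  then have "\<bar>corr n1 n2 q (int i - int j) h0 (\<lambda>_. 1) k - (\<Sum>w\<in>grid n1 n2. h0 w * k w)\<bar> = \<bar>(\<Sum>w\<in>grid n1 n2. h0 w * (k (fst w, snd w + e) - k w))\<bar>" by (rule arg_cong)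
  also have "\<dots> \<le> (\<Sum>w\<in>grid n1 n2. of_bool (snd w \<in> ?X))"
  proof (intro order_trans[OF sum_abs] sum_mono)
    fix w assume w: "w \<in> grid n1 n2"
    let ?v = "h0 w * (k (fst w, snd w + e) - k w)"
    show "\<bar>?v\<bar> \<le> of_bool (snd w \<in> ?X)"
    proof (cases "snd w \<in> ?X")
      case True
      have "\<bar>k (fst w, snd w + e) - k w\<bar> \<le> 1" using kb(1,2)[of "(fst w, snd w + e)"] kb(1,2)[of w] by (simp add: abs_le_iff)
      then have "\<bar>h0 w\<bar> * \<bar>k (fst w, snd w + e) - k w\<bar> \<le> 1 * 1" using b by (intro mult_mono) auto
      then show ?thesis using True by (simp add: abs_mult)
    next
      case False
      have fw: "fst w \<in> {1..n1}" "snd w \<in> {1..n2}" using w by (auto simp: grid_def)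
      then have "snd w div S\<^sup>2 = (snd w + e) div S\<^sup>2" "snd w + e \<in> {1..n2}" using False eD by auto
      moreover have "snd w mod q\<^sup>2 = (snd w + e) mod q\<^sup>2" by (simp add: e_def)
      ultimately have "k w = k (fst w, snd w + e)" using fw w by (intro k) (auto simp: lab2_def grid_def)
      then show ?thesis by simp
    qed
  qed
  also have "\<dots> = real_of_int n1 * real (card ?X)"
  proof -
    have "(\<Sum>w\<in>grid n1 n2. of_bool (snd w \<in> ?X)) = real (card (grid n1 n2 \<inter> {w. snd w \<in> ?X}))"
      by (simp add: of_bool_def sum.If_cases)
    also have "grid n1 n2 \<inter> {w. snd w \<in> ?X} = {1..n1} \<times> ?X" by (auto simp: grid_def)
    finally show ?thesis using n by (simp add: card_cartesian_product)
  qed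
  also have "\<dots> \<le> 12 * real_of_int (n1 * n2) / real G"
  proof -
    have GG: "int G \<le> (int G)\<^sup>2" using G by (intro self_le_power) auto
    have GG2: "2 \<le> (int G)\<^sup>2" using G GG by linarith
    have DD: "1 \<le> (int D)\<^sup>2" using G by (simp add: one_le_power)
    have "(int G)\<^sup>2 * int (card ?X) \<le> 12 * n2"
      by (rule card_crossing_grid_le) (use S GG2 DD in \<open>simp_all add: S_def power_mult_distrib\<close>)
    then have "int G * int (card ?X) \<le> 12 * n2" using mult_right_mono[OF GG, of "int (card ?X)"] by linarith
    then have "real_of_int (int G * int (card ?X)) \<le> real_of_int (12 * n2)" by (simp only: of_int_le_iff)
    then have "real (card ?X) \<le> 12 * real_of_int n2 / real G" using G by (simp add: field_simps)
    then have "real_of_int n1 * real (card ?X) \<le> real_of_int n1 * (12 * real_of_int n2 / real G)" using n by (intro mult_left_mono) auto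
    then show ?thesis by (simp add: mult_ac)
  qed
  finally show "\<bar>corr n1 n2 q (int i - int j) h0 (\<lambda>_. 1) k - (\<Sum>w\<in>grid n1 n2. h0 w * k w)\<bar> \<le> 12 * real_of_int (n1 * n2) / real G" .
qed

text \<open>Two points of one fine cell: the congruence makes their distance a multiple of
  \<open>u * Q\<close>, and the common block of length \<open>u * v\<close> limits the number of
  steps.\<close>

lemma progression_step:
  fixes x x' u s :: int and c :: nat
  assumes "x mod (u * int c * Q) = x' mod (u * int c * Q)" "x div s = x' div s" "s > 0" "u > 0" "s = u * v" and p: "Q > 0" "c > 0"
  obtains r where "x' = x + u * (Q * r)" "\<bar>r\<bar> \<le> v"
proof -
  obtain t where t: "x' = x + u * int c * Q * t" using assms(1) by (metis add.commute mod_eqE)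
  have Z: "x' = x + u * (Q * (int c * t))" using t by (simp add: mult_ac)
  have d: "\<bar>x' - x\<bar> < s"
  proof -
    have "x div s * s = x' div s * s" by (simp only: assms(2))
    then show ?thesis unfolding abs_less_iff
      using div_mult_mod_eq[of x s] div_mult_mod_eq[of x' s] pos_mod_sign[OF assms(3), of x] pos_mod_sign[OF assms(3), of x']
        pos_mod_bound[OF assms(3), of x] pos_mod_bound[OF assms(3), of x'] by linarith
  qed
  show thesis
  proof (rule that[of "int c * t"])
    show "x' = x + u * (Q * (int c * t))" by (rule Z)
    have "u * 1 * \<bar>int c * t\<bar> \<le> u * Q * \<bar>int c * t\<bar>" using p assms by (intro mult_mono) auto
    also have "\<dots> = \<bar>x' - x\<bar>" using assms p by (simp add: t abs_mult)
    finally have "u * \<bar>int c * t\<bar> \<le> u * v" using d assms(5) by simp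
    then show "\<bar>int c * t\<bar> \<le> v" using assms(4) by (simp only: mult_le_cancel_left_pos)
  qed
qed

section \<open>Energy increment\<close>

lemma Lam_add_1: "Lam n1 n2 q M h0 (\<lambda>w. h1 w + h1' w) h2 = Lam n1 n2 q M h0 h1 h2 + Lam n1 n2 q M h0 h1' h2"
  by (simp add: Lam_def corr_def add_divide_distrib ring_distribs sum.distrib)

lemma Lam_add_2: "Lam n1 n2 q M h0 h1 (\<lambda>w. h2 w + h2' w) = Lam n1 n2 q M h0 h1 h2 + Lam n1 n2 q M h0 h1 h2'"
  by (simp add: Lam_def corr_def add_divide_distrib ring_distribs sum.distrib)

lemma cexp_energy_mono:
  assumes "finite B" "\<And>x. x \<in> B \<Longrightarrow> \<phi>1 x = \<rho> (\<phi>2 x)"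
  shows "(\<Sum>x\<in>B. cexp B \<phi>1 f x ^ 2) \<le> (\<Sum>x\<in>B. cexp B \<phi>2 f x ^ 2)"
proof -
  have "0 \<le> (\<Sum>x\<in>B. (cexp B \<phi>2 f x - cexp B \<phi>1 f x) ^ 2)" by (rule sum_nonneg) simp
  also have "\<dots> = (\<Sum>x\<in>B. cexp B \<phi>2 f x ^ 2) - (\<Sum>x\<in>B. cexp B \<phi>1 f x ^ 2)"
    by (rule cexp_energy[OF assms(1), where \<rho> = \<rho>]) (rule assms(2))
  finally show ?thesis by simp
qed

lemma lab1_refine:
  assumes "q dvd q'" "S = S' * c" "S' > 0" "c > 0"
  shows "lab1 q S w = (\<lambda>(a, b, y). (a mod q, b div c, y)) (lab1 q' S' w)"
  using label_refine[OF assms, of "fst w"] by (simp add: lab1_def)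

lemma lab2_refine:
  assumes "q dvd q'" "S = S' * c" "S' > 0" "c > 0"
  shows "lab2 q S w = (\<lambda>(a, b, y). (a mod q\<^sup>2, b div c\<^sup>2, y)) (lab2 q' S' w)"
  using label_refine[of "q\<^sup>2" "q'\<^sup>2" "S\<^sup>2" "S'\<^sup>2" "c\<^sup>2" "snd w"] assms
  by (simp add: lab2_def power_mult_distrib)

text \<open>The cells have difference \<open>q\<close> and block length \<open>S = G * D\<close>,
  where \<open>D = q * M\<close> with \<open>M = G ^ 2 * p\<close> bounds the shifts in x. The
  inverse theorem gives progressions of step \<open>q * a_Q K\<close> and of length at least
  \<open>G * p\<close>. The next level has difference \<open>G * q\<close>, a multiple of this step,
  and blocks of length \<open>q * p\<close>, short compared with those progressions. In y all step
  sizes and block lengths are squared.\<close>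

lemma level_step:
  fixes n1 n2 :: int and K G g g' q p :: nat and f :: "int \<times> int \<Rightarrow> real"
  defines "B \<equiv> grid n1 n2"
  defines "S \<equiv> G ^ 3 * q * p"
  defines "\<Pi>1 \<equiv> cexp B (lab1 (int q) (int S)) f"
  defines "\<Pi>2 \<equiv> cexp B (lab2 (int q) (int S)) f"
  defines "\<Pi>1' \<equiv> cexp B (lab1 (int (G * q)) (int (q * p))) f"
  defines "\<Pi>2' \<equiv> cexp B (lab2 (int (G * q)) (int (q * p))) f"
  assumes n: "n1 \<ge> 1" "n2 \<ge> 1" and f: "\<And>w. w \<notin> grid n1 n2 \<Longrightarrow> f w = 0" "\<And>w. 0 \<le> f w" "\<And>w. f w \<le> 1"
    and K: "K \<ge> 1" and G: "G = a_E K * g" "G = a_Q K * g'" "a_T K \<le> G" "2 * a_C K \<le> G" "3 * K \<le> G" "G \<ge> 2"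
    and qp: "q \<ge> 1" "p \<ge> 1" and S: "int S \<le> n1" "(int S)\<^sup>2 \<le> n2"
  shows "Lam n1 n2 (int q) (G ^ 2 * p) f f f \<ge> (\<Sum>w\<in>B. f w * \<Pi>1 w * \<Pi>2 w) - 16 * real_of_int (n1 * n2) / real K \<or>
    (\<Sum>w\<in>B. \<Pi>1' w ^ 2) + (\<Sum>w\<in>B. \<Pi>2' w ^ 2) \<ge> (\<Sum>w\<in>B. \<Pi>1 w ^ 2) + (\<Sum>w\<in>B. \<Pi>2 w ^ 2) + real_of_int (n1 * n2) / real (a_C K) ^ 2"
proof -
  define M D \<sigma> where "M = G ^ 2 * p" and "D = q * M" and "\<sigma> = g * G * p"
  let ?n = "real_of_int (n1 * n2)" and ?C = "real (a_C K)" and ?L = "Lam n1 n2 (int q) M"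
  note ap = a_pos[OF K]
  have n0: "?n > 0" using n by simp
  have fB: "finite B" by (simp add: B_def)
  have cB: "real (card B) = ?n" using card_grid[OF n] by (simp add: B_def)
  have "a_E K * g > 0" "a_Q K * g' > 0" using G(6) unfolding G(1)[symmetric] G(2)[symmetric] by linarith+
  then have g: "g \<ge> 1" "g' \<ge> 1" by (simp_all add: Suc_le_eq)
  have SD: "S = G * D" by (simp add: S_def D_def M_def power3_eq_cube power2_eq_square)
  have M0: "M > 0" using G(6) qp by (simp add: M_def)
  have D1: "D \<ge> 1" using M0 qp by (simp add: D_def)
  have DS: "D \<le> S" using mult_right_mono[of 1 G D] G(6) by (simp add: SD)
  have M\<sigma>: "M = a_E K * \<sigma>"
  proof -
    have "M = G * (G * p)" by (simp add: M_def power2_eq_square)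
    also have "\<dots> = (a_E K * g) * (G * p)" using G(1) by simp
    finally show ?thesis by (simp add: \<sigma>_def mult.assoc)
  qed
  have Gs: "G * p \<le> \<sigma>" using g by (simp add: \<sigma>_def mult.assoc)
  have pG: "G \<le> G * p" using qp by simp
  have T\<sigma>: "a_T K \<le> \<sigma>" using G(3) Gs pG by linarith
  have \<sigma>0: "\<sigma> > 0" using Gs pG G(6) by linarith
  have q1: "int q \<ge> 1" using qp by simp
  have qM: "int q * int M \<le> n1"
  proof -
    have "int q * int M = int D" by (simp add: D_def)
    also have "\<dots> \<le> int S" using DS by simp
    finally show ?thesis using S(1) by linarith
  qed
  have qM2: "(int q)\<^sup>2 * (int M)\<^sup>2 \<le> n2"
  proof -
    have "(int q)\<^sup>2 * (int M)\<^sup>2 = (int D)\<^sup>2" by (simp add: D_def power_mult_distrib)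
    also have "\<dots> \<le> (int S)\<^sup>2" using DS by (intro power_mono) auto
    finally show ?thesis using S(2) by linarith
  qed
  have Pb: "0 \<le> \<Pi>1 w" "\<Pi>1 w \<le> 1" "0 \<le> \<Pi>2 w" "\<Pi>2 w \<le> 1" for w
    unfolding \<Pi>1_def \<Pi>2_def by (intro cexp_bounds fB f(2,3))+
  have Ps: "\<Pi>1 w = 0" "\<Pi>2 w = 0" if "w \<notin> grid n1 n2" for w using that by (simp_all add: \<Pi>1_def \<Pi>2_def cexp_def B_def)
  have iS: "int S = int G * int D" by (simp add: SD)
  have "\<bar>?L f \<Pi>1 f - ?L (\<lambda>w. f w * \<Pi>1 w) (\<lambda>_. 1) f\<bar> \<le> 12 * ?n / real G"
  proof (rule invariance_1[OF n G(6) D1 _ q1 _ M0 _ Pb(1,2) Ps(1)])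
    show "int G * int D \<le> n1" using S(1) by (simp add: iS)
    show "int D = int q * int M" by (simp add: D_def)
    show "\<Pi>1 w = \<Pi>1 w'" if "w \<in> grid n1 n2" "w' \<in> grid n1 n2" "lab1 (int q) (int G * int D) w = lab1 (int q) (int G * int D) w'" for w w'
      using that by (simp add: \<Pi>1_def cexp_def B_def iS)
  qed (use f in auto)
  moreover have "\<bar>?L (\<lambda>w. f w * \<Pi>1 w) (\<lambda>_. 1) \<Pi>2 - (\<Sum>w\<in>grid n1 n2. f w * \<Pi>1 w * \<Pi>2 w)\<bar> \<le> 12 * ?n / real G"
  proof (rule invariance_2[OF n G(6) D1 _ q1 _ M0 _ Pb(3,4) Ps(2)])
    show "(int G * int D)\<^sup>2 \<le> n2" using S(2) by (simp add: iS)
    show "int D = int q * int M" by (simp add: D_def)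
    show "\<Pi>2 w = \<Pi>2 w'" if "w \<in> grid n1 n2" "w' \<in> grid n1 n2" "lab2 (int q) (int G * int D) w = lab2 (int q) (int G * int D) w'" for w w'
      using that by (simp add: \<Pi>2_def cexp_def B_def iS)
    show "\<bar>f w * \<Pi>1 w\<bar> \<le> 1" for w using f Pb by (simp add: abs_mult mult_le_one)
  qed
  moreover have "12 * ?n / real G \<le> 4 * ?n / real K"
  proof -
    have "real (3 * K) \<le> real G" using G(5) by (simp only: of_nat_le_iff)
    then have "12 * ?n / real G \<le> 12 * ?n / real (3 * K)" using K n0 by (intro divide_left_mono) auto
    then show ?thesis by simp
  qed
  moreover have "?L f f f = ?L f (\<lambda>w. f w - \<Pi>1 w) f + ?L f \<Pi>1 f"
    using Lam_add_1[of n1 n2 "int q" M f "\<lambda>w. f w - \<Pi>1 w" \<Pi>1 f] by simp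
  moreover have "?L (\<lambda>w. f w * \<Pi>1 w) (\<lambda>_. 1) f = ?L (\<lambda>w. f w * \<Pi>1 w) (\<lambda>_. 1) (\<lambda>w. f w - \<Pi>2 w) + ?L (\<lambda>w. f w * \<Pi>1 w) (\<lambda>_. 1) \<Pi>2"
    using Lam_add_2[of n1 n2 "int q" M "\<lambda>w. f w * \<Pi>1 w" "\<lambda>_. 1" "\<lambda>w. f w - \<Pi>2 w" \<Pi>2] by simp
  moreover have "16 * ?n / real K = 4 * (4 * ?n / real K)" by simp
  \<comment> \<open>The difference between the count and the main term consists of two invariance
    errors, each at most \<open>4 * ?n / K\<close>, and of correlations with
    \<open>f - \<Pi>1\<close> and with \<open>f - \<Pi>2\<close>. If the count is too small by more
    than \<open>16 * ?n / K\<close>, one of these two correlations is large.\<close>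
  ultimately consider (ok) "?L f f f \<ge> (\<Sum>w\<in>B. f w * \<Pi>1 w * \<Pi>2 w) - 16 * ?n / real K"
    | (one) "\<bar>?L f (\<lambda>w. f w - \<Pi>1 w) f\<bar> \<ge> 4 * ?n / real K" | (two) "\<bar>?L (\<lambda>w. f w * \<Pi>1 w) (\<lambda>_. 1) (\<lambda>w. f w - \<Pi>2 w)\<bar> \<ge> 4 * ?n / real K"
    unfolding B_def by linarith
  then show ?thesis
  proof cases
    case ok
    then show ?thesis by (simp add: M_def)
  next
    case one
    interpret two_actions "torus n1 n2" "Tq n1 (int q)" "Sq n2 (int q)" by (rule two_actions_torus[OF n])
    have sub: "B \<subseteq> torus n1 n2" using n by (auto simp: B_def grid_def torus_def)
    let ?h = "\<lambda>w. f w - \<Pi>1 w"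
    have hb: "\<bar>?h w\<bar> \<le> 1" for w using f(2,3)[of w] Pb(1,2)[of w] by (simp add: abs_le_iff)
    have hs: "?h w = 0" if "w \<notin> grid n1 n2" for w using that f Ps by simp
    have fb: "\<bar>f w\<bar> \<le> 1" for w using f by simp
    have big: "real \<sigma> * (2 * (?n / ?C)) \<le> (\<Sum>w\<in>torus n1 n2. norm (\<Sum>e<\<sigma>. complex_of_real (?h (Tq n1 (int q) (int (a_Q K) * int e) w))))"
      by (rule Lam_inverse_1[OF n q1 qM qM2 f(1) hs f(1) fb hb fb K T\<sigma> M\<sigma> one])
    obtain l :: "int \<times> int \<times> int \<Rightarrow> complex" where l: "\<And>x. norm (l x) \<le> real \<sigma>" "norm (\<Sum>w\<in>B. ?h w *\<^sub>R l (lab1 (int (G * q)) (int (q * p)) w)) \<ge> real \<sigma> * (?n / ?C)"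
    proof (rule inverse_to_cells[OF sub _ hb big])
      show "?h w = 0" if "w \<notin> B" for w using hs that by (simp add: B_def)
      fix w w' assume w: "w \<in> B" "w' \<in> B" "lab1 (int (G * q)) (int (q * p)) w = lab1 (int (G * q)) (int (q * p)) w'"
      have e: "int q * int g' * int (a_Q K) = int (G * q)" unfolding G(2) by simp
      obtain r where r: "fst w' = fst w + int q * (int (a_Q K) * r)" "\<bar>r\<bar> \<le> int p"
      proof (rule progression_step[of "fst w" "int q" g' "int (a_Q K)" "fst w'" "int (q * p)" "int p"])
        show "fst w mod (int q * int g' * int (a_Q K)) = fst w' mod (int q * int g' * int (a_Q K))" "fst w div int (q * p) = fst w' div int (q * p)"
          using w(3) by (simp_all only: e lab1_def prod.inject)
      qed (use qp g ap in auto)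
      have "w' = Tq n1 (int q) (int (a_Q K) * r) w"
      proof -
        have "sh (2 * n1) (int q * (int (a_Q K) * r)) (fst w) = fst w'"
          unfolding r(1) by (rule sh_eq) (use w r in \<open>auto simp: B_def grid_def\<close>)
        moreover have "snd w' = snd w" using w(3) by (simp add: lab1_def)
        ultimately show ?thesis by (simp add: Tq_def prod_eq_iff)
      qed
      moreover have "2 * \<bar>real_of_int r\<bar> \<le> 2 * real p"
      proof -
        have "real_of_int \<bar>r\<bar> \<le> real_of_int (int p)" using r(2) by (simp only: of_int_le_iff)
        then show ?thesis by simp
      qed
      ultimately show "\<exists>r. w' = Tq n1 (int q) (int (a_Q K) * r) w \<and> 2 * \<bar>real_of_int r\<bar> \<le> 2 * real p" by blast
    next
      have "2 * a_C K * p \<le> \<sigma>" using mult_right_mono[OF G(4), of p] Gs by linarith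
      then have "real (2 * a_C K * p) \<le> real \<sigma>" by (simp only: of_nat_le_iff)
      then have "2 * real p \<le> real \<sigma> / ?C" using ap by (simp add: field_simps)
      then have "2 * real p * ?n \<le> real \<sigma> / ?C * ?n" using n0 by (intro mult_right_mono) auto
      then show "2 * real p * real (card B) \<le> real \<sigma> * (?n / ?C)" unfolding cB by simp
    qed (rule that)
    have "(\<Sum>w\<in>B. \<Pi>1' w ^ 2) \<ge> (\<Sum>w\<in>B. \<Pi>1 w ^ 2) + real (card B) * (1 / ?C) ^ 2"
      unfolding \<Pi>1'_def \<Pi>1_def
    proof (rule cexp_diff_large[OF fB _ l(1)])
      show "lab1 (int q) (int S) w = (\<lambda>(a, b, y). (a mod int q, b div (int G ^ 3), y)) (lab1 (int (G * q)) (int (q * p)) w)" for w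
        by (rule lab1_refine) (use qp G(6) in \<open>auto simp: S_def\<close>)
      show "real \<sigma> * (real (card B) * (1 / ?C)) \<le> norm (\<Sum>x\<in>B. (f x - cexp B (lab1 (int q) (int S)) f x) *\<^sub>R l (lab1 (int (G * q)) (int (q * p)) x))"
        using l(2) unfolding cB \<Pi>1_def by simp
    qed (use \<sigma>0 in auto)
    moreover have "(\<Sum>w\<in>B. \<Pi>2 w ^ 2) \<le> (\<Sum>w\<in>B. \<Pi>2' w ^ 2)"
      unfolding \<Pi>2'_def \<Pi>2_def
    proof (rule cexp_energy_mono[OF fB])
      show "lab2 (int q) (int S) w = (\<lambda>(a, b, y). (a mod (int q)\<^sup>2, b div (int G ^ 3)\<^sup>2, y)) (lab2 (int (G * q)) (int (q * p)) w)" for w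
        by (rule lab2_refine) (use qp G(6) in \<open>auto simp: S_def\<close>)
    qed
    moreover have "real (card B) * (1 / ?C) ^ 2 = ?n / ?C ^ 2" unfolding cB by (simp add: power_divide)
    ultimately show ?thesis by linarith
  next
    case two
    interpret two_actions "torus n1 n2" "Sq n2 (int q)" "Tq n1 (int q)"
      by (rule two_actions.two_actions_swap[OF two_actions_torus[OF n]])
    have sub: "B \<subseteq> torus n1 n2" using n by (auto simp: B_def grid_def torus_def)
    let ?h = "\<lambda>w. f w - \<Pi>2 w"
    define \<tau> where "\<tau> = (a_t K * \<sigma>) ^ 2"
    have hb: "\<bar>?h w\<bar> \<le> 1" for w using f(2,3)[of w] Pb(3,4)[of w] by (simp add: abs_le_iff)
    have hs: "?h w = 0" if "w \<notin> grid n1 n2" for w using that f Ps by simp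
    have fb: "\<bar>f w * \<Pi>1 w\<bar> \<le> 1" for w using f Pb by (simp add: abs_mult mult_le_one)
    have fs: "f w * \<Pi>1 w = 0" if "w \<notin> grid n1 n2" for w using that f by simp
    have big: "real \<tau> * (2 * (?n / ?C)) \<le> (\<Sum>w\<in>torus n1 n2. norm (\<Sum>e<\<tau>. complex_of_real (?h (Sq n2 (int q) (int (a_Q K) * int e) w))))"
      unfolding \<tau>_def by (rule Lam_inverse_2[OF n q1 qM qM2 fs hs fb hb K T\<sigma> M\<sigma> two])
    have \<tau>: "2 * a_C K * p ^ 2 \<le> \<tau>" "\<tau> > 0"
    proof -
      have "G * p \<le> a_t K * \<sigma>" using Gs mult_right_mono[of 1 "a_t K" \<sigma>] ap(3) by linarith
      then have "(G * p) ^ 2 \<le> \<tau>" unfolding \<tau>_def by (intro power_mono) auto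
      moreover have "2 * a_C K * p ^ 2 \<le> G ^ 2 * p ^ 2" using G(4) self_le_power[of G 2] G(6) by (intro mult_right_mono) auto
      ultimately show "2 * a_C K * p ^ 2 \<le> \<tau>" unfolding power_mult_distrib by linarith
      show "\<tau> > 0" using \<sigma>0 ap by (simp add: \<tau>_def)
    qed
    obtain l :: "int \<times> int \<times> int \<Rightarrow> complex" where l: "\<And>x. norm (l x) \<le> real \<tau>" "norm (\<Sum>w\<in>B. ?h w *\<^sub>R l (lab2 (int (G * q)) (int (q * p)) w)) \<ge> real \<tau> * (?n / ?C)"
    proof (rule inverse_to_cells[OF sub _ hb big])
      show "?h w = 0" if "w \<notin> B" for w using hs that by (simp add: B_def)
      fix w w' assume w: "w \<in> B" "w' \<in> B" "lab2 (int (G * q)) (int (q * p)) w = lab2 (int (G * q)) (int (q * p)) w'"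
      have e: "(int q)\<^sup>2 * int (G * g') * int (a_Q K) = (int (G * q))\<^sup>2"
      proof -
        have "(int (G * q))\<^sup>2 = (int q)\<^sup>2 * (int G * int G)" by (simp add: power2_eq_square)
        also have "int G * int G = int G * int (a_Q K * g')" using G(2) by simp
        finally show ?thesis by simp
      qed
      obtain r where r: "snd w' = snd w + (int q)\<^sup>2 * (int (a_Q K) * r)" "\<bar>r\<bar> \<le> (int p)\<^sup>2"
      proof (rule progression_step[of "snd w" "(int q)\<^sup>2" "G * g'" "int (a_Q K)" "snd w'" "(int (q * p))\<^sup>2" "(int p)\<^sup>2"])
        show "snd w mod ((int q)\<^sup>2 * int (G * g') * int (a_Q K)) = snd w' mod ((int q)\<^sup>2 * int (G * g') * int (a_Q K))" "snd w div (int (q * p))\<^sup>2 = snd w' div (int (q * p))\<^sup>2"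
          using w(3) by (simp_all only: e lab2_def prod.inject)
      qed (use qp g ap G(6) in \<open>auto simp: power_mult_distrib\<close>)
      have "w' = Sq n2 (int q) (int (a_Q K) * r) w"
      proof -
        have "sh (2 * n2) ((int q)\<^sup>2 * (int (a_Q K) * r)) (snd w) = snd w'"
          unfolding r(1) by (rule sh_eq) (use w r in \<open>auto simp: B_def grid_def\<close>)
        moreover have "fst w' = fst w" using w(3) by (simp add: lab2_def)
        ultimately show ?thesis by (simp add: Sq_def prod_eq_iff)
      qed
      moreover have "2 * \<bar>real_of_int r\<bar> \<le> 2 * real p ^ 2"
      proof -
        have "real_of_int \<bar>r\<bar> \<le> real_of_int ((int p)\<^sup>2)" using r(2) by (simp only: of_int_le_iff)
        then show ?thesis by simp
      qed
      ultimately show "\<exists>r. w' = Sq n2 (int q) (int (a_Q K) * r) w \<and> 2 * \<bar>real_of_int r\<bar> \<le> 2 * real p ^ 2" by blast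
    next
      have "real (2 * a_C K * p ^ 2) \<le> real \<tau>" using \<tau>(1) by (simp only: of_nat_le_iff)
      then have "2 * real p ^ 2 \<le> real \<tau> / ?C" using ap by (simp add: field_simps)
      then have "2 * real p ^ 2 * ?n \<le> real \<tau> / ?C * ?n" using n0 by (intro mult_right_mono) auto
      then show "2 * real p ^ 2 * real (card B) \<le> real \<tau> * (?n / ?C)" unfolding cB by simp
    qed (rule that)
    have "(\<Sum>w\<in>B. \<Pi>2' w ^ 2) \<ge> (\<Sum>w\<in>B. \<Pi>2 w ^ 2) + real (card B) * (1 / ?C) ^ 2"
      unfolding \<Pi>2'_def \<Pi>2_def
    proof (rule cexp_diff_large[OF fB _ l(1)])
      show "lab2 (int q) (int S) w = (\<lambda>(a, b, y). (a mod (int q)\<^sup>2, b div (int G ^ 3)\<^sup>2, y)) (lab2 (int (G * q)) (int (q * p)) w)" for w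
        by (rule lab2_refine) (use qp G(6) in \<open>auto simp: S_def\<close>)
      show "real \<tau> * (real (card B) * (1 / ?C)) \<le> norm (\<Sum>x\<in>B. (f x - cexp B (lab2 (int q) (int S)) f x) *\<^sub>R l (lab2 (int (G * q)) (int (q * p)) x))"
        using l(2) unfolding cB \<Pi>2_def by simp
    qed (use \<tau>(2) in auto)
    moreover have "(\<Sum>w\<in>B. \<Pi>1 w ^ 2) \<le> (\<Sum>w\<in>B. \<Pi>1' w ^ 2)"
      unfolding \<Pi>1'_def \<Pi>1_def
    proof (rule cexp_energy_mono[OF fB])
      show "lab1 (int q) (int S) w = (\<lambda>(a, b, y). (a mod int q, b div (int G ^ 3), y)) (lab1 (int (G * q)) (int (q * p)) w)" for w
        by (rule lab1_refine) (use qp G(6) in \<open>auto simp: S_def\<close>)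
    qed
    moreover have "real (card B) * (1 / ?C) ^ 2 = ?n / ?C ^ 2" unfolding cB by (simp add: power_divide)
    ultimately show ?thesis by linarith
  qed
qed

text \<open>The energies of both partitions together never exceed \<open>2 * n1 * n2\<close>, and
  each level that fails adds \<open>n1 * n2 / a_C K ^ 2\<close>, so failure cannot persist through
  all levels up to \<open>2 * a_C K ^ 2\<close>. Level \<open>i\<close> has difference
  \<open>G ^ i\<close> and block length \<open>G ^ (m - 3 * i)\<close>.\<close>

lemma exists_level:
  fixes K G g g' m :: nat and f :: "int \<times> int \<Rightarrow> real"
  assumes n: "n1 \<ge> 1" "n2 \<ge> 1" and f: "\<And>w. w \<notin> grid n1 n2 \<Longrightarrow> f w = 0" "\<And>w. 0 \<le> f w" "\<And>w. f w \<le> 1"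
    and K: "K \<ge> 1" and G: "G = a_E K * g" "G = a_Q K * g'" "a_T K \<le> G" "2 * a_C K \<le> G" "3 * K \<le> G" "G \<ge> 2"
    and m: "m \<ge> 8 * a_C K ^ 2 + 3" "int (G ^ m) \<le> n1" "(int (G ^ m))\<^sup>2 \<le> n2"
  shows "\<exists>i\<le>2 * a_C K ^ 2. Lam n1 n2 (int (G ^ i)) (G ^ (m - 4 * i - 1)) f f f
    \<ge> (\<Sum>w\<in>grid n1 n2. f w) ^ 3 / real_of_int (n1 * n2) ^ 2 - 16 * real_of_int (n1 * n2) / real K"
proof (rule ccontr)
  assume neg: "\<not> ?thesis"
  let ?B = "grid n1 n2" and ?n = "real_of_int (n1 * n2)" and ?C = "real (a_C K)" and ?I = "2 * a_C K ^ 2"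
  define P1 where "P1 i = cexp ?B (lab1 (int (G ^ i)) (int (G ^ (m - 3 * i)))) f" for i
  define P2 where "P2 i = cexp ?B (lab2 (int (G ^ i)) (int (G ^ (m - 3 * i)))) f" for i
  define En where "En i = (\<Sum>w\<in>?B. P1 i w ^ 2) + (\<Sum>w\<in>?B. P2 i w ^ 2)" for i
  have n0: "?n > 0" using n by simp
  have C0: "?C > 0" using a_pos[OF K] by simp
  have Bne: "?B \<noteq> {}" using n by (auto simp: grid_def)
  have cB: "real (card ?B) = ?n" by (rule card_grid[OF n])
  have step: "En (Suc i) \<ge> En i + ?n / ?C ^ 2" if i: "i \<le> ?I" for i
  proof -
    have mi: "4 * i + 3 \<le> m" using i m(1) by linarith
    let ?q = "G ^ i" and ?p = "G ^ (m - 4 * i - 3)"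
    \<comment> \<open>From one level to the next \<open>q\<close> gains a factor \<open>G\<close>
      and the block length loses \<open>G ^ 3\<close>, so \<open>p\<close> loses
      \<open>G ^ 4\<close>. The lower bound on \<open>m\<close> keeps the subtractions of naturals
      exact.\<close>
    have e: "3 + i + (m - 4 * i - 3) = m - 3 * i" "i + (m - 4 * i - 3) = m - 3 * Suc i" "2 + (m - 4 * i - 3) = m - 4 * i - 1"
    proof -
      obtain k where "m = 4 * i + 3 + k" using mi by (rule less_eqE)
      then show "3 + i + (m - 4 * i - 3) = m - 3 * i" "i + (m - 4 * i - 3) = m - 3 * Suc i" "2 + (m - 4 * i - 3) = m - 4 * i - 1" by simp_all
    qed
    have S: "G ^ 3 * ?q * ?p = G ^ (m - 3 * i)" by (simp only: power_add[symmetric] e)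
    have S': "?q * ?p = G ^ (m - 3 * Suc i)" by (simp only: power_add[symmetric] e)
    have M: "G ^ 2 * ?p = G ^ (m - 4 * i - 1)" by (simp only: power_add[symmetric] e)
    have qS: "G * ?q = G ^ Suc i" by simp
    have le: "G ^ (m - 3 * i) \<le> G ^ m" using G(6) by (intro power_increasing) auto
    have "int (G ^ 3 * ?q * ?p) \<le> int (G ^ m)" unfolding S using le by (simp only: of_nat_le_iff)
    then have S1: "int (G ^ 3 * ?q * ?p) \<le> n1" using m(2) by linarith
    have "(int (G ^ 3 * ?q * ?p))\<^sup>2 \<le> (int (G ^ m))\<^sup>2" unfolding S using le by (intro power_mono) (simp_all only: of_nat_le_iff of_nat_0_le_iff)
    then have S2: "(int (G ^ 3 * ?q * ?p))\<^sup>2 \<le> n2" using m(3) by linarith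
    have q1: "?q \<ge> 1" "?p \<ge> 1" using G(6) by (simp_all add: one_le_power)
    from level_step[where f = f, OF n f K G q1 S1 S2, unfolded S S' M qS, folded P1_def P2_def]
    have "Lam n1 n2 (int ?q) (G ^ (m - 4 * i - 1)) f f f \<ge> (\<Sum>w\<in>?B. f w * P1 i w * P2 i w) - 16 * ?n / real K \<or> En (Suc i) \<ge> En i + ?n / ?C ^ 2"
      unfolding En_def .
    moreover have "(\<Sum>w\<in>?B. f w) ^ 3 / ?n ^ 2 \<le> (\<Sum>w\<in>?B. f w * P1 i w * P2 i w)"
      using cexp_triple_ge[where f = f, OF finite_grid Bne f(2)] unfolding P1_def P2_def cB by blast
    moreover have "\<not> Lam n1 n2 (int ?q) (G ^ (m - 4 * i - 1)) f f f \<ge> (\<Sum>w\<in>?B. f w) ^ 3 / ?n ^ 2 - 16 * ?n / real K"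
      using neg i by blast
    ultimately show ?thesis by linarith
  qed
  have grow: "En i \<ge> real i * (?n / ?C ^ 2)" if "i \<le> Suc ?I" for i
    using that
  proof (induction i)
    case 0
    show ?case by (simp add: En_def sum_nonneg)
  next
    case (Suc i)
    then have "En i \<ge> real i * (?n / ?C ^ 2)" "En (Suc i) \<ge> En i + ?n / ?C ^ 2" using step[of i] by auto
    moreover have "real (Suc i) * (?n / ?C ^ 2) = real i * (?n / ?C ^ 2) + ?n / ?C ^ 2" by (simp only: of_nat_Suc distrib_right mult_1 add.commute)
    ultimately show ?case by linarith
  qed
  have "real (Suc ?I) * (?n / ?C ^ 2) > 2 * ?n"
  proof -
    have "2 * ?n = real ?I * (?n / ?C ^ 2)" using C0 by simp
    also have "\<dots> < real (Suc ?I) * (?n / ?C ^ 2)" using n0 C0 by (intro mult_strict_right_mono divide_pos_pos) auto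
    finally show ?thesis .
  qed
  moreover have "En (Suc ?I) \<le> 2 * ?n"
  proof -
    have "cexp ?B \<phi> f w ^ 2 \<le> 1" for \<phi> :: "int \<times> int \<Rightarrow> int \<times> int \<times> int" and w
      by (intro power_le_one cexp_bounds finite_grid f(2,3))
    then have "(\<Sum>w\<in>?B. cexp ?B \<phi> f w ^ 2) \<le> (\<Sum>w\<in>?B. 1)" for \<phi> :: "int \<times> int \<Rightarrow> int \<times> int \<times> int"
      by (intro sum_mono)
    then have "(\<Sum>w\<in>?B. cexp ?B \<phi> f w ^ 2) \<le> ?n" for \<phi> :: "int \<times> int \<Rightarrow> int \<times> int \<times> int"
      by (simp add: cB)
    from add_mono[OF this this] show ?thesis unfolding En_def P1_def P2_def by simp
  qed
  ultimately show False using grow[of "Suc ?I"] by simp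
qed

section \<open>Size of the constants\<close>

text \<open>Starting at \<open>K = 2\<close> makes numerical constants powers of \<open>K\<close> as
  well.\<close>

definition poly_bd :: "(nat \<Rightarrow> nat) \<Rightarrow> bool" where
  "poly_bd f \<longleftrightarrow> (\<exists>c. \<forall>K\<ge>2. f K \<le> K ^ c)"

text \<open>The class is closed under sums, products, powers with \<open>poly_bd\<close> exponents
  and factorials of \<open>poly_bd\<close> arguments. A factorial of an argument of exponential size
  would leave it, so the argument of every factorial among the constants has to be polynomial in
  \<open>K\<close>.\<close>

definition exp_bd :: "(nat \<Rightarrow> nat) \<Rightarrow> bool" where
  "exp_bd f \<longleftrightarrow> (\<exists>c::nat. \<forall>K\<ge>2. real (f K) \<le> exp (real K ^ c))"

lemma poly_bd_const: "poly_bd (\<lambda>K. n)"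
  unfolding poly_bd_def
proof (intro exI allI impI)
  fix K :: nat assume "K \<ge> 2"
  have "n \<le> 2 ^ n" by (rule less_imp_le) simp
  also have "\<dots> \<le> K ^ n" using \<open>K \<ge> 2\<close> by (rule power_mono) simp
  finally show "n \<le> K ^ n" .
qed

lemma poly_bd_id: "poly_bd (\<lambda>K. K)"
  unfolding poly_bd_def by (intro exI[of _ 1]) simp

lemma poly_bd_mult: assumes "poly_bd f" "poly_bd g" shows "poly_bd (\<lambda>K. f K * g K)"
proof -
  obtain a b where "\<forall>K\<ge>2. f K \<le> K ^ a" "\<forall>K\<ge>2. g K \<le> K ^ b" using assms unfolding poly_bd_def by blast
  then have "\<forall>K\<ge>2. f K * g K \<le> K ^ (a + b)" by (simp add: power_add mult_mono)
  then show ?thesis unfolding poly_bd_def by blast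
qed

lemma poly_bd_power: assumes "poly_bd f" shows "poly_bd (\<lambda>K. f K ^ n)"
proof -
  obtain a where "\<forall>K\<ge>2. f K \<le> K ^ a" using assms unfolding poly_bd_def by blast
  then have "\<forall>K\<ge>2. f K ^ n \<le> K ^ (a * n)" by (simp add: power_mult power_mono)
  then show ?thesis unfolding poly_bd_def by blast
qed

lemma poly_bd_square: assumes "poly_bd f" shows "poly_bd (\<lambda>K. f (K ^ 2))"
proof -
  obtain a where a: "\<forall>K\<ge>2. f K \<le> K ^ a" using assms unfolding poly_bd_def by blast
  have "f (K ^ 2) \<le> K ^ (2 * a)" if "K \<ge> 2" for K
  proof -
    have "K \<le> K ^ 2" using that by (intro self_le_power) auto
    then show ?thesis using a that by (simp add: power_mult)
  qed
  then show ?thesis unfolding poly_bd_def by blast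
qed

lemma power_sum_le:
  fixes K :: real
  assumes "K \<ge> 2"
  shows "K ^ a + K ^ b \<le> K ^ (a + b + 1)"
proof -
  have 1: "1 \<le> K ^ a" "1 \<le> K ^ b" using assms by (auto intro: one_le_power)
  then have "K ^ a * 1 \<le> K ^ a * K ^ b" "1 * K ^ b \<le> K ^ a * K ^ b" by (intro mult_mono; simp)+
  then have "K ^ a + K ^ b \<le> 2 * (K ^ a * K ^ b)" by simp
  also have "\<dots> \<le> K * (K ^ a * K ^ b)" using assms 1 by (intro mult_right_mono) auto
  finally show ?thesis by (simp add: power_add mult_ac)
qed

lemma exp_bd_poly: assumes "poly_bd f" shows "exp_bd f"
proof -
  obtain a where a: "\<forall>K\<ge>2. f K \<le> K ^ a" using assms unfolding poly_bd_def by blast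
  have "real (f K) \<le> exp (real K ^ a)" if "K \<ge> 2" for K
  proof -
    have "real (f K) \<le> real (K ^ a)" using a that by (simp only: of_nat_le_iff)
    also have "\<dots> \<le> exp (real K ^ a)" using exp_ge_add_one_self[of "real K ^ a"] unfolding of_nat_power by linarith
    finally show ?thesis .
  qed
  then show ?thesis unfolding exp_bd_def by blast
qed

lemma exp_bd_const: "exp_bd (\<lambda>K. n)"
  by (rule exp_bd_poly[OF poly_bd_const])

lemma exp_bd_id: "exp_bd (\<lambda>K. K)"
  by (rule exp_bd_poly[OF poly_bd_id])

lemma exp_bd_mult: assumes "exp_bd f" "exp_bd g" shows "exp_bd (\<lambda>K. f K * g K)"
proof -
  obtain a b where ab: "\<forall>K\<ge>2. real (f K) \<le> exp (real K ^ a)" "\<forall>K\<ge>2. real (g K) \<le> exp (real K ^ b)" using assms unfolding exp_bd_def by blast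
  have "real (f K * g K) \<le> exp (real K ^ (a + b + 1))" if K: "K \<ge> 2" for K
  proof -
    have "real (f K) * real (g K) \<le> exp (real K ^ a) * exp (real K ^ b)" using ab K by (intro mult_mono) auto
    also have "\<dots> \<le> exp (real K ^ (a + b + 1))" unfolding exp_add[symmetric] exp_le_cancel_iff using K by (intro power_sum_le) simp
    finally show ?thesis by simp
  qed
  then show ?thesis unfolding exp_bd_def by blast
qed

lemma exp_bd_add: assumes "exp_bd f" "exp_bd g" shows "exp_bd (\<lambda>K. f K + g K)"
proof -
  have "exp_bd (\<lambda>K. (2::nat) * ((f K + 1) * (g K + 1)))" if "exp_bd (\<lambda>K. f K + 1)" "exp_bd (\<lambda>K. g K + 1)"
    using that by (intro exp_bd_mult exp_bd_const)
  moreover have "exp_bd (\<lambda>K. h K + 1)" if h: "exp_bd h" for h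
  proof -
    obtain a where a: "\<forall>K\<ge>2. real (h K) \<le> exp (real K ^ a)" using h unfolding exp_bd_def by blast
    have "real (h K + 1) \<le> exp (real K ^ (a + 0 + 1))" if K: "K \<ge> 2" for K
    proof -
      have "1 + 1 \<le> exp (1::real)" by (rule exp_ge_add_one_self)
      then have "2 * exp (real K ^ a) \<le> exp 1 * exp (real K ^ a)" by (intro mult_right_mono) auto
      also have "\<dots> = exp (real K ^ a + real K ^ 0)" by (simp add: mult_exp_exp add.commute)
      also have "\<dots> \<le> exp (real K ^ (a + 0 + 1))" unfolding exp_le_cancel_iff using K by (intro power_sum_le) simp
      finally have "2 * exp (real K ^ a) \<le> exp (real K ^ (a + 0 + 1))" .
      moreover have "1 \<le> exp (real K ^ a)" by simp
      moreover have "real (h K) \<le> exp (real K ^ a)" using a K by blast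
      moreover have "real (h K + 1) = real (h K) + 1" by simp
      ultimately show ?thesis by linarith
    qed
    then show ?thesis unfolding exp_bd_def by blast
  qed
  ultimately have "exp_bd (\<lambda>K. (2::nat) * ((f K + 1) * (g K + 1)))" using assms by blast
  then obtain c where c: "\<forall>K\<ge>2. real (2 * ((f K + 1) * (g K + 1))) \<le> exp (real K ^ c)" unfolding exp_bd_def by blast
  have "real (f K + g K) \<le> exp (real K ^ c)" if "K \<ge> 2" for K
  proof -
    have "f K + g K \<le> 2 * ((f K + 1) * (g K + 1))" by (simp add: algebra_simps)
    then have "real (f K + g K) \<le> real (2 * ((f K + 1) * (g K + 1)))" by (simp only: of_nat_le_iff)
    then show ?thesis using c that by (meson order_trans)
  qed
  then show ?thesis unfolding exp_bd_def by blast
qed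

lemma exp_bd_power: assumes "exp_bd f" "poly_bd g" shows "exp_bd (\<lambda>K. f K ^ g K)"
proof -
  obtain a b where ab: "\<forall>K\<ge>2. real (f K) \<le> exp (real K ^ a)" "\<forall>K\<ge>2. g K \<le> K ^ b" using assms unfolding exp_bd_def poly_bd_def by blast
  have "real (f K ^ g K) \<le> exp (real K ^ (b + a))" if K: "K \<ge> 2" for K
  proof -
    have "real (f K) ^ g K \<le> exp (real K ^ a) ^ g K" using ab K by (intro power_mono) auto
    also have "\<dots> = exp (real (g K) * real K ^ a)" by (rule exp_of_nat_mult[symmetric])
    also have "\<dots> \<le> exp (real (K ^ b) * real K ^ a)" unfolding exp_le_cancel_iff
      by (rule mult_right_mono) (use ab K in \<open>simp_all only: of_nat_le_iff zero_le_power of_nat_0_le_iff\<close>)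
    finally show ?thesis by (simp add: power_add)
  qed
  then show ?thesis unfolding exp_bd_def by blast
qed

lemma exp_bd_fact: assumes "poly_bd f" shows "exp_bd (\<lambda>K. fact (f K))"
proof -
  have "exp_bd (\<lambda>K. f K ^ f K)" by (rule exp_bd_power[OF exp_bd_poly[OF assms] assms])
  then obtain c where c: "\<forall>K\<ge>2. real (f K ^ f K) \<le> exp (real K ^ c)" unfolding exp_bd_def by blast
  have "real (fact (f K)) \<le> exp (real K ^ c)" if "K \<ge> 2" for K
  proof -
    have "fact (f K) \<le> f K ^ f K" using fact_le_power[of "f K", where 'a = nat] by simp
    then have "real (fact (f K)) \<le> real (f K ^ f K)" by (simp only: of_nat_le_iff)
    then show ?thesis using c that by (meson order_trans)
  qed
  then show ?thesis unfolding exp_bd_def by blast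
qed

lemma exp_bd_square: assumes "exp_bd f" shows "exp_bd (\<lambda>K. f (K ^ 2))"
proof -
  obtain a where a: "\<forall>K\<ge>2. real (f K) \<le> exp (real K ^ a)" using assms unfolding exp_bd_def by blast
  have "real (f (K ^ 2)) \<le> exp (real K ^ (2 * a))" if "K \<ge> 2" for K
  proof -
    have "K \<le> K ^ 2" using that by (intro self_le_power) auto
    then have "2 \<le> K ^ 2" using that by linarith
    then have "real (f (K ^ 2)) \<le> exp (real (K ^ 2) ^ a)" using a by blast
    then show ?thesis by (simp add: power_mult)
  qed
  then show ?thesis unfolding exp_bd_def by blast
qed

lemmas poly_bd_intros = poly_bd_mult poly_bd_power poly_bd_id poly_bd_const

lemma poly_bd_pet:
  "poly_bd c_K1" "poly_bd c_J" "poly_bd c_K2" "poly_bd c_Jt" "poly_bd c_K3" "poly_bd c_Js" "poly_bd c_B" "poly_bd c_K4"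
proof -
  show 1: "poly_bd c_K1" unfolding c_K1_def by (intro poly_bd_intros)
  show 2: "poly_bd c_J" unfolding c_J_def by (intro poly_bd_intros 1)
  show 3: "poly_bd c_K2" unfolding c_K2_def by (intro poly_bd_intros 1 2)
  show 4: "poly_bd c_Jt" unfolding c_Jt_def by (intro poly_bd_intros 3)
  show 5: "poly_bd c_K3" unfolding c_K3_def by (intro poly_bd_intros 3 4)
  show 6: "poly_bd c_Js" unfolding c_Js_def by (intro poly_bd_intros 5)
  show "poly_bd c_B" unfolding c_B_def by (intro poly_bd_intros 2 6)
  show "poly_bd c_K4" unfolding c_K4_def by (intro poly_bd_intros 5 6)
qed

lemma poly_bd_m: "poly_bd m_A" "poly_bd m_k1" "poly_bd m_B" "poly_bd m_C" "poly_bd m_k2" "poly_bd m_c"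
proof -
  show 1: "poly_bd m_A" unfolding m_A_def by (intro poly_bd_intros poly_bd_pet)
  show 2: "poly_bd m_k1" unfolding m_k1_def by (intro poly_bd_intros 1)
  show 3: "poly_bd m_B" unfolding m_B_def by (intro poly_bd_intros 1)
  show 4: "poly_bd m_C" unfolding m_C_def by (intro poly_bd_intros 3)
  show "poly_bd m_k2" unfolding m_k2_def by (intro poly_bd_intros 4)
  show "poly_bd m_c" unfolding m_c_def by (intro poly_bd_intros 4)
qed

lemmas exp_bd_intros = exp_bd_mult exp_bd_add exp_bd_power exp_bd_fact exp_bd_id exp_bd_const poly_bd_intros

lemma exp_bd_pet: "exp_bd c_D" "exp_bd c_e"
proof -
  show 1: "exp_bd c_D" unfolding c_D_def by (intro exp_bd_intros poly_bd_pet exp_bd_poly[OF poly_bd_pet(2)])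
  show "exp_bd c_e" unfolding c_e_def c_Y_def
    by (intro exp_bd_intros 1 poly_bd_pet exp_bd_poly[OF poly_bd_pet(2)] exp_bd_poly[OF poly_bd_pet(7)])
qed

lemma exp_bd_ph:
  assumes "exp_bd Q" "poly_bd k"
  shows "exp_bd (\<lambda>K. ph_q (Q K) (k K))" "exp_bd (\<lambda>K. ph_P (Q K) (k K))"
  unfolding ph_q_def ph_P_def by (intro exp_bd_intros assms exp_bd_poly[OF assms(2)])+

lemma exp_bd_m: "exp_bd m_Q" "exp_bd m_E" "exp_bd m_T"
proof -
  note c = exp_bd_poly[OF poly_bd_m(1)] exp_bd_poly[OF poly_bd_m(2)] exp_bd_poly[OF poly_bd_m(3)] exp_bd_poly[OF poly_bd_m(4)] exp_bd_poly[OF poly_bd_m(5)]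
  have Q0: "exp_bd m_Q0" unfolding m_Q0_def by (intro exp_bd_intros exp_bd_pet)
  have q1: "exp_bd m_q1" unfolding m_q1_def by (intro exp_bd_ph Q0 poly_bd_m)
  have P1: "exp_bd m_P1" unfolding m_P1_def by (intro exp_bd_ph Q0 poly_bd_m)
  have Q1: "exp_bd m_Q1" unfolding m_Q1_def by (intro exp_bd_intros Q0 q1)
  have q2: "exp_bd m_q2" unfolding m_q2_def by (intro exp_bd_ph Q1 poly_bd_m)
  have P2: "exp_bd m_P2" unfolding m_P2_def by (intro exp_bd_ph Q1 poly_bd_m)
  have e: "exp_bd m_e" unfolding m_e_def by (intro exp_bd_intros exp_bd_pet Q0 Q1 c)
  have h1: "exp_bd m_h1" unfolding m_h1_def by (intro exp_bd_intros e c)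
  have Y: "exp_bd m_Y" unfolding m_Y_def by (intro exp_bd_intros e h1 q1 P1 Q1 c)
  have h2: "exp_bd m_h2" unfolding m_h2_def by (intro exp_bd_intros e h1 Y c)
  have h3: "exp_bd m_h3" unfolding m_h3_def by (intro exp_bd_intros e h1 h2 q2 P2 c)
  show "exp_bd m_Q" unfolding m_Q_def by (intro exp_bd_intros Q1 q2)
  show "exp_bd m_E" unfolding m_E_def by (intro exp_bd_intros e h1 h2 h3)
  show "exp_bd m_T" unfolding m_T_def by (intro exp_bd_intros e h1 h2 P1 P2 c)
qed

text \<open>A common multiple of the constants: \<open>level_step\<close> needs \<open>a_E K\<close>
  and \<open>a_Q K\<close> to divide \<open>G\<close>, and \<open>G\<close> to be large in
  comparison with the others.\<close>

definition f_G :: "nat \<Rightarrow> nat" where "f_G K = 6 * K * a_C K * a_E K * a_Q K * a_T K"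
text \<open>One bound for three purposes: for the modulus \<open>G ^ i\<close>, for the quotient of
  the root of \<open>n2\<close> by \<open>M\<close>, and as the threshold above which enough levels
  fit below \<open>n2\<close>. The exponent is generous; the last purpose needs about
  \<open>16 * a_C K ^ 2\<close>, twice the range of exponents because the scale is squared in
  y.\<close>

definition f_B :: "nat \<Rightarrow> nat" where "f_B K = f_G K ^ (16 * a_C K ^ 2 * 10)"

lemma exp_bd_f_B: "exp_bd f_B"
proof -
  have C: "poly_bd a_C" unfolding a_C_def by (rule poly_bd_square) (rule poly_bd_m)
  have Q: "exp_bd a_Q" unfolding a_Q_def by (rule exp_bd_square) (rule exp_bd_m)
  have T: "exp_bd a_T" unfolding a_T_def by (rule exp_bd_square) (rule exp_bd_m)
  have mE: "exp_bd (\<lambda>K. m_E (K ^ 2))" by (rule exp_bd_square) (rule exp_bd_m)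
  have t: "exp_bd a_t" unfolding a_t_def by (intro exp_bd_mult exp_bd_const Q mE exp_bd_poly[OF C])
  have E: "exp_bd a_E" unfolding a_E_def by (intro exp_bd_mult t mE)
  have G: "exp_bd f_G" unfolding f_G_def by (intro exp_bd_intros Q T E exp_bd_poly[OF C])
  show ?thesis unfolding f_B_def by (intro exp_bd_intros G C)
qed

section \<open>The weight \<open>mu\<close> as a count of pairs with a given difference\<close>

lemma card_pairs_diff:
  "card {p \<in> {..<M} \<times> {..<M}. int (fst p) - int (snd p) = d} = nat (int M - \<bar>d\<bar>)"
proof -
  have "{p \<in> {..<M} \<times> {..<M}. int (fst p) - int (snd p) = d} = (\<lambda>t. (t + nat d, t + nat (- d))) ` {..<nat (int M - \<bar>d\<bar>)}"
  proof (intro equalityI subsetI)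
    fix p assume "p \<in> {p \<in> {..<M} \<times> {..<M}. int (fst p) - int (snd p) = d}"
    then have p: "fst p < M" "snd p < M" "int (fst p) - int (snd p) = d" by auto
    then have "p = (\<lambda>t. (t + nat d, t + nat (- d))) (min (fst p) (snd p))" by (cases p) (auto simp: min_def)
    moreover have "min (fst p) (snd p) < nat (int M - \<bar>d\<bar>)" using p by (auto simp: min_def)
    ultimately show "p \<in> (\<lambda>t. (t + nat d, t + nat (- d))) ` {..<nat (int M - \<bar>d\<bar>)}" by blast
  qed auto
  moreover have "inj_on (\<lambda>t. (t + nat d, t + nat (- d))) {..<nat (int M - \<bar>d\<bar>)}" by (auto simp: inj_on_def)
  ultimately show ?thesis by (simp add: card_image)
qed

lemma sum_mu:
  fixes G :: "int \<Rightarrow> real"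
  assumes "M > 0"
  shows "(\<Sum>j<M. \<Sum>i<M. G (int i - int j)) / real M ^ 2 = (\<Sum>d\<in>{- int M..int M}. mu (real M) d * G d)"
proof -
  let ?P = "{..<M} \<times> {..<M}" and ?d = "\<lambda>p. int (fst p) - int (snd p)"
  have "(\<Sum>j<M. \<Sum>i<M. G (int i - int j)) = (\<Sum>i<M. \<Sum>j<M. G (int i - int j))" by (rule sum.swap)
  also have "\<dots> = (\<Sum>p\<in>?P. G (?d p))" by (simp only: sum_Times fst_conv snd_conv)
  also have "\<dots> = (\<Sum>d\<in>{- int M..int M}. \<Sum>p\<in>{p\<in>?P. ?d p = d}. G (?d p))"
    by (rule sum.group[symmetric]) auto
  also have "\<dots> = (\<Sum>d\<in>{- int M..int M}. real M ^ 2 * (mu (real M) d * G d))"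
  proof (rule sum.cong[OF refl])
    fix d assume d: "d \<in> {- int M..int M}"
    have "(\<Sum>p\<in>{p\<in>?P. ?d p = d}. G (?d p)) = (\<Sum>p\<in>{p\<in>?P. ?d p = d}. G d)" by (rule sum.cong) auto
    also have "\<dots> = real (nat (int M - \<bar>d\<bar>)) * G d" by (simp only: sum_constant card_pairs_diff)
    also have "real (nat (int M - \<bar>d\<bar>)) = real M ^ 2 * mu (real M) d"
    proof -
      have db: "\<bar>d\<bar> \<le> int M" using d by auto
      then have "real_of_int \<bar>d\<bar> \<le> real M" by linarith
      then have "max (1 - real_of_int \<bar>d\<bar> / real M) 0 = 1 - real_of_int \<bar>d\<bar> / real M" using assms by (simp add: divide_le_eq)
      then have "mu (real M) d = 1 / real M * (1 - real_of_int \<bar>d\<bar> / real M)" by (simp add: mu_def)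
      then show ?thesis using assms db by (simp add: power2_eq_square field_simps)
    qed
    finally show "(\<Sum>p\<in>{p\<in>?P. ?d p = d}. G (?d p)) = real M ^ 2 * (mu (real M) d * G d)" by simp
  qed
  finally show ?thesis using assms by (simp flip: sum_distrib_left)
qed

lemma mu_eq_0: "\<bar>d\<bar> > int M \<Longrightarrow> mu (real M) d = 0"
proof -
  assume d: "\<bar>d\<bar> > int M"
  show ?thesis
  proof (cases "M = 0")
    case False
    have "real M \<le> real_of_int \<bar>d\<bar>" using d by linarith
    then have "1 - real_of_int \<bar>d\<bar> / real M \<le> 0" using False by simp
    then show ?thesis by (simp add: mu_def)
  qed (simp add: mu_def)
qed

text \<open>The infinite sum has finite support: \<open>mu\<close> vanishes for |d| > M, and (x, y)
  has to lie in the grid.\<close>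

lemma infsum_eq_Lam:
  fixes M :: nat and q :: int
  assumes A: "A \<subseteq> grid n1 n2" and M: "M > 0"
  shows "(\<Sum>\<^sub>\<infinity>(x, y, d)\<in>(UNIV :: (int \<times> int \<times> int) set).
      mu (real M) d * indicat_real A (x, y) * indicat_real A (x + q * d, y) * indicat_real A (x, y + q\<^sup>2 * d\<^sup>2))
    = Lam n1 n2 q M (indicat_real A) (indicat_real A) (indicat_real A)"
proof -
  let ?F = "\<lambda>(x, y, d). mu (real M) d * indicat_real A (x, y) * indicat_real A (x + q * d, y) * indicat_real A (x, y + q\<^sup>2 * d\<^sup>2)"
  let ?D = "{- int M..int M}"
  let ?U = "{1..n1} \<times> {1..n2} \<times> ?D"
  have "infsum ?F UNIV = infsum ?F ?U"
  proof (rule infsum_cong_neutral)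
    fix t assume "t \<in> UNIV - ?U"
    then obtain x y d where t: "t = (x, y, d)" "(x, y, d) \<notin> ?U" by (cases t) auto
    show "?F t = 0"
    proof (cases "(x, y) \<in> A")
      case True
      then have "\<bar>d\<bar> > int M" using t A by (auto simp: grid_def)
      then show ?thesis by (simp add: t mu_eq_0)
    qed (simp add: t)
  qed auto
  also have "\<dots> = sum ?F ?U" by (rule infsum_finite) simp
  also have "\<dots> = (\<Sum>x\<in>{1..n1}. \<Sum>y\<in>{1..n2}. \<Sum>d\<in>?D. mu (real M) d * indicat_real A (x, y) * indicat_real A (x + q * d, y) * indicat_real A (x, y + q\<^sup>2 * d\<^sup>2))"
    by (simp add: sum_Times)
  also have "\<dots> = (\<Sum>w\<in>grid n1 n2. \<Sum>d\<in>?D. mu (real M) d * (indicat_real A w * indicat_real A (fst w + q * d, snd w) * indicat_real A (fst w, snd w + q\<^sup>2 * d\<^sup>2)))"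
    by (simp add: grid_def sum_Times mult.assoc)
  also have "\<dots> = (\<Sum>d\<in>?D. \<Sum>w\<in>grid n1 n2. mu (real M) d * (indicat_real A w * indicat_real A (fst w + q * d, snd w) * indicat_real A (fst w, snd w + q\<^sup>2 * d\<^sup>2)))"
    by (rule sum.swap)
  also have "\<dots> = (\<Sum>d\<in>?D. mu (real M) d * corr n1 n2 q d (indicat_real A) (indicat_real A) (indicat_real A))"
    by (simp only: corr_def sum_distrib_left)
  also have "\<dots> = Lam n1 n2 q M (indicat_real A) (indicat_real A) (indicat_real A)"
    unfolding Lam_def by (rule sum_mu[OF M, symmetric])
  finally show ?thesis .
qed

lemma f_G_props:
  assumes "K \<ge> 1"
  shows "f_G K = a_E K * (6 * K * a_C K * a_Q K * a_T K)" "f_G K = a_Q K * (6 * K * a_C K * a_E K * a_T K)"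
    "a_T K \<le> f_G K" "2 * a_C K \<le> f_G K" "3 * K \<le> f_G K" "f_G K \<ge> 2"
proof -
  have T: "a_T K \<ge> 1" by (simp add: a_T_def m_T_def)
  have p: "a_C K \<ge> 1" "a_Q K \<ge> 1" "a_E K \<ge> 1" using a_pos[OF assms] by simp_all
  show "f_G K = a_E K * (6 * K * a_C K * a_Q K * a_T K)" "f_G K = a_Q K * (6 * K * a_C K * a_E K * a_T K)" by (simp_all add: f_G_def)
  have "1 * 1 * 1 * 1 * 1 * a_T K \<le> f_G K" unfolding f_G_def using assms p by (intro mult_mono) auto
  then show "a_T K \<le> f_G K" by simp
  have "2 * 1 * a_C K * 1 * 1 * 1 \<le> f_G K" unfolding f_G_def using assms p T by (intro mult_mono) auto
  then show "2 * a_C K \<le> f_G K" by simp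
  have "3 * K * 1 * 1 * 1 * 1 \<le> f_G K" unfolding f_G_def using assms p T by (intro mult_mono) auto
  then show "3 * K \<le> f_G K" by simp
  then show "f_G K \<ge> 2" using assms by linarith
qed

section \<open>Choice of the top scale and conclusion\<close>

lemma corners_popular_difference:
  fixes n1 n2 :: int and K :: nat
  assumes n: "n1 \<ge> 1" "n2 \<ge> 1" "real_of_int n1 \<ge> sqrt (real_of_int n2)" and \<delta>: "\<delta> > 0"
    and A: "A \<subseteq> grid n1 n2" "real (card A) \<ge> \<delta> * real_of_int (n1 * n2)" and K: "K \<ge> 1" and large: "n2 > int (f_B K)"
  shows "\<exists>q M :: nat. q > 0 \<and> M > 0 \<and> q \<le> f_B K \<and> real M * real (f_B K) \<ge> sqrt (real_of_int n2) \<and>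
    Lam n1 n2 (int q) M (indicat_real A) (indicat_real A) (indicat_real A) \<ge> (\<delta> ^ 3 - 16 / real K) * real_of_int (n1 * n2)"
proof -
  define G C where "G = f_G K" and "C = a_C K"
  note Gp = f_G_props[OF K, folded G_def]
  have C1: "C \<ge> 1" using a_pos[OF K] by (simp add: C_def)
  have C2: "1 \<le> C ^ 2" using C1 by simp
  have B: "f_B K = G ^ (16 * C ^ 2 * 10)" by (simp add: f_B_def G_def C_def)
  let ?P = "\<lambda>m. (int (G ^ m))\<^sup>2 \<le> n2"
  have Ple: "m \<le> nat n2" if "?P m" for m
  proof -
    have "m < 2 ^ m" by simp
    also have "(2::nat) ^ m \<le> G ^ m" using Gp(6) by (rule power_mono) simp
    also have "\<dots> \<le> (G ^ m)\<^sup>2" using Gp(6) by (intro self_le_power) (auto simp: one_le_power)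
    finally have "int m \<le> (int (G ^ m))\<^sup>2" by (metis less_imp_le of_nat_le_iff of_nat_power)
    then show ?thesis using that by linarith
  qed
  have P0: "?P 0" using n by simp
  \<comment> \<open>The largest power of \<open>G\<close> whose square fits into \<open>n2\<close>.
    By maximality the next power exceeds the root of \<open>n2\<close>, so that \<open>M\<close>
    falls short of the root only by a power of \<open>G\<close>.\<close>
  define m where "m = (GREATEST m. ?P m)"
  have Pm: "?P m" unfolding m_def using P0 Ple by (rule GreatestI_nat)
  have mmax: "k \<le> m" if "?P k" for k unfolding m_def using that Ple by (rule Greatest_le_nat)
  have large_m: "8 * C ^ 2 + 3 \<le> m"
  proof (rule mmax)
    have "(G ^ (8 * C ^ 2 + 3))\<^sup>2 = G ^ ((8 * C ^ 2 + 3) * 2)" by (simp only: power_mult)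
    also have "\<dots> \<le> G ^ (16 * C ^ 2 * 10)"
    proof (rule power_increasing)
      show "(8 * C ^ 2 + 3) * 2 \<le> 16 * C ^ 2 * 10" using C2 by (simp only: distrib_right mult.assoc)
    qed (use Gp(6) in simp)
    finally have "int ((G ^ (8 * C ^ 2 + 3))\<^sup>2) \<le> int (f_B K)" unfolding B by (simp only: of_nat_le_iff)
    then show "(int (G ^ (8 * C ^ 2 + 3)))\<^sup>2 \<le> n2" using large by (simp only: of_nat_power[of "G ^ _" 2])
  qed
  \<comment> \<open>The hypothesis that \<open>n1\<close> is at least the root of \<open>n2\<close>
    enters here: the same top scale \<open>G ^ m\<close> is admissible in both directions.\<close>
  have Gm: "int (G ^ m) \<le> n1"
  proof -
    have "real_of_int ((int (G ^ m))\<^sup>2) \<le> real_of_int n2" using Pm by (simp only: of_int_le_iff)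
    then have "real (G ^ m) ^ 2 \<le> real_of_int n2" by simp
    then have "real (G ^ m) \<le> sqrt (real_of_int n2)" by (rule real_le_rsqrt)
    then have "real_of_int (int (G ^ m)) \<le> real_of_int n1" using n(3) by simp
    then show ?thesis by (simp only: of_int_le_iff)
  qed
  let ?f = "indicat_real A" and ?n = "real_of_int (n1 * n2)"
  have n0: "?n > 0" using n by simp
  have "\<exists>i\<le>2 * a_C K ^ 2. Lam n1 n2 (int (G ^ i)) (G ^ (m - 4 * i - 1)) ?f ?f ?f
    \<ge> (\<Sum>w\<in>grid n1 n2. ?f w) ^ 3 / ?n ^ 2 - 16 * ?n / real K"
  proof (rule exists_level[OF n(1,2) _ _ _ K Gp(1-6) _ Gm Pm])
    show "8 * a_C K ^ 2 + 3 \<le> m" using large_m by (simp add: C_def)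
  qed (use A in \<open>auto simp: indicator_def\<close>)
  then obtain i where i: "i \<le> 2 * C ^ 2" "Lam n1 n2 (int (G ^ i)) (G ^ (m - 4 * i - 1)) ?f ?f ?f
    \<ge> (\<Sum>w\<in>grid n1 n2. ?f w) ^ 3 / ?n ^ 2 - 16 * ?n / real K" unfolding C_def by blast
  have sf: "(\<Sum>w\<in>grid n1 n2. ?f w) = real (card A)"
    using A(1) by (simp add: indicator_def sum.If_cases Int_absorb1 Int_absorb2)
  have d3: "\<delta> ^ 3 * ?n \<le> real (card A) ^ 3 / ?n ^ 2"
  proof -
    have "(\<delta> * ?n) ^ 3 \<le> real (card A) ^ 3" using A(2) \<delta> n0 by (intro power_mono) auto
    then have "(\<delta> * ?n) ^ 3 / ?n ^ 2 \<le> real (card A) ^ 3 / ?n ^ 2" by (rule divide_right_mono) simp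
    moreover have "(\<delta> * ?n) ^ 3 / ?n ^ 2 = \<delta> ^ 3 * ?n" using n0 by (simp add: power_mult_distrib power2_eq_square power3_eq_cube)
    ultimately show ?thesis by linarith
  qed
  have res: "(\<delta> ^ 3 - 16 / real K) * ?n \<le> Lam n1 n2 (int (G ^ i)) (G ^ (m - 4 * i - 1)) ?f ?f ?f"
  proof -
    have "(\<delta> ^ 3 - 16 / real K) * ?n = \<delta> ^ 3 * ?n - 16 * ?n / real K" by (simp add: left_diff_distrib)
    then show ?thesis using i(2) d3 unfolding sf by linarith
  qed
  have q: "G ^ i \<le> f_B K" unfolding B using Gp(6) i(1) by (intro power_increasing) linarith+
  have M: "sqrt (real_of_int n2) \<le> real (G ^ (m - 4 * i - 1)) * real (f_B K)"
  proof -
    have "\<not> ?P (Suc m)" using mmax[of "Suc m"] by auto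
    then have "real_of_int n2 \<le> real_of_int ((int (G ^ Suc m))\<^sup>2)" unfolding of_int_le_iff by linarith
    then have "real_of_int n2 \<le> real (G ^ Suc m) ^ 2" by simp
    then have "sqrt (real_of_int n2) \<le> real (G ^ Suc m)" by (rule real_le_lsqrt[rotated 1]) simp
    also have "\<dots> \<le> real (G ^ (m - 4 * i - 1) * f_B K)" unfolding of_nat_le_iff
    proof -
      \<comment> \<open>Level \<open>i\<close> costs \<open>4 * i + 2\<close> powers of
        \<open>G\<close>, at most \<open>8 * C ^ 2 + 2\<close> by the bound on
        \<open>i\<close>.\<close>
      have "Suc m \<le> (m - 4 * i - 1) + 16 * C ^ 2 * 10" using i(1) large_m C2 by linarith
      then have "G ^ Suc m \<le> G ^ ((m - 4 * i - 1) + 16 * C ^ 2 * 10)" using Gp(6) by (intro power_increasing) auto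
      then show "G ^ Suc m \<le> G ^ (m - 4 * i - 1) * f_B K" by (simp only: B power_add)
    qed
    finally show ?thesis by simp
  qed
  have "G ^ i > 0" "G ^ (m - 4 * i - 1) > 0" using Gp(6) by simp_all
  then show ?thesis using q M res by blast
qed

theorem theorem7p1:
  "\<exists>C::real. C \<ge> 1 \<and>
     (\<forall>(N1::int) (N2::int) (\<delta>::real) (A::(int \<times> int) set) (\<epsilon>::real).
        N1 > 0 \<longrightarrow> N2 > 0 \<longrightarrow> of_int N1 \<ge> sqrt (of_int N2) \<longrightarrow>
        0 < \<delta> \<longrightarrow> \<delta> \<le> 1 \<longrightarrow>
        A \<subseteq> interval_upto (of_int N1) \<times> interval_upto (of_int N2) \<longrightarrow>
        real (card A) \<ge> \<delta> * of_int N1 * of_int N2 \<longrightarrow>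
        0 < \<epsilon> \<longrightarrow> \<epsilon> \<le> 1 / 2 \<longrightarrow>
        of_int N2 \<le> exp (C * \<epsilon> powr (- C)) \<or>
        (\<exists>(q::int) (M::int).
           q > 0 \<and> M > 0 \<and>
           of_int q \<le> exp (C * \<epsilon> powr (- C)) \<and>
           of_int M \<ge> sqrt (of_int N2) / exp (C * \<epsilon> powr (- C)) \<and>
           (\<Sum>\<^sub>\<infinity>(x, y, d)\<in>(UNIV :: (int \<times> int \<times> int) set).
              mu (of_int M) d * indicat_real A (x, y) * indicat_real A (x + q * d, y)
                * indicat_real A (x, y + q\<^sup>2 * d\<^sup>2))
             \<ge> (\<delta> ^ 3 - \<epsilon>) * of_int N1 * of_int N2))"
proof -
  obtain c :: nat where c: "\<And>K. K \<ge> 2 \<Longrightarrow> real (f_B K) \<le> exp (real K ^ c)"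
    using exp_bd_f_B unfolding exp_bd_def by blast
  \<comment> \<open>From \<open>K \<le> 17 / \<epsilon>\<close> one gets
    \<open>K ^ c \<le> 17 ^ c * \<epsilon> powr (- c)\<close>; the maximum lets one constant serve
    as coefficient and as exponent.\<close>
  define C where "C = max (17 ^ c) (real c)"
  have C1: "C \<ge> 1" unfolding C_def by (rule order_trans[OF one_le_power max.cobounded1]) simp
  show ?thesis
  proof (intro exI[of _ C] conjI allI impI C1)
    fix N1 N2 :: int and \<delta> :: real and A :: "(int \<times> int) set" and \<epsilon> :: real
    assume N: "N1 > 0" "N2 > 0" "of_int N1 \<ge> sqrt (of_int N2)" and \<delta>: "0 < \<delta>" "\<delta> \<le> 1"
      and A: "A \<subseteq> interval_upto (of_int N1) \<times> interval_upto (of_int N2)" "real (card A) \<ge> \<delta> * of_int N1 * of_int N2"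
      and \<epsilon>: "0 < \<epsilon>" "\<epsilon> \<le> 1 / 2"
    let ?E = "exp (C * \<epsilon> powr (- C))"
    \<comment> \<open>The energy increment loses \<open>16 / K\<close>, which this choice makes at
      most \<open>\<epsilon>\<close>.\<close>
    define K where "K = nat \<lceil>16 / \<epsilon>\<rceil>"
    have e2: "2 \<le> 1 / \<epsilon>" using \<epsilon> by (simp add: field_simps)
    have Kge: "real K \<ge> 16 / \<epsilon>" unfolding K_def by (rule real_nat_ceiling_ge)
    have Kle: "real K \<le> 17 / \<epsilon>"
    proof -
      have "0 \<le> 16 / \<epsilon>" using \<epsilon> by simp
      then have "real K \<le> 16 / \<epsilon> + 1" unfolding K_def by linarith
      also have "\<dots> \<le> 17 / \<epsilon>" using e2 by (simp add: field_simps)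
      finally show ?thesis .
    qed
    have "16 * (1 / \<epsilon>) \<le> real K" using Kge by simp
    then have "32 \<le> real K" using e2 by linarith
    then have K2: "K \<ge> 2" by linarith
    have BE: "real (f_B K) \<le> ?E"
    proof -
      have "real K ^ c \<le> (17 / \<epsilon>) ^ c" using Kle by (rule power_mono) simp
      also have "\<dots> = 17 ^ c * \<epsilon> powr (- real c)"
        using \<epsilon> by (simp add: power_divide powr_minus_divide powr_realpow)
      also have "\<dots> \<le> C * \<epsilon> powr (- C)"
      proof (rule mult_mono)
        show "\<epsilon> powr (- real c) \<le> \<epsilon> powr (- C)"
          using \<epsilon> by (intro powr_mono') (auto simp: C_def)
      qed (use C1 in \<open>auto simp: C_def\<close>)
      finally have "exp (real K ^ c) \<le> ?E" by simp
      then show ?thesis using c[OF K2] by linarith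
    qed
    show "of_int N2 \<le> ?E \<or> (\<exists>(q::int) (M::int). q > 0 \<and> M > 0 \<and> of_int q \<le> ?E \<and> of_int M \<ge> sqrt (of_int N2) / ?E \<and>
           (\<Sum>\<^sub>\<infinity>(x, y, d)\<in>(UNIV :: (int \<times> int \<times> int) set).
              mu (of_int M) d * indicat_real A (x, y) * indicat_real A (x + q * d, y)
                * indicat_real A (x, y + q\<^sup>2 * d\<^sup>2))
             \<ge> (\<delta> ^ 3 - \<epsilon>) * of_int N1 * of_int N2)"
    proof (cases "of_int N2 \<le> ?E")
      case False
      then have "real (f_B K) < real_of_int N2" using BE by linarith
      then have large: "N2 > int (f_B K)" by linarith
      have A': "A \<subseteq> grid N1 N2" using A(1) by (auto simp: interval_upto_def grid_def)
      have N': "N1 \<ge> 1" "N2 \<ge> 1" "K \<ge> 1" using N K2 by auto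
      have cA: "real (card A) \<ge> \<delta> * real_of_int (N1 * N2)" using A(2) by simp
      obtain q M :: nat where qM: "q > 0" "M > 0" "q \<le> f_B K" "real M * real (f_B K) \<ge> sqrt (real_of_int N2)"
        and L: "Lam N1 N2 (int q) M (indicat_real A) (indicat_real A) (indicat_real A) \<ge> (\<delta> ^ 3 - 16 / real K) * real_of_int (N1 * N2)"
        using corners_popular_difference[OF N'(1,2) N(3) \<delta>(1) A' cA N'(3) large] by blast
      have "real q \<le> real (f_B K)" using qM(3) by (simp only: of_nat_le_iff)
      then have 1: "real_of_int (int q) \<le> ?E" using BE by simp
      have "sqrt (real_of_int N2) \<le> real M * ?E"
        using qM(4) mult_left_mono[OF BE, of "real M"] by simp
      then have 2: "sqrt (real_of_int N2) / ?E \<le> real_of_int (int M)" by (simp add: pos_divide_le_eq)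
      have "16 / real K \<le> \<epsilon>" using Kge \<epsilon> K2 by (simp add: field_simps)
      then have "(\<delta> ^ 3 - \<epsilon>) * real_of_int (N1 * N2) \<le> (\<delta> ^ 3 - 16 / real K) * real_of_int (N1 * N2)"
        using N by (intro mult_right_mono) auto
      then have 3: "(\<delta> ^ 3 - \<epsilon>) * of_int N1 * of_int N2 \<le> Lam N1 N2 (int q) M (indicat_real A) (indicat_real A) (indicat_real A)"
        using L by (simp only: of_int_mult mult.assoc)
      show ?thesis
      proof (rule disjI2, rule exI[of _ "int q"], rule exI[of _ "int M"], intro conjI)
        show "0 < int q" "0 < int M" using qM by simp_all
        show "(\<delta> ^ 3 - \<epsilon>) * of_int N1 * of_int N2 \<le> (\<Sum>\<^sub>\<infinity>(x, y, d)\<in>(UNIV :: (int \<times> int \<times> int) set).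
              mu (of_int (int M)) d * indicat_real A (x, y) * indicat_real A (x + int q * d, y)
                * indicat_real A (x, y + (int q)\<^sup>2 * d\<^sup>2))"
          using 3 unfolding of_int_of_nat_eq infsum_eq_Lam[OF A' qM(2)] .
      qed (use 1 2 in simp_all)
    qed simp
  qed
qed

end
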